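(* Let $F$ be an algebraically closed field and let $A_1,A_2$ be unital finite dimensional quasi-hereditary $F$-algebras with weight posets $(I_1,\leq_1)$ and $(I_2,\leq_2)$. If $A_1$ and $A_2$ are BGG algebras, then $A_1\otimes A_2$ (quasi-hereditary with weight poset $I_1\times I_2$) is a BGG algebra.
   Context: A finite dimensional algebra $A$ is a BGG algebra if it is quasi-hereditary, with weight poset $(I,\leq)$ and simple modules $L(i)$, $i\in I$, and there is a duality functor on the category $A\text{-mod}$ of finitely generated modules, i.e. a contravariant exact functor $\delta$ on $A\text{-mod}$ with $\delta^2\cong \mathrm{id}$, such that $\delta L(i)\cong L(i)$ for all $i\in I$. The tensor product is over $F$. The partial order on $I_1\times I_2$ is $(x_1,x_2)\leq(y_1,y_2)$ iff $x_k\leq_k y_k$ for $k=1,2$; the simple, standard, costandard, projective, injective and tilting modules of $A_1\otimes A_2$ labelled by $(x_1,x_2)$ are the tensor products of the corresponding modules of $A_1$ and $A_2$ labelled by $x_1$ and $x_2$. *)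

theory Defs
  imports
    "HOL-Library.FuncSet"
    "HOL-Library.Poly_Mapping"
    "HOL-Computational_Algebra.Polynomial"
    "HOL-Algebra.Module"
    "HOL-Algebra.QuotRing"
begin

section \<open>Algebras and left modules\<close>

text \<open>
  The ground field is a type of class \<open>field\<close>. An algebra is a record of type
  \<open>('f, 'a) module\<close>, which carries both the ring operations and the scalar multiplication
  by \<open>'f\<close>. The locales \<open>module\<close> and \<open>algebra\<close> of \<open>HOL-Algebra\<close> require commutative rings, so
  left modules over a noncommutative ring are introduced here. They are records of
  type \<open>('a, 'm) module\<close>; their fields \<open>mult\<close> and \<open>one\<close> are irrelevant, as in \<open>HOL-Algebra\<close>.
\<close>

definition field_ring :: "'f::field ring" where
  "field_ring = \<lparr>carrier = UNIV, mult = (*), one = 1, zero = 0, add = (+)\<rparr>"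

locale left_module = R?: ring R + M?: abelian_group M for R (structure) and M (structure) +
  assumes smult_closed:
      "\<lbrakk>a \<in> carrier R; x \<in> carrier M\<rbrakk> \<Longrightarrow> a \<odot>\<^bsub>M\<^esub> x \<in> carrier M"
    and smult_l_distr:
      "\<lbrakk>a \<in> carrier R; b \<in> carrier R; x \<in> carrier M\<rbrakk>
        \<Longrightarrow> (a \<oplus>\<^bsub>R\<^esub> b) \<odot>\<^bsub>M\<^esub> x = (a \<odot>\<^bsub>M\<^esub> x) \<oplus>\<^bsub>M\<^esub> (b \<odot>\<^bsub>M\<^esub> x)"
    and smult_r_distr:
      "\<lbrakk>a \<in> carrier R; x \<in> carrier M; y \<in> carrier M\<rbrakk>
        \<Longrightarrow> a \<odot>\<^bsub>M\<^esub> (x \<oplus>\<^bsub>M\<^esub> y) = (a \<odot>\<^bsub>M\<^esub> x) \<oplus>\<^bsub>M\<^esub> (a \<odot>\<^bsub>M\<^esub> y)"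
    and smult_assoc1:
      "\<lbrakk>a \<in> carrier R; b \<in> carrier R; x \<in> carrier M\<rbrakk>
        \<Longrightarrow> (a \<otimes>\<^bsub>R\<^esub> b) \<odot>\<^bsub>M\<^esub> x = a \<odot>\<^bsub>M\<^esub> (b \<odot>\<^bsub>M\<^esub> x)"
    and smult_one:
      "x \<in> carrier M \<Longrightarrow> \<one>\<^bsub>R\<^esub> \<odot>\<^bsub>M\<^esub> x = x"

definition gen_submodule ::
    "('r, 'd) ring_scheme \<Rightarrow> ('r, 'm) module \<Rightarrow> 'm set \<Rightarrow> 'm set" where
  "gen_submodule R M S = \<Inter>{H. submodule H R M \<and> S \<subseteq> H}"

definition finitely_generated :: "('r, 'd) ring_scheme \<Rightarrow> ('r, 'm) module \<Rightarrow> bool" where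
  "finitely_generated R M \<longleftrightarrow>
     (\<exists>S. finite S \<and> S \<subseteq> carrier M \<and> gen_submodule R M S = carrier M)"

definition fd_algebra :: "('f::field, 'a) module \<Rightarrow> bool" where
  "fd_algebra A \<longleftrightarrow>
     ring A \<and> module field_ring A \<and> finitely_generated field_ring A \<and>
     (\<forall>c. \<forall>x\<in>carrier A. \<forall>y\<in>carrier A.
        (c \<odot>\<^bsub>A\<^esub> x) \<otimes>\<^bsub>A\<^esub> y = c \<odot>\<^bsub>A\<^esub> (x \<otimes>\<^bsub>A\<^esub> y) \<and>
        x \<otimes>\<^bsub>A\<^esub> (c \<odot>\<^bsub>A\<^esub> y) = c \<odot>\<^bsub>A\<^esub> (x \<otimes>\<^bsub>A\<^esub> y))"

definition scalar_action :: "('f, 'a) module \<Rightarrow> ('a, 'm) module \<Rightarrow> 'f \<Rightarrow> 'm \<Rightarrow> 'm" where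
  "scalar_action A M c x = (c \<odot>\<^bsub>A\<^esub> \<one>\<^bsub>A\<^esub>) \<odot>\<^bsub>M\<^esub> x"

text \<open>
  Maps are extensional (\<open>undefined\<close> outside the carrier of the source), so that equality of
  morphisms is equality of functions.
\<close>

definition Hom :: "('r, 'd) ring_scheme \<Rightarrow> ('r, 'm) module \<Rightarrow> ('r, 'n) module \<Rightarrow> ('m \<Rightarrow> 'n) set"
  where
  "Hom R M N = {f \<in> carrier M \<rightarrow>\<^sub>E carrier N.
     (\<forall>x\<in>carrier M. \<forall>y\<in>carrier M. f (x \<oplus>\<^bsub>M\<^esub> y) = f x \<oplus>\<^bsub>N\<^esub> f y) \<and>
     (\<forall>a\<in>carrier R. \<forall>x\<in>carrier M. f (a \<odot>\<^bsub>M\<^esub> x) = a \<odot>\<^bsub>N\<^esub> f x)}"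

definition Epi :: "('r, 'd) ring_scheme \<Rightarrow> ('r, 'm) module \<Rightarrow> ('r, 'n) module \<Rightarrow> ('m \<Rightarrow> 'n) set"
  where
  "Epi R M N = {f \<in> Hom R M N. f ` carrier M = carrier N}"

definition isomorphic :: "('r, 'd) ring_scheme \<Rightarrow> ('r, 'm) module \<Rightarrow> ('r, 'n) module \<Rightarrow> bool"
  where
  "isomorphic R M N \<longleftrightarrow> (\<exists>f\<in>Hom R M N. bij_betw f (carrier M) (carrier N))"

definition kernel_module :: "('r, 'm) module \<Rightarrow> ('r, 'n) module \<Rightarrow> ('m \<Rightarrow> 'n) \<Rightarrow> ('r, 'm) module"
  where
  "kernel_module M N f = M\<lparr>carrier := a_kernel M N f\<rparr>"

text \<open>
  The quotient by a submodule. The multiplication and unit are those of the quotient ring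
  \<open>M Quot H\<close>, and are meaningful if \<open>M\<close> is an algebra and \<open>H\<close> an ideal.
\<close>

definition quot_module :: "('r, 'm) module \<Rightarrow> 'm set \<Rightarrow> ('r, 'm set) module" where
  "quot_module M H =
     \<lparr>carrier = a_rcosets\<^bsub>M\<^esub> H, mult = rcoset_mult M H, one = H +>\<^bsub>M\<^esub> \<one>\<^bsub>M\<^esub>,
      zero = H, add = set_add M,
      smult = (\<lambda>a X. \<Union>x\<in>X. H +>\<^bsub>M\<^esub> (a \<odot>\<^bsub>M\<^esub> x))\<rparr>"

definition simple_module :: "('r, 'd) ring_scheme \<Rightarrow> ('r, 'm) module \<Rightarrow> bool" where
  "simple_module R M \<longleftrightarrow>
     left_module R M \<and> carrier M \<noteq> {\<zero>\<^bsub>M\<^esub>} \<and>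
     (\<forall>H. submodule H R M \<longrightarrow> H = {\<zero>\<^bsub>M\<^esub>} \<or> H = carrier M)"

definition has_filtration ::
    "('r, 'd) ring_scheme \<Rightarrow> ('r, 'm) module \<Rightarrow> 'j set \<Rightarrow> ('j \<Rightarrow> ('r, 'n) module) \<Rightarrow> bool" where
  "has_filtration R M J X \<longleftrightarrow>
     (\<exists>n F. F 0 = {\<zero>\<^bsub>M\<^esub>} \<and> F n = carrier M \<and> (\<forall>k\<le>n. submodule (F k) R M) \<and>
        (\<forall>k<n. F k \<subseteq> F (Suc k) \<and>
           (\<exists>j\<in>J. isomorphic R (quot_module (M\<lparr>carrier := F (Suc k)\<rparr>) (F k)) (X j))))"

section \<open>The category of finitely generated modules\<close>

text \<open>
  A finitely generated module over a finite dimensional algebra over \<open>'f\<close> is finite dimensional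
  over \<open>'f\<close>, so it is isomorphic to a module whose carrier is a subset of \<open>nat \<Rightarrow> 'f\<close> (with
  arbitrary operations). The category of finitely generated modules is therefore represented by
  its modules with carrier in this type, with all homomorphisms between them.
\<close>

definition fg_modules :: "('f, 'a) module \<Rightarrow> ('a, nat \<Rightarrow> 'f) module set" where
  "fg_modules A = {M. left_module A M \<and> finitely_generated A M}"

definition short_exact ::
    "('r, 'd) ring_scheme \<Rightarrow> ('r, 'm) module \<Rightarrow> ('r, 'm) module \<Rightarrow> ('r, 'm) module
      \<Rightarrow> ('m \<Rightarrow> 'm) \<Rightarrow> ('m \<Rightarrow> 'm) \<Rightarrow> bool" where
  "short_exact R L M N f g \<longleftrightarrow>
     f \<in> Hom R L M \<and> inj_on f (carrier L) \<and> g \<in> Epi R M N \<and> f ` carrier L = a_kernel M N g"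

definition projective :: "('f, 'a) module \<Rightarrow> ('a, nat \<Rightarrow> 'f) module \<Rightarrow> bool" where
  "projective A P \<longleftrightarrow> P \<in> fg_modules A \<and>
     (\<forall>M\<in>fg_modules A. \<forall>N\<in>fg_modules A. \<forall>g\<in>Epi A M N. \<forall>f\<in>Hom A P N.
        \<exists>h\<in>Hom A P M. compose (carrier P) g h = f)"

definition projective_cover ::
    "('f, 'a) module \<Rightarrow> ('a, nat \<Rightarrow> 'f) module \<Rightarrow> ('a, 'm) module \<Rightarrow> bool" where
  "projective_cover A P M \<longleftrightarrow> projective A P \<and>
     (\<exists>p\<in>Epi A P M. \<forall>H. submodule H A P \<and> H <+>\<^bsub>P\<^esub> a_kernel P M p = carrier P
        \<longrightarrow> H = carrier P)"

text \<open>
  A contravariant functor with object map \<open>D\<close> and morphism maps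
  \<open>D' M N : Hom(M, N) \<rightarrow> Hom(D N, D M)\<close>. Functors between module categories of algebras over
  a field are linear over that field.
\<close>

locale duality_functor =
  fixes A :: "('f::field, 'a) module"
    and D :: "('a, nat \<Rightarrow> 'f) module \<Rightarrow> ('a, nat \<Rightarrow> 'f) module"
    and D' :: "('a, nat \<Rightarrow> 'f) module \<Rightarrow> ('a, nat \<Rightarrow> 'f) module
                \<Rightarrow> ((nat \<Rightarrow> 'f) \<Rightarrow> (nat \<Rightarrow> 'f)) \<Rightarrow> ((nat \<Rightarrow> 'f) \<Rightarrow> (nat \<Rightarrow> 'f))"
  assumes obj: "M \<in> fg_modules A \<Longrightarrow> D M \<in> fg_modules A"
    and mor: "\<lbrakk>M \<in> fg_modules A; N \<in> fg_modules A; f \<in> Hom A M N\<rbrakk> \<Longrightarrow> D' M N f \<in> Hom A (D N) (D M)"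
    and ident: "M \<in> fg_modules A \<Longrightarrow> D' M M (\<lambda>x\<in>carrier M. x) = (\<lambda>x\<in>carrier (D M). x)"
    and comp: "\<lbrakk>L \<in> fg_modules A; M \<in> fg_modules A; N \<in> fg_modules A; f \<in> Hom A L M; g \<in> Hom A M N\<rbrakk>
      \<Longrightarrow> D' L N (compose (carrier L) g f) = compose (carrier (D N)) (D' L M f) (D' M N g)"
    and additive: "\<lbrakk>M \<in> fg_modules A; N \<in> fg_modules A; f \<in> Hom A M N; g \<in> Hom A M N\<rbrakk>
      \<Longrightarrow> D' M N (\<lambda>x\<in>carrier M. f x \<oplus>\<^bsub>N\<^esub> g x)
          = (\<lambda>x\<in>carrier (D N). D' M N f x \<oplus>\<^bsub>D M\<^esub> D' M N g x)"
    and homogeneous: "\<lbrakk>M \<in> fg_modules A; N \<in> fg_modules A; f \<in> Hom A M N\<rbrakk>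
      \<Longrightarrow> D' M N (\<lambda>x\<in>carrier M. scalar_action A N c (f x))
          = (\<lambda>x\<in>carrier (D N). scalar_action A (D M) c (D' M N f x))"
    and exact: "\<lbrakk>L \<in> fg_modules A; M \<in> fg_modules A; N \<in> fg_modules A; short_exact A L M N f g\<rbrakk>
      \<Longrightarrow> short_exact A (D N) (D M) (D L) (D' M N g) (D' L M f)"
    and involutive: "\<exists>\<eta>.
      (\<forall>M\<in>fg_modules A. \<eta> M \<in> Hom A M (D (D M)) \<and> bij_betw (\<eta> M) (carrier M) (carrier (D (D M)))) \<and>
      (\<forall>M\<in>fg_modules A. \<forall>N\<in>fg_modules A. \<forall>f\<in>Hom A M N.
         compose (carrier M) (\<eta> N) f
         = compose (carrier M) (D' (D N) (D M) (D' M N f)) (\<eta> M))"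

section \<open>Quasi-hereditary algebras and BGG algebras\<close>

text \<open>
  In the following, \<open>L\<close> is a family of modules representing the simple modules. Its members may
  have carriers in any type.
\<close>

definition labels_simples ::
    "('f, 'a) module \<Rightarrow> 'i set \<Rightarrow> ('i \<Rightarrow> ('a, 'm) module) \<Rightarrow> bool" where
  "labels_simples A I L \<longleftrightarrow>
     (\<forall>i\<in>I. simple_module A (L i)) \<and>
     (\<forall>i\<in>I. \<forall>j\<in>I. isomorphic A (L i) (L j) \<longrightarrow> i = j) \<and>
     (\<forall>S\<in>fg_modules A. simple_module A S \<longrightarrow> (\<exists>i\<in>I. isomorphic A S (L i)))"

text \<open>
  Quasi-heredity in the sense of Cline, Parshall and Scott (highest weight categories): there are
  standard modules \<open>\<Delta> i\<close> such that the kernel of \<open>\<Delta> i \<rightarrow> L i\<close> has composition factors \<open>L j\<close> with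
  \<open>j < i\<close>, and the kernel of \<open>P i \<rightarrow> \<Delta> i\<close>, where \<open>P i\<close> is the projective cover of \<open>L i\<close>, has a
  filtration with subquotients \<open>\<Delta> j\<close> with \<open>i < j\<close>. The order on the weights \<open>I\<close> is given by the
  relation \<open>r\<close>, with \<open>i \<le> j\<close> iff \<open>(i, j) \<in> r\<close>.
\<close>

definition standard_modules ::
    "('f, 'a) module \<Rightarrow> 'i set \<Rightarrow> ('i \<times> 'i) set \<Rightarrow> ('i \<Rightarrow> ('a, 'm) module)
      \<Rightarrow> ('i \<Rightarrow> ('a, nat \<Rightarrow> 'f) module) \<Rightarrow> bool" where
  "standard_modules A I r L \<Delta> \<longleftrightarrow> (\<forall>i\<in>I. \<Delta> i \<in> fg_modules A \<and>
     (\<exists>f\<in>Epi A (\<Delta> i) (L i).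
        has_filtration A (kernel_module (\<Delta> i) (L i) f) {j \<in> I. (j, i) \<in> r \<and> j \<noteq> i} L) \<and>
     (\<exists>P. projective_cover A P (L i) \<and>
        (\<exists>g\<in>Epi A P (\<Delta> i).
           has_filtration A (kernel_module P (\<Delta> i) g) {j \<in> I. (i, j) \<in> r \<and> j \<noteq> i} \<Delta>)))"

definition quasi_hereditary ::
    "('f::field, 'a) module \<Rightarrow> 'i set \<Rightarrow> ('i \<times> 'i) set \<Rightarrow> ('i \<Rightarrow> ('a, 'm) module) \<Rightarrow> bool" where
  "quasi_hereditary A I r L \<longleftrightarrow>
     fd_algebra A \<and> partial_order_on I r \<and> labels_simples A I L \<and>
     (\<exists>\<Delta>. standard_modules A I r L \<Delta>)"

text \<open>
  Since the carrier of \<open>L i\<close> need not be in \<open>nat \<Rightarrow> 'f\<close>, the condition \<open>D (L i) \<cong> L i\<close> is imposed on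
  the objects of \<^term>\<open>fg_modules A\<close> isomorphic to \<open>L i\<close>; there always are such objects.
\<close>

definition BGG_algebra ::
    "('f::field, 'a) module \<Rightarrow> 'i set \<Rightarrow> ('i \<times> 'i) set \<Rightarrow> ('i \<Rightarrow> ('a, 'm) module) \<Rightarrow> bool" where
  "BGG_algebra A I r L \<longleftrightarrow>
     quasi_hereditary A I r L \<and>
     (\<exists>D D'. duality_functor A D D' \<and>
        (\<forall>i\<in>I. \<forall>S\<in>fg_modules A. isomorphic A S (L i) \<longrightarrow> isomorphic A (D S) (L i)))"

section \<open>Tensor products\<close>

definition bilinear_ext ::
    "('p \<Rightarrow> 'q \<Rightarrow> 's) \<Rightarrow> ('p \<Rightarrow>\<^sub>0 'f) \<Rightarrow> ('q \<Rightarrow>\<^sub>0 'f) \<Rightarrow> ('s \<Rightarrow>\<^sub>0 'f::field)" where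
  "bilinear_ext b u v =
     (\<Sum>p\<in>Poly_Mapping.keys u. \<Sum>q\<in>Poly_Mapping.keys v.
        Poly_Mapping.single (b p q) (Poly_Mapping.lookup u p * Poly_Mapping.lookup v q))"

text \<open>
  The vector space with basis \<open>carrier V \<times> carrier W\<close>, and the tensor product as its quotient by
  the bilinearity relations. If \<open>V\<close> and \<open>W\<close> are algebras, then the componentwise product on
  \<open>carrier V \<times> carrier W\<close> makes the former an algebra, the relations generate an ideal, and
  the quotient is the tensor product algebra. For vector spaces, \<open>mult\<close> and \<open>one\<close> are irrelevant.
\<close>

definition free_space ::
    "('f::field, 'v) module \<Rightarrow> ('f, 'w) module \<Rightarrow> ('f, 'v \<times> 'w \<Rightarrow>\<^sub>0 'f) module" where
  "free_space V W =
     \<lparr>carrier = {u. Poly_Mapping.keys u \<subseteq> carrier V \<times> carrier W},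
      mult = bilinear_ext (\<lambda>(v, w) (v', w'). (v \<otimes>\<^bsub>V\<^esub> v', w \<otimes>\<^bsub>W\<^esub> w')),
      one = Poly_Mapping.single (\<one>\<^bsub>V\<^esub>, \<one>\<^bsub>W\<^esub>) 1,
      zero = 0, add = (+),
      smult = (\<lambda>c. Poly_Mapping.map ((*) c))\<rparr>"

definition tensor_relations ::
    "('f::field, 'v) module \<Rightarrow> ('f, 'w) module \<Rightarrow> ('v \<times> 'w \<Rightarrow>\<^sub>0 'f) set" where
  "tensor_relations V W =
     (let e = (\<lambda>v w. Poly_Mapping.single (v, w) (1::'f)) in
       {e (v \<oplus>\<^bsub>V\<^esub> v') w - e v w - e v' w | v v' w.
          v \<in> carrier V \<and> v' \<in> carrier V \<and> w \<in> carrier W} \<union>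
       {e v (w \<oplus>\<^bsub>W\<^esub> w') - e v w - e v w' | v w w'.
          v \<in> carrier V \<and> w \<in> carrier W \<and> w' \<in> carrier W} \<union>
       {e (c \<odot>\<^bsub>V\<^esub> v) w - Poly_Mapping.single (v, w) c | c v w.
          v \<in> carrier V \<and> w \<in> carrier W} \<union>
       {e v (c \<odot>\<^bsub>W\<^esub> w) - Poly_Mapping.single (v, w) c | c v w.
          v \<in> carrier V \<and> w \<in> carrier W})"

definition tensor ::
    "('f::field, 'v) module \<Rightarrow> ('f, 'w) module \<Rightarrow> ('f, ('v \<times> 'w \<Rightarrow>\<^sub>0 'f) set) module" where
  "tensor V W =
     quot_module (free_space V W)
       (gen_submodule field_ring (free_space V W) (tensor_relations V W))"

definition restrict_scalars :: "('f, 'a) module \<Rightarrow> ('a, 'm) module \<Rightarrow> ('f, 'm) module" where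
  "restrict_scalars A M =
     \<lparr>carrier = carrier M, mult = mult M, one = \<one>\<^bsub>M\<^esub>, zero = \<zero>\<^bsub>M\<^esub>, add = add M,
      smult = scalar_action A M\<rparr>"

text \<open>
  The module over \<^term>\<open>tensor A B\<close> with
  \<open>(a \<otimes> b) \<odot> (m \<otimes> n) = (a \<odot> m) \<otimes> (b \<odot> n)\<close>. The zero of a quotient is the submodule that is
  factored out.
\<close>

definition tensor_module ::
    "('f::field, 'a) module \<Rightarrow> ('f, 'b) module \<Rightarrow> ('a, 'm) module \<Rightarrow> ('b, 'n) module
      \<Rightarrow> (('a \<times> 'b \<Rightarrow>\<^sub>0 'f) set, ('m \<times> 'n \<Rightarrow>\<^sub>0 'f) set) module" where
  "tensor_module A B M N =
     (let V = restrict_scalars A M; W = restrict_scalars B N; T = tensor V W in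
       \<lparr>carrier = carrier T, mult = mult T, one = \<one>\<^bsub>T\<^esub>, zero = \<zero>\<^bsub>T\<^esub>, add = add T,
        smult = (\<lambda>X Y. \<Union>x\<in>X. \<Union>y\<in>Y. \<zero>\<^bsub>T\<^esub> +>\<^bsub>free_space V W\<^esub>
          bilinear_ext (\<lambda>(a, b) (m, n). (a \<odot>\<^bsub>M\<^esub> m, b \<odot>\<^bsub>N\<^esub> n)) x y)\<rparr>)"

definition prod_order :: "('i \<times> 'i) set \<Rightarrow> ('j \<times> 'j) set \<Rightarrow> (('i \<times> 'j) \<times> ('i \<times> 'j)) set" where
  "prod_order r s = {((x1, x2), (y1, y2)). (x1, y1) \<in> r \<and> (x2, y2) \<in> s}"

end

(*
  Quasi-heredity is inherited because the standard modules, projective covers and simple modules of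
  A1 \<otimes> A2 are outer tensor products, and the products of two filtrations are ordered lexicographically.

  For the duality, a duality functor D is representable: D M = Hom (M, T), where T = D A carries a second,
  commuting action that comes from the right multiplications of A. Exactness of D says that T is injective, and
  the isomorphism of D with its own inverse gives a bijection of T that exchanges the two actions. Conversely
  these data determine a duality functor, and D L \<cong> L for a simple module L amounts to a nonzero
  homomorphism from L to Hom (L, T). All of this passes to T1 \<otimes> T2: the slices of a tensor along linear forms
  of one factor reduce statements about T1 \<otimes> T2 to statements about T1 and T2.
*)
theory Submission
  imports Defs
begin

section \<open>Left modules\<close>

text \<open>A module over a tensor product of algebras is in general no tensor product of modules,
  so two duality functors cannot be combined object by object; what can be tensored is the module
  representing each of them. Properties of the functor must then be recast as properties of that
  module that survive the tensor product. Besides injectivity these are \<open>full\<close> and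
  \<open>faithful\<close>, which say that A is recovered from its action on T; together they make M
  isomorphic to its double dual. Injectivity of T1 \<otimes> T2 is the delicate point: a map is
  first extended linearly over one algebra only, then corrected over the other by a retraction of a
  coinduced module. Algebraic closedness enters through Schur's lemma, in the simplicity of a tensor
  product of simple modules, and from there in the labels and the projective covers. Objects of the
  category have carriers in sequences of scalars, while tensor products consist of cosets of formal
  sums; hence outer tensor products are handled up to isomorphism, and copies made by
  \<open>enc\<close> lead back into the category.\<close>

abbreviation (input) add_in ("_ +[_] _" [65, 0, 66] 65) where "x +[M] y \<equiv> x \<oplus>\<^bsub>M\<^esub> y"
abbreviation (input) minus_in ("_ -[_] _" [65, 0, 66] 65) where "x -[M] y \<equiv> x \<ominus>\<^bsub>M\<^esub> y"
abbreviation (input) neg_in ("-[_] _" [0, 81] 80) where "-[M] x \<equiv> \<ominus>\<^bsub>M\<^esub> x"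
abbreviation (input) smult_in ("_ *[_] _" [70, 0, 71] 70) where "a *[M] x \<equiv> a \<odot>\<^bsub>M\<^esub> x"
abbreviation (input) mult_in ("_ **[_] _" [70, 0, 71] 70) where "x **[R] y \<equiv> x \<otimes>\<^bsub>R\<^esub> y"
abbreviation (input) zero_in ("0[_]") where "0[M] \<equiv> \<zero>\<^bsub>M\<^esub>"
abbreviation (input) one_in ("1[_]") where "1[R] \<equiv> \<one>\<^bsub>R\<^esub>"

lemmas (in left_module) is_module = left_module_axioms

lemmas (in left_module) [simp, intro] = smult_closed
lemmas (in left_module) [simp] = smult_one

text \<open>Homomorphisms that need not be extensional, unlike those in \<open>Hom\<close>: they can be composed as plain functions.\<close>

definition ahom :: "('r, 'd) ring_scheme \<Rightarrow> ('r, 'm) module \<Rightarrow> ('r, 'n) module \<Rightarrow> ('m \<Rightarrow> 'n) set" where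
 "ahom R M N = {f \<in> carrier M \<rightarrow> carrier N. (\<forall>x\<in>carrier M. \<forall>y\<in>carrier M. f (x +[M] y) = f x +[N] f y) \<and>
  (\<forall>a\<in>carrier R. \<forall>x\<in>carrier M. f (a *[M] x) = a *[N] f x)}"

abbreviation (input) "lin \<equiv> ahom field_ring"
abbreviation (input) "vsub U \<equiv> submodule U field_ring"
abbreviation (input) "span_of \<equiv> gen_submodule field_ring"
abbreviation (input) "rs \<equiv> restrict_scalars"
abbreviation (input) "pm_single \<equiv> Poly_Mapping.single"
abbreviation (input) "pm_keys \<equiv> Poly_Mapping.keys"

lemma ahomI:
 assumes "\<And>x. x \<in> carrier M \<Longrightarrow> f x \<in> carrier N"
  and "\<And>x y. \<lbrakk>x \<in> carrier M; y \<in> carrier M\<rbrakk> \<Longrightarrow> f (x +[M] y) = f x +[N] f y"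
  and "\<And>a x. \<lbrakk>a \<in> carrier R; x \<in> carrier M\<rbrakk> \<Longrightarrow> f (a *[M] x) = a *[N] f x"
 shows "f \<in> ahom R M N" using assms by (auto simp: ahom_def)

lemma ahomD:
 assumes "f \<in> ahom R M N"
 shows ahom_closed: "x \<in> carrier M \<Longrightarrow> f x \<in> carrier N"
  and ahom_add: "\<lbrakk>x \<in> carrier M; y \<in> carrier M\<rbrakk> \<Longrightarrow> f (x +[M] y) = f x +[N] f y"
  and ahom_smult: "\<lbrakk>a \<in> carrier R; x \<in> carrier M\<rbrakk> \<Longrightarrow> f (a *[M] x) = a *[N] f x"
 using assms by (auto simp: ahom_def)

lemma Hom_iff: "f \<in> Hom R M N \<longleftrightarrow> f \<in> ahom R M N \<and> f \<in> extensional (carrier M)"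
 by (auto simp: Hom_def ahom_def PiE_def)

lemma Hom_ahom: "f \<in> Hom R M N \<Longrightarrow> f \<in> ahom R M N" by (simp add: Hom_iff)

lemma ahom_cong:
 assumes "f \<in> ahom R M N" "\<And>x. x \<in> carrier M \<Longrightarrow> g x = f x" "left_module R M"
 shows "g \<in> ahom R M N"
proof -
 interpret M: left_module R M by fact
 show ?thesis by (rule ahomI) (simp_all add: assms(2) ahomD[OF assms(1)])
qed

lemma restrict_Hom:
 assumes "f \<in> ahom R M N" "left_module R M"
 shows "restrict f (carrier M) \<in> Hom R M N" unfolding Hom_iff by (auto intro: ahom_cong[OF assms(1) _ assms(2)])

lemma ahom_comp:
 assumes "f \<in> ahom R L M" "g \<in> ahom R M N"
 shows "(\<lambda>x. g (f x)) \<in> ahom R L N" by (rule ahomI) (simp_all add: ahomD[OF assms(1)] ahomD[OF assms(2)])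

lemma ahom_id: "(\<lambda>x. x) \<in> ahom R M M" by (auto intro: ahomI)

lemma left_moduleI:
 assumes "ring R"
  and "\<And>x y. \<lbrakk>x \<in> carrier M; y \<in> carrier M\<rbrakk> \<Longrightarrow> x +[M] y \<in> carrier M"
  and "0[M] \<in> carrier M"
  and "\<And>x y z. \<lbrakk>x \<in> carrier M; y \<in> carrier M; z \<in> carrier M\<rbrakk> \<Longrightarrow> (x +[M] y) +[M] z = x +[M] (y +[M] z)"
  and "\<And>x y. \<lbrakk>x \<in> carrier M; y \<in> carrier M\<rbrakk> \<Longrightarrow> x +[M] y = y +[M] x"
  and "\<And>x. x \<in> carrier M \<Longrightarrow> 0[M] +[M] x = x"
  and "\<And>x. x \<in> carrier M \<Longrightarrow> \<exists>y\<in>carrier M. y +[M] x = 0[M]"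
  and "\<And>a x. \<lbrakk>a \<in> carrier R; x \<in> carrier M\<rbrakk> \<Longrightarrow> a *[M] x \<in> carrier M"
  and "\<And>a b x. \<lbrakk>a \<in> carrier R; b \<in> carrier R; x \<in> carrier M\<rbrakk>
     \<Longrightarrow> (a +[R] b) *[M] x = (a *[M] x) +[M] (b *[M] x)"
  and "\<And>a x y. \<lbrakk>a \<in> carrier R; x \<in> carrier M; y \<in> carrier M\<rbrakk>
     \<Longrightarrow> a *[M] (x +[M] y) = (a *[M] x) +[M] (a *[M] y)"
  and "\<And>a b x. \<lbrakk>a \<in> carrier R; b \<in> carrier R; x \<in> carrier M\<rbrakk>
     \<Longrightarrow> (a **[R] b) *[M] x = a *[M] (b *[M] x)"
  and "\<And>x. x \<in> carrier M \<Longrightarrow> 1[R] *[M] x = x"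
 shows "left_module R M" by (intro left_module.intro left_module_axioms.intro abelian_groupI assms)

context left_module
begin

lemma smult_l_null [simp]:
 assumes x: "x \<in> carrier M" shows "0[R] *[M] x = 0[M]"
proof -
 have "0[R] *[M] x +[M] 0[R] *[M] x = 0[R] *[M] x +[M] 0[M]" using smult_l_distr[of "0[R]" "0[R]" x] x by simp
 then show ?thesis using x by (simp only: M.add.r_cancel_one' M.add.l_cancel_one' M.add.l_cancel_one M.add.r_cancel_one smult_closed R.zero_closed M.r_zero)
qed

lemma smult_r_null [simp]:
 assumes a: "a \<in> carrier R" shows "a *[M] 0[M] = 0[M]"
proof -
 have "a *[M] 0[M] +[M] a *[M] 0[M] = a *[M] 0[M] +[M] 0[M]" using smult_r_distr[of a "0[M]" "0[M]"] a by simp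
 then show ?thesis using a by (simp only: M.add.r_cancel_one' M.add.l_cancel_one' M.add.l_cancel_one M.add.r_cancel_one smult_closed M.zero_closed M.r_zero)
qed

lemma smult_neg_one:
 assumes x: "x \<in> carrier M" shows "(-[R] 1[R]) *[M] x = -[M] x"
proof -
 have "(-[R] 1[R]) *[M] x +[M] x = 0[M]" using smult_l_distr[of "-[R] 1[R]" "1[R]" x] x by (simp add: R.l_neg)
 then show ?thesis using x by (metis M.add.inv_equality R.one_closed R.add.inv_closed smult_closed)
qed

lemma minus_eq_zero:
 assumes "x \<in> carrier M" "y \<in> carrier M" shows "x -[M] y = 0[M] \<longleftrightarrow> x = y"
proof
 assume "x -[M] y = 0[M]"
 then have "(x -[M] y) +[M] y = y" using assms by simp
 then show "x = y" using assms by (simp add: a_minus_def M.a_assoc M.l_neg)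
qed (use assms in "simp add: a_minus_def M.r_neg")

lemma smult_r_minus:
 assumes "a \<in> carrier R" "x \<in> carrier M" shows "a *[M] (-[M] x) = -[M] (a *[M] x)"
proof -
 have "a *[M] (-[M] x) +[M] a *[M] x = 0[M]" using assms by (simp add: smult_r_distr[symmetric] M.l_neg)
 then show ?thesis using assms by (metis M.add.inv_equality M.a_inv_closed smult_closed)
qed

lemma submoduleI:
 assumes "H \<subseteq> carrier M" "0[M] \<in> H" "\<And>x y. \<lbrakk>x \<in> H; y \<in> H\<rbrakk> \<Longrightarrow> x +[M] y \<in> H"
  and s: "\<And>a x. \<lbrakk>a \<in> carrier R; x \<in> H\<rbrakk> \<Longrightarrow> a *[M] x \<in> H"
 shows "submodule H R M"
proof (intro submodule.intro subgroup.intro submodule_axioms.intro)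
 fix x assume "x \<in> H"
 then have "-[M] x \<in> H" using s[of "-[R] 1[R]" x] assms(1) smult_neg_one[of x] by auto
 then show "inv\<^bsub>add_monoid M\<^esub> x \<in> H" by (simp add: a_inv_def)
qed (use assms in auto)

lemma carrier_submodule: "submodule (carrier M) R M" by (rule submoduleI) auto

lemma zero_submodule: "submodule {0[M]} R M" by (rule submoduleI) auto

end

lemma submoduleD:
 assumes "submodule H R M"
 shows "H \<subseteq> carrier M"
  and "0[M] \<in> H"
  and "\<And>x y. \<lbrakk>x \<in> H; y \<in> H\<rbrakk> \<Longrightarrow> x +[M] y \<in> H"
  and "\<And>x. x \<in> H \<Longrightarrow> -[M] x \<in> H"
  and "\<And>a x. \<lbrakk>a \<in> carrier R; x \<in> H\<rbrakk> \<Longrightarrow> a *[M] x \<in> H"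
  and "\<And>x. x \<in> H \<Longrightarrow> x \<in> carrier M"
proof -
 interpret submodule H R M by fact
 show "H \<subseteq> carrier M" "0[M] \<in> H" "\<And>x y. \<lbrakk>x \<in> H; y \<in> H\<rbrakk> \<Longrightarrow> x +[M] y \<in> H"
  "\<And>x. x \<in> H \<Longrightarrow> -[M] x \<in> H" "\<And>a x. \<lbrakk>a \<in> carrier R; x \<in> H\<rbrakk> \<Longrightarrow> a *[M] x \<in> H"
  "\<And>x. x \<in> H \<Longrightarrow> x \<in> carrier M" using subset one_closed m_closed m_inv_closed by (auto simp: a_inv_def)
qed

lemma submodule_minus:
 assumes "submodule H R M" "x \<in> H" "y \<in> H"
 shows "x -[M] y \<in> H" using submoduleD[OF assms(1)] assms by (simp add: a_minus_def)

text \<open>The module axioms are equations and can be checked after an injective map that respects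
  the operations. Negatives come from multiplication by -1.\<close>

lemma left_module_inj:
 assumes "left_module R M" and inj: "inj_on \<phi> (carrier N)"
  and cl: "\<And>x. x \<in> carrier N \<Longrightarrow> \<phi> x \<in> carrier M"
  and a: "\<And>x y. \<lbrakk>x \<in> carrier N; y \<in> carrier N\<rbrakk> \<Longrightarrow> x +[N] y \<in> carrier N \<and> \<phi> (x +[N] y) = \<phi> x +[M] \<phi> y"
  and z: "0[N] \<in> carrier N" "\<phi> 0[N] = 0[M]"
  and s: "\<And>a x. \<lbrakk>a \<in> carrier R; x \<in> carrier N\<rbrakk> \<Longrightarrow> a *[N] x \<in> carrier N \<and> \<phi> (a *[N] x) = a *[M] \<phi> x"
 shows "left_module R N"
proof -
 interpret M: left_module R M by fact
 have eq: "x = y" if "\<phi> x = \<phi> y" "x \<in> carrier N" "y \<in> carrier N" for x y using inj that by (auto dest: inj_onD)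
 show ?thesis
 proof (rule left_moduleI)
  show "\<exists>y\<in>carrier N. y +[N] x = 0[N]" if "x \<in> carrier N" for x by (rule bexI[of _ "(-[R] 1[R]) *[N] x"], rule eq)
    (use that in "simp_all add: a s z cl M.smult_neg_one M.M.l_neg")
  show "x +[N] y = y +[N] x" if "x \<in> carrier N" "y \<in> carrier N" for x y
   by (rule eq) (use that M.M.a_comm in "simp_all add: a cl")
  show "ring R" by (rule M.R.ring_axioms)
 qed ((rule eq)?, simp_all add: a s z cl M.M.a_assoc M.smult_l_distr M.smult_r_distr M.smult_assoc1)+
qed

text \<open>Dual to the previous lemma: equations pass to the image of a map that respects the
  operations. This gives quotients and transported structures, whose operations are known on
  representatives.\<close>

lemma left_module_surj:
 assumes "left_module R M" and surj: "\<phi> ` carrier M = carrier N"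
  and a: "\<And>x y. \<lbrakk>x \<in> carrier M; y \<in> carrier M\<rbrakk> \<Longrightarrow> \<phi> x +[N] \<phi> y = \<phi> (x +[M] y)"
  and z: "\<phi> 0[M] = 0[N]"
  and s: "\<And>a x. \<lbrakk>a \<in> carrier R; x \<in> carrier M\<rbrakk> \<Longrightarrow> a *[N] \<phi> x = \<phi> (a *[M] x)"
 shows "left_module R N"
proof -
 interpret M: left_module R M by fact
 have z': "0[N] = \<phi> 0[M]" using z by simp
 note [simp] = a s z'
 have c: "carrier N = \<phi> ` carrier M" by (rule surj[symmetric])
 show ?thesis
 proof (rule left_moduleI)
  show "\<exists>y\<in>carrier N. y +[N] x = 0[N]" if x: "x \<in> carrier N" for x
  proof -
   obtain x' where x': "x = \<phi> x'" "x' \<in> carrier M" using x[folded surj] by (rule imageE)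
   show ?thesis by (rule bexI[of _ "\<phi> (-[M] x')"]) (use x' in "simp_all add: c M.M.l_neg")
  qed
  show "ring R" by (rule M.R.ring_axioms)
  fix x y assume "x \<in> carrier N" "y \<in> carrier N"
  then have "x \<in> \<phi> ` carrier M" "y \<in> \<phi> ` carrier M" by (simp_all only: c)
  then show "x +[N] y = y +[N] x" by (elim imageE) (simp add: M.M.a_comm)
 qed (unfold c, auto simp: M.M.a_assoc M.smult_l_distr M.smult_r_distr M.smult_assoc1)
qed

lemma submodule_left_module:
 assumes "left_module R M" "submodule H R M"
 shows "left_module R (M\<lparr>carrier := H\<rparr>)"
 by (rule left_module_inj[OF assms(1), where \<phi> = "\<lambda>x. x"]) (auto simp: submoduleD[OF assms(2)])

lemma submodule_sub:
 assumes "left_module R M" "submodule H R M"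
 shows "submodule K R (M\<lparr>carrier := H\<rparr>) \<longleftrightarrow> submodule K R M \<and> K \<subseteq> H"
proof -
 interpret M: left_module R M by fact
 interpret H: left_module R "M\<lparr>carrier := H\<rparr>" by (rule submodule_left_module[OF assms])
 show ?thesis
 proof (intro iffI conjI)
  assume K: "submodule K R (M\<lparr>carrier := H\<rparr>)"
  show "K \<subseteq> H" using submoduleD(1)[OF K] by simp
  then show "submodule K R M" using submoduleD[OF K] submoduleD(1)[OF assms(2)] by (intro M.submoduleI) auto
 next
  assume K: "submodule K R M \<and> K \<subseteq> H"
  then show "submodule K R (M\<lparr>carrier := H\<rparr>)" using submoduleD[of K] by (intro H.submoduleI) auto
 qed
qed

lemma incl_ahom:
 assumes "submodule H R M"
 shows "(\<lambda>x. x) \<in> ahom R (M\<lparr>carrier := H\<rparr>) M" by (rule ahomI) (auto simp: submoduleD[OF assms])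

locale module_hom = M: left_module R M + N: left_module R N for R M N +
 fixes f
 assumes hom: "f \<in> ahom R M N"
begin

lemmas hom_simps [simp] = ahomD[OF hom]

lemma hom_zero [simp]: "f 0[M] = 0[N]" using hom_simps(3)[of "0[R]" "0[M]"] by simp

lemma hom_neg [simp]: "x \<in> carrier M \<Longrightarrow> f (-[M] x) = -[N] (f x)"
 using hom_simps(3)[of "-[R] 1[R]" x] by (simp add: M.smult_neg_one N.smult_neg_one)

lemma hom_minus [simp]: "\<lbrakk>x \<in> carrier M; y \<in> carrier M\<rbrakk> \<Longrightarrow> f (x -[M] y) = f x -[N] f y" by (simp add: a_minus_def)

lemma kernel_eq: "a_kernel M N f = {x \<in> carrier M. f x = 0[N]}" by (auto simp: a_kernel_def kernel_def)

lemma kernel_submodule: "submodule (a_kernel M N f) R M" unfolding kernel_eq by (rule M.submoduleI) auto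

lemma image_submodule:
 assumes "submodule H R M" shows "submodule (f ` H) R N"
proof (rule N.submoduleI)
 note H = submoduleD[OF assms]
 show "f ` H \<subseteq> carrier N" using H by auto
 show "0[N] \<in> f ` H" using H hom_zero by (metis imageI)
 show "x +[N] y \<in> f ` H" if xy: "x \<in> f ` H" "y \<in> f ` H" for x y
 proof -
  obtain u v where "u \<in> H" "v \<in> H" "x = f u" "y = f v" using xy by blast
  then show ?thesis using H by (intro image_eqI[of _ _ "u +[M] v"]) simp_all
 qed
 show "a *[N] x \<in> f ` H" if ax: "a \<in> carrier R" "x \<in> f ` H" for a x
 proof -
  obtain u where "u \<in> H" "x = f u" using ax by blast
  then show ?thesis using H ax by (intro image_eqI[of _ _ "a *[M] u"]) simp_all
 qed
qed

lemma vimage_submodule: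
 assumes "submodule K R N" shows "submodule {x \<in> carrier M. f x \<in> K} R M"
 by (rule M.submoduleI) (auto simp: submoduleD[OF assms])

lemma inj_iff: "inj_on f (carrier M) \<longleftrightarrow> (\<forall>x\<in>carrier M. f x = 0[N] \<longrightarrow> x = 0[M])"
proof (intro iffI ballI impI inj_onI)
 fix x assume "inj_on f (carrier M)" "x \<in> carrier M" "f x = 0[N]"
 then show "x = 0[M]" by (metis inj_onD hom_zero M.M.zero_closed)
next
 fix x y assume *: "\<forall>x\<in>carrier M. f x = 0[N] \<longrightarrow> x = 0[M]" "x \<in> carrier M" "y \<in> carrier M" "f x = f y"
 then have "f (x -[M] y) = 0[N]" by (simp add: a_minus_def N.M.r_neg)
 then have "x -[M] y = 0[M]" using * by blast
 then show "x = y" using * by (simp add: M.minus_eq_zero)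
qed

lemma inv_ahom:
 assumes "bij_betw f (carrier M) (carrier N)"
 shows "inv_into (carrier M) f \<in> ahom R N M"
proof -
 let ?g = "inv_into (carrier M) f"
 have g: "\<And>y. y \<in> carrier N \<Longrightarrow> ?g y \<in> carrier M" "\<And>y. y \<in> carrier N \<Longrightarrow> f (?g y) = y"
  using assms by (auto simp: bij_betw_def f_inv_into_f inv_into_into)
 have e: "\<And>x. x \<in> carrier M \<Longrightarrow> ?g (f x) = x" using assms by (simp add: bij_betw_def)
 show ?thesis
 proof (rule ahomI)
  fix x y assume xy: "x \<in> carrier N" "y \<in> carrier N"
  have "f (?g x +[M] ?g y) = x +[N] y" using xy g by simp
  moreover have "?g (f (?g x +[M] ?g y)) = ?g x +[M] ?g y" by (rule e) (use xy g in simp)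
  ultimately show "?g (x +[N] y) = ?g x +[M] ?g y" by metis
 next
  fix a x assume xy: "a \<in> carrier R" "x \<in> carrier N"
  have "f (a *[M] ?g x) = a *[N] x" using xy g by simp
  moreover have "?g (f (a *[M] ?g x)) = a *[M] ?g x" by (rule e) (use xy g in simp)
  ultimately show "?g (a *[N] x) = a *[M] ?g x" by metis
 qed (use g in auto)
qed

end

lemma isomorphicI:
 assumes "left_module R M" "f \<in> ahom R M N" "bij_betw f (carrier M) (carrier N)"
 shows "isomorphic R M N"
proof -
 have "bij_betw (restrict f (carrier M)) (carrier M) (carrier N)"
  using assms(3) by (simp add: bij_betw_def inj_on_def image_restrict_eq)
 then show ?thesis using restrict_Hom[OF assms(2,1)] unfolding isomorphic_def by blast
qed

lemma isomorphicE:
 assumes "isomorphic R M N"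
 obtains f where "f \<in> ahom R M N" "bij_betw f (carrier M) (carrier N)"
 using assms by (auto simp: isomorphic_def Hom_iff)

lemma isomorphic_sym:
 assumes "left_module R M" "left_module R N" "isomorphic R M N"
 shows "isomorphic R N M"
proof -
 obtain f where f: "f \<in> ahom R M N" "bij_betw f (carrier M) (carrier N)" by (rule isomorphicE[OF assms(3)])
 interpret module_hom R M N f using assms f by (simp add: module_hom_def module_hom_axioms_def)
 show ?thesis by (rule isomorphicI[OF assms(2) inv_ahom[OF f(2)] bij_betw_inv_into[OF f(2)]])
qed

lemma isomorphic_trans:
 assumes "left_module R L" "isomorphic R L M" "isomorphic R M N"
 shows "isomorphic R L N"
proof -
 obtain f where f: "f \<in> ahom R L M" "bij_betw f (carrier L) (carrier M)" by (rule isomorphicE[OF assms(2)])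
 obtain g where g: "g \<in> ahom R M N" "bij_betw g (carrier M) (carrier N)" by (rule isomorphicE[OF assms(3)])
 show ?thesis by (rule isomorphicI[OF assms(1) ahom_comp[OF f(1) g(1)]])
   (use bij_betw_trans[OF f(2) g(2)] in "simp add: comp_def")
qed

definition transport :: "('m \<Rightarrow> 'n) \<Rightarrow> ('r, 'm) module \<Rightarrow> ('r, 'n) module" where
 "transport \<phi> M = (let i = inv_into (carrier M) \<phi> in
  \<lparr>carrier = \<phi> ` carrier M, mult = (\<lambda>x y. \<phi> 0[M]), one = \<phi> 0[M], zero = \<phi> 0[M],
   add = (\<lambda>x y. \<phi> (i x +[M] i y)), smult = (\<lambda>a x. \<phi> (a *[M] i x))\<rparr>)"

lemma transport:
 assumes "left_module R M" "inj_on \<phi> (carrier M)"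
 shows "left_module R (transport \<phi> M)" "\<phi> \<in> ahom R M (transport \<phi> M)"
  "bij_betw \<phi> (carrier M) (carrier (transport \<phi> M))"
proof -
 interpret M: left_module R M by fact
 note [simp] = inv_into_f_f[OF assms(2)]
 show "left_module R (transport \<phi> M)"
  by (rule left_module_surj[OF assms(1), where \<phi> = \<phi>]) (auto simp: transport_def Let_def)
 show "\<phi> \<in> ahom R M (transport \<phi> M)" by (rule ahomI) (auto simp: transport_def Let_def)
 show "bij_betw \<phi> (carrier M) (carrier (transport \<phi> M))"
  using assms(2) by (auto simp: transport_def Let_def bij_betw_def)
qed

section \<open>Quotient modules\<close>

locale sub_module = M: left_module R M for R and M :: "('r, 'm) module" +
 fixes H assumes sub: "submodule H R M"
begin

lemmas sub_simps [simp] = submoduleD(2-5)[OF sub]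

lemma abelian_sub: "abelian_subgroup H M"
proof -
 interpret submodule H R M by (rule sub)
 show ?thesis
  by (rule abelian_subgroupI3) (auto intro: additive_subgroup.intro simp: subgroup_axioms M.M.abelian_group_axioms)
qed

sublocale abelian_subgroup H M by (rule abelian_sub)

lemma coset_mem: "y \<in> H +>\<^bsub>M\<^esub> x \<longleftrightarrow> (\<exists>h\<in>H. y = h +[M] x)" by (auto simp: a_r_coset_def')

lemma coset_eqI:
 assumes "h \<in> H" "x \<in> carrier M" shows "H +>\<^bsub>M\<^esub> (h +[M] x) = H +>\<^bsub>M\<^esub> x"
proof -
 have h: "h \<in> carrier M" using assms submoduleD(6)[OF sub] by auto
 show ?thesis
 proof (intro equalityI subsetI)
  fix y assume "y \<in> H +>\<^bsub>M\<^esub> (h +[M] x)"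
  then obtain k where k: "k \<in> H" "y = k +[M] (h +[M] x)" by (auto simp: coset_mem)
  then have "y = (k +[M] h) +[M] x" using h assms submoduleD(6)[OF sub] by (simp add: M.M.a_assoc)
  then show "y \<in> H +>\<^bsub>M\<^esub> x" unfolding coset_mem using k assms by (intro bexI[of _ "k +[M] h"]) simp_all
 next
  fix y assume "y \<in> H +>\<^bsub>M\<^esub> x"
  then obtain k where k: "k \<in> H" "y = k +[M] x" by (auto simp: coset_mem)
  then have "y = (k +[M] -[M] h) +[M] (h +[M] x)" using h assms submoduleD(6)[OF sub]
   by (simp add: M.M.a_assoc M.M.r_neg1)
  then show "y \<in> H +>\<^bsub>M\<^esub> (h +[M] x)" unfolding coset_mem using k assms
   by (intro bexI[of _ "k +[M] -[M] h"]) simp_all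
 qed
qed

lemma coset_self: "x \<in> carrier M \<Longrightarrow> x \<in> H +>\<^bsub>M\<^esub> x" using sub_simps(1) by (force simp: coset_mem)

lemma coset_eq_iff:
 assumes x: "x \<in> carrier M" and y: "y \<in> carrier M"
 shows "H +>\<^bsub>M\<^esub> x = H +>\<^bsub>M\<^esub> y \<longleftrightarrow> x -[M] y \<in> H"
proof
 assume "H +>\<^bsub>M\<^esub> x = H +>\<^bsub>M\<^esub> y"
 then obtain h where h: "h \<in> H" "x = h +[M] y" using coset_self[OF x] by (auto simp: coset_mem)
 have "h \<in> carrier M" using h submoduleD(6)[OF sub] by auto
 then have "x -[M] y = h" using y h by (simp add: a_minus_def M.M.a_assoc M.M.r_neg)
 then show "x -[M] y \<in> H" using h by simp
next
 assume "x -[M] y \<in> H"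
 then have "H +>\<^bsub>M\<^esub> ((x -[M] y) +[M] y) = H +>\<^bsub>M\<^esub> y" using y by (rule coset_eqI)
 then show "H +>\<^bsub>M\<^esub> x = H +>\<^bsub>M\<^esub> y" using x y by (simp add: a_minus_def M.M.a_assoc M.M.l_neg)
qed

text \<open>\<open>quot_module\<close> and \<open>tensor_module\<close> define actions as unions
  over representatives; once all representatives lead to the same coset, the union collapses to
  it.\<close>

lemma coset_UN:
 assumes x: "x \<in> carrier M" and g: "\<And>h. h \<in> H \<Longrightarrow> g (h +[M] x) = c"
 shows "(\<Union>z\<in>H +>\<^bsub>M\<^esub> x. g z) = c"
proof -
 have "g z = c" if "z \<in> H +>\<^bsub>M\<^esub> x" for z using that g by (auto simp: coset_mem)
 then show ?thesis using coset_self[OF x] by auto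
qed

lemma quot_carrier: "carrier (quot_module M H) = (\<lambda>x. H +>\<^bsub>M\<^esub> x) ` carrier M"
 by (auto simp: quot_module_def A_RCOSETS_def')

lemma quot_zero: "0[quot_module M H] = H +>\<^bsub>M\<^esub> 0[M]"
proof -
 have "H +>\<^bsub>M\<^esub> 0[M] = H" using submoduleD(6)[OF sub] by (auto simp: coset_mem)
 then show ?thesis by (simp add: quot_module_def)
qed

lemma quot_add: "\<lbrakk>x \<in> carrier M; y \<in> carrier M\<rbrakk>
  \<Longrightarrow> (H +>\<^bsub>M\<^esub> x) +[quot_module M H] (H +>\<^bsub>M\<^esub> y) = H +>\<^bsub>M\<^esub> (x +[M] y)" by (simp add: quot_module_def a_rcos_sum)

lemma quot_smult:
 assumes a: "a \<in> carrier R" and x: "x \<in> carrier M"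
 shows "a *[quot_module M H] (H +>\<^bsub>M\<^esub> x) = H +>\<^bsub>M\<^esub> (a *[M] x)"
proof -
 have "(\<Union>z\<in>H +>\<^bsub>M\<^esub> x. H +>\<^bsub>M\<^esub> (a *[M] z)) = H +>\<^bsub>M\<^esub> (a *[M] x)" using a x submoduleD(6)[OF sub]
  by (intro coset_UN) (simp_all add: M.smult_r_distr coset_eqI)
 then show ?thesis by (simp add: quot_module_def)
qed

lemma quot_left_module: "left_module R (quot_module M H)"
 by (rule left_module_surj[OF M.is_module, where \<phi> = "\<lambda>x. H +>\<^bsub>M\<^esub> x"])
  (auto simp: quot_carrier quot_zero quot_add quot_smult)

lemma quot_proj: "(\<lambda>x. H +>\<^bsub>M\<^esub> x) \<in> ahom R M (quot_module M H)"
 by (rule ahomI) (auto simp: quot_carrier quot_add quot_smult)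

lemma quot_proj_zero: "x \<in> carrier M \<Longrightarrow> H +>\<^bsub>M\<^esub> x = 0[quot_module M H] \<longleftrightarrow> x \<in> H"
 proof -
 assume x: "x \<in> carrier M"
 have "-[M] 0[M] = 0[M]" by (rule M.M.add.inv_equality) simp_all
 then have "x -[M] 0[M] = x" using x unfolding a_minus_def by (simp only: M.M.r_zero)
 then show ?thesis using x by (simp add: quot_zero coset_eq_iff)
qed

text \<open>The first isomorphism theorem, with the induced map defined through a chosen
  representative. It identifies the layers of filtrations.\<close>

lemma quot_isoI:
 assumes N: "left_module R N" and f: "f \<in> ahom R M N" "f ` carrier M = carrier N"
  and k: "\<And>x. x \<in> carrier M \<Longrightarrow> f x = 0[N] \<longleftrightarrow> x \<in> H"
 shows "isomorphic R (quot_module M H) N"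
proof -
 interpret f: module_hom R M N f using N f by (simp add: module_hom_def module_hom_axioms_def M.is_module)
 interpret N: left_module R N by (rule N)
 define g where "g X = f (SOME x. x \<in> X \<and> x \<in> carrier M)" for X
 have g: "g (H +>\<^bsub>M\<^esub> x) = f x" if x: "x \<in> carrier M" for x
 proof -
  have "\<exists>y. y \<in> H +>\<^bsub>M\<^esub> x \<and> y \<in> carrier M" using coset_self[OF x] x by auto
  from someI_ex[OF this] obtain h where h: "h \<in> H" "(SOME y. y \<in> H +>\<^bsub>M\<^esub> x \<and> y \<in> carrier M) = h +[M] x"
   by (auto simp: coset_mem)
  have "h \<in> carrier M" using h submoduleD(6)[OF sub] by auto
  then show ?thesis using k[of h] h x by (simp add: g_def)
 qed
 have "g \<in> ahom R (quot_module M H) N" by (rule ahomI) (auto simp: quot_carrier quot_add quot_smult g)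
 moreover have "bij_betw g (carrier (quot_module M H)) (carrier N)"
 proof (rule bij_betwI')
  fix X Y assume "X \<in> carrier (quot_module M H)" "Y \<in> carrier (quot_module M H)"
  then obtain x y where xy: "x \<in> carrier M" "y \<in> carrier M" "X = H +>\<^bsub>M\<^esub> x" "Y = H +>\<^bsub>M\<^esub> y"
   by (auto simp: quot_carrier)
  have "f x = f y \<longleftrightarrow> f (x -[M] y) = 0[N]" using xy by (simp add: f.N.minus_eq_zero)
  then show "(g X = g Y) = (X = Y)" using xy k[of "x -[M] y"] by (simp add: g coset_eq_iff)
 next
  fix X assume "X \<in> carrier (quot_module M H)"
  then show "g X \<in> carrier N" by (auto simp: quot_carrier g)
 next
  fix y assume "y \<in> carrier N"
  then obtain x where x: "x \<in> carrier M" "y = f x" using f(2) by blast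
  then show "\<exists>X\<in>carrier (quot_module M H). y = g X" by (auto simp: quot_carrier g)
 qed
 ultimately show ?thesis by (rule isomorphicI[OF quot_left_module])
qed

text \<open>An isomorphism out of a quotient is exchanged for a surjection with kernel
  \<open>H\<close>, so that later arguments work with elements instead of cosets.\<close>

lemma quot_isoD:
 assumes "isomorphic R (quot_module M H) N" "left_module R N"
 obtains f where "f \<in> ahom R M N" "f ` carrier M = carrier N"
  "\<And>x. x \<in> carrier M \<Longrightarrow> f x = 0[N] \<longleftrightarrow> x \<in> H"
proof -
 obtain g where g: "g \<in> ahom R (quot_module M H) N" "bij_betw g (carrier (quot_module M H)) (carrier N)"
  by (rule isomorphicE[OF assms(1)])
 interpret g: module_hom R "quot_module M H" N g
  using g assms quot_left_module by (simp add: module_hom_def module_hom_axioms_def)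
 have inj: "inj_on g (carrier (quot_module M H))" and im: "g ` carrier (quot_module M H) = carrier N"
  using g(2) by (auto simp: bij_betw_def)
 show ?thesis
 proof
  show "(\<lambda>x. g (H +>\<^bsub>M\<^esub> x)) \<in> ahom R M N" by (rule ahom_comp[OF quot_proj g(1)])
  show "(\<lambda>x. g (H +>\<^bsub>M\<^esub> x)) ` carrier M = carrier N" using im by (simp add: quot_carrier image_image)
  show "g (H +>\<^bsub>M\<^esub> x) = 0[N] \<longleftrightarrow> x \<in> H" if "x \<in> carrier M" for x
  proof -
   have "g (H +>\<^bsub>M\<^esub> x) = 0[N] \<longleftrightarrow> H +>\<^bsub>M\<^esub> x = 0[quot_module M H]"
    using g.inj_iff inj that g.hom_zero by (metis quot_carrier imageI)
   then show ?thesis using quot_proj_zero[OF that] by simp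
  qed
 qed
qed

end

section \<open>Generated submodules\<close>

lemma gen_submodule:
 assumes "left_module R M" "S \<subseteq> carrier M"
 shows "submodule (gen_submodule R M S) R M" "S \<subseteq> gen_submodule R M S"
  "\<And>H. \<lbrakk>submodule H R M; S \<subseteq> H\<rbrakk> \<Longrightarrow> gen_submodule R M S \<subseteq> H"
proof -
 interpret left_module R M by fact
 have "gen_submodule R M S \<subseteq> carrier M" using carrier_submodule assms by (auto simp: gen_submodule_def)
 then show "submodule (gen_submodule R M S) R M" by (intro submoduleI) (auto simp: gen_submodule_def submoduleD)
qed (auto simp: gen_submodule_def)

lemma (in left_module) sum_submodule:
 assumes "submodule H R M" "submodule K R M"
 shows "submodule (H <+>\<^bsub>M\<^esub> K) R M" "H \<subseteq> H <+>\<^bsub>M\<^esub> K" "K \<subseteq> H <+>\<^bsub>M\<^esub> K"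
proof -
 note h = submoduleD[OF assms(1)] and k = submoduleD[OF assms(2)]
 have mem: "z \<in> H <+>\<^bsub>M\<^esub> K \<longleftrightarrow> (\<exists>x\<in>H. \<exists>y\<in>K. z = x +[M] y)" for z by (auto simp: set_add_def')
 show "submodule (H <+>\<^bsub>M\<^esub> K) R M"
 proof (rule submoduleI)
  show "H <+>\<^bsub>M\<^esub> K \<subseteq> carrier M" using h k by (auto simp: mem)
  show "0[M] \<in> H <+>\<^bsub>M\<^esub> K" unfolding mem by (rule bexI[OF _ h(2)], rule bexI[OF _ k(2)]) simp
  fix z w assume "z \<in> H <+>\<^bsub>M\<^esub> K" "w \<in> H <+>\<^bsub>M\<^esub> K"
  then obtain x y x' y' where *: "x \<in> H" "y \<in> K" "z = x +[M] y" "x' \<in> H" "y' \<in> K" "w = x' +[M] y'"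
   by (auto simp: mem)
  then have "z +[M] w = (x +[M] x') +[M] (y +[M] y')" using h(6) k(6) by (simp add: M.add.m_ac)
  moreover have "x +[M] x' \<in> H" "y +[M] y' \<in> K" using * h k by auto
  ultimately show "z +[M] w \<in> H <+>\<^bsub>M\<^esub> K" unfolding mem by blast
 next
  fix a z assume a: "a \<in> carrier R" "z \<in> H <+>\<^bsub>M\<^esub> K"
  then obtain x y where *: "x \<in> H" "y \<in> K" "z = x +[M] y" by (auto simp: mem)
  then have "a *[M] z = a *[M] x +[M] a *[M] y" using a h(6) k(6) by (simp add: smult_r_distr)
  then show "a *[M] z \<in> H <+>\<^bsub>M\<^esub> K" unfolding mem using * a h(5) k(5) by blast
 qed
 show "H \<subseteq> H <+>\<^bsub>M\<^esub> K"
 proof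
  fix x assume "x \<in> H" then show "x \<in> H <+>\<^bsub>M\<^esub> K"
   unfolding mem by (intro bexI[of _ x] bexI[of _ "0[M]"]) (use h k in auto)
 qed
 show "K \<subseteq> H <+>\<^bsub>M\<^esub> K"
 proof
  fix x assume "x \<in> K" then show "x \<in> H <+>\<^bsub>M\<^esub> K"
   unfolding mem by (intro bexI[of _ "0[M]"] bexI[of _ x]) (use h k in auto)
 qed
qed

section \<open>Simple modules\<close>

text \<open>First half of Schur's lemma: the kernel is a submodule that misses x. The second half is
  the same argument with the image.\<close>

lemma simple_hom_inj:
 assumes "simple_module R M" "left_module R N" "f \<in> ahom R M N" "x \<in> carrier M" "f x \<noteq> 0[N]"
 shows "inj_on f (carrier M)"
proof -
 interpret f: module_hom R M N f using assms by (simp add: module_hom_def module_hom_axioms_def simple_module_def)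
 have "a_kernel M N f = {0[M]}" using f.kernel_submodule assms(1,4,5) by (auto simp: simple_module_def f.kernel_eq)
 then show ?thesis by (auto simp: f.inj_iff f.kernel_eq)
qed

lemma simple_hom_surj:
 assumes "simple_module R N" "left_module R M" "f \<in> ahom R M N" "x \<in> carrier M" "f x \<noteq> 0[N]"
 shows "f ` carrier M = carrier N"
proof -
 interpret f: module_hom R M N f using assms by (simp add: module_hom_def module_hom_axioms_def simple_module_def)
 show ?thesis using f.image_submodule[OF f.M.carrier_submodule] assms(1,4,5) by (auto simp: simple_module_def)
qed

lemma simple_hom_iso:
 assumes "simple_module R M" "simple_module R N" "f \<in> ahom R M N" "x \<in> carrier M" "f x \<noteq> 0[N]"
 shows "isomorphic R M N" "bij_betw f (carrier M) (carrier N)"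
 using simple_hom_inj[OF assms(1) _ assms(3-)] simple_hom_surj[OF assms(2) _ assms(3-)] assms(1-3)
 by (auto simp: simple_module_def bij_betw_def intro!: isomorphicI)

lemma simple_module_iso:
 assumes "simple_module R M" "left_module R N" "isomorphic R M N"
 shows "simple_module R N"
proof -
 have M: "left_module R M" using assms(1) by (simp add: simple_module_def)
 obtain f where f: "f \<in> ahom R M N" "bij_betw f (carrier M) (carrier N)" by (rule isomorphicE[OF assms(3)])
 interpret f: module_hom R M N f using assms f M by (simp add: module_hom_def module_hom_axioms_def)
 have im: "f ` carrier M = carrier N" using f(2) by (simp add: bij_betw_def)
 show ?thesis unfolding simple_module_def
 proof (intro conjI allI impI)
  show "left_module R N" by fact
  show "carrier N \<noteq> {0[N]}"
  proof
   assume *: "carrier N = {0[N]}"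
   have "carrier M \<subseteq> {0[M]}"
   proof
    fix x assume "x \<in> carrier M"
    moreover have "f x = 0[N]" using * im calculation by blast
    ultimately show "x \<in> {0[M]}" using f(2) f.inj_iff by (auto simp: bij_betw_def)
   qed
   then show False using assms(1) f.M.M.zero_closed by (auto simp: simple_module_def)
  qed
  fix H assume H: "submodule H R N"
  let ?K = "{x \<in> carrier M. f x \<in> H}"
  have "?K = {0[M]} \<or> ?K = carrier M" using f.vimage_submodule[OF H] assms(1) by (simp add: simple_module_def)
  moreover have "H = f ` ?K" using im submoduleD(1)[OF H] by auto
  ultimately show "H = {0[N]} \<or> H = carrier N" using im by auto
 qed
qed

lemma simple_sub:
 assumes "simple_module R M" "submodule H R M" "x \<in> H" "x \<noteq> 0[M]"
 shows "H = carrier M" using assms by (auto simp: simple_module_def)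

section \<open>Finite dimensional vector spaces\<close>

lemma field_ring_simps [simp]:
 "carrier field_ring = UNIV" "0[field_ring] = 0" "1[field_ring] = 1"
 "x +[field_ring] y = x + y" "x **[field_ring] y = x * y" by (simp_all add: field_ring_def)

lemma ring_field_ring: "ring (field_ring :: 'f::field ring)"
proof (rule ringI)
 show "abelian_group (field_ring :: 'f::field ring)"
  by (rule abelian_groupI) (auto simp: algebra_simps intro: exI[of _ "- _"] left_minus)
 show "monoid (field_ring :: 'f::field ring)" by (rule monoidI) (auto simp: algebra_simps)
qed (auto simp: algebra_simps)

lemma neg_field_ring [simp]: "-[field_ring] (x::'f::field) = - x"
proof -
 interpret ring "field_ring :: 'f ring" by (rule ring_field_ring)
 show ?thesis by (rule minus_equality) simp_all
qed

definition lfun :: "('f::field, 'v) module \<Rightarrow> ('v \<Rightarrow> 'f) set" where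
 "lfun V = {l. (\<forall>x\<in>carrier V. \<forall>y\<in>carrier V. l (x +[V] y) = l x + l y) \<and>
  (\<forall>c. \<forall>x\<in>carrier V. l (c *[V] x) = c * l x)}"

lemma lfunI:
 assumes "\<And>x y. \<lbrakk>x \<in> carrier V; y \<in> carrier V\<rbrakk> \<Longrightarrow> l (x +[V] y) = l x + l y"
  and "\<And>c x. x \<in> carrier V \<Longrightarrow> l (c *[V] x) = c * l x"
 shows "l \<in> lfun V" using assms by (auto simp: lfun_def)

lemma lfunD:
 assumes "l \<in> lfun V"
 shows lfun_add: "\<lbrakk>x \<in> carrier V; y \<in> carrier V\<rbrakk> \<Longrightarrow> l (x +[V] y) = l x + l y"
  and lfun_smult: "x \<in> carrier V \<Longrightarrow> l (c *[V] x) = c * l x" using assms by (auto simp: lfun_def)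

lemma lfun_comp: "\<lbrakk>f \<in> lin V W; l \<in> lfun W\<rbrakk> \<Longrightarrow> (\<lambda>x. l (f x)) \<in> lfun V" by (auto intro!: lfunI simp: ahomD lfunD)

lemma lfun_plus: "\<lbrakk>l \<in> lfun V; m \<in> lfun V\<rbrakk> \<Longrightarrow> (\<lambda>x. l x + m x) \<in> lfun V"
 by (auto intro!: lfunI simp: lfunD algebra_simps)

lemma lfun_scale: "l \<in> lfun V \<Longrightarrow> (\<lambda>x. c * l x) \<in> lfun V" by (auto intro!: lfunI simp: lfunD algebra_simps)

lemma lfun_sub: "\<lbrakk>l \<in> lfun V; H \<subseteq> carrier V\<rbrakk> \<Longrightarrow> l \<in> lfun (V\<lparr>carrier := H\<rparr>)" by (simp add: lfun_def subset_iff)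

locale vspace = left_module field_ring V for V :: "('f::field, 'v) module"
begin

lemma vsmult_one [simp]: "x \<in> carrier V \<Longrightarrow> 1 *[V] x = x" using smult_one[of x] by simp

lemma vsmult_zero [simp]: "x \<in> carrier V \<Longrightarrow> 0 *[V] x = 0[V]" using smult_l_null[of x] by simp

lemma lfun_zero: "l \<in> lfun V \<Longrightarrow> l 0[V] = 0" using lfun_smult[of l V "0[V]" 0] smult_l_null[of "0[V]"] by simp

lemma neg_eq: "x \<in> carrier V \<Longrightarrow> -[V] x = (- 1) *[V] x" using smult_neg_one[of x] by simp

lemma lfun_neg: "\<lbrakk>l \<in> lfun V; x \<in> carrier V\<rbrakk> \<Longrightarrow> l (-[V] x) = - l x"
 using lfun_smult[of l V x "-1"] by (simp add: neg_eq)

lemma lfun_minus: "\<lbrakk>l \<in> lfun V; x \<in> carrier V; y \<in> carrier V\<rbrakk> \<Longrightarrow> l (x -[V] y) = l x - l y"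
 by (simp add: a_minus_def lfun_add lfun_neg)

lemma lfun_finsum:
 assumes "l \<in> lfun V" "finite A" "f \<in> A \<rightarrow> carrier V"
 shows "l (finsum V f A) = (\<Sum>i\<in>A. l (f i))" using assms(2,3)
proof (induction A rule: finite_induct)
 case empty then show ?case using assms(1) by (simp add: lfun_zero)
next
 case (insert a A)
 then have "finsum V f A \<in> carrier V" by (auto intro: M.finsum_closed)
 then show ?case using insert assms(1) by (simp add: M.finsum_insert lfun_add Pi_def)
qed

lemma smult_inverse: "\<lbrakk>c \<noteq> 0; x \<in> carrier V; c *[V] x \<in> H; vsub H V\<rbrakk> \<Longrightarrow> x \<in> H"
 using submoduleD(5)[of H field_ring V "inverse c" "c *[V] x"] smult_assoc1[of "inverse c" c x] by simp

lemma add_eqI: "\<lbrakk>x \<in> carrier V; y \<in> carrier V\<rbrakk> \<Longrightarrow> (x -[V] y) +[V] y = x" by (simp add: a_minus_def M.a_assoc M.l_neg)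

lemma smult_minus_distr: "\<lbrakk>x \<in> carrier V; y \<in> carrier V\<rbrakk> \<Longrightarrow> c *[V] (x -[V] y) = c *[V] x -[V] c *[V] y"
 by (simp add: a_minus_def smult_r_distr smult_r_minus)

end

section \<open>Adjoining a vector, flags and coordinates\<close>

definition adjoin :: "('f::field, 'v) module \<Rightarrow> 'v set \<Rightarrow> 'v \<Rightarrow> 'v set" where
 "adjoin V U s = {u +[V] c *[V] s | u c. u \<in> U}"

context vspace
begin

lemma
 assumes U: "vsub U V" and s: "s \<in> carrier V"
 shows adjoin_submodule: "submodule (adjoin V U s) field_ring V"
  and adjoin_ge: "U \<subseteq> adjoin V U s"
  and adjoin_mem: "s \<in> adjoin V U s"
proof -
 note u = submoduleD[OF U]
 have mem: "u +[V] c *[V] s \<in> adjoin V U s" if "u \<in> U" for u c using that by (auto simp: adjoin_def)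
 show "submodule (adjoin V U s) field_ring V"
 proof (rule submoduleI)
  show "adjoin V U s \<subseteq> carrier V" using u(6) s by (auto simp: adjoin_def)
  show "0[V] \<in> adjoin V U s" using mem[OF u(2), of 0] s smult_l_null[OF s] by simp
  fix x y assume "x \<in> adjoin V U s" "y \<in> adjoin V U s"
  then obtain a b c d where *: "a \<in> U" "b \<in> U" "x = a +[V] c *[V] s" "y = b +[V] d *[V] s"
   by (auto simp: adjoin_def)
  have "x +[V] y = (a +[V] b) +[V] (c + d) *[V] s"
   using * s u(6) smult_l_distr[of c d s] by (simp add: M.add.m_ac)
  then show "x +[V] y \<in> adjoin V U s" using mem u(3) * by simp
 next
  fix a x assume "x \<in> adjoin V U s"
  then obtain b c where *: "b \<in> U" "x = b +[V] c *[V] s" by (auto simp: adjoin_def)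
  have "a *[V] x = a *[V] b +[V] (a * c) *[V] s"
   using * s u(6) smult_assoc1[of a c s] by (simp add: smult_r_distr)
  then show "a *[V] x \<in> adjoin V U s" using mem u(5)[of a b] * by simp
 qed
 show "U \<subseteq> adjoin V U s"
 proof
  fix x assume "x \<in> U" then show "x \<in> adjoin V U s" using mem[of x 0] s u(6) smult_l_null[OF s] by simp
 qed
 show "s \<in> adjoin V U s" using mem[OF u(2), of 1] s smult_one[OF s] by simp
qed

text \<open>Outside \<open>U\<close> the coefficient of \<open>s\<close> is well defined: two values
  would put a nonzero multiple of \<open>s\<close>, hence \<open>s\<close> itself, into
  \<open>U\<close>. The form exhibits \<open>U\<close> as a hyperplane of the larger space.\<close>

lemma adjoin_functional:
 assumes U: "vsub U V" and s: "s \<in> carrier V" "s \<notin> U"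
 obtains l where "l \<in> lfun (V\<lparr>carrier := adjoin V U s\<rparr>)" "l s = 1" "U = {w \<in> adjoin V U s. l w = 0}"
proof -
 note u = submoduleD[OF U]
 have uniq: "c = d" if *: "a +[V] c *[V] s = b +[V] d *[V] s" "a \<in> U" "b \<in> U" for a b c d
 proof (rule ccontr)
  assume "c \<noteq> d"
  have ab: "a \<in> carrier V" "b \<in> carrier V" using * u(6) by auto
  have "(c - d) *[V] s = c *[V] s +[V] (- d) *[V] s" using smult_l_distr[of c "-d" s] s by simp
  also have "(- d) *[V] s = -[V] (d *[V] s)" using s smult_assoc1[of "-1" d s] neg_eq[of "d *[V] s"] by simp
  also have "c *[V] s = -[V] a +[V] (a +[V] c *[V] s)" using ab s by (simp add: M.r_neg1 M.a_assoc M.r_neg2)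
  also have "\<dots> = -[V] a +[V] (b +[V] d *[V] s)" using * by simp
  also have "\<dots> +[V] -[V] (d *[V] s) = -[V] a +[V] b" using ab s by (simp add: M.a_assoc M.r_neg)
  finally have "(c - d) *[V] s \<in> U" using u *(2,3) by simp
  then show False using smult_inverse[OF _ s(1) _ U] \<open>c \<noteq> d\<close> s(2) by force
 qed
 define l where "l w = (THE c. \<exists>a\<in>U. w = a +[V] c *[V] s)" for w
 have l: "l (a +[V] c *[V] s) = c" if "a \<in> U" for a c
  unfolding l_def by (rule the_equality) (use that uniq in blast)+
 have l0: "l a = 0" if "a \<in> U" for a using l[OF that, of 0] that u(6) s smult_l_null[OF s(1)] by simp
 show ?thesis
 proof
  show "l \<in> lfun (V\<lparr>carrier := adjoin V U s\<rparr>)"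
  proof (rule lfunI; simp)
   fix x y assume "x \<in> adjoin V U s" "y \<in> adjoin V U s"
   then obtain a b c d where *: "a \<in> U" "b \<in> U" "x = a +[V] c *[V] s" "y = b +[V] d *[V] s"
    by (auto simp: adjoin_def)
   have "x +[V] y = (a +[V] b) +[V] (c + d) *[V] s"
    using * s u(6) smult_l_distr[of c d s] by (simp add: M.add.m_ac)
   then show "l (x +[V] y) = l x + l y" using * l u(3) by simp
  next
   fix a x assume "x \<in> adjoin V U s"
   then obtain b c where *: "b \<in> U" "x = b +[V] c *[V] s" by (auto simp: adjoin_def)
   have "a *[V] x = a *[V] b +[V] (a * c) *[V] s"
    using * s u(6) smult_assoc1[of a c s] by (simp add: smult_r_distr)
   then show "l (a *[V] x) = a * l x" using * l u(5)[of a b] by simp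
  qed
  show "l s = 1" using l[OF u(2), of 1] s smult_one[OF s(1)] by simp
  show "U = {w \<in> adjoin V U s. l w = 0}"
  proof (intro equalityI subsetI)
   fix w assume "w \<in> {w \<in> adjoin V U s. l w = 0}"
   then obtain a c where *: "a \<in> U" "w = a +[V] c *[V] s" "l w = 0" by (auto simp: adjoin_def)
   then have "c = 0" using l by simp
   then show "w \<in> U" using * u(6) s smult_l_null[OF s(1)] by simp
  qed (use adjoin_ge[OF U s(1)] l0 in auto)
 qed
qed

text \<open>Linear algebra without a dimension function: a finite spanning set is adjoined to
  \<open>U0\<close> one vector at a time, skipping the vectors already reached.\<close>

lemma flag_induct:
 assumes fg: "finitely_generated field_ring V" and U0: "vsub U0 V" and P0: "P U0"
  and step: "\<And>U s. \<lbrakk>vsub U V; U0 \<subseteq> U; s \<in> carrier V; s \<notin> U; P U\<rbrakk> \<Longrightarrow> P (adjoin V U s)"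
 shows "P (carrier V)"
proof -
 obtain S where S: "finite S" "S \<subseteq> carrier V" "span_of V S = carrier V"
  using fg by (auto simp: finitely_generated_def)
 have "\<exists>W. vsub W V \<and> U0 \<subseteq> W \<and> S \<subseteq> W \<and> P W" using S(1,2)
 proof (induction S rule: finite_induct)
  case empty then show ?case using U0 P0 by auto
 next
  case (insert s S)
  then obtain W where W: "vsub W V" "U0 \<subseteq> W" "S \<subseteq> W" "P W" by auto
  have s: "s \<in> carrier V" using insert by simp
  show ?case
  proof (cases "s \<in> W")
   case True then show ?thesis using W by auto
  next
   case False
   then show ?thesis using step[OF W(1,2) s False W(4)] adjoin_submodule[OF W(1) s] adjoin_ge[OF W(1) s]
     adjoin_mem[OF W(1) s] W(2,3) by (intro exI[of _ "adjoin V W s"]) auto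
  qed
 qed
 then obtain W where W: "vsub W V" "S \<subseteq> W" "P W" by auto
 have "W = carrier V" using gen_submodule(3)[OF is_module S(2) W(1,2)] S(3) submoduleD(1)[OF W(1)] by simp
 then show ?thesis using W(3) by simp
qed

end

text \<open>Coordinates are sequences that vanish from n on rather than tuples: this embeds every
  finite dimensional space in the one type of sequences in which the objects of
  \<open>fg_modules\<close> have their carriers.\<close>

definition coords :: "('f::field, 'v) module \<Rightarrow> nat \<Rightarrow> ('v \<Rightarrow> nat \<Rightarrow> 'f) \<Rightarrow> bool" where
 "coords V n \<phi> \<longleftrightarrow> bij_betw \<phi> (carrier V) {v. \<forall>i\<ge>n. v i = 0} \<and>
  (\<forall>x\<in>carrier V. \<forall>y\<in>carrier V. \<phi> (x +[V] y) = (\<lambda>i. \<phi> x i + \<phi> y i)) \<and>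
  (\<forall>c. \<forall>x\<in>carrier V. \<phi> (c *[V] x) = (\<lambda>i. c * \<phi> x i))"

text \<open>The splitting w = (w - l(w) s) + l(w) s of \<open>V\<close> along the hyperplane l = 0.
  The form \<open>l\<close> becomes coordinate number n, a place where the coordinates of the
  hyperplane vanish.\<close>

lemma (in vspace) coords_step:
 assumes l: "l \<in> lfun V" and s: "s \<in> carrier V" "l s = 1"
  and \<phi>: "coords (V\<lparr>carrier := {w \<in> carrier V. l w = 0}\<rparr>) n \<phi>"
 shows "\<exists>\<psi>. coords V (Suc n) \<psi>"
proof -
 define r where "r w = w -[V] l w *[V] s" for w
 let ?U = "{w \<in> carrier V. l w = 0}"
 have r: "r w \<in> ?U" if "w \<in> carrier V" for w using that l s by (simp add: r_def lfun_minus lfun_smult)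
 have radd: "r (x +[V] y) = r x +[V] r y" if "x \<in> carrier V" "y \<in> carrier V" for x y
  using that l s smult_l_distr[of "l x" "l y" s] by (simp add: r_def lfun_add a_minus_def M.minus_add M.add.m_ac)
 have rs: "r (c *[V] x) = c *[V] r x" if "x \<in> carrier V" for x c using that l s smult_assoc1[of c "l x" s]
  by (simp add: r_def lfun_smult smult_minus_distr)
 have \<phi>: "bij_betw \<phi> ?U {v. \<forall>i\<ge>n. v i = 0}"
  "\<And>x y. \<lbrakk>x \<in> ?U; y \<in> ?U\<rbrakk> \<Longrightarrow> \<phi> (x +[V] y) = (\<lambda>i. \<phi> x i + \<phi> y i)"
  "\<And>c x. x \<in> ?U \<Longrightarrow> \<phi> (c *[V] x) = (\<lambda>i. c * \<phi> x i)" using \<phi> by (auto simp: coords_def)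
 have \<phi>n: "\<phi> x i = 0" if "x \<in> ?U" "i \<ge> n" for x i using \<phi>(1) that by (auto simp: bij_betw_def)
 define \<psi> where "\<psi> w = (\<phi> (r w))(n := l w)" for w
 have "coords V (Suc n) \<psi>" unfolding coords_def
 proof (intro conjI ballI allI)
  show "bij_betw \<psi> (carrier V) {v. \<forall>i\<ge>Suc n. v i = 0}"
  proof (rule bij_betw_imageI)
   show "inj_on \<psi> (carrier V)"
   proof (rule inj_onI)
    fix x y assume xy: "x \<in> carrier V" "y \<in> carrier V" "\<psi> x = \<psi> y"
    have e: "l x = l y" using fun_cong[OF xy(3), of n] by (simp add: \<psi>_def)
    have "\<phi> (r x) = \<phi> (r y)"
    proof
     fix i show "\<phi> (r x) i = \<phi> (r y) i" using fun_cong[OF xy(3), of i] \<phi>n[OF r[OF xy(1)]] \<phi>n[OF r[OF xy(2)]]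
      by (cases "i = n") (simp_all add: \<psi>_def)
    qed
    then have "r x = r y" using \<phi>(1) r xy by (auto simp: bij_betw_def dest: inj_onD)
    then have "r x +[V] l x *[V] s = r y +[V] l y *[V] s" using e by simp
    then show "x = y" using xy s by (simp add: r_def add_eqI)
   qed
   show "\<psi> ` carrier V = {v. \<forall>i\<ge>Suc n. v i = 0}"
   proof (intro equalityI subsetI)
    fix v assume "v \<in> \<psi> ` carrier V"
    then show "v \<in> {v. \<forall>i\<ge>Suc n. v i = 0}" using \<phi>n[OF r] by (auto simp: \<psi>_def)
   next
    fix v :: "nat \<Rightarrow> 'f" assume v: "v \<in> {v. \<forall>i\<ge>Suc n. v i = 0}"
    have "v(n := 0) \<in> {v. \<forall>i\<ge>n. v i = 0}" using v by auto
    then obtain u where u: "u \<in> ?U" "\<phi> u = v(n := 0)"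
     using \<phi>(1) unfolding bij_betw_def by (metis (no_types, lifting) imageE)
    let ?w = "u +[V] v n *[V] s"
    have lw: "l ?w = v n" using u l s by (simp add: lfun_add lfun_smult)
    have "r ?w = u" using u s lw by (simp add: r_def a_minus_def M.a_assoc M.r_neg)
    then have "\<psi> ?w = v" using u lw by (simp add: \<psi>_def)
    then show "v \<in> \<psi> ` carrier V" using u s by (metis (no_types, lifting) M.a_closed UNIV_I field_ring_simps(1) imageI mem_Collect_eq smult_closed)
   qed
  qed
 next
  fix x y assume "x \<in> carrier V" "y \<in> carrier V"
  then show "\<psi> (x +[V] y) = (\<lambda>i. \<psi> x i + \<psi> y i)" using \<phi>(2)[OF r r] l by (auto simp: \<psi>_def radd lfun_add)
 next
  fix c x assume "x \<in> carrier V"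
  then show "\<psi> (c *[V] x) = (\<lambda>i. c * \<psi> x i)" using \<phi>(3)[OF r] l by (auto simp: \<psi>_def rs lfun_smult)
 qed
 then show ?thesis by blast
qed

lemma (in vspace) coords_zero:
 assumes "carrier V = {0[V]}" shows "\<exists>\<phi>. coords V 0 \<phi>"
 by (rule exI[of _ "\<lambda>x i. 0"]) (use assms in "auto simp: coords_def bij_betw_def")

lemma vspace_sub: "\<lbrakk>vspace V; vsub U V\<rbrakk> \<Longrightarrow> vspace (V\<lparr>carrier := U\<rparr>)" by (simp add: vspace_def submodule_left_module)

lemma (in vspace) coords_ex:
 assumes "finitely_generated field_ring V" obtains n \<phi> where "coords V n \<phi>"
proof -
 have "\<exists>n \<phi>. coords (V\<lparr>carrier := carrier V\<rparr>) n \<phi>"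
 proof (rule flag_induct[OF assms zero_submodule])
  interpret Z: vspace "V\<lparr>carrier := {0[V]}\<rparr>" by (rule vspace_sub[OF vspace_axioms zero_submodule])
  show "\<exists>n \<phi>. coords (V\<lparr>carrier := {0[V]}\<rparr>) n \<phi>" using Z.coords_zero by auto
  fix U s assume U: "vsub U V" and s: "s \<in> carrier V" "s \<notin> U"
   and IH: "\<exists>n \<phi>. coords (V\<lparr>carrier := U\<rparr>) n \<phi>"
  obtain l where l: "l \<in> lfun (V\<lparr>carrier := adjoin V U s\<rparr>)" "l s = 1" "U = {w \<in> adjoin V U s. l w = 0}"
   by (rule adjoin_functional[OF U s])
  interpret W: vspace "V\<lparr>carrier := adjoin V U s\<rparr>"
   by (rule vspace_sub[OF vspace_axioms adjoin_submodule[OF U s(1)]])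
  obtain n \<phi> where "coords (V\<lparr>carrier := U\<rparr>) n \<phi>" using IH by auto
  then show "\<exists>n \<phi>. coords (V\<lparr>carrier := adjoin V U s\<rparr>) n \<phi>"
   using W.coords_step[OF l(1) _ l(2), of n \<phi>] adjoin_mem[OF U s(1)] l(3) by (auto simp flip: l(3))
 qed
 then show ?thesis using that by auto
qed

lemma (in vspace) coords_gen:
 assumes "coords V n \<phi>" shows "finitely_generated field_ring V"
proof -
 have \<phi>: "bij_betw \<phi> (carrier V) {v. \<forall>i\<ge>n. v i = 0}"
  "\<And>x y. \<lbrakk>x \<in> carrier V; y \<in> carrier V\<rbrakk> \<Longrightarrow> \<phi> (x +[V] y) = (\<lambda>i. \<phi> x i + \<phi> y i)"
  "\<And>c x. x \<in> carrier V \<Longrightarrow> \<phi> (c *[V] x) = (\<lambda>i. c * \<phi> x i)" using assms by (auto simp: coords_def)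
 have inj: "x = y" if "\<phi> x = \<phi> y" "x \<in> carrier V" "y \<in> carrier V" for x y
  using \<phi>(1) that by (auto simp: bij_betw_def dest: inj_onD)
 have "\<exists>x\<in>carrier V. \<phi> x = (\<lambda>j. if j = i then 1 else 0)" if "i < n" for i
 proof -
  have "(\<lambda>j. if j = i then 1 else 0) \<in> \<phi> ` carrier V" using \<phi>(1) that by (simp add: bij_betw_def)
  then show ?thesis by (auto simp: image_iff)
 qed
 then obtain b where b: "\<And>i. i < n \<Longrightarrow> b i \<in> carrier V" "\<And>i. i < n \<Longrightarrow> \<phi> (b i) = (\<lambda>j. if j = i then 1 else 0)" by metis
 let ?S = "b ` {..<n}" let ?G = "span_of V ?S"
 have S: "?S \<subseteq> carrier V" using b by auto
 note G = submoduleD[OF gen_submodule(1)[OF is_module S]]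
 \<comment> \<open>Elimination: subtracting a multiple of \<open>b k\<close> clears coordinate k and
   leads back to vectors with one nonzero coordinate less.\<close>
 have "\<forall>x\<in>carrier V. (\<forall>i\<ge>k. \<phi> x i = 0) \<longrightarrow> x \<in> ?G" if "k \<le> n" for k using that
 proof (induction k)
  case 0
  have "x = 0[V]" if "x \<in> carrier V" "\<forall>i. \<phi> x i = 0" for x
   using that inj[of x "0 *[V] x"] \<phi>(3)[of x 0] smult_l_null[of x] by auto
  then show ?case using G(2) by auto
 next
  case (Suc k)
  show ?case
  proof (intro ballI impI)
   fix x assume x: "x \<in> carrier V" "\<forall>i\<ge>Suc k. \<phi> x i = 0"
   let ?y = "(- \<phi> x k) *[V] b k"
   have bk: "b k \<in> carrier V" "b k \<in> ?G" using b Suc gen_submodule(2)[OF is_module S] by auto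
   have "\<forall>i\<ge>k. \<phi> (x +[V] ?y) i = 0"
    using x bk(1) b(2)[of k] Suc.prems by (auto simp: \<phi>(2,3) not_less_eq_eq[symmetric] le_Suc_eq)
   then have "x +[V] ?y \<in> ?G" using Suc x bk by simp
   then have "(x +[V] ?y) +[V] \<phi> x k *[V] b k \<in> ?G" using G(3,5) bk by simp
   moreover have "(x +[V] ?y) +[V] \<phi> x k *[V] b k = x"
    using x bk smult_l_distr[of "- \<phi> x k" "\<phi> x k" "b k"] by (simp add: M.a_assoc flip: smult_l_distr)
   ultimately show "x \<in> ?G" by simp
  qed
 qed
 from this[of n] have "carrier V \<subseteq> ?G" using \<phi>(1) by (auto simp: bij_betw_def)
 then show ?thesis unfolding finitely_generated_def using S G(1) by (intro exI[of _ ?S]) auto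
qed

text \<open>A test for finite dimension by forms instead of spanning sets: \<open>V\<close> is cut
  down by the kernels of the forms one after another, and each cut lowers the dimension by at most
  one.\<close>

lemma coords_sep:
 assumes "finite L" "vspace V" "L \<subseteq> lfun V" "\<And>x. \<lbrakk>x \<in> carrier V; \<forall>l\<in>L. l x = 0\<rbrakk> \<Longrightarrow> x = 0[V]"
 shows "\<exists>n \<phi>. coords V n \<phi>" using assms
proof (induction L arbitrary: V rule: finite_induct)
 case empty
 interpret vspace V by fact
 have "carrier V = {0[V]}" using empty by auto
 then show ?case using coords_zero by blast
next
 case (insert l L)
 interpret vspace V by fact
 have l: "l \<in> lfun V" and L: "L \<subseteq> lfun V" using insert by auto
 let ?U = "{x \<in> carrier V. l x = 0}"
 have U: "vsub ?U V" by (rule submoduleI) (auto simp: lfun_zero[OF l] lfunD[OF l])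
 have IH: "\<exists>n \<phi>. coords (V\<lparr>carrier := ?U\<rparr>) n \<phi>"
  by (rule insert.IH) (use vspace_sub[OF vspace_axioms U] L insert in "auto intro: lfun_sub")
 show ?case
 proof (cases "\<exists>x\<in>carrier V. l x \<noteq> 0")
  case False
  then have "?U = carrier V" by auto
  then show ?thesis using IH by simp
 next
  case True
  then obtain x where x: "x \<in> carrier V" "l x \<noteq> 0" by auto
  let ?s = "inverse (l x) *[V] x"
  have "?s \<in> carrier V" "l ?s = 1" using x l by (auto simp: lfun_smult)
  moreover obtain n \<phi> where "coords (V\<lparr>carrier := ?U\<rparr>) n \<phi>" using IH by auto
  ultimately show ?thesis using coords_step[OF l] by blast
 qed
qed

lemma (in vspace) fdim_sep:
 assumes "finite L" "L \<subseteq> lfun V" "\<And>x. \<lbrakk>x \<in> carrier V; \<forall>l\<in>L. l x = 0\<rbrakk> \<Longrightarrow> x = 0[V]"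
 shows "finitely_generated field_ring V" using coords_sep[OF assms(1) vspace_axioms assms(2,3)] coords_gen by auto

section \<open>Separating families of forms, dual bases and extension of linear maps\<close>

definition separating :: "('f::field, 'v) module \<Rightarrow> ('v \<Rightarrow> 'f) set \<Rightarrow> bool" where
 "separating V L \<longleftrightarrow> finite L \<and> L \<subseteq> lfun V \<and> (\<forall>x\<in>carrier V. (\<forall>l\<in>L. l x = 0) \<longrightarrow> x = 0[V])"

text \<open>Basis and dual basis together. That \<open>b\<close> spans is encoded in the last
  clause, since a vector minus its expansion has all coordinates zero.\<close>

definition basis :: "('f::field, 'v) module \<Rightarrow> nat \<Rightarrow> (nat \<Rightarrow> 'v) \<Rightarrow> (nat \<Rightarrow> 'v \<Rightarrow> 'f) \<Rightarrow> bool" where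
 "basis V n b c \<longleftrightarrow> (\<forall>i<n. b i \<in> carrier V \<and> c i \<in> lfun V) \<and> (\<forall>i<n. \<forall>j<n. c i (b j) = (if i = j then 1 else 0)) \<and>
  (\<forall>x\<in>carrier V. (\<forall>i<n. c i x = 0) \<longrightarrow> x = 0[V])"

lemma basisD:
 assumes "basis V n b c"
 shows "\<And>i. i < n \<Longrightarrow> b i \<in> carrier V" "\<And>i. i < n \<Longrightarrow> c i \<in> lfun V"
  "\<And>i j. \<lbrakk>i < n; j < n\<rbrakk> \<Longrightarrow> c i (b j) = (if i = j then 1 else 0)"
  "\<And>x. \<lbrakk>x \<in> carrier V; \<forall>i<n. c i x = 0\<rbrakk> \<Longrightarrow> x = 0[V]" using assms by (auto simp: basis_def)

locale fdspace = vspace V for V :: "('f::field, 'v) module" +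
 assumes fg: "finitely_generated field_ring V"
begin

lemma basis_ex:
 obtains n b c where "basis V n b c"
proof -
 obtain n \<phi> where "coords V n \<phi>" by (rule coords_ex[OF fg])
 then have \<phi>: "bij_betw \<phi> (carrier V) {v. \<forall>i\<ge>n. v i = 0}"
  "\<And>x y. \<lbrakk>x \<in> carrier V; y \<in> carrier V\<rbrakk> \<Longrightarrow> \<phi> (x +[V] y) = (\<lambda>i. \<phi> x i + \<phi> y i)"
  "\<And>c x. x \<in> carrier V \<Longrightarrow> \<phi> (c *[V] x) = (\<lambda>i. c * \<phi> x i)" by (auto simp: coords_def)
 have "\<exists>x\<in>carrier V. \<phi> x = (\<lambda>j. if j = i then 1 else 0)" if "i < n" for i
 proof -
  have "(\<lambda>j. if j = i then 1 else 0) \<in> \<phi> ` carrier V" using \<phi>(1) that by (simp add: bij_betw_def)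
  then show ?thesis by (auto simp: image_iff)
 qed
 then obtain b where b: "\<And>i. i < n \<Longrightarrow> b i \<in> carrier V" "\<And>i. i < n \<Longrightarrow> \<phi> (b i) = (\<lambda>j. if j = i then 1 else 0)" by metis
 show ?thesis
 proof (rule that[of n b "\<lambda>i x. \<phi> x i"], unfold basis_def, intro conjI allI impI ballI)
  show "(\<lambda>x. \<phi> x i) \<in> lfun V" if "i < n" for i by (rule lfunI) (auto simp: \<phi>)
  show "\<phi> (b j) i = (if i = j then 1 else 0)" if "i < n" "j < n" for i j using b that by simp
  show "x = 0[V]" if "x \<in> carrier V" "\<forall>i<n. \<phi> x i = 0" for x
  proof -
   have "\<phi> x = \<phi> (0 *[V] x)"
   proof
    fix i
    have "\<phi> x \<in> {v. \<forall>i\<ge>n. v i = 0}" using \<phi>(1) that(1) by (auto simp: bij_betw_def)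
    then show "\<phi> x i = \<phi> (0 *[V] x) i" using that \<phi>(3)[of x 0] by (cases "i < n") auto
   qed
   then have "x = 0 *[V] x" using \<phi>(1) that by (auto simp: bij_betw_def dest: inj_onD)
   then show ?thesis using smult_l_null[of x] that by simp
  qed
 qed (use b in auto)
qed

lemma sep_ex:
 obtains L where "separating V L"
proof -
 obtain n b c where "basis V n b c" by (rule basis_ex)
 note * = basisD[OF this]
 show ?thesis by (rule that[of "c ` {..<n}"]) (use * in "auto simp: separating_def")
qed

lemma lfun_eqI:
 assumes "x \<in> carrier V" "y \<in> carrier V" "\<And>l. l \<in> lfun V \<Longrightarrow> l x = l y"
 shows "x = y"
proof -
 obtain L where "separating V L" by (rule sep_ex)
 then have L: "L \<subseteq> lfun V" "\<And>x. \<lbrakk>x \<in> carrier V; \<forall>l\<in>L. l x = 0\<rbrakk> \<Longrightarrow> x = 0[V]" by (auto simp: separating_def)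
 have "x -[V] y = 0[V]" by (rule L(2)) (use assms L(1) in "auto simp: lfun_minus")
 then show ?thesis using assms minus_eq_zero by simp
qed

lemma dual_vector:
 assumes "x \<in> carrier V" "x \<noteq> 0[V]" obtains l where "l \<in> lfun V" "l x = 1"
proof -
 obtain l where l: "l \<in> lfun V" "l x \<noteq> 0" using lfun_eqI[of x "0[V]"] assms lfun_zero by force
 show ?thesis by (rule that[OF lfun_scale[OF l(1), of "inverse (l x)"]]) (use l in simp)
qed

text \<open>Along a flag starting at \<open>U\<close>, precomposition with the projection
  \<open>r\<close> that kills the new vector extends the map by one dimension.\<close>

lemma extend:
 assumes U: "vsub U V" and X: "vspace X" and f: "f \<in> lin (V\<lparr>carrier := U\<rparr>) X"
 obtains g where "g \<in> lin V X" "\<And>u. u \<in> U \<Longrightarrow> g u = f u"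
proof -
 interpret X: vspace X by fact
 have "\<exists>g. g \<in> lin (V\<lparr>carrier := carrier V\<rparr>) X \<and> (\<forall>u\<in>U. g u = f u)"
 proof (rule flag_induct[OF fg U])
  show "\<exists>g. g \<in> lin (V\<lparr>carrier := U\<rparr>) X \<and> (\<forall>u\<in>U. g u = f u)" using f by auto
  fix W s assume W: "vsub W V" "U \<subseteq> W" and s: "s \<in> carrier V" "s \<notin> W"
   and "\<exists>g. g \<in> lin (V\<lparr>carrier := W\<rparr>) X \<and> (\<forall>u\<in>U. g u = f u)"
  then obtain g where g: "g \<in> lin (V\<lparr>carrier := W\<rparr>) X" "\<forall>u\<in>U. g u = f u" by auto
  let ?W = "adjoin V W s"
  obtain l where l: "l \<in> lfun (V\<lparr>carrier := ?W\<rparr>)" "l s = 1" "W = {w \<in> ?W. l w = 0}"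
   by (rule adjoin_functional[OF W(1) s])
  note aW = submoduleD[OF adjoin_submodule[OF W(1) s(1)]]
  note ll = lfunD[OF l(1), simplified] note gg = ahomD[OF g(1), simplified]
  have sW: "s \<in> ?W" by (rule adjoin_mem[OF W(1) s(1)])
  define r where "r w = w +[V] (- l w) *[V] s" for w
  have r: "r w \<in> W" if "w \<in> ?W" for w by (subst l(3)) (use that aW sW in "simp add: r_def ll l(2)")
  have radd: "r (x +[V] y) = r x +[V] r y" if "x \<in> ?W" "y \<in> ?W" for x y
   using that s aW(6) smult_l_distr[of "- l x" "- l y" s] by (simp add: r_def ll M.add.m_ac)
  have rs: "r (c *[V] x) = c *[V] r x" if "x \<in> ?W" for x c
   using that s aW(6) smult_assoc1[of c "- l x" s] by (simp add: r_def ll smult_r_distr)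
  have "(\<lambda>w. g (r w)) \<in> lin (V\<lparr>carrier := ?W\<rparr>) X" by (rule ahomI) (simp_all add: radd rs r gg)
  moreover have "g (r u) = f u" if "u \<in> U" for u
  proof -
   have u: "u \<in> W" "u \<in> ?W" "l u = 0" using that W(2) l(3) by auto
   then have "r u = u" using aW(6) smult_l_null[OF s(1)] by (simp add: r_def)
   then show ?thesis using g(2) that by simp
  qed
  ultimately show "\<exists>g. g \<in> lin (V\<lparr>carrier := ?W\<rparr>) X \<and> (\<forall>u\<in>U. g u = f u)" by blast
 qed
 then show ?thesis using that by auto
qed

text \<open>The identity of the kernel extends to a projection \<open>p\<close> of V onto it; x - p
  x then depends on f x alone, which turns any choice of preimages into a linear section.\<close>

lemma section_ex:
 assumes X: "vspace X" and f: "f \<in> lin V X" "f ` carrier V = carrier X"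
 obtains s where "s \<in> lin X V" "\<And>x. x \<in> carrier X \<Longrightarrow> f (s x) = x"
proof -
 interpret X: vspace X by fact
 interpret f: module_hom field_ring V X f
  using f(1) is_module X.is_module by (simp add: module_hom_def module_hom_axioms_def)
 let ?K = "a_kernel V X f"
 obtain p where p: "p \<in> lin V (V\<lparr>carrier := ?K\<rparr>)" "\<And>u. u \<in> ?K \<Longrightarrow> p u = u"
  using extend[OF f.kernel_submodule vspace_sub[OF vspace_axioms f.kernel_submodule] ahom_id] by metis
 interpret p: module_hom field_ring V "V\<lparr>carrier := ?K\<rparr>" p
  using p(1) is_module submodule_left_module[OF is_module f.kernel_submodule]
  by (simp add: module_hom_def module_hom_axioms_def)
 have pK: "p x \<in> carrier V" "f (p x) = 0[X]" if "x \<in> carrier V" for x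
  using p.hom_simps(1)[OF that] by (auto simp: f.kernel_eq)
 define q where "q x = x -[V] p x" for x
 have q: "q x = q y" if "x \<in> carrier V" "y \<in> carrier V" "f x = f y" for x y
 proof -
  have "x -[V] y \<in> ?K" using that by (simp add: f.kernel_eq X.minus_eq_zero)
  then have "p (x -[V] y) = x -[V] y" by (rule p(2))
  moreover have "p (x -[V] y) = p x -[V] p y"
   using that p.hom_simps(2)[of x "(- 1) *[V] y"] p.hom_simps(3)[of "- 1" y] pK by (simp add: a_minus_def neg_eq)
  ultimately have e: "p x -[V] p y = x -[V] y" by simp
  have "x = (p x -[V] p y) +[V] y" using that by (simp add: e add_eqI)
  then show ?thesis unfolding q_def
   using that pK by (simp add: a_minus_def) (metis (no_types, lifting) M.a_assoc M.a_closed M.a_comm M.a_inv_closed M.r_neg M.r_zero M.r_neg2)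
 qed
 have qh: "q \<in> lin V V"
  by (rule ahomI) (use pK p.hom_simps(2,3) in "simp_all add: q_def a_minus_def M.minus_add M.add.m_ac smult_r_distr smult_r_minus")
 have fq: "f (q x) = f x" if "x \<in> carrier V" for x
  using that pK by (simp add: q_def a_minus_def f.hom_neg X.neg_eq X.smult_r_null)
 define i where "i = inv_into (carrier V) f"
 have i: "i x \<in> carrier V" "f (i x) = x" if "x \<in> carrier X" for x
  using that f(2) by (auto simp: i_def inv_into_into f_inv_into_f)
 show ?thesis
 proof
  show "f (q (i x)) = x" if "x \<in> carrier X" for x using fq i that by simp
  show "(\<lambda>x. q (i x)) \<in> lin X V"
  proof (rule ahomI)
   fix x y assume xy: "x \<in> carrier X" "y \<in> carrier X"
   have "q (i (x +[X] y)) = q (i x +[V] i y)" by (rule q) (use xy i in simp_all)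
   then show "q (i (x +[X] y)) = q (i x) +[V] q (i y)" using xy i ahomD[OF qh] by simp
  next
   fix c :: 'f and x assume xy: "x \<in> carrier X"
   have "q (i (c *[X] x)) = q (c *[V] i x)" by (rule q) (use xy i in simp_all)
   then show "q (i (c *[X] x)) = c *[V] q (i x)" using xy i ahomD[OF qh] by simp
  qed (use i ahomD[OF qh] in auto)
 qed
qed

end

lemma fdspace_inj:
 assumes "vspace V" "fdspace W" "f \<in> lin V W" "inj_on f (carrier V)"
 shows "fdspace V"
proof -
 interpret V: vspace V by fact
 interpret W: fdspace W by fact
 interpret f: module_hom field_ring V W f
  using assms(3) V.is_module W.is_module by (simp add: module_hom_def module_hom_axioms_def)
 obtain L where "separating W L" by (rule W.sep_ex)
 then have L: "finite L" "L \<subseteq> lfun W" "\<And>x. \<lbrakk>x \<in> carrier W; \<forall>l\<in>L. l x = 0\<rbrakk> \<Longrightarrow> x = 0[W]"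
  by (auto simp: separating_def)
 have "finitely_generated field_ring V"
 proof (rule V.fdim_sep[of "(\<lambda>l x. l (f x)) ` L"])
  show "(\<lambda>l x. l (f x)) ` L \<subseteq> lfun V" using L(2) lfun_comp[OF assms(3)] by auto
  show "x = 0[V]" if "x \<in> carrier V" "\<forall>l\<in>(\<lambda>l x. l (f x)) ` L. l x = 0" for x
   using that L(3)[of "f x"] assms(4) f.inj_iff by auto
 qed (use L in simp)
 then show ?thesis by (simp add: fdspace_def fdspace_axioms_def V.vspace_axioms)
qed

lemma fdspace_sub:
 assumes "fdspace V" "vsub U V" shows "fdspace (V\<lparr>carrier := U\<rparr>)"
 by (rule fdspace_inj[OF _ assms(1) incl_ahom[OF assms(2)]]) (use assms in "auto simp: fdspace_def vspace_sub")

context fdspace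
begin

text \<open>Pivots replace dimension: \<open>piv U\<close> collects the positions of the first
  nonzero coordinates of vectors of \<open>U\<close>. It grows strictly with \<open>U\<close>,
  because equal pivot sets allow elimination, and has at most n elements.\<close>

lemma chain_measure:
 obtains m :: "'v set \<Rightarrow> nat" and n where
  "\<forall>U W. vsub U V \<longrightarrow> vsub W V \<longrightarrow> U \<subset> W \<longrightarrow> m U < m W" "\<forall>U. m U \<le> n"
proof -
 obtain n b c where "basis V n b c" by (rule basis_ex)
 note c = basisD(2,4)[OF this]
 define piv where "piv U = {i. i < n \<and> (\<exists>u\<in>U. c i u \<noteq> 0 \<and> (\<forall>j<i. c j u = 0))}" for U
 have fin: "finite (piv U)" "piv U \<subseteq> {..<n}" for U by (auto simp: piv_def)
 \<comment> \<open>Gaussian elimination: a vector w of \<open>W\<close> is cleared coordinate by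
   coordinate with vectors of \<open>U\<close> that have the pivots required.\<close>
 have eq: "W \<subseteq> U" if sub: "vsub U V" "vsub W V" "U \<subseteq> W" "piv W \<subseteq> piv U" for U W
 proof
  fix w assume w: "w \<in> W"
  note u = submoduleD[OF sub(1)] and ww = submoduleD[OF sub(2)]
  have "\<exists>u\<in>U. \<forall>j<k. c j (w -[V] u) = 0" if "k \<le> n" for k using that
  proof (induction k)
   case 0 then show ?case using u(2) by auto
  next
   case (Suc k)
   then obtain x where x: "x \<in> U" "\<forall>j<k. c j (w -[V] x) = 0" by auto
   have k: "k < n" using Suc by simp
   show ?case
   proof (cases "c k (w -[V] x) = 0")
    case True then show ?thesis using x by (auto simp: less_Suc_eq)
   next
    case False
    have "w -[V] x \<in> W" using w x(1) sub(3) submodule_minus[OF sub(2)] by auto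
    then have "k \<in> piv W" using False x k by (auto simp: piv_def)
    then obtain y where y: "y \<in> U" "c k y \<noteq> 0" "\<forall>j<k. c j y = 0" using sub(4) by (auto simp: piv_def)
    let ?d = "c k (w -[V] x) / c k y"
    have mem: "x \<in> carrier V" "y \<in> carrier V" "w \<in> carrier V" using x y w u(6) ww(6) by auto
    have "c j (w -[V] (x +[V] ?d *[V] y)) = 0" if "j < Suc k" for j using that x(2) y(2,3) mem k c(1)
     by (cases "j = k") (auto simp: lfun_minus lfun_add lfun_smult less_Suc_eq)
    then show ?thesis using x y u by (intro bexI[of _ "x +[V] ?d *[V] y"]) auto
   qed
  qed
  then obtain x where x: "x \<in> U" "\<forall>j<n. c j (w -[V] x) = 0" by blast
  then have "w -[V] x = 0[V]" using c(2) w ww(6) u(6) by simp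
  then show "w \<in> U" using x w ww(6) u(6) minus_eq_zero by simp
 qed
 have mono: "piv U \<subseteq> piv W" if "U \<subseteq> W" for U W using that by (auto simp: piv_def)
 show ?thesis
 proof (rule that[of "\<lambda>U. card (piv U)" n], intro allI impI)
  fix U W assume *: "vsub U V" "vsub W V" "U \<subset> W"
  then have "piv U \<subset> piv W" using eq[OF *(1,2)] mono[of U W] by blast
  then show "card (piv U) < card (piv W)" using fin(1) by (rule psubset_card_mono[rotated])
 next
  show "\<forall>U. card (piv U) \<le> n" using card_mono[OF finite_lessThan fin(2)] by simp
 qed
qed

text \<open>On the carrier, a form is the combination of the coordinate forms with coefficients
  \<open>l (b i)\<close>.\<close>

lemma dual_induct:
 assumes l: "l \<in> lfun V"
  and bas: "basis V n b c"
  and P: "\<And>i. i < n \<Longrightarrow> P (c i)"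
  and cong: "\<And>l m. \<lbrakk>l \<in> lfun V; m \<in> lfun V; \<forall>x\<in>carrier V. l x = m x; P l\<rbrakk> \<Longrightarrow> P m"
  and add: "\<And>l m. \<lbrakk>l \<in> lfun V; m \<in> lfun V; P l; P m\<rbrakk> \<Longrightarrow> P (\<lambda>x. l x + m x)"
  and scale: "\<And>l a. \<lbrakk>l \<in> lfun V; P l\<rbrakk> \<Longrightarrow> P (\<lambda>x. a * l x)" and zero: "P (\<lambda>x. 0)"
 shows "P l"
proof -
 note b = basisD[OF bas]
 let ?s = "\<lambda>k x. \<Sum>i<k. l (b i) * c i x"
 have *: "?s k \<in> lfun V \<and> P (?s k)" if "k \<le> n" for k using that
 proof (induction k)
  case 0 then show ?case using zero by (auto intro: lfunI)
 next
  case (Suc k)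
  then have "c k \<in> lfun V" "P (c k)" using b P by auto
  then show ?case
   using Suc add[of "?s k" "\<lambda>x. l (b k) * c k x"] scale[of "c k" "l (b k)"] lfun_scale[of "c k" V "l (b k)"]
    lfun_plus[of "?s k" V "\<lambda>x. l (b k) * c k x"] by simp
 qed
 have "?s n x = l x" if x: "x \<in> carrier V" for x
 proof -
  let ?y = "finsum V (\<lambda>i. c i x *[V] b i) {..<n}"
  have cl: "(\<lambda>i. c i x *[V] b i) \<in> {..<n} \<rightarrow> carrier V" using b by auto
  have y: "?y \<in> carrier V" by (rule M.finsum_closed[OF cl])
  have cj: "m ?y = (\<Sum>i<n. c i x * m (b i))" if "m \<in> lfun V" for m
   using lfun_finsum[OF that _ cl] b(1) that by (simp add: lfun_smult)
  have "c j ?y = c j x" if "j < n" for j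
  proof -
   have "c j ?y = (\<Sum>i<n. c i x * (if j = i then 1 else 0))"
    unfolding cj[OF b(2)[OF that]] by (rule sum.cong) (use that b(3) in auto)
   also have "\<dots> = c j x" using that by (simp add: if_distrib cong: if_cong)
   finally show ?thesis .
  qed
  then have "x -[V] ?y = 0[V]" using x y b by (intro b(4)) (auto simp: lfun_minus)
  then have "x = ?y" using x y minus_eq_zero by simp
  then show ?thesis using cj[OF l] by (simp add: mult.commute)
 qed
 then show ?thesis using cong[of "?s n" l] * l by auto
qed

text \<open>A finite dimensional space is its double dual: \<open>\<Psi>\<close> is evaluation at
  the vector with coordinates \<open>\<Psi> (c i)\<close>. Later this turns functionals on forms
  into vectors of a dualizing module.\<close>

lemma reflexive:
 assumes cong: "\<And>l m. \<lbrakk>l \<in> lfun V; m \<in> lfun V; \<forall>x\<in>carrier V. l x = m x\<rbrakk> \<Longrightarrow> \<Psi> l = \<Psi> m"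
  and add: "\<And>l m. \<lbrakk>l \<in> lfun V; m \<in> lfun V\<rbrakk> \<Longrightarrow> \<Psi> (\<lambda>x. l x + m x) = \<Psi> l + \<Psi> m"
  and scale: "\<And>l a. l \<in> lfun V \<Longrightarrow> \<Psi> (\<lambda>x. a * l x) = a * \<Psi> l"
 obtains v where "v \<in> carrier V" "\<And>l. l \<in> lfun V \<Longrightarrow> l v = \<Psi> l"
proof -
 obtain n b c where bas: "basis V n b c" by (rule basis_ex)
 note b = basisD[OF bas]
 let ?y = "finsum V (\<lambda>i. \<Psi> (c i) *[V] b i) {..<n}"
 have cl: "(\<lambda>i. \<Psi> (c i) *[V] b i) \<in> {..<n} \<rightarrow> carrier V" using b by auto
 have y: "?y \<in> carrier V" by (rule M.finsum_closed[OF cl])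
 show ?thesis
 proof (rule that[OF y])
  fix l assume "l \<in> lfun V"
  then show "l ?y = \<Psi> l"
  proof (rule dual_induct[OF _ bas])
   fix i assume i: "i < n"
   have "c i ?y = (\<Sum>j<n. \<Psi> (c j) * (if i = j then 1 else 0))"
    unfolding lfun_finsum[OF b(2)[OF i] finite_lessThan cl] by (rule sum.cong) (use i b in "auto simp: lfun_smult")
   then show "c i ?y = \<Psi> (c i)" using i by (simp add: if_distrib cong: if_cong)
  next
   show "0 = \<Psi> (\<lambda>x. 0)" using scale[of "\<lambda>x. 0" 0] by (simp add: lfun_def)
  next
   fix l m assume *: "l \<in> lfun V" "m \<in> lfun V" "\<forall>x\<in>carrier V. l x = m x" "l ?y = \<Psi> l"
   have "\<Psi> l = \<Psi> m" by (rule cong[OF *(1-3)])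
   then show "m ?y = \<Psi> m" using *(3,4) y by simp
  qed (simp_all add: add scale)
 qed
qed

end

section \<open>Eigenvectors\<close>

text \<open>The vector p(f) v, evaluated by Horner's scheme.\<close>

definition peval :: "('f::field, 'v) module \<Rightarrow> ('v \<Rightarrow> 'v) \<Rightarrow> 'v \<Rightarrow> 'f poly \<Rightarrow> 'v" where
 "peval V f v p = fold_coeffs (\<lambda>a w. a *[V] v +[V] f w) p 0[V]"

locale vspace_endo = vspace V for V :: "('f::field, 'v) module" +
 fixes f v assumes f: "f \<in> lin V V" and v: "v \<in> carrier V"
begin

sublocale f: module_hom field_ring V V f using f is_module by (simp add: module_hom_def module_hom_axioms_def)

abbreviation "ev \<equiv> peval V f v"

lemma ev_0 [simp]: "ev 0 = 0[V]" by (simp add: peval_def)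

lemma ev_pCons: "ev (pCons a p) = a *[V] v +[V] f (ev p)"
 by (cases "a = 0 \<and> p = 0") (use v smult_l_null[OF v] in "auto simp: peval_def")

lemma ev_closed [simp]: "ev p \<in> carrier V" by (induction p) (use v in "auto simp: ev_pCons")

lemma ev_add: "ev (p + q) = ev p +[V] ev q"
proof (induction p q rule: poly_induct2)
 case (pCons a p b q)
 have "ev (pCons a p + pCons b q) = (a + b) *[V] v +[V] f (ev p +[V] ev q)" by (simp add: ev_pCons pCons)
 also have "\<dots> = (a *[V] v +[V] f (ev p)) +[V] (b *[V] v +[V] f (ev q))"
  using v smult_l_distr[of a b v] by (simp add: M.add.m_ac)
 finally show ?case by (simp add: ev_pCons)
qed simp

lemma ev_smult: "ev (Polynomial.smult c p) = c *[V] ev p"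
 by (induction p) (use v smult_assoc1[of c _ v] in "simp_all add: ev_pCons smult_r_distr")

text \<open>The spaces of all vectors (X^k p)(f) v decrease with k and become stationary. Then X^k
  and some X^(k+1) p have the same value at v, and their difference is a nonzero polynomial since
  its coefficient at k is 1.\<close>

lemma annihilator:
 assumes "finitely_generated field_ring V" shows "\<exists>q. q \<noteq> 0 \<and> ev q = 0[V]"
proof -
 interpret fdspace V using assms by unfold_locales
 obtain m n where m: "\<forall>U W. vsub U V \<longrightarrow> vsub W V \<longrightarrow> U \<subset> W \<longrightarrow> m U < (m W :: nat)"
  "\<forall>U. m U \<le> n" by (rule chain_measure)
 define U where "U k = range (\<lambda>p. ev (monom 1 k * p))" for k
 have sub: "submodule (U k) field_ring V" for k
 proof (rule submoduleI)
  show "0[V] \<in> U k" unfolding U_def by (rule range_eqI[of _ _ 0]) simp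
  show "x +[V] y \<in> U k" if "x \<in> U k" "y \<in> U k" for x y
   using that unfolding U_def by (auto simp flip: ev_add distrib_left)
  show "a *[V] x \<in> U k" if "x \<in> U k" for a x
   using that unfolding U_def by (auto simp flip: ev_smult mult_smult_right)
 qed (auto simp: U_def)
 have le: "U (Suc k) \<subseteq> U k" for k
 proof
  fix x assume "x \<in> U (Suc k)"
  then obtain p where p: "x = ev (monom 1 (Suc k) * p)" by (auto simp: U_def)
  have "monom 1 (Suc k) * p = monom 1 k * (monom 1 1 * p)" by (simp add: mult_monom flip: mult.assoc)
  then show "x \<in> U k" unfolding U_def p by (metis mult.assoc rangeI)
 qed
 \<comment> \<open>A decreasing chain is stationary where its measure is least.\<close>
 define k where "k = arg_min (\<lambda>k. m (U k)) (\<lambda>_. True)"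
 have "m (U k) \<le> m (U (Suc k))" unfolding k_def by (rule arg_min_nat_le) simp
 then have "U (Suc k) = U k" using m(1) sub le[of k] by (metis leD psubsetI)
 then have "ev (monom 1 k * 1) \<in> U (Suc k)" unfolding U_def by blast
 then obtain p where p: "ev (monom 1 k) = ev (monom 1 (Suc k) * p)" by (auto simp: U_def)
 let ?q = "monom 1 k + Polynomial.smult (- 1) (monom 1 (Suc k) * p)"
 have "ev ?q = 0[V]" unfolding ev_add ev_smult p[symmetric] by (simp add: neg_eq[symmetric] M.r_neg)
 moreover have "coeff ?q k = 1" by (simp add: coeff_monom_mult)
 ultimately show ?thesis by (metis coeff_0 zero_neq_one)
qed

end

text \<open>An annihilating polynomial of \<open>v\<close> of least degree splits as (X - c) p over
  an algebraically closed field. By minimality p(f) v is nonzero, and f - c kills it.\<close>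

lemma eigenvector:
 fixes V :: "('f::alg_closed_field, 'v) module"
 assumes "fdspace V" and f: "f \<in> lin V V" and v: "v \<in> carrier V" and v0: "v \<noteq> 0[V]"
 shows "\<exists>c w. w \<in> carrier V \<and> w \<noteq> 0[V] \<and> f w = c *[V] w"
proof -
 interpret fdspace V by fact
 interpret vspace_endo V f v using f v by unfold_locales
 obtain q where q: "q \<noteq> 0" "ev q = 0[V]" "\<And>p. \<lbrakk>p \<noteq> 0; ev p = 0[V]\<rbrakk> \<Longrightarrow> degree q \<le> degree p"
 proof -
  obtain q0 where "q0 \<noteq> 0 \<and> ev q0 = 0[V]" using annihilator[OF fg] by auto
  from ex_has_least_nat[of "\<lambda>q. q \<noteq> 0 \<and> ev q = 0[V]", OF this, of degree] show ?thesis using that by blast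
 qed
 have "degree q \<noteq> 0"
 proof
  assume "degree q = 0"
  then obtain c where c: "q = [:c:]" by (rule degree_eq_zeroE)
  then have "c *[V] v = 0[V]" "c \<noteq> 0" using q v by (auto simp: ev_pCons)
  then show False using smult_inverse[OF _ v _ zero_submodule] v0 by auto
 qed
 then obtain c where "poly q c = 0" using alg_closed_imp_poly_has_root[of q] by auto
 then obtain p where p: "q = [:- c, 1:] * p" by (auto simp: poly_eq_0_iff_dvd elim: dvdE)
 have p0: "p \<noteq> 0" using q(1) p by auto
 have "degree q = Suc (degree p)" unfolding p using p0 by (subst degree_mult_eq) auto
 then have w: "ev p \<noteq> 0[V]" using q(3)[of p] p0 by auto
 have "q = Polynomial.smult (- c) p + pCons 0 p" unfolding p by simp
 then have "ev (Polynomial.smult (- c) p) +[V] ev (pCons 0 p) = 0[V]" using q(2) ev_add[of "Polynomial.smult (- c) p" "pCons 0 p"] by simp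
 then have "(- c) *[V] ev p +[V] f (ev p) = 0[V]" unfolding ev_smult ev_pCons using v by simp
 then have "f (ev p) +[V] (- c) *[V] ev p = 0[V]" by (simp add: M.a_comm)
 then have "f (ev p) = -[V] ((- c) *[V] ev p)" by (intro M.minus_equality[symmetric]) simp_all
 also have "\<dots> = c *[V] ev p" using neg_eq[of "(- c) *[V] ev p"] smult_assoc1[of "- 1" "- c" "ev p"] by simp
 finally show ?thesis using w by (intro exI[of _ c] exI[of _ "ev p"]) simp
qed

section \<open>Modules over finite dimensional algebras\<close>

lemma module_homI: "\<lbrakk>left_module R M; left_module R N; f \<in> ahom R M N\<rbrakk> \<Longrightarrow> module_hom R M N f"
 by (simp add: module_hom_def module_hom_axioms_def)

lemma restrict_scalars_simps [simp]:
 "carrier (rs A M) = carrier M" "0[rs A M] = 0[M]"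
 "x +[rs A M] y = x +[M] y"
 "c *[rs A M] x = (c *[A] 1[A]) *[M] x"
 "rs A (M\<lparr>carrier := H\<rparr>) = (rs A M)\<lparr>carrier := H\<rparr>"
 by (simp_all add: restrict_scalars_def scalar_action_def fun_eq_iff)

lemma minus_restrict_scalars [simp]: "-[rs A M] x = -[M] x" by (simp add: a_inv_def m_inv_def restrict_scalars_def)

definition regular :: "('f, 'a) module \<Rightarrow> ('a, 'a) module" where
 "regular A = \<lparr>carrier = carrier A, mult = mult A, one = 1[A], zero = 0[A], add = add A, smult = mult A\<rparr>"

locale falg =
 fixes A :: "('f::field, 'a) module"
 assumes fd: "fd_algebra A"
begin

lemma A_ring: "ring A" and A_module: "module field_ring A"
 and A_fg: "finitely_generated field_ring A" using fd by (auto simp: fd_algebra_def)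

sublocale ring A by (rule A_ring)

sublocale V: fdspace A
proof (intro fdspace.intro fdspace_axioms.intro vspace.intro)
 interpret m: Module.module field_ring A by (rule A_module)
 show "left_module field_ring A"
  by (intro left_module.intro left_module_axioms.intro Module.module.axioms(2)[OF A_module] ring_field_ring
    m.smult_closed m.smult_l_distr m.smult_r_distr m.smult_assoc1 m.smult_one)
qed (rule A_fg)

lemma mult_smult:
 assumes "x \<in> carrier A" "y \<in> carrier A"
 shows "(c *[A] x) **[A] y = c *[A] (x **[A] y)" "x **[A] (c *[A] y) = c *[A] (x **[A] y)"
 using fd assms by (auto simp: fd_algebra_def)

abbreviation sc :: "'f \<Rightarrow> 'a" where "sc c \<equiv> c *[A] 1[A]"

lemma smult_cl [simp]: "x \<in> carrier A \<Longrightarrow> c *[A] x \<in> carrier A" by (simp add: V.smult_closed)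

lemma sc_simps:
 "sc (c + d) = sc c +[A] sc d" "sc 1 = 1[A]"
 "a \<in> carrier A \<Longrightarrow> sc c **[A] a = c *[A] a" "a \<in> carrier A \<Longrightarrow> a **[A] sc c = c *[A] a"
 using V.smult_l_distr[of c d "1[A]"] by (simp_all add: mult_smult)

lemma sc_mult: "sc (c * d) = sc c **[A] sc d" using V.smult_assoc1[of c d "1[A]"] by (simp add: sc_simps(3))

lemma rs_vspace: "left_module A M \<Longrightarrow> vspace (rs A M)"
proof -
 assume "left_module A M"
 then interpret M: left_module A M .
 show ?thesis unfolding vspace_def by (rule left_moduleI)
   (use M.M.a_inv_closed M.M.l_neg in "auto simp: ring_field_ring M.M.add.m_ac M.smult_l_distr M.smult_r_distr sc_simps(1,2) sc_mult M.smult_assoc1")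
qed

lemma rs_ahom:
 "f \<in> ahom A M N \<Longrightarrow> f \<in> lin (rs A M) (rs A N)" by (rule ahomI) (simp_all add: ahomD)

lemma rs_submodule:
 assumes "left_module A M" "submodule H A M" shows "vsub H (rs A M)"
proof -
 interpret vspace "rs A M" by (rule rs_vspace[OF assms(1)])
 show ?thesis by (rule submoduleI) (auto simp: submoduleD[OF assms(2)])
qed

lemma fg_iff:
 assumes "left_module A M"
 shows "finitely_generated A M \<longleftrightarrow> finitely_generated field_ring (rs A M)"
proof
 interpret M: left_module A M by fact
 let ?V = "rs A M"
 interpret W: vspace ?V by (rule rs_vspace[OF assms])
 assume "finitely_generated field_ring ?V"
 then obtain S where S: "finite S" "S \<subseteq> carrier M" "span_of ?V S = carrier M"
  by (auto simp: finitely_generated_def)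
 have "span_of ?V S \<subseteq> gen_submodule A M S"
  by (rule gen_submodule(3)[OF W.is_module _ rs_submodule[OF assms gen_submodule(1)[OF assms S(2)]]])
   (use S gen_submodule(2)[OF assms S(2)] in simp_all)
 then have "carrier M \<subseteq> gen_submodule A M S" using S(3) by simp
 then show "finitely_generated A M"
  using S submoduleD(1)[OF gen_submodule(1)[OF assms S(2)]] unfolding finitely_generated_def by blast
next
 interpret M: left_module A M by fact
 let ?V = "rs A M"
 interpret W: vspace ?V by (rule rs_vspace[OF assms])
 assume "finitely_generated A M"
 then obtain S where S: "finite S" "S \<subseteq> carrier M" "gen_submodule A M S = carrier M"
  by (auto simp: finitely_generated_def)
 obtain B where B: "finite B" "B \<subseteq> carrier A" "span_of A B = carrier A"
  using A_fg by (auto simp: finitely_generated_def)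
 let ?T = "(\<lambda>(b, s). b *[M] s) ` (B \<times> S)"
 have T: "?T \<subseteq> carrier ?V" using S(2) B(2) by auto
 let ?H = "span_of ?V ?T"
 note H = gen_submodule[OF W.is_module T]
 note h = submoduleD[OF H(1), simplified]
 have 1: "a *[M] s \<in> ?H" if a: "a \<in> carrier A" and s: "s \<in> S" for a s
 proof -
  have sM: "s \<in> carrier M" using s S by auto
  have "submodule {a \<in> carrier A. a *[M] s \<in> ?H} field_ring A"
  proof (rule V.submoduleI)
   fix c :: 'f and x assume "x \<in> {a \<in> carrier A. a *[M] s \<in> ?H}"
   moreover have "(c *[A] x) *[M] s = sc c *[M] (x *[M] s)" if "x \<in> carrier A"
    using that sM by (simp add: sc_simps flip: M.smult_assoc1)
   ultimately show "c *[A] x \<in> {a \<in> carrier A. a *[M] s \<in> ?H}" using h(5)[where a = c and x = "x *[M] s"] by simp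
  qed (use sM h in "auto simp: M.smult_l_distr")
  moreover have "B \<subseteq> {a \<in> carrier A. a *[M] s \<in> ?H}" using B(2) H(2) s by auto
  ultimately show ?thesis using gen_submodule(3)[OF V.is_module B(2)] a B(3) by blast
 qed
 \<comment> \<open>Stability of the span under \<open>A\<close> is tested on the products b s, where
   associativity reduces it to the previous claim.\<close>
 have 2: "a *[M] x \<in> ?H" if a: "a \<in> carrier A" and x: "x \<in> ?H" for a x
 proof -
  have "submodule {x \<in> carrier M. \<forall>a\<in>carrier A. a *[M] x \<in> ?H} field_ring ?V"
  proof (rule W.submoduleI)
   fix c :: 'f and x assume x: "x \<in> {x \<in> carrier M. \<forall>a\<in>carrier A. a *[M] x \<in> ?H}"
   have "a *[M] (sc c *[M] x) \<in> ?H" if "a \<in> carrier A" for a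
   proof -
    have "a *[M] (sc c *[M] x) = sc c *[M] (a *[M] x)" using that x by (simp add: sc_simps flip: M.smult_assoc1)
    then show ?thesis using h(5)[where a = c and x = "a *[M] x"] x that by simp
   qed
   then show "c *[?V] x \<in> {x \<in> carrier M. \<forall>a\<in>carrier A. a *[M] x \<in> ?H}" using x by simp
  qed (use h in "auto simp: M.smult_r_distr")
  moreover have "a *[M] (b *[M] s) \<in> ?H" if "a \<in> carrier A" "b \<in> B" "s \<in> S" for a b s
   by (subst M.smult_assoc1[symmetric]) (use that B(2) S(2) 1 in auto)
  then have "?T \<subseteq> {x \<in> carrier M. \<forall>a\<in>carrier A. a *[M] x \<in> ?H}" using B(2) S(2) by auto
  ultimately show ?thesis using H(3) x a by blast
 qed
 have "submodule ?H A M" by (rule M.submoduleI) (use h 2 in auto)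
 moreover have "s \<in> ?H" if "s \<in> S" for s using 1[of "1[A]" s] S(2) that by (simp add: subset_iff)
 then have "S \<subseteq> ?H" by blast
 ultimately have "carrier M \<subseteq> ?H" using gen_submodule(3)[OF assms S(2)] S(3) by blast
 then show "finitely_generated field_ring ?V"
  using h(1) T B(1) S(1) unfolding finitely_generated_def by (intro exI[of _ ?T]) auto
qed

lemma fg_fdspace:
 assumes "left_module A M"
 shows "finitely_generated A M \<longleftrightarrow> fdspace (rs A M)"
 using fg_iff[OF assms] rs_vspace[OF assms] by (simp add: fdspace_def fdspace_axioms_def)

lemma regular_left_module: "left_module A (regular A)" by (rule left_moduleI)
  (use a_inv_closed l_neg in "auto simp: regular_def m_assoc l_distr r_distr add.m_ac ring_axioms")

end

locale fdmod = falg A + left_module A M for A :: "('f::field, 'a) module" and M :: "('a, 'm) module" +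
 assumes fgM: "finitely_generated A M"
begin

sublocale rs: fdspace "rs A M" using fg_fdspace[OF is_module] fgM by simp

end

lemma fdmod_iff: "fd_algebra A \<Longrightarrow> fdmod A M \<longleftrightarrow> left_module A M \<and> finitely_generated A M"
 by (simp add: fdmod_def fdmod_axioms_def falg_def)

lemma fg_modules_fdmod: "fd_algebra A \<Longrightarrow> M \<in> fg_modules A \<longleftrightarrow> fdmod A M" by (simp add: fdmod_iff fg_modules_def)

lemma fdmod_inj:
 assumes "fdmod A N" "left_module A M" "f \<in> ahom A M N" "inj_on f (carrier M)"
 shows "fdmod A M"
proof -
 interpret N: fdmod A N by fact
 have "fdspace (rs A M)"
  by (rule fdspace_inj[OF N.rs_vspace[OF assms(2)] N.rs.fdspace_axioms N.rs_ahom[OF assms(3)]])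
   (use assms(4) in simp)
 then show ?thesis using assms(2) by (simp add: fdmod_iff N.fd N.fg_fdspace)
qed

lemma fdmod_sub:
 assumes "fdmod A M" "submodule H A M" shows "fdmod A (M\<lparr>carrier := H\<rparr>)"
proof -
 interpret fdmod A M by fact
 show ?thesis
  by (rule fdmod_inj[OF assms(1) submodule_left_module[OF is_module assms(2)] incl_ahom[OF assms(2)]]) simp
qed

lemma fdmod_surj:
 assumes "fdmod A M" "left_module A N" "f \<in> ahom A M N" "f ` carrier M = carrier N"
 shows "fdmod A N"
proof -
 interpret M: fdmod A M by fact
 interpret f: module_hom A M N f by (rule module_homI[OF M.is_module assms(2,3)])
 obtain S where S: "finite S" "S \<subseteq> carrier M" "gen_submodule A M S = carrier M"
  using M.fgM by (auto simp: finitely_generated_def)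
 have fS: "f ` S \<subseteq> carrier N" using S by auto
 note g = gen_submodule[OF assms(2) fS]
 have "carrier M \<subseteq> {x \<in> carrier M. f x \<in> gen_submodule A N (f ` S)}" unfolding S(3)[symmetric]
  by (rule gen_submodule(3)[OF M.is_module S(2)]) (use f.vimage_submodule[OF g(1)] g(2) S in auto)
 then have "f ` carrier M \<subseteq> gen_submodule A N (f ` S)" by blast
 then have "gen_submodule A N (f ` S) = carrier N" using submoduleD(1)[OF g(1)] assms(4) by auto
 then show ?thesis
  using assms(2) S(1) fS by (auto simp: fdmod_iff M.fd finitely_generated_def intro!: exI[of _ "f ` S"])
qed

lemma fdmod_iso: "\<lbrakk>fdmod A M; left_module A N; isomorphic A M N\<rbrakk> \<Longrightarrow> fdmod A N"
 by (elim isomorphicE) (auto intro: fdmod_surj simp: bij_betw_def)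

lemma simple_fdmod:
 assumes "fd_algebra A" "simple_module A M" shows "fdmod A M"
proof -
 interpret M: left_module A M using assms(2) by (simp add: simple_module_def)
 obtain x where x: "x \<in> carrier M" "x \<noteq> 0[M]" using assms(2) by (auto simp: simple_module_def)
 have S: "{x} \<subseteq> carrier M" using x by simp
 note g = gen_submodule[OF M.is_module S]
 have "gen_submodule A M {x} = carrier M" by (rule simple_sub[OF assms(2) g(1), of x]) (use g x in auto)
 then show ?thesis using x(1) M.is_module assms(1)
  by (auto simp: fdmod_iff finitely_generated_def intro!: exI[of _ "{x}"])
qed

text \<open>A copy of a finite dimensional module with carrier in \<open>nat \<Rightarrow> 'f\<close>, hence an object of \<open>fg_modules\<close>.\<close>

definition enc_map :: "('f::field, 'a) module \<Rightarrow> ('a, 'm) module \<Rightarrow> 'm \<Rightarrow> nat \<Rightarrow> 'f" where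
 "enc_map A M = (SOME \<phi>. inj_on \<phi> (carrier M))"

definition enc :: "('f::field, 'a) module \<Rightarrow> ('a, 'm) module \<Rightarrow> ('a, nat \<Rightarrow> 'f) module" where
 "enc A M = transport (enc_map A M) M"

lemma enc:
 assumes "fdmod A M"
 shows "enc A M \<in> fg_modules A" "enc_map A M \<in> ahom A M (enc A M)"
  "bij_betw (enc_map A M) (carrier M) (carrier (enc A M))" "isomorphic A M (enc A M)"
  "fdmod A (enc A M)" "left_module A (enc A M)"
proof -
 interpret fdmod A M by fact
 obtain n \<phi> where "coords (rs A M) n \<phi>" by (rule rs.coords_ex[OF rs.fg])
 then have "inj_on \<phi> (carrier M)" by (simp add: coords_def bij_betw_def)
 then have i: "inj_on (enc_map A M) (carrier M)" unfolding enc_map_def by (rule someI[where P = "\<lambda>\<phi>. inj_on \<phi> (carrier M)"])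
 note t = transport[OF is_module i, folded enc_def]
 show iso: "isomorphic A M (enc A M)" by (rule isomorphicI[OF is_module t(2,3)])
 show "fdmod A (enc A M)" by (rule fdmod_iso[OF assms t(1) iso])
 then show "enc A M \<in> fg_modules A" by (simp add: fg_modules_fdmod fd)
 show "enc_map A M \<in> ahom A M (enc A M)" "bij_betw (enc_map A M) (carrier M) (carrier (enc A M))" "left_module A (enc A M)"
  by (rule t)+
qed

section \<open>Simple submodules and quotients\<close>

context fdmod
begin

lemma submodule_measure:
 obtains m :: "'m set \<Rightarrow> nat" and n where
  "\<forall>U W. submodule U A M \<longrightarrow> submodule W A M \<longrightarrow> U \<subset> W \<longrightarrow> m U < m W" "\<forall>U. m U \<le> n"
proof -
 obtain m :: "'m set \<Rightarrow> nat" and n where m: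
  "\<forall>U W. vsub U (rs A M) \<longrightarrow> vsub W (rs A M) \<longrightarrow> U \<subset> W \<longrightarrow> m U < m W"
  "\<forall>U. m U \<le> n" by (rule rs.chain_measure)
 show ?thesis by (rule that[of m n]) (use m rs_submodule[OF is_module] in auto)
qed

lemma minimal_submodule:
 assumes "\<exists>U. submodule U A M \<and> P U"
 obtains U where "submodule U A M" "P U" "\<forall>W. submodule W A M \<longrightarrow> P W \<longrightarrow> W \<subseteq> U \<longrightarrow> W = U"
proof -
 obtain m :: "'m set \<Rightarrow> nat" and n where m: "\<forall>U W. submodule U A M \<longrightarrow> submodule W A M \<longrightarrow> U \<subset> W \<longrightarrow> m U < m W" "\<forall>U. m U \<le> n"
  by (rule submodule_measure)
 obtain U where "submodule U A M \<and> P U" "\<forall>W. submodule W A M \<and> P W \<longrightarrow> m U \<le> m W"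
  using assms ex_has_least_nat[of "\<lambda>U. submodule U A M \<and> P U" _ m] by blast
 then show ?thesis using m(1) by (intro that[of U]) (auto simp: psubset_eq not_less[symmetric])
qed

lemma maximal_submodule:
 assumes "\<exists>U. submodule U A M \<and> P U"
 obtains U where "submodule U A M" "P U" "\<forall>W. submodule W A M \<longrightarrow> P W \<longrightarrow> U \<subseteq> W \<longrightarrow> W = U"
proof -
 obtain m :: "'m set \<Rightarrow> nat" and n where m: "\<forall>U W. submodule U A M \<longrightarrow> submodule W A M \<longrightarrow> U \<subset> W \<longrightarrow> m U < m W" "\<forall>U. m U \<le> n"
  by (rule submodule_measure)
 obtain U where U: "submodule U A M \<and> P U" "\<forall>W. submodule W A M \<and> P W \<longrightarrow> n - m U \<le> n - m W"
  using assms ex_has_least_nat[of "\<lambda>U. submodule U A M \<and> P U" _ "\<lambda>U. n - m U"] by blast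
 have "\<not> m U < m W" if "submodule W A M" "P W" for W
  using U(2) that m(2) spec[OF m(2), of W] by (auto dest!: spec[of _ W])
 then show ?thesis by (rule_tac that[of U]) (use m(1) U(1) in "auto simp: psubset_eq")
qed

lemma simple_submodule_ex:
 assumes "submodule H A M" "H \<noteq> {0[M]}"
 obtains S where "submodule S A M" "S \<subseteq> H" "simple_module A (M\<lparr>carrier := S\<rparr>)"
proof -
 have "\<exists>U. submodule U A M \<and> U \<subseteq> H \<and> U \<noteq> {0[M]}" using assms by blast
 then obtain S where S: "submodule S A M" "S \<subseteq> H \<and> S \<noteq> {0[M]}"
  "\<forall>W. submodule W A M \<longrightarrow> W \<subseteq> H \<and> W \<noteq> {0[M]} \<longrightarrow> W \<subseteq> S \<longrightarrow> W = S" by (rule minimal_submodule)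
 have "simple_module A (M\<lparr>carrier := S\<rparr>)" unfolding simple_module_def
  using S submodule_left_module[OF is_module S(1)] by (auto simp: submodule_sub[OF is_module S(1)])
 then show ?thesis by (rule_tac that[of S]) (use S in auto)
qed

text \<open>The bounded measure provides a maximal proper submodule above \<open>H\<close>;
  preimages of submodules of the quotient lie between it and \<open>M\<close>.\<close>

lemma simple_quotient_ex:
 assumes "submodule H A M" "H \<noteq> carrier M"
 obtains K where "submodule K A M" "H \<subseteq> K" "K \<noteq> carrier M" "simple_module A (quot_module M K)"
proof -
 have "\<exists>U. submodule U A M \<and> H \<subseteq> U \<and> U \<noteq> carrier M" by (rule exI[of _ H]) (simp add: assms)
 then obtain K where K: "submodule K A M" "H \<subseteq> K \<and> K \<noteq> carrier M"
  "\<forall>W. submodule W A M \<longrightarrow> H \<subseteq> W \<and> W \<noteq> carrier M \<longrightarrow> K \<subseteq> W \<longrightarrow> W = K" by (rule maximal_submodule)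
 interpret K: sub_module A M K by (rule sub_module.intro[OF is_module sub_module_axioms.intro[OF K(1)]])
 let ?Q = "quot_module M K"
 interpret p: module_hom A M ?Q "\<lambda>x. K +>\<^bsub>M\<^esub> x" by (rule module_homI[OF is_module K.quot_left_module K.quot_proj])
 have "simple_module A ?Q" unfolding simple_module_def
 proof (intro conjI allI impI)
  show "left_module A ?Q" by (rule K.quot_left_module)
  show "carrier ?Q \<noteq> {0[?Q]}"
  proof
   assume *: "carrier ?Q = {0[?Q]}"
   have "x \<in> K" if "x \<in> carrier M" for x
   proof -
    have "K +>\<^bsub>M\<^esub> x \<in> carrier ?Q" using that by simp
    then show ?thesis using * K.quot_proj_zero[OF that] by simp
   qed
   then show False using K(2) submoduleD(1)[OF K(1)] by blast
  qed
  fix U assume U: "submodule U A ?Q"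
  let ?W = "{x \<in> carrier M. K +>\<^bsub>M\<^esub> x \<in> U}"
  have KW: "K \<subseteq> ?W"
  proof
   fix x assume "x \<in> K"
   then have "x \<in> carrier M" "K +>\<^bsub>M\<^esub> x = 0[?Q]" using submoduleD(6)[OF K(1)] K.quot_proj_zero by auto
   then show "x \<in> ?W" using submoduleD(2)[OF U] by simp
  qed
  have U_eq: "U = (\<lambda>x. K +>\<^bsub>M\<^esub> x) ` ?W" using submoduleD(1)[OF U] by (auto simp: K.quot_carrier)
  show "U = {0[?Q]} \<or> U = carrier ?Q"
  proof (cases "?W = carrier M")
   case True
   then have "U = (\<lambda>x. K +>\<^bsub>M\<^esub> x) ` carrier M" using U_eq by simp
   then show ?thesis by (simp add: K.quot_carrier)
  next
   case False
   then have "?W = K" using K(3) p.vimage_submodule[OF U] KW K(2) by blast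
   then have "U = (\<lambda>x. K +>\<^bsub>M\<^esub> x) ` K" using U_eq by simp
   moreover have "K +>\<^bsub>M\<^esub> x = 0[?Q]" if "x \<in> K" for x using K.quot_proj_zero[of x] submoduleD(6)[OF K(1) that] that by simp
   ultimately have "U \<subseteq> {0[?Q]}" by auto
   then show ?thesis using submoduleD(2)[OF U] by auto
  qed
 qed
 then show ?thesis by (rule_tac that[of K]) (use K in auto)
qed

end

text \<open>Here algebraic closedness enters: f has an eigenvector, and since scalars are central
  the eigenspace is a nonzero submodule.\<close>

lemma schur_scalar:
 fixes A :: "('f::alg_closed_field, 'a) module"
 assumes "fd_algebra A" "simple_module A M" "f \<in> ahom A M M"
 obtains c where "\<And>x. x \<in> carrier M \<Longrightarrow> f x = (c *[A] 1[A]) *[M] x"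
proof -
 interpret fdmod A M by (rule simple_fdmod[OF assms(1,2)])
 obtain v where v: "v \<in> carrier M" "v \<noteq> 0[M]" using assms(2) M.zero_closed by (auto simp: simple_module_def)
 obtain c w where w: "w \<in> carrier M" "w \<noteq> 0[M]" "f w = sc c *[M] w"
  using eigenvector[OF rs.fdspace_axioms rs_ahom[OF assms(3)], of v] v by auto
 let ?K = "{x \<in> carrier M. f x = sc c *[M] x}"
 have "submodule ?K A M"
 proof (rule submoduleI)
  show "0[M] \<in> ?K" using ahomD(3)[OF assms(3), of "0[A]" "0[M]"] ahomD(1)[OF assms(3)] by simp
  show "a *[M] x \<in> ?K" if "a \<in> carrier A" "x \<in> ?K" for a x
  proof -
   have "a *[M] (sc c *[M] x) = sc c *[M] (a *[M] x)" using that by (simp add: sc_simps flip: smult_assoc1)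
   then show ?thesis using that ahomD[OF assms(3)] by simp
  qed
 qed (use ahomD[OF assms(3)] in "auto simp: smult_r_distr")
 then have "?K = carrier M" by (rule simple_sub[OF assms(2) _ _ w(2)]) (use w in simp)
 then show ?thesis using that[of c] by blast
qed

section \<open>Homomorphism modules\<close>

text \<open>The action is a parameter because it has different origins: a second action on the
  target in \<open>hom2\<close> and \<open>dual_module\<close>, right multiplications of the source
  in \<open>coind\<close>.\<close>

definition hom_module :: "('r, 'd) ring_scheme \<Rightarrow> ('r, 'm) module \<Rightarrow> ('r, 'n) module
  \<Rightarrow> ('s \<Rightarrow> ('m \<Rightarrow> 'n) \<Rightarrow> 'm \<Rightarrow> 'n) \<Rightarrow> ('s, 'm \<Rightarrow> 'n) module" where
 "hom_module R M N act = \<lparr>carrier = Hom R M N, mult = (\<lambda>f g. f), one = (\<lambda>x. undefined),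
  zero = (\<lambda>x\<in>carrier M. 0[N]), add = (\<lambda>f g. \<lambda>x\<in>carrier M. f x +[N] g x), smult = act\<rparr>"

lemma hom_module_simps [simp]:
 "carrier (hom_module R M N act) = Hom R M N"
 "0[hom_module R M N act] = (\<lambda>x\<in>carrier M. 0[N])"
 "f +[hom_module R M N act] g = (\<lambda>x\<in>carrier M. f x +[N] g x)"
 "a *[hom_module R M N act] f = act a f" by (simp_all add: hom_module_def)

lemma Hom_eqI:
 assumes "f \<in> Hom R M N" "g \<in> Hom R M N" "\<And>x. x \<in> carrier M \<Longrightarrow> f x = g x"
 shows "f = g" using assms by (auto simp: Hom_iff intro: extensionalityI)

lemma hom_zero_Hom: "\<lbrakk>left_module R M; left_module R N\<rbrakk> \<Longrightarrow> (\<lambda>x\<in>carrier M. 0[N]) \<in> Hom R M N"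
proof -
 assume M: "left_module R M" and "left_module R N"
 interpret N: left_module R N by fact
 show ?thesis by (intro restrict_Hom[OF _ M] ahomI) simp_all
qed

lemma hom_add_ahom:
 assumes "left_module R N" "f \<in> ahom R M N" "g \<in> ahom R M N"
 shows "(\<lambda>x. f x +[N] g x) \<in> ahom R M N"
proof -
 interpret N: left_module R N by fact
 show ?thesis by (rule ahomI) (simp_all add: ahomD[OF assms(2)] ahomD[OF assms(3)] N.smult_r_distr N.M.add.m_ac)
qed

lemma hom_module_left_module:
 assumes M: "left_module R M" and N: "left_module R N" and S: "ring S"
  and cl: "\<And>a f. \<lbrakk>a \<in> carrier S; f \<in> Hom R M N\<rbrakk> \<Longrightarrow> act a f \<in> Hom R M N"
  and l: "\<And>a b f x. \<lbrakk>a \<in> carrier S; b \<in> carrier S; f \<in> Hom R M N; x \<in> carrier M\<rbrakk>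
    \<Longrightarrow> act (a +[S] b) f x = act a f x +[N] act b f x"
  and r: "\<And>a f g x. \<lbrakk>a \<in> carrier S; f \<in> Hom R M N; g \<in> Hom R M N; x \<in> carrier M\<rbrakk>
    \<Longrightarrow> act a (\<lambda>x\<in>carrier M. f x +[N] g x) x = act a f x +[N] act a g x"
  and a: "\<And>a b f x. \<lbrakk>a \<in> carrier S; b \<in> carrier S; f \<in> Hom R M N; x \<in> carrier M\<rbrakk>
    \<Longrightarrow> act (a **[S] b) f x = act a (act b f) x"
  and o: "\<And>f x. \<lbrakk>f \<in> Hom R M N; x \<in> carrier M\<rbrakk> \<Longrightarrow> act 1[S] f x = f x"
 shows "left_module S (hom_module R M N act)"
proof -
 interpret M: left_module R M by fact
 interpret N: left_module R N by fact
 interpret S: ring S by fact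
 have ad: "(\<lambda>x\<in>carrier M. f x +[N] g x) \<in> Hom R M N" if "f \<in> Hom R M N" "g \<in> Hom R M N" for f g
  by (rule restrict_Hom[OF hom_add_ahom[OF N] M]) (use that in "simp_all add: Hom_iff")
 have c: "f x \<in> carrier N" if "f \<in> Hom R M N" "x \<in> carrier M" for f x using that by (auto simp: Hom_iff ahomD)
 note z = hom_zero_Hom[OF M N]
 show ?thesis
 proof (rule left_moduleI, unfold hom_module_simps)
  show "\<exists>g\<in>Hom R M N. (\<lambda>x\<in>carrier M. g x +[N] f x) = (\<lambda>x\<in>carrier M. 0[N])" if f: "f \<in> Hom R M N" for f
  proof (rule bexI)
   show "restrict (\<lambda>x. -[N] f x) (carrier M) \<in> Hom R M N" by (intro restrict_Hom[OF _ M] ahomI)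
     (simp_all add: ahomD[OF Hom_ahom[OF f]] N.M.minus_add N.smult_r_minus)
  qed (use c[OF f] in "auto simp: N.M.l_neg intro!: restrict_ext")
 next
  fix f g h assume h: "f \<in> Hom R M N" "g \<in> Hom R M N" "h \<in> Hom R M N"
  show "(\<lambda>x\<in>carrier M. (\<lambda>x\<in>carrier M. f x +[N] g x) x +[N] h x) = (\<lambda>x\<in>carrier M. f x +[N] (\<lambda>x\<in>carrier M. g x +[N] h x) x)"
   by (rule restrict_ext) (use c h in "simp add: N.M.a_assoc")
 next
  fix f g assume h: "f \<in> Hom R M N" "g \<in> Hom R M N"
  show "(\<lambda>x\<in>carrier M. f x +[N] g x) = (\<lambda>x\<in>carrier M. g x +[N] f x)"
   by (rule restrict_ext) (use c h in "simp add: N.M.a_comm")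
 next
  fix f assume f: "f \<in> Hom R M N"
  show "(\<lambda>x\<in>carrier M. (\<lambda>x\<in>carrier M. 0[N]) x +[N] f x) = f" by (rule Hom_eqI[OF ad[OF z f] f]) (use c f in simp)
  show "act 1[S] f = f" by (rule Hom_eqI[OF cl[OF S.one_closed f] f o[OF f]])
 next
  fix a b f assume h: "a \<in> carrier S" "b \<in> carrier S" "f \<in> Hom R M N"
  show "act (a +[S] b) f = (\<lambda>x\<in>carrier M. act a f x +[N] act b f x)"
   by (rule Hom_eqI[OF cl ad[OF cl cl]]) (use h l in simp_all)
  show "act (a **[S] b) f = act a (act b f)" by (rule Hom_eqI[OF cl cl[OF _ cl]]) (use h a in simp_all)
 next
  fix a f g assume h: "a \<in> carrier S" "f \<in> Hom R M N" "g \<in> Hom R M N"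
  show "act a (\<lambda>x\<in>carrier M. f x +[N] g x) = (\<lambda>x\<in>carrier M. act a f x +[N] act a g x)"
   by (rule Hom_eqI[OF cl ad[OF cl cl]]) (use h ad r in simp_all)
 qed (use ad z cl S in auto)
qed

text \<open>A homomorphism is determined by its values on finitely many generators, and these values
  by finitely many forms; the resulting forms on the Hom space have no common zero.\<close>

lemma hom_module_fdmod:
 assumes lm: "left_module S (hom_module R M N act)" and "fd_algebra S"
  and M: "left_module R M" "finitely_generated R M" and N: "left_module R N" and V: "fdspace V"
  and VN: "carrier V = carrier N" "0[V] = 0[N]" "\<And>x y. \<lbrakk>x \<in> carrier N; y \<in> carrier N\<rbrakk> \<Longrightarrow> x +[V] y = x +[N] y"
  and act: "\<And>c f x. \<lbrakk>f \<in> Hom R M N; x \<in> carrier M\<rbrakk> \<Longrightarrow> act (c *[S] 1[S]) f x = c *[V] (f x)"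
 shows "fdmod S (hom_module R M N act)"
proof -
 interpret S: falg S using assms by unfold_locales
 interpret N: left_module R N by fact
 interpret V: fdspace V by fact
 let ?H = "hom_module R M N act" let ?V = "rs S ?H"
 interpret H: vspace ?V by (rule S.rs_vspace[OF lm])
 obtain G where G: "finite G" "G \<subseteq> carrier M" "gen_submodule R M G = carrier M"
  using M by (auto simp: finitely_generated_def)
 obtain L where "separating V L" by (rule V.sep_ex)
 then have L: "finite L" "L \<subseteq> lfun V" "\<And>x. \<lbrakk>x \<in> carrier V; \<forall>l\<in>L. l x = 0\<rbrakk> \<Longrightarrow> x = 0[V]"
  by (auto simp: separating_def)
 have c: "f x \<in> carrier N" if "f \<in> Hom R M N" "x \<in> carrier M" for f x using that by (auto simp: Hom_iff ahomD)
 have "finitely_generated field_ring ?V"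
 proof (rule H.fdim_sep[of "(\<lambda>(l, x) f. l (f x)) ` (L \<times> G)"])
  show "(\<lambda>(l, x) f. l (f x)) ` (L \<times> G) \<subseteq> lfun ?V"
  proof
   fix m assume "m \<in> (\<lambda>(l, x) f. l (f x)) ` (L \<times> G)"
   then obtain lx where "lx \<in> L \<times> G" "m = (\<lambda>(l, x) f. l (f x)) lx" by (rule imageE)
   define l x where "l = fst lx" and "x = snd lx"
   have lx: "l \<in> L" "x \<in> G" and m0: "m = (\<lambda>f. l (f x))"
    using \<open>lx \<in> L \<times> G\<close> \<open>m = _\<close> by (auto simp: l_def x_def case_prod_beta mem_Times_iff)
   have m: "m = (\<lambda>f. l (f x))" "l \<in> lfun V" "x \<in> carrier M" using lx m0 L(2) G(2) by auto
   show "m \<in> lfun ?V" unfolding m by (rule lfunI) (use m c in "auto simp: VN(3)[symmetric] VN(1) lfunD act")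
  qed
  fix f assume f: "f \<in> carrier ?V" "\<forall>m\<in>(\<lambda>(l, x) f. l (f x)) ` (L \<times> G). m f = 0"
  have fH: "f \<in> Hom R M N" using f by simp
  interpret f: module_hom R M N f by (rule module_homI[OF M(1) N Hom_ahom[OF fH]])
  have "f x = 0[N]" if "x \<in> G" for x using L(3)[of "f x"] f(2) that G(2) c[OF fH] by (auto simp: VN)
  then have "G \<subseteq> a_kernel M N f" using G(2) by (auto simp: f.kernel_eq)
  then have "carrier M \<subseteq> a_kernel M N f" using gen_submodule(3)[OF M(1) G(2) f.kernel_submodule] G(3) by simp
  then show "f = 0[?V]" using fH hom_zero_Hom[OF M(1) N] by (auto simp: f.kernel_eq intro!: Hom_eqI)
 qed (use L G in simp)
 then show ?thesis using lm S.fd by (simp add: fdmod_iff S.fg_iff)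
qed

section \<open>Lifting and labels for modules of arbitrary type\<close>

text \<open>Projectivity is defined by objects of \<open>fg_modules\<close>; copies made by
  \<open>enc\<close> extend the lifting property to finite dimensional modules on any type.\<close>

lemma projective_lift:
 assumes A: "fd_algebra A" and P: "projective A P" and M: "fdmod A M" and N: "fdmod A N"
  and g: "g \<in> ahom A M N" "g ` carrier M = carrier N" and f: "f \<in> ahom A P N"
 obtains h where "h \<in> ahom A P M" "\<And>x. x \<in> carrier P \<Longrightarrow> g (h x) = f x"
proof -
 note eM = enc[OF M] and eN = enc[OF N]
 interpret M: fdmod A M by fact
 interpret N: fdmod A N by fact
 interpret P: fdmod A P using P by (simp add: projective_def fg_modules_fdmod A)
 let ?i = "inv_into (carrier M) (enc_map A M)"
 interpret eM: module_hom A M "enc A M" "enc_map A M" by (rule module_homI[OF M.is_module eM(6,2)])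
 have i: "?i \<in> ahom A (enc A M) M" by (rule eM.inv_ahom[OF eM(3)])
 have injN: "x = y" if "enc_map A N x = enc_map A N y" "x \<in> carrier N" "y \<in> carrier N" for x y
  using eN(3) that by (auto simp: bij_betw_def dest: inj_onD)
 let ?g = "restrict (\<lambda>x. enc_map A N (g (?i x))) (carrier (enc A M))"
 let ?f = "restrict (\<lambda>x. enc_map A N (f x)) (carrier P)"
 have "?g ` carrier (enc A M) = enc_map A N ` g ` ?i ` carrier (enc A M)" by (simp add: image_image)
 also have "?i ` carrier (enc A M) = carrier M" by (rule bij_betw_imp_surj_on[OF bij_betw_inv_into[OF eM(3)]])
 finally have "?g ` carrier (enc A M) = carrier (enc A N)" using g(2) eN(3) by (simp add: bij_betw_def)
 then have "?g \<in> Epi A (enc A M) (enc A N)"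
  unfolding Epi_def using restrict_Hom[OF ahom_comp[OF ahom_comp[OF i g(1)] eN(2)] eM(6)] by simp
 moreover have "?f \<in> Hom A P (enc A N)" by (rule restrict_Hom[OF ahom_comp[OF f eN(2)] P.is_module])
 ultimately obtain h where h: "h \<in> Hom A P (enc A M)" "compose (carrier P) ?g h = ?f"
  using P eM(1) eN(1) unfolding projective_def by blast
 have hh: "h \<in> ahom A P (enc A M)" by (rule Hom_ahom[OF h(1)])
 show ?thesis
 proof (rule that[OF ahom_comp[OF hh i]])
  fix x assume x: "x \<in> carrier P"
  have "enc_map A N (g (?i (h x))) = enc_map A N (f x)"
   using fun_cong[OF h(2), of x] x ahomD(1)[OF hh x] by (simp add: compose_def)
  then show "g (?i (h x)) = f x"
   using injN x ahomD(1)[OF f] ahomD(1)[OF g(1)] ahomD(1)[OF i] ahomD(1)[OF hh x] by blast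
 qed
qed

lemma label_ex:
 assumes "fd_algebra A" "labels_simples A I L" "simple_module A S"
 obtains i where "i \<in> I" "isomorphic A S (L i)"
proof -
 note e = enc[OF simple_fdmod[OF assms(1,3)]]
 have "simple_module A (enc A S)" by (rule simple_module_iso[OF assms(3) e(6,4)])
 then obtain i where "i \<in> I" "isomorphic A (enc A S) (L i)"
  using assms(2) e(1) unfolding labels_simples_def by blast
 then show ?thesis using that isomorphic_trans[OF _ e(4)] assms(3) unfolding simple_module_def by blast
qed

section \<open>Tensor products of vector spaces\<close>

definition bilin :: "('f::field, 'v) module \<Rightarrow> ('f, 'w) module \<Rightarrow> ('f, 'x) module \<Rightarrow> ('v \<Rightarrow> 'w \<Rightarrow> 'x) \<Rightarrow> bool" where
 "bilin V W X b \<longleftrightarrow> (\<forall>v\<in>carrier V. \<forall>w\<in>carrier W. b v w \<in> carrier X) \<and>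
  (\<forall>v\<in>carrier V. \<forall>v'\<in>carrier V. \<forall>w\<in>carrier W. b (v +[V] v') w = b v w +[X] b v' w) \<and>
  (\<forall>v\<in>carrier V. \<forall>w\<in>carrier W. \<forall>w'\<in>carrier W. b v (w +[W] w') = b v w +[X] b v w') \<and>
  (\<forall>c. \<forall>v\<in>carrier V. \<forall>w\<in>carrier W. b (c *[V] v) w = c *[X] b v w \<and> b v (c *[W] w) = c *[X] b v w)"

lemma bilinD:
 assumes "bilin V W X b"
 shows "\<lbrakk>v \<in> carrier V; w \<in> carrier W\<rbrakk> \<Longrightarrow> b v w \<in> carrier X"
  and "\<lbrakk>v \<in> carrier V; v' \<in> carrier V; w \<in> carrier W\<rbrakk> \<Longrightarrow> b (v +[V] v') w = b v w +[X] b v' w"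
  and "\<lbrakk>v \<in> carrier V; w \<in> carrier W; w' \<in> carrier W\<rbrakk> \<Longrightarrow> b v (w +[W] w') = b v w +[X] b v w'"
  and "\<lbrakk>v \<in> carrier V; w \<in> carrier W\<rbrakk> \<Longrightarrow> b (c *[V] v) w = c *[X] b v w"
  and "\<lbrakk>v \<in> carrier V; w \<in> carrier W\<rbrakk> \<Longrightarrow> b v (c *[W] w) = c *[X] b v w" using assms by (auto simp: bilin_def)

lemma bilinI:
 assumes "\<And>v w. \<lbrakk>v \<in> carrier V; w \<in> carrier W\<rbrakk> \<Longrightarrow> b v w \<in> carrier X"
  and "\<And>v v' w. \<lbrakk>v \<in> carrier V; v' \<in> carrier V; w \<in> carrier W\<rbrakk> \<Longrightarrow> b (v +[V] v') w = b v w +[X] b v' w"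
  and "\<And>v w w'. \<lbrakk>v \<in> carrier V; w \<in> carrier W; w' \<in> carrier W\<rbrakk> \<Longrightarrow> b v (w +[W] w') = b v w +[X] b v w'"
  and "\<And>c v w. \<lbrakk>v \<in> carrier V; w \<in> carrier W\<rbrakk> \<Longrightarrow> b (c *[V] v) w = c *[X] b v w"
  and "\<And>c v w. \<lbrakk>v \<in> carrier V; w \<in> carrier W\<rbrakk> \<Longrightarrow> b v (c *[W] w) = c *[X] b v w"
 shows "bilin V W X b" using assms by (auto simp: bilin_def)

section \<open>Formal linear combinations and bilinear extension\<close>

lemma lookup_scale [simp]:
 "Poly_Mapping.lookup (Poly_Mapping.map ((*) c) u) k = c * Poly_Mapping.lookup u (k :: 'k) " for c :: "'f::field"
 by (simp add: Poly_Mapping.map.rep_eq when_def)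

lemma pm_induct [consumes 1, case_names zero add single]:
 assumes "pm_keys u \<subseteq> C" "P 0" and add: "\<And>u v. \<lbrakk>P u; P v\<rbrakk> \<Longrightarrow> P (u + v)"
  and single: "\<And>p c. p \<in> C \<Longrightarrow> P (pm_single p c)"
 shows "P (u :: 'k \<Rightarrow>\<^sub>0 'f::field)"
proof -
 have "\<forall>u. pm_keys u = K \<longrightarrow> K \<subseteq> C \<longrightarrow> P u" if "finite K" for K using that
 proof (induction K rule: finite_induct)
  case empty
  have "u = 0" if "pm_keys u = {}" for u :: "'k \<Rightarrow>\<^sub>0 'f"
   by (rule poly_mapping_eqI) (use that in "auto simp: in_keys_iff")
  then show ?case using assms(2) by blast
 next
  case (insert p K)
  show ?case
  proof (intro allI impI)
   fix u :: "'k \<Rightarrow>\<^sub>0 'f" assume u: "pm_keys u = insert p K" "insert p K \<subseteq> C"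
   let ?v = "u - pm_single p (Poly_Mapping.lookup u p)"
   have "pm_keys ?v = K"
   proof (rule Set.set_eqI)
    fix q
    have "q \<in> pm_keys u \<longleftrightarrow> q = p \<or> q \<in> K" using u by simp
    then show "q \<in> pm_keys ?v \<longleftrightarrow> q \<in> K"
     using insert.hyps(2) by (auto simp: in_keys_iff lookup_minus lookup_single when_def)
   qed
   then have "P ?v" using insert.IH u(2) by blast
   then have "P (?v + pm_single p (Poly_Mapping.lookup u p))" using add single u(2) by blast
   then show "P u" by simp
  qed
 qed
 from this[OF finite_keys[of u]] show ?thesis using assms(1) by simp
qed

text \<open>Supports change under addition, so bilinearity is proved after enlarging all index sets
  to common finite ones.\<close>

lemma bilinear_ext_superset:
 assumes "finite K" "finite L" "pm_keys u \<subseteq> K" "pm_keys v \<subseteq> L"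
 shows "bilinear_ext b u v = (\<Sum>p\<in>K. \<Sum>q\<in>L. pm_single (b p q) (Poly_Mapping.lookup u p * Poly_Mapping.lookup v q))"
proof -
 have inner: "(\<Sum>q\<in>pm_keys v. pm_single (b p q) (Poly_Mapping.lookup u p * Poly_Mapping.lookup v q))
  = (\<Sum>q\<in>L. pm_single (b p q) (Poly_Mapping.lookup u p * Poly_Mapping.lookup v q))" for p
  by (rule sum.mono_neutral_left) (use assms in "auto simp: in_keys_iff")
 show ?thesis unfolding bilinear_ext_def inner
  by (rule sum.mono_neutral_left) (use assms in "auto simp: in_keys_iff")
qed

lemma bilinear_ext_add_left: "bilinear_ext b (u + u') v = bilinear_ext b u v + bilinear_ext b u' v"
proof -
 let ?K = "pm_keys u \<union> pm_keys u' \<union> pm_keys (u + u')"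
 show ?thesis by (subst (1 2 3) bilinear_ext_superset[of ?K "pm_keys v"])
   (auto simp: lookup_add algebra_simps single_add sum.distrib)
qed

lemma bilinear_ext_add_right: "bilinear_ext b u (v + v') = bilinear_ext b u v + bilinear_ext b u v'"
proof -
 let ?K = "pm_keys v \<union> pm_keys v' \<union> pm_keys (v + v')"
 show ?thesis by (subst (1 2 3) bilinear_ext_superset[of "pm_keys u" ?K])
   (auto simp: lookup_add algebra_simps single_add sum.distrib)
qed

lemma bilinear_ext_zero [simp]: "bilinear_ext b 0 v = 0" "bilinear_ext b u 0 = 0"
 by (simp_all add: bilinear_ext_def)

lemma bilinear_ext_single [simp]:
 "bilinear_ext b (pm_single p c) (pm_single q d) = pm_single (b p q) (c * d)"
 by (subst bilinear_ext_superset[of "{p}" "{q}"]) auto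

lemma bilinear_ext_diff_left: "bilinear_ext b (u - u') v = bilinear_ext b u v - bilinear_ext b u' v"
 using bilinear_ext_add_left[of b "u - u'" u' v] by simp

lemma bilinear_ext_diff_right: "bilinear_ext b u (v - v') = bilinear_ext b u v - bilinear_ext b u v'"
 using bilinear_ext_add_right[of b u "v - v'" v'] by simp

lemma scale_sum: "Poly_Mapping.map ((*) c) (sum f A) = (\<Sum>i\<in>A. Poly_Mapping.map ((*) c) (f i))" for c :: "'f::field"
 by (rule poly_mapping_eqI) (simp only: lookup_sum lookup_scale sum_distrib_left)

lemma scale_single: "Poly_Mapping.map ((*) c) (pm_single p d) = pm_single p (c * d)" for c :: "'f::field"
 by (rule poly_mapping_eqI) (auto simp: lookup_single when_def)

lemma keys_scale: "pm_keys (Poly_Mapping.map ((*) c) u) \<subseteq> pm_keys u" for c :: "'f::field"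
 by (auto simp: in_keys_iff)

lemma ext_scale:
 "bilinear_ext b (Poly_Mapping.map ((*) c) x) y = Poly_Mapping.map ((*) c) (bilinear_ext b x y)"
 "bilinear_ext b x (Poly_Mapping.map ((*) c) y) = Poly_Mapping.map ((*) c) (bilinear_ext b x y)"
 using bilinear_ext_superset[OF finite_keys finite_keys keys_scale[of c x] order_refl[of "pm_keys y"], of b]
  bilinear_ext_superset[OF finite_keys finite_keys order_refl[of "pm_keys x"] keys_scale[of c y], of b]
  bilinear_ext_superset[OF finite_keys finite_keys order_refl[of "pm_keys x"] order_refl[of "pm_keys y"], of b]
 by (simp_all only: scale_sum scale_single lookup_scale ac_simps)

lemma free_space_simps [simp]:
 "carrier (free_space V W) = {u. pm_keys u \<subseteq> carrier V \<times> carrier W}"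
 "0[free_space V W] = 0" "x +[free_space V W] y = x + y"
 "c *[free_space V W] x = Poly_Mapping.map ((*) c) x"
 "1[free_space V W] = pm_single (1[V], 1[W]) 1"
 "x **[free_space V W] y = bilinear_ext (\<lambda>(v, w) (v', w'). (v **[V] v', w **[W] w')) x y"
 by (simp_all add: free_space_def)

lemma vspace_free_space:
 fixes V :: "('f::field, 'v) module" and W :: "('f, 'w) module"
 shows "vspace (free_space V W)" unfolding vspace_def
proof (rule left_moduleI, unfold free_space_simps field_ring_simps)
 let ?C = "{u :: ('v \<times> 'w) \<Rightarrow>\<^sub>0 'f. pm_keys u \<subseteq> carrier V \<times> carrier W}"
 show "x + y \<in> ?C" if "x \<in> ?C" "y \<in> ?C" for x y using that Poly_Mapping.keys_add[of x y] by blast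
 show "Poly_Mapping.map ((*) a) x \<in> ?C" if "x \<in> ?C" for a x using that keys_scale[of a x] by blast
 show "\<exists>y\<in>?C. y + x = 0" if "x \<in> ?C" for x using that by (intro bexI[of _ "- x"]) auto
qed (auto simp: ring_field_ring algebra_simps lookup_add intro!: poly_mapping_eqI)

lemma tensor_relations_cases [consumes 1, case_names add_left add_right smult_left smult_right]:
 assumes "r \<in> tensor_relations V W"
  and "\<And>v v' w. \<lbrakk>v \<in> carrier V; v' \<in> carrier V; w \<in> carrier W\<rbrakk> \<Longrightarrow> P (pm_single (v +[V] v', w) 1
    - pm_single (v, w) 1 - pm_single (v', w) 1)"
  and "\<And>v w w'. \<lbrakk>v \<in> carrier V; w \<in> carrier W; w' \<in> carrier W\<rbrakk> \<Longrightarrow> P (pm_single (v, w +[W] w') 1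
    - pm_single (v, w) 1 - pm_single (v, w') 1)"
  and "\<And>c v w. \<lbrakk>v \<in> carrier V; w \<in> carrier W\<rbrakk> \<Longrightarrow> P (pm_single (c *[V] v, w) 1 - pm_single (v, w) c)"
  and "\<And>c v w. \<lbrakk>v \<in> carrier V; w \<in> carrier W\<rbrakk> \<Longrightarrow> P (pm_single (v, c *[W] w) 1 - pm_single (v, w) c)"
 shows "P r" using assms(1) unfolding tensor_relations_def Let_def
 by (elim UnE CollectE exE conjE) (simp_all only: assms(2-5))

lemma tensor_relationsI:
 "\<lbrakk>v \<in> carrier V; v' \<in> carrier V; w \<in> carrier W\<rbrakk> \<Longrightarrow> pm_single (v +[V] v', w) 1
  - pm_single (v, w) 1 - pm_single (v', w) 1 \<in> tensor_relations V W"
 "\<lbrakk>v \<in> carrier V; w \<in> carrier W; w' \<in> carrier W\<rbrakk> \<Longrightarrow> pm_single (v, w +[W] w') 1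
  - pm_single (v, w) 1 - pm_single (v, w') 1 \<in> tensor_relations V W"
 "\<lbrakk>v \<in> carrier V; w \<in> carrier W\<rbrakk> \<Longrightarrow> pm_single (c *[V] v, w) 1 - pm_single (v, w) c \<in> tensor_relations V W"
 "\<lbrakk>v \<in> carrier V; w \<in> carrier W\<rbrakk> \<Longrightarrow> pm_single (v, c *[W] w) 1 - pm_single (v, w) c \<in> tensor_relations V W"
 unfolding tensor_relations_def Let_def Un_iff by blast+

lemma (in vspace) quot_lfun:
 assumes H: "vsub H V" and l: "l \<in> lfun V" "\<And>x. x \<in> H \<Longrightarrow> l x = 0"
 obtains m where "m \<in> lfun (quot_module V H)" "\<forall>x\<in>carrier V. m (H +>\<^bsub>V\<^esub> x) = l x"
proof -
 interpret sub_module field_ring V H by (rule sub_module.intro[OF is_module sub_module_axioms.intro[OF H]])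
 define m where "m X = l (SOME x. x \<in> X)" for X
 have m: "m (H +>\<^bsub>V\<^esub> x) = l x" if x: "x \<in> carrier V" for x
 proof -
  have "\<exists>y. y \<in> H +>\<^bsub>V\<^esub> x" using coset_self[OF x] by auto
  from someI_ex[OF this] obtain h where h: "h \<in> H" "(SOME y. y \<in> H +>\<^bsub>V\<^esub> x) = h +[V] x" by (auto simp: coset_mem)
  then show ?thesis using l x submoduleD(6)[OF H] by (simp add: m_def lfun_add)
 qed
 show ?thesis by (rule that[of m, OF lfunI]) (use m l in "auto simp: quot_carrier quot_add quot_smult lfunD")
qed

abbreviation relsub :: "('f::field, 'v) module \<Rightarrow> ('f, 'w) module \<Rightarrow> ('v \<times> 'w \<Rightarrow>\<^sub>0 'f) set" where
 "relsub V W \<equiv> span_of (free_space V W) (tensor_relations V W)"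

definition tens :: "('f::field, 'v) module \<Rightarrow> ('f, 'w) module \<Rightarrow> 'v \<Rightarrow> 'w \<Rightarrow> ('v \<times> 'w \<Rightarrow>\<^sub>0 'f) set" where
 "tens V W v w = relsub V W +>\<^bsub>free_space V W\<^esub> pm_single (v, w) 1"

section \<open>The concrete tensor product of two vector spaces\<close>

locale tensor_space = V: vspace V + W: vspace W
 for V :: "('f::field, 'v) module" and W :: "('f, 'w) module"
begin

abbreviation "F \<equiv> free_space V W"
abbreviation "K \<equiv> relsub V W"
abbreviation "T \<equiv> tensor V W"
abbreviation "cl \<equiv> (\<lambda>x. relsub V W +>\<^bsub>free_space V W\<^esub> x)"
abbreviation "e \<equiv> (\<lambda>v w c. pm_single (v, w) (c :: 'f))"

sublocale F: vspace F by (rule vspace_free_space)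

lemma minus_F: "x \<in> carrier F \<Longrightarrow> y \<in> carrier F \<Longrightarrow> x -[F] y = x - y"
proof -
 assume y: "y \<in> carrier F"
 have "(-[F] y) = - y" by (rule F.M.minus_equality) (use y in auto)
 then show ?thesis by (simp add: a_minus_def)
qed

lemma keys_e: "\<lbrakk>v \<in> carrier V; w \<in> carrier W\<rbrakk> \<Longrightarrow> pm_keys (e v w c) \<subseteq> carrier V \<times> carrier W" by auto

lemma keys_minus: "\<lbrakk>pm_keys x \<subseteq> C; pm_keys y \<subseteq> C\<rbrakk> \<Longrightarrow> pm_keys (x - y) \<subseteq> C" for x y :: "'k \<Rightarrow>\<^sub>0 'f"
 using Poly_Mapping.keys_add[of x "- y"] by auto

lemma rel_subset: "tensor_relations V W \<subseteq> carrier F"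
proof
 fix r assume "r \<in> tensor_relations V W"
 then have "pm_keys r \<subseteq> carrier V \<times> carrier W"
  by (cases r rule: tensor_relations_cases) (intro keys_minus keys_e; simp)+
 then show "r \<in> carrier F" by simp
qed

lemma K_sub: "vsub K F" by (rule gen_submodule(1)[OF F.is_module rel_subset])

sublocale q: sub_module field_ring F K by (rule sub_module.intro[OF F.is_module sub_module_axioms.intro[OF K_sub]])

lemma T_vspace: "vspace T" unfolding vspace_def tensor_def by (rule q.quot_left_module)

sublocale T: vspace T by (rule T_vspace)

lemma cl_hom: "cl \<in> lin F T" unfolding tensor_def by (rule q.quot_proj)

sublocale cl: module_hom field_ring F T cl by (rule module_homI[OF F.is_module T.is_module cl_hom])

lemma cl_surj: "carrier T = cl ` carrier F" unfolding tensor_def by (rule q.quot_carrier)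

lemma cl_zero_iff: "x \<in> carrier F \<Longrightarrow> cl x = 0[T] \<longleftrightarrow> x \<in> K" unfolding tensor_def by (rule q.quot_proj_zero)

lemma cl_e: "\<lbrakk>v \<in> carrier V; w \<in> carrier W\<rbrakk> \<Longrightarrow> cl (e v w c) = c *[T] tens V W v w"
 using cl.hom_simps(3)[of c "e v w 1"] by (simp add: tens_def)

lemma tens_cl: "tens V W v w = cl (e v w 1)" by (simp add: tens_def)

lemma tens_closed: "\<lbrakk>v \<in> carrier V; w \<in> carrier W\<rbrakk> \<Longrightarrow> tens V W v w \<in> carrier T"
 unfolding tens_def by (rule cl.hom_simps(1)) auto

lemma rel_cl:
 assumes "x - y \<in> tensor_relations V W" "x \<in> carrier F" "y \<in> carrier F" shows "cl x = cl y"
proof -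
 have "x - y \<in> K" using gen_submodule(2)[OF F.is_module rel_subset] assms(1) by blast
 then show ?thesis using q.coset_eq_iff[OF assms(2,3)] minus_F[OF assms(2,3)] by simp
qed

lemma tens_bilin: "bilin V W T (tens V W)"
proof (rule bilinI)
 fix v v' w assume h: "v \<in> carrier V" "v' \<in> carrier V" "w \<in> carrier W"
 have "cl (e (v +[V] v') w 1) = cl (e v w 1 + e v' w 1)"
  by (rule rel_cl) (use h F.M.a_closed[of "e v w 1" "e v' w 1"] tensor_relationsI(1)[OF h] in "simp_all add: diff_diff_eq")
 then show "tens V W (v +[V] v') w = tens V W v w +[T] tens V W v' w"
  using h cl.hom_simps(2)[of "e v w 1" "e v' w 1"] by (simp add: tens_cl)
next
 fix v w w' assume h: "v \<in> carrier V" "w \<in> carrier W" "w' \<in> carrier W"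
 have "cl (e v (w +[W] w') 1) = cl (e v w 1 + e v w' 1)"
  by (rule rel_cl) (use h F.M.a_closed[of "e v w 1" "e v w' 1"] tensor_relationsI(2)[OF h] in "simp_all add: diff_diff_eq")
 then show "tens V W v (w +[W] w') = tens V W v w +[T] tens V W v w'"
  using h cl.hom_simps(2)[of "e v w 1" "e v w' 1"] by (simp add: tens_cl)
next
 fix c v w assume h: "v \<in> carrier V" "w \<in> carrier W"
 have "cl (e (c *[V] v) w 1) = cl (e v w c)" "cl (e v (c *[W] w) 1) = cl (e v w c)"
  by (rule rel_cl; use h tensor_relationsI(3,4)[OF h] in simp)+
 then show "tens V W (c *[V] v) w = c *[T] tens V W v w" "tens V W v (c *[W] w) = c *[T] tens V W v w"
  using cl_e[OF h, of c] by (simp_all only: tens_cl)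
qed (rule tens_closed)

lemmas tens_simps = bilinD[OF tens_bilin]

text \<open>A multiple of a pure tensor is again pure, the scalar being absorbed by the first
  factor; hence sums of pure tensors reach everything.\<close>

lemma tensor_induct [consumes 1, case_names tens add]:
 assumes z: "z \<in> carrier T"
  and t: "\<And>v w. \<lbrakk>v \<in> carrier V; w \<in> carrier W\<rbrakk> \<Longrightarrow> P (tens V W v w)"
  and a: "\<And>x y. \<lbrakk>x \<in> carrier T; y \<in> carrier T; P x; P y\<rbrakk> \<Longrightarrow> P (x +[T] y)"
 shows "P z"
proof -
 obtain u where u: "z = cl u" "u \<in> carrier F" using z unfolding cl_surj by (rule imageE)
 then have "pm_keys u \<subseteq> carrier V \<times> carrier W" by simp
 then have "u \<in> carrier F \<and> P (cl u)"
 proof (induction u rule: pm_induct)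
  case zero
  have "0[T] = 0 *[T] tens V W 0[V] 0[W]" using tens_closed by simp
  also have "\<dots> = tens V W (0 *[V] 0[V]) 0[W]" by (rule tens_simps(4)[symmetric]) auto
  finally have "P 0[T]" using t by simp
  then show ?case using cl.hom_zero by simp
 next
  case (add u v)
  then show ?case using a[of "cl u" "cl v"] cl.hom_simps(2)[of u v] F.M.a_closed[of u v] by simp
 next
  case (single p c)
  obtain v w where p: "p = (v, w)" "v \<in> carrier V" "w \<in> carrier W" using single by auto
  then have "cl (pm_single p c) = tens V W (c *[V] v) w" by (simp add: cl_e tens_simps)
  then show ?case using t p by simp
 qed
 then show ?thesis using u by simp
qed

text \<open>The form l \<otimes> m, defined on formal sums, descends because it vanishes on the
  relations. Such forms are what shows that the quotient has not collapsed.\<close>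

lemma tens_forms:
 assumes l: "l \<in> lfun V" and m: "m \<in> lfun W"
 shows "\<exists>f\<in>lfun T. \<forall>v\<in>carrier V. \<forall>w\<in>carrier W. f (tens V W v w) = l v * m w"
proof -
 define g where "g u = (\<Sum>p\<in>pm_keys u. Poly_Mapping.lookup u p * (l (fst p) * m (snd p)))" for u :: "'v \<times> 'w \<Rightarrow>\<^sub>0 'f"
 have sup: "g u = (\<Sum>p\<in>S. Poly_Mapping.lookup u p * (l (fst p) * m (snd p)))"
  if "finite S" "pm_keys u \<subseteq> S" for u S
  unfolding g_def by (rule sum.mono_neutral_left) (use that in "auto simp: in_keys_iff")
 have add: "g (u + v) = g u + g v" for u v by (subst (1 2 3) sup[of "pm_keys u \<union> pm_keys v \<union> pm_keys (u + v)"])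
   (auto simp: lookup_add algebra_simps sum.distrib)
 have diff: "g (u - v) = g u - g v" for u v using add[of "u - v" v] by simp
 have sc: "g (Poly_Mapping.map ((*) c) u) = c * g u" for c u
  by (subst (1 2) sup[of "pm_keys u"]) (auto simp: keys_scale sum_distrib_left mult.assoc)
 have sg: "g (e v w c) = c * (l v * m w)" for v w c by (subst sup[of "{(v, w)}"]) auto
 have gF: "g \<in> lfun F" by (rule lfunI) (auto simp: add sc)
 have "submodule {x \<in> carrier F. g x = 0} field_ring F"
 proof (rule F.submoduleI)
  show "x +[F] y \<in> {x \<in> carrier F. g x = 0}" if "x \<in> {x \<in> carrier F. g x = 0}" "y \<in> {x \<in> carrier F. g x = 0}" for x y
   using that F.M.a_closed[of x y] by (simp add: add)
  show "c *[F] x \<in> {x \<in> carrier F. g x = 0}" if "x \<in> {x \<in> carrier F. g x = 0}" for c x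
   using that F.smult_closed[of c x] by (simp add: sc)
 qed (auto simp: g_def)
 moreover have "tensor_relations V W \<subseteq> {x \<in> carrier F. g x = 0}"
 proof
  fix x assume x: "x \<in> tensor_relations V W"
  then have "g x = 0"
   by (cases x rule: tensor_relations_cases) (use l m in "simp_all add: diff add sg lfunD algebra_simps")
  then show "x \<in> {x \<in> carrier F. g x = 0}" using rel_subset x by blast
 qed
 ultimately have "K \<subseteq> {x \<in> carrier F. g x = 0}" by (rule gen_submodule(3)[OF F.is_module rel_subset])
 then have gK: "g x = 0" if "x \<in> K" for x using that by blast
 obtain f where f: "f \<in> lfun (quot_module F K)" "\<forall>x\<in>carrier F. f (cl x) = g x"
  by (rule F.quot_lfun[OF K_sub gF gK])
 show ?thesis by (rule bexI[of _ f]) (use f in "auto simp: tensor_def[symmetric] tens_cl sg")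
qed

end

section \<open>Componentwise operations on tensor products\<close>

locale tensor_op = T1: tensor_space V1 W1 + T2: tensor_space V2 W2 + T3: tensor_space V3 W3
 for V1 :: "('f::field, 'v1) module" and W1 :: "('f, 'w1) module"
  and V2 :: "('f, 'v2) module" and W2 :: "('f, 'w2) module"
  and V3 :: "('f, 'v3) module" and W3 :: "('f, 'w3) module" +
 fixes b :: "'v1 \<Rightarrow> 'v2 \<Rightarrow> 'v3" and g :: "'w1 \<Rightarrow> 'w2 \<Rightarrow> 'w3"
 assumes b: "bilin V1 V2 V3 b" and g: "bilin W1 W2 W3 g"
begin

abbreviation "ext \<equiv> bilinear_ext (\<lambda>(v, w) (v', w'). (b v v', g w w'))"

text \<open>The product of \<open>tensor A B\<close> and the action of \<open>tensor_module\<close>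
  both unfold to this union over representatives, so proving it well defined once serves
  both.\<close>

definition "Op X Y = (\<Union>x\<in>X. \<Union>y\<in>Y. T3.cl (ext x y))"

lemma ext_closed: "\<lbrakk>x \<in> carrier T1.F; y \<in> carrier T2.F\<rbrakk> \<Longrightarrow> ext x y \<in> carrier T3.F"
proof -
 assume x: "x \<in> carrier T1.F" and y: "y \<in> carrier T2.F"
 have "pm_keys x \<subseteq> carrier V1 \<times> carrier W1" using x by simp
 then show ?thesis
 proof (induction x rule: pm_induct)
  case (add u v) then show ?case using T3.F.M.a_closed[of "ext u y" "ext v y"] by (simp add: bilinear_ext_add_left)
 next
  case (single p c)
  have "pm_keys y \<subseteq> carrier V2 \<times> carrier W2" using y by simp
  then show ?case
  proof (induction y rule: pm_induct)
   case (add u v)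
   then show ?case using T3.F.M.a_closed[of "ext _ u" "ext _ v"] by (simp add: bilinear_ext_add_right)
  next
   case (single q d)
   then show ?case using \<open>p \<in> _\<close> bilinD(1)[OF b] bilinD(1)[OF g] by auto
  qed simp
 qed simp
qed

lemma cl_ext_e:
 assumes "v1 \<in> carrier V1" "w1 \<in> carrier W1" "v2 \<in> carrier V2" "w2 \<in> carrier W2"
 shows "T3.cl (ext (T1.e v1 w1 c) (T2.e v2 w2 d)) = (c * d) *[T3.T] tens V3 W3 (b v1 v2) (g w1 w2)"
 using assms bilinD(1)[OF b] bilinD(1)[OF g] by (simp add: T3.cl_e)

lemma T3_cancel:
 assumes "x \<in> carrier T3.T" "y \<in> carrier T3.T"
 shows "(x +[T3.T] y) -[T3.T] x -[T3.T] y = 0[T3.T]" "x -[T3.T] x = 0[T3.T]"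
 using assms by (simp_all add: a_minus_def T3.T.M.r_neg T3.T.M.a_assoc T3.T.M.add.m_lcomm[of y "-[T3.T] x"])

lemma T3_cancel_scale: "x \<in> carrier T3.T \<Longrightarrow> c *[T3.T] x -[T3.T] c *[T3.T] x = 0[T3.T]"
 by (rule T3_cancel(2)[of "c *[T3.T] x"]) auto

lemma cl_diff: "\<lbrakk>x \<in> carrier T3.F; y \<in> carrier T3.F\<rbrakk> \<Longrightarrow> T3.cl (x - y) = T3.cl x -[T3.T] T3.cl y"
 using T3.cl.hom_minus[of x y] by (simp add: T3.minus_F)

lemma F3_diff: "\<lbrakk>x \<in> carrier T3.F; y \<in> carrier T3.F\<rbrakk> \<Longrightarrow> x - y \<in> carrier T3.F" using T3.keys_minus by simp

text \<open>By additivity \<open>y\<close> may be taken to be a single term; a defining relation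
  times a single term then vanishes because \<open>b\<close>, \<open>g\<close> and the tensor map
  are bilinear.\<close>

lemma rel_left:
 assumes r: "r \<in> tensor_relations V1 W1" and y: "y \<in> carrier T2.F"
 shows "T3.cl (ext r y) = 0[T3.T]"
proof -
 note B = bilinD[OF b] and G = bilinD[OF g] and t = T3.tens_simps
 have "pm_keys y \<subseteq> carrier V2 \<times> carrier W2" using y by simp
 then have "ext r y \<in> carrier T3.F \<and> T3.cl (ext r y) = 0[T3.T]"
 proof (induction y rule: pm_induct)
  case zero then show ?case using T3.cl.hom_zero by simp
 next
  case (add u v)
  then show ?case using T3.cl.hom_simps(2)[of "ext r u" "ext r v"] T3.F.M.a_closed[of "ext r u" "ext r v"]
   by (simp add: bilinear_ext_add_right)
 next
  case (single q d)
  then obtain v2 w2 where q: "q = (v2, w2)" "v2 \<in> carrier V2" "w2 \<in> carrier W2" by auto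
  have rF: "r \<in> carrier T1.F" using T1.rel_subset r by blast
  have "pm_single q d \<in> carrier T2.F" using q by simp
  then have 1: "ext r (pm_single q d) \<in> carrier T3.F" by (rule ext_closed[OF rF])
  have E: "T3.cl (ext (T1.e v w c) (T2.e v2 w2 d)) = (c * d) *[T3.T] tens V3 W3 (b v v2) (g w w2)"
   "ext (T1.e v w c) (T2.e v2 w2 d) \<in> carrier T3.F"
   if "v \<in> carrier V1" "w \<in> carrier W1" for v w c
   using that q cl_ext_e[OF that q(2,3), of c d] ext_closed[of "T1.e v w c" "T2.e v2 w2 d"] by simp_all
  have "T3.cl (ext r (pm_single q d)) = 0[T3.T]" using r unfolding q(1) by (cases r rule: tensor_relations_cases)
    (simp_all del: bilinear_ext_single free_space_simps add: bilinear_ext_diff_left cl_diff F3_diff E q B G t T3_cancel T3_cancel_scale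
     mult.commute T3.T.smult_r_distr T3.T.smult_assoc1[simplified, symmetric])
  then show ?case using 1 by simp
 qed
 then show ?thesis by simp
qed

lemma rel_right:
 assumes r: "r \<in> tensor_relations V2 W2" and y: "y \<in> carrier T1.F"
 shows "T3.cl (ext y r) = 0[T3.T]"
proof -
 note B = bilinD[OF b] and G = bilinD[OF g] and t = T3.tens_simps
 have "pm_keys y \<subseteq> carrier V1 \<times> carrier W1" using y by simp
 then have "ext y r \<in> carrier T3.F \<and> T3.cl (ext y r) = 0[T3.T]"
 proof (induction y rule: pm_induct)
  case zero then show ?case using T3.cl.hom_zero by simp
 next
  case (add u v)
  then show ?case using T3.cl.hom_simps(2)[of "ext u r" "ext v r"] T3.F.M.a_closed[of "ext u r" "ext v r"]
   by (simp add: bilinear_ext_add_left)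
 next
  case (single q d)
  then obtain v2 w2 where q: "q = (v2, w2)" "v2 \<in> carrier V1" "w2 \<in> carrier W1" by auto
  have rF: "r \<in> carrier T2.F" using T2.rel_subset r by blast
  have "pm_single q d \<in> carrier T1.F" using q by simp
  then have 1: "ext (pm_single q d) r \<in> carrier T3.F" by (rule ext_closed[OF _ rF])
  have E: "T3.cl (ext (T1.e v2 w2 d) (T2.e v w c)) = (d * c) *[T3.T] tens V3 W3 (b v2 v) (g w2 w)"
   "ext (T1.e v2 w2 d) (T2.e v w c) \<in> carrier T3.F"
   if "v \<in> carrier V2" "w \<in> carrier W2" for v w c
   using that q cl_ext_e[OF q(2,3) that, of d c] ext_closed[of "T1.e v2 w2 d" "T2.e v w c"] by simp_all
  have "T3.cl (ext (pm_single q d) r) = 0[T3.T]" using r unfolding q(1) by (cases r rule: tensor_relations_cases)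
    (simp_all del: bilinear_ext_single free_space_simps add: bilinear_ext_diff_right cl_diff F3_diff E q B G t T3_cancel T3_cancel_scale
     mult.commute T3.T.smult_r_distr T3.T.smult_assoc1[simplified, symmetric])
  then show ?case using 1 by simp
 qed
 then show ?thesis by simp
qed

lemma K_left:
 assumes "x \<in> T1.K" "y \<in> carrier T2.F" shows "ext x y \<in> T3.K"
proof -
 let ?S = "{x \<in> carrier T1.F. ext x y \<in> T3.K}"
 note K3 = submoduleD[OF T3.K_sub]
 have "vsub ?S T1.F"
 proof (rule T1.F.submoduleI)
  fix x z assume a: "x \<in> ?S" "z \<in> ?S"
  have a': "x \<in> carrier T1.F" "z \<in> carrier T1.F" "ext x y \<in> T3.K" "ext z y \<in> T3.K"
   using a by (simp_all only: mem_Collect_eq)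
  note T1.F.M.a_closed[OF a'(1,2)]
  moreover have "ext (x + z) y \<in> T3.K" using K3(3)[OF a'(3,4)] by (simp only: bilinear_ext_add_left free_space_simps(3))
  ultimately show "x +[T1.F] z \<in> ?S" by (simp only: mem_Collect_eq free_space_simps(3))
 next
  fix c x assume a: "x \<in> ?S"
  have a': "x \<in> carrier T1.F" "ext x y \<in> T3.K" using a by (simp_all only: mem_Collect_eq)
  have "c *[T1.F] x \<in> carrier T1.F" by (rule T1.F.smult_closed[OF _ a'(1)]) simp
  moreover have "ext (c *[T1.F] x) y \<in> T3.K" using K3(5)[OF _ a'(2), of c] by (simp only: free_space_simps(4) ext_scale field_ring_simps UNIV_I)
  ultimately show "c *[T1.F] x \<in> ?S" by (simp only: mem_Collect_eq)
 qed (use K3(2) in auto)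
 moreover have "tensor_relations V1 W1 \<subseteq> ?S"
 proof
  fix r assume r: "r \<in> tensor_relations V1 W1"
  have "r \<in> carrier T1.F" by (rule subsetD[OF T1.rel_subset r])
  then show "r \<in> ?S" using rel_left[OF r assms(2)] T3.cl_zero_iff[OF ext_closed[OF _ assms(2)], of r] by (simp only: mem_Collect_eq)
 qed
 ultimately have "T1.K \<subseteq> ?S" by (rule gen_submodule(3)[OF T1.F.is_module T1.rel_subset])
 then show ?thesis using assms(1) by blast
qed

lemma K_right:
 assumes "x \<in> carrier T1.F" "y \<in> T2.K" shows "ext x y \<in> T3.K"
proof -
 let ?S = "{y \<in> carrier T2.F. ext x y \<in> T3.K}"
 note K3 = submoduleD[OF T3.K_sub]
 have "vsub ?S T2.F"
 proof (rule T2.F.submoduleI)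
  fix y z assume a: "y \<in> ?S" "z \<in> ?S"
  have a': "y \<in> carrier T2.F" "z \<in> carrier T2.F" "ext x y \<in> T3.K" "ext x z \<in> T3.K"
   using a by (simp_all only: mem_Collect_eq)
  note T2.F.M.a_closed[OF a'(1,2)]
  moreover have "ext x (y + z) \<in> T3.K" using K3(3)[OF a'(3,4)] by (simp only: bilinear_ext_add_right free_space_simps(3))
  ultimately show "y +[T2.F] z \<in> ?S" by (simp only: mem_Collect_eq free_space_simps(3))
 next
  fix c y assume a: "y \<in> ?S"
  have a': "y \<in> carrier T2.F" "ext x y \<in> T3.K" using a by (simp_all only: mem_Collect_eq)
  have "c *[T2.F] y \<in> carrier T2.F" by (rule T2.F.smult_closed[OF _ a'(1)]) simp
  moreover have "ext x (c *[T2.F] y) \<in> T3.K" using K3(5)[OF _ a'(2), of c] by (simp only: free_space_simps(4) ext_scale field_ring_simps UNIV_I)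
  ultimately show "c *[T2.F] y \<in> ?S" by (simp only: mem_Collect_eq)
 qed (use K3(2) in auto)
 moreover have "tensor_relations V2 W2 \<subseteq> ?S"
 proof
  fix r assume r: "r \<in> tensor_relations V2 W2"
  have "r \<in> carrier T2.F" by (rule subsetD[OF T2.rel_subset r])
  then show "r \<in> ?S" using rel_right[OF r assms(1)] T3.cl_zero_iff[OF ext_closed[OF assms(1)], of r] by (simp only: mem_Collect_eq)
 qed
 ultimately have "T2.K \<subseteq> ?S" by (rule gen_submodule(3)[OF T2.F.is_module T2.rel_subset])
 then show ?thesis using assms(2) by blast
qed

text \<open>Well-definedness: (h + x)(k + y) differs from x y by products with a factor in one of
  the two relation spaces, and these lie in the third relation space.\<close>

lemma Op_cl:
 assumes x: "x \<in> carrier T1.F" and y: "y \<in> carrier T2.F"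
 shows "Op (T1.cl x) (T2.cl y) = T3.cl (ext x y)" unfolding Op_def
proof (rule T1.q.coset_UN[OF x], rule T2.q.coset_UN[OF y])
 fix h k assume h: "h \<in> T1.K" and k: "k \<in> T2.K"
 have hF: "h \<in> carrier T1.F" and kF: "k \<in> carrier T2.F"
  using submoduleD(6)[OF T1.K_sub h] submoduleD(6)[OF T2.K_sub k] by auto
 have "ext (h + x) (k + y) = (ext h (k + y) + ext x k) + ext x y"
  by (simp add: bilinear_ext_add_left bilinear_ext_add_right)
 moreover have "ext h (k + y) + ext x k \<in> T3.K"
  using K_left[OF h, of "k + y"] K_right[OF x k] T2.F.M.a_closed[OF kF y] submoduleD(3)[OF T3.K_sub, of "ext h (k + y)" "ext x k"]
  by simp
 ultimately show "T3.cl (ext (h +[T1.F] x) (k +[T2.F] y)) = T3.cl (ext x y)"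
  using T3.q.coset_eqI[of "ext h (k + y) + ext x k" "ext x y"] ext_closed[OF x y] by simp
qed

lemma Op_tens:
 assumes "v1 \<in> carrier V1" "w1 \<in> carrier W1" "v2 \<in> carrier V2" "w2 \<in> carrier W2"
 shows "Op (tens V1 W1 v1 w1) (tens V2 W2 v2 w2) = tens V3 W3 (b v1 v2) (g w1 w2)"
 using assms Op_cl[of "T1.e v1 w1 1" "T2.e v2 w2 1"] cl_ext_e[OF assms, of 1 1]
  T3.tens_closed[of "b v1 v2" "g w1 w2"] bilinD(1)[OF b] bilinD(1)[OF g] by (simp add: T1.tens_cl T2.tens_cl)

lemma Op_bilin: "bilin T1.T T2.T T3.T Op"
proof (rule bilinI; unfold T1.cl_surj T2.cl_surj; elim imageE; hypsubst)
 fix x y assume xy: "x \<in> carrier T1.F" "y \<in> carrier T2.F"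
 show "Op (T1.cl x) (T2.cl y) \<in> carrier T3.T"
  unfolding Op_cl[OF xy] by (rule T3.cl.hom_simps(1)[OF ext_closed[OF xy]])
 fix c
 have cx: "Poly_Mapping.map ((*) c) x \<in> carrier T1.F" "Poly_Mapping.map ((*) c) y \<in> carrier T2.F"
  using T1.F.smult_closed[of c x] T2.F.smult_closed[of c y] xy by simp_all
 show "Op (c *[T1.T] T1.cl x) (T2.cl y) = c *[T3.T] Op (T1.cl x) (T2.cl y)"
  using T1.cl.hom_simps(3)[of c x] T3.cl.hom_simps(3)[of c "ext x y"] Op_cl[OF cx(1) xy(2)] Op_cl[OF xy] xy ext_closed[OF xy]
  by (simp add: ext_scale)
 show "Op (T1.cl x) (c *[T2.T] T2.cl y) = c *[T3.T] Op (T1.cl x) (T2.cl y)"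
  using T2.cl.hom_simps(3)[of c y] T3.cl.hom_simps(3)[of c "ext x y"] Op_cl[OF xy(1) cx(2)] Op_cl[OF xy] xy ext_closed[OF xy]
  by (simp add: ext_scale)
next
 fix x x' y assume xy: "x \<in> carrier T1.F" "x' \<in> carrier T1.F" "y \<in> carrier T2.F"
 show "Op (T1.cl x +[T1.T] T1.cl x') (T2.cl y) = Op (T1.cl x) (T2.cl y) +[T3.T] Op (T1.cl x') (T2.cl y)"
  using T1.cl.hom_simps(2)[OF xy(1,2)] T3.cl.hom_simps(2)[OF ext_closed[OF xy(1,3)] ext_closed[OF xy(2,3)]]
   Op_cl[OF T1.F.M.a_closed[OF xy(1,2)] xy(3)] Op_cl[OF xy(1,3)] Op_cl[OF xy(2,3)]
  by (simp add: bilinear_ext_add_left)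
next
 fix x y y' assume xy: "x \<in> carrier T1.F" "y \<in> carrier T2.F" "y' \<in> carrier T2.F"
 show "Op (T1.cl x) (T2.cl y +[T2.T] T2.cl y') = Op (T1.cl x) (T2.cl y) +[T3.T] Op (T1.cl x) (T2.cl y')"
  using T2.cl.hom_simps(2)[OF xy(2,3)] T3.cl.hom_simps(2)[OF ext_closed[OF xy(1,2)] ext_closed[OF xy(1,3)]]
   Op_cl[OF xy(1) T2.F.M.a_closed[OF xy(2,3)]] Op_cl[OF xy(1,2)] Op_cl[OF xy(1,3)]
  by (simp add: bilinear_ext_add_right)
qed

end

lemma (in module_hom) hom_finsum:
 assumes "finite I" "g \<in> I \<rightarrow> carrier M"
 shows "f (finsum M g I) = finsum N (\<lambda>i. f (g i)) I" using assms
proof (induction I rule: finite_induct)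
 case (insert i I)
 then have "finsum M g I \<in> carrier M" "g i \<in> carrier M" "g \<in> I \<rightarrow> carrier M" by (auto intro: M.M.finsum_closed)
 moreover have "(\<lambda>i. f (g i)) \<in> I \<rightarrow> carrier N"
  by (rule Pi_I) (rule hom_simps(1), rule funcset_mem[OF \<open>g \<in> I \<rightarrow> carrier M\<close>])
 ultimately show ?case using insert by (simp add: M.M.finsum_insert N.M.finsum_insert)
qed simp

context fdspace
begin

lemma basis_span:
 assumes bas: "basis V n b c" and H: "vsub H V" and bH: "\<And>i. i < n \<Longrightarrow> b i \<in> H" and x: "x \<in> carrier V"
 shows "x \<in> H"
proof -
 note B = basisD[OF bas] and h = submoduleD[OF H]
 have "\<forall>x\<in>carrier V. (\<forall>i<n. i \<ge> k \<longrightarrow> c i x = 0) \<longrightarrow> x \<in> H" if "k \<le> n" for k using that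
 proof (induction k)
  case 0
  show ?case
  proof (intro ballI impI)
   fix x assume "x \<in> carrier V" "\<forall>i<n. i \<ge> 0 \<longrightarrow> c i x = 0"
   then have "x = 0[V]" by (intro B(4)) auto
   then show "x \<in> H" using h(2) by simp
  qed
 next
  case (Suc k)
  show ?case
  proof (intro ballI impI)
   fix x assume x: "x \<in> carrier V" "\<forall>i<n. i \<ge> Suc k \<longrightarrow> c i x = 0"
   let ?y = "c k x *[V] b k"
   have k: "k < n" using Suc.prems by simp
   have bk: "b k \<in> carrier V" "b k \<in> H" using B(1) bH k by auto
   have "c i (x -[V] ?y) = 0" if "i < n" "i \<ge> k" for i using that x bk B(2)[OF that(1)] B(3)[OF that(1) k]
    by (cases "i = k") (simp_all add: lfun_minus lfun_smult)
   then have "x -[V] ?y \<in> H" using Suc x bk by simp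
   then have "(x -[V] ?y) +[V] ?y \<in> H" using h(3,5) bk by simp
   then show "x \<in> H" using x bk by (simp add: add_eqI)
  qed
 qed
 from this[of n] show ?thesis using x by auto
qed

end

text \<open>The tensor product up to isomorphism; the products of linear forms in \<open>t_forms\<close> replace the universal property.\<close>

locale vtensor = V: fdspace V + W: fdspace W + T: vspace T
 for V :: "('f::field, 'v) module" and W :: "('f, 'w) module" and T :: "('f, 't) module" +
 fixes t :: "'v \<Rightarrow> 'w \<Rightarrow> 't"
 assumes t_bilin: "bilin V W T t"
  and t_span: "\<forall>H. vsub H T \<longrightarrow> (\<forall>v\<in>carrier V. \<forall>w\<in>carrier W. t v w \<in> H) \<longrightarrow> H = carrier T"
  and t_forms: "\<forall>l\<in>lfun V. \<forall>m\<in>lfun W. \<exists>f\<in>lfun T. \<forall>v\<in>carrier V. \<forall>w\<in>carrier W. f (t v w) = l v * m w"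
begin

lemmas t_simps [simp] = bilinD[OF t_bilin]

lemma t_zero [simp]:
 "w \<in> carrier W \<Longrightarrow> t 0[V] w = 0[T]" "v \<in> carrier V \<Longrightarrow> t v 0[W] = 0[T]"
proof -
 show "t 0[V] w = 0[T]" if "w \<in> carrier W" using that t_simps(4)[of "0[V]" w 0] by simp
 show "t v 0[W] = 0[T]" if "v \<in> carrier V" using that t_simps(5)[of v "0[W]" 0] by simp
qed

lemma T_span: "\<lbrakk>vsub H T; \<And>v w. \<lbrakk>v \<in> carrier V; w \<in> carrier W\<rbrakk> \<Longrightarrow> t v w \<in> H; z \<in> carrier T\<rbrakk> \<Longrightarrow> z \<in> H"
 using t_span by blast

lemma T_induct [consumes 1, case_names tens add]:
 assumes z: "z \<in> carrier T"
  and P: "\<And>v w. \<lbrakk>v \<in> carrier V; w \<in> carrier W\<rbrakk> \<Longrightarrow> P (t v w)"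
  and a: "\<And>x y. \<lbrakk>x \<in> carrier T; y \<in> carrier T; P x; P y\<rbrakk> \<Longrightarrow> P (x +[T] y)"
 shows "P z"
proof -
 let ?H = "{z \<in> carrier T. \<forall>c. P (c *[T] z)}"
 have P0: "P 0[T]" using P[of "0[V]" "0[W]"] by simp
 have "vsub ?H T"
 proof (rule T.submoduleI)
  show "x +[T] y \<in> ?H" if "x \<in> ?H" "y \<in> ?H" for x y using that a by (simp add: T.smult_r_distr)
  show "c *[T] x \<in> ?H" if "x \<in> ?H" for c x
   using that T.smult_assoc1[of _ c x] by (simp flip: T.smult_assoc1[simplified])
 qed (use P0 in auto)
 moreover have "t v w \<in> ?H" if "v \<in> carrier V" "w \<in> carrier W" for v w using that P by (simp flip: t_simps(4))
 ultimately have "z \<in> ?H" using z by (rule T_span)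
 then have "P (1 *[T] z)" by blast
 then show ?thesis using z by simp
qed

lemma T_fg: "finitely_generated field_ring T"
proof -
 obtain S where S: "finite S" "S \<subseteq> carrier V" "span_of V S = carrier V"
  using V.fg by (auto simp: finitely_generated_def)
 obtain R where R: "finite R" "R \<subseteq> carrier W" "span_of W R = carrier W"
  using W.fg by (auto simp: finitely_generated_def)
 let ?G = "(\<lambda>(v, w). t v w) ` (S \<times> R)"
 have G: "?G \<subseteq> carrier T" using subsetD[OF S(2)] subsetD[OF R(2)] by (auto simp del: subset_iff)
 let ?H = "span_of T ?G"
 note H = gen_submodule[OF T.is_module G]
 note h = submoduleD[OF H(1)]
 have 1: "t v w \<in> ?H" if v: "v \<in> carrier V" and w: "w \<in> R" for v w
 proof -
  have wW: "w \<in> carrier W" using w R by auto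
  have "submodule {v \<in> carrier V. t v w \<in> ?H} field_ring V" by (rule V.submoduleI) (use wW h in auto)
  moreover have "S \<subseteq> {v \<in> carrier V. t v w \<in> ?H}" using S(2) H(2) w by auto
  ultimately show ?thesis using gen_submodule(3)[OF V.is_module S(2)] v S(3) by auto
 qed
 have 2: "t v w \<in> ?H" if v: "v \<in> carrier V" and w: "w \<in> carrier W" for v w
 proof -
  have "submodule {w \<in> carrier W. t v w \<in> ?H} field_ring W" by (rule W.submoduleI) (use v h in auto)
  moreover have "R \<subseteq> {w \<in> carrier W. t v w \<in> ?H}" using R(2) 1[OF v] by auto
  ultimately show ?thesis using gen_submodule(3)[OF W.is_module R(2)] w R(3) by auto
 qed
 have "?H = carrier T" using t_span H(1) 2 by blast
 then show ?thesis using G S(1) R(1) unfolding finitely_generated_def by (intro exI[of _ ?G]) auto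
qed

sublocale T: fdspace T by unfold_locales (rule T_fg)

text \<open>The map is written down in coordinates: z goes to the sum of the vectors b (e i) (e' j)
  with coefficients F i j z, where F i j is the product of two coordinate forms.\<close>

lemma univ:
 assumes X: "vspace X" and b: "bilin V W X b"
 obtains h where "h \<in> lin T X" "\<forall>v\<in>carrier V. \<forall>w\<in>carrier W. h (t v w) = b v w"
proof -
 interpret X: vspace X by fact
 note bs = bilinD[OF b]
 obtain n e c where "basis V n e c" by (rule V.basis_ex)
 note B1 = basisD[OF this] and span1 = V.basis_span[OF this]
 obtain m e' c' where "basis W m e' c'" by (rule W.basis_ex)
 note B2 = basisD[OF this] and span2 = W.basis_span[OF this]
 have "\<exists>f. f \<in> lfun T \<and> (\<forall>v\<in>carrier V. \<forall>w\<in>carrier W. f (t v w) = c i v * c' j w)" if "i < n" "j < m" for i j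
  using t_forms B1(2)[OF that(1)] B2(2)[OF that(2)] by blast
 then obtain F where F: "\<And>i j. \<lbrakk>i < n; j < m\<rbrakk> \<Longrightarrow> F i j \<in> lfun T"
  "\<And>i j v w. \<lbrakk>i < n; j < m; v \<in> carrier V; w \<in> carrier W\<rbrakk> \<Longrightarrow> F i j (t v w) = c i v * c' j w" by metis
 let ?I = "{..<n} \<times> {..<m}"
 define h where "h z = finsum X (\<lambda>(i, j). F i j z *[X] b (e i) (e' j)) ?I" for z
 have cl: "(\<lambda>(i, j). F i j z *[X] b (e i) (e' j)) \<in> ?I \<rightarrow> carrier X" for z using bs(1) B1(1) B2(1) by auto
 have h: "h \<in> lin T X"
 proof (rule ahomI)
  show "h z \<in> carrier X" for z unfolding h_def by (rule X.M.finsum_closed[OF cl])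
  show "h (x +[T] y) = h x +[X] h y" if "x \<in> carrier T" "y \<in> carrier T" for x y
   unfolding h_def X.M.finsum_addf[OF cl cl, symmetric]
   by (rule X.M.finsum_cong') (use that F(1) bs(1) B1(1) B2(1) X.smult_l_distr in "auto simp: lfun_add")
  show "h (a *[T] x) = a *[X] h x" if "x \<in> carrier T" for a x
  proof -
   have aX: "(\<lambda>x. a *[X] x) \<in> lin X X"
    by (rule ahomI) (auto simp: X.smult_r_distr mult.commute simp flip: X.smult_assoc1[simplified])
   interpret s: module_hom field_ring X X "\<lambda>x. a *[X] x" by (rule module_homI[OF X.is_module X.is_module aX])
   have "a *[X] h x = finsum X (\<lambda>p. a *[X] (case p of (i, j) \<Rightarrow> F i j x *[X] b (e i) (e' j))) ?I"
    unfolding h_def by (rule s.hom_finsum[OF _ cl]) simp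
   also have "\<dots> = h (a *[T] x)" unfolding h_def
    by (rule X.M.finsum_cong') (use that F(1) bs(1) B1(1) B2(1) X.smult_assoc1 in "auto simp: lfun_smult")
   finally show ?thesis by simp
  qed
 qed
 interpret h: module_hom field_ring T X h by (rule module_homI[OF T.is_module X.is_module h])
 have 0: "h (t (e k) (e' l)) = b (e k) (e' l)" if kl: "k < n" "l < m" for k l
 proof -
  have "h (t (e k) (e' l)) = finsum X (\<lambda>p. if (k, l) = p then b (e (fst p)) (e' (snd p)) else 0[X]) ?I"
   unfolding h_def
   by (rule X.M.finsum_cong') (use kl B1(1,3) B2(1,3) bs(1) in "auto simp: F(2) split: if_splits")
  also have "\<dots> = b (e k) (e' l)" by (subst X.M.add.finprod_singleton) (use kl B1(1) B2(1) bs(1) in auto)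
  finally show ?thesis .
 qed
 have 1: "h (t v (e' l)) = b v (e' l)" if v: "v \<in> carrier V" and l: "l < m" for v l
 proof -
  have "submodule {v \<in> carrier V. h (t v (e' l)) = b v (e' l)} field_ring V"
   by (rule V.submoduleI) (use B2(1)[OF l] bs bs(4)[of "0[V]" "e' l" 0] in auto)
  then have "v \<in> {v \<in> carrier V. h (t v (e' l)) = b v (e' l)}" by (rule span1) (use 0 l B1(1) v in auto)
  then show ?thesis by simp
 qed
 have 2: "h (t v w) = b v w" if v: "v \<in> carrier V" and w: "w \<in> carrier W" for v w
 proof -
  have "submodule {w \<in> carrier W. h (t v w) = b v w} field_ring W"
   by (rule W.submoduleI) (use v bs bs(5)[of v "0[W]" 0] in auto)
  then have "w \<in> {w \<in> carrier W. h (t v w) = b v w}" by (rule span2) (use 1 v B2(1) w in auto)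
  then show ?thesis by simp
 qed
 show ?thesis by (rule that[OF h]) (use 2 in auto)
qed

lemma ahom_eq:
 assumes X: "vspace X" and f: "f \<in> lin T X" and g: "g \<in> lin T X"
  and eq: "\<And>v w. \<lbrakk>v \<in> carrier V; w \<in> carrier W\<rbrakk> \<Longrightarrow> f (t v w) = g (t v w)" and z: "z \<in> carrier T"
 shows "f z = g z" using z by (induction z rule: T_induct) (simp_all add: eq ahomD[OF f] ahomD[OF g])

text \<open>The contraction id \<otimes> m of the second factor. Its values on pure tensors
  determine it on the carrier, so the choice is harmless.\<close>

definition slice :: "('w \<Rightarrow> 'f) \<Rightarrow> 't \<Rightarrow> 'v" where
 "slice m = (SOME s. s \<in> lin T V \<and> (\<forall>v\<in>carrier V. \<forall>w\<in>carrier W. s (t v w) = m w *[V] v))"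

lemma
 assumes "m \<in> lfun W"
 shows slice_hom: "slice m \<in> lin T V"
  and slice_t: "\<lbrakk>v \<in> carrier V; w \<in> carrier W\<rbrakk> \<Longrightarrow> slice m (t v w) = m w *[V] v"
proof -
 have "bilin V W V (\<lambda>v w. m w *[V] v)"
  by (rule bilinI) (use assms in "auto simp: lfunD V.smult_r_distr V.smult_l_distr[simplified] V.smult_assoc1[simplified] mult.commute simp flip: V.smult_assoc1[simplified]")
 then obtain h where "h \<in> lin T V \<and> (\<forall>v\<in>carrier V. \<forall>w\<in>carrier W. h (t v w) = m w *[V] v)"
  by (rule univ[OF V.vspace_axioms]) blast
 then have "slice m \<in> lin T V \<and> (\<forall>v\<in>carrier V. \<forall>w\<in>carrier W. slice m (t v w) = m w *[V] v)"
  unfolding slice_def by (rule someI[where P = "\<lambda>s. s \<in> lin T V \<and> (\<forall>v\<in>carrier V. \<forall>w\<in>carrier W. s (t v w) = m w *[V] v)"])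
 then show "slice m \<in> lin T V" "\<lbrakk>v \<in> carrier V; w \<in> carrier W\<rbrakk> \<Longrightarrow> slice m (t v w) = m w *[V] v" by auto
qed

lemma slice_closed [simp]: "\<lbrakk>m \<in> lfun W; z \<in> carrier T\<rbrakk> \<Longrightarrow> slice m z \<in> carrier V" by (rule ahom_closed[OF slice_hom])

lemma slice_add [simp]: "\<lbrakk>m \<in> lfun W; y \<in> carrier T; z \<in> carrier T\<rbrakk> \<Longrightarrow> slice m (y +[T] z) = slice m y +[V] slice m z"
 by (rule ahom_add[OF slice_hom])

lemma slice_smult [simp]: "\<lbrakk>m \<in> lfun W; z \<in> carrier T\<rbrakk> \<Longrightarrow> slice m (c *[T] z) = c *[V] slice m z"
 using ahom_smult[OF slice_hom, of m c z] by simp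

lemma slice_cong:
 assumes "l \<in> lfun W" "m \<in> lfun W" "\<forall>w\<in>carrier W. l w = m w" "z \<in> carrier T"
 shows "slice l z = slice m z"
 using assms(4) by (induction z rule: T_induct) (use assms in "simp_all add: slice_t")

lemma slice_plus:
 assumes "l \<in> lfun W" "m \<in> lfun W" "z \<in> carrier T"
 shows "slice (\<lambda>w. l w + m w) z = slice l z +[V] slice m z" using assms(3)
proof (induction z rule: T_induct)
 case (tens v w)
 then show ?case using assms V.smult_l_distr[of "l w" "m w" v] by (simp add: slice_t lfun_plus)
next
 case (add x y)
 then show ?case using assms by (simp add: lfun_plus V.M.add.m_ac)
qed

lemma slice_scale:
 assumes "l \<in> lfun W" "z \<in> carrier T"
 shows "slice (\<lambda>w. c * l w) z = c *[V] slice l z" using assms(2)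
proof (induction z rule: T_induct)
 case (tens v w)
 then show ?case using assms V.smult_assoc1[of c "l w" v] by (simp add: slice_t lfun_scale)
next
 case (add x y)
 then show ?case using assms by (simp add: lfun_scale V.smult_r_distr)
qed

text \<open>Contractions along a dual basis are the coordinates of a tensor with values in
  \<open>V\<close>; in particular all contractions together determine the tensor.\<close>

lemma slice_expand:
 assumes bas: "basis W n b c" and z: "z \<in> carrier T"
 shows "z = finsum T (\<lambda>j. t (slice (c j) z) (b j)) {..<n}"
proof -
 note B = basisD[OF bas]
 define E where "E z = finsum T (\<lambda>j. t (slice (c j) z) (b j)) {..<n}" for z
 have cl: "(\<lambda>j. t (slice (c j) z) (b j)) \<in> {..<n} \<rightarrow> carrier T" if "z \<in> carrier T" for z using that B(1,2) by auto
 have Eadd: "E (x +[T] y) = E x +[T] E y" if "x \<in> carrier T" "y \<in> carrier T" for x y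
  unfolding E_def T.M.finsum_addf[OF cl[OF that(1)] cl[OF that(2)], symmetric]
  by (rule T.M.finsum_cong') (use that B(1,2) in auto)
 have Ecl: "E z \<in> carrier T" if "z \<in> carrier T" for z unfolding E_def by (rule T.M.finsum_closed[OF cl[OF that]])
 have 0: "E (t v (b k)) = t v (b k)" if "v \<in> carrier V" "k < n" for v k
 proof -
  have "E (t v (b k)) = finsum T (\<lambda>j. if k = j then t v (b j) else 0[T]) {..<n}"
   unfolding E_def by (rule T.M.finsum_cong') (use that B in "auto simp: slice_t")
  also have "\<dots> = t v (b k)" by (subst T.M.add.finprod_singleton) (use that B(1) in auto)
  finally show ?thesis .
 qed
 have Esc: "E (t (a *[V] v) w) = a *[T] E (t v w)" if "v \<in> carrier V" "w \<in> carrier W" for a v w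
 proof -
  have aX: "(\<lambda>x. a *[T] x) \<in> lin T T"
   by (rule ahomI) (auto simp: T.smult_r_distr mult.commute simp flip: T.smult_assoc1[simplified])
  interpret s: module_hom field_ring T T "\<lambda>x. a *[T] x" by (rule module_homI[OF T.is_module T.is_module aX])
  show ?thesis unfolding E_def s.hom_finsum[OF finite_lessThan cl[OF t_simps(1)[OF that]]]
   by (rule T.M.finsum_cong') (use that B(1,2) in auto)
 qed
 have "E (t v w) = t v w" if v: "v \<in> carrier V" and w: "w \<in> carrier W" for v w
 proof -
  have "submodule {w \<in> carrier W. E (t v w) = t v w} field_ring W"
  proof (rule W.submoduleI)
   show "0[W] \<in> {w \<in> carrier W. E (t v w) = t v w}" using v Esc[of v "0[W]" 0] Ecl by simp
   show "a *[W] w \<in> {w \<in> carrier W. E (t v w) = t v w}" if "w \<in> {w \<in> carrier W. E (t v w) = t v w}" for a w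
    using that v Esc[of v w a] by simp
  qed (use v Eadd in auto)
  then have "w \<in> {w \<in> carrier W. E (t v w) = t v w}" by (rule W.basis_span[OF bas]) (use 0 v w B(1) in auto)
  then show ?thesis by simp
 qed
 note tt = this
 have "E z = z" using z by (induction z rule: T_induct) (simp_all add: Eadd tt)
 then show ?thesis by (simp add: E_def)
qed

lemma slice_eqI:
 assumes "y \<in> carrier T" "z \<in> carrier T" "\<And>m. m \<in> lfun W \<Longrightarrow> slice m y = slice m z"
 shows "y = z"
proof -
 obtain n b c where bas: "basis W n b c" by (rule W.basis_ex)
 have "y = finsum T (\<lambda>j. t (slice (c j) y) (b j)) {..<n}" by (rule slice_expand[OF bas assms(1)])
 also have "\<dots> = finsum T (\<lambda>j. t (slice (c j) z) (b j)) {..<n}"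
  by (rule T.M.finsum_cong') (use basisD[OF bas] assms in auto)
 also have "\<dots> = z" by (rule slice_expand[OF bas assms(2), symmetric])
 finally show ?thesis .
qed

text \<open>V \<otimes> W is the space of linear maps from the forms on W to V: a linear family of
  would-be contractions comes from a tensor. Elements of A \<otimes> B and of T1 \<otimes> T2 are
  later constructed in this way.\<close>

lemma of_slices:
 assumes cl: "\<And>l. l \<in> lfun W \<Longrightarrow> \<Psi> l \<in> carrier V"
  and cong: "\<And>l m. \<lbrakk>l \<in> lfun W; m \<in> lfun W; \<forall>x\<in>carrier W. l x = m x\<rbrakk> \<Longrightarrow> \<Psi> l = \<Psi> m"
  and add: "\<And>l m. \<lbrakk>l \<in> lfun W; m \<in> lfun W\<rbrakk> \<Longrightarrow> \<Psi> (\<lambda>x. l x + m x) = \<Psi> l +[V] \<Psi> m"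
  and scale: "\<And>l a. l \<in> lfun W \<Longrightarrow> \<Psi> (\<lambda>x. a * l x) = a *[V] \<Psi> l"
 obtains z where "z \<in> carrier T" "\<And>l. l \<in> lfun W \<Longrightarrow> slice l z = \<Psi> l"
proof -
 obtain n b c where bas: "basis W n b c" by (rule W.basis_ex)
 note B = basisD[OF bas]
 let ?z = "finsum T (\<lambda>j. t (\<Psi> (c j)) (b j)) {..<n}"
 have c: "(\<lambda>j. t (\<Psi> (c j)) (b j)) \<in> {..<n} \<rightarrow> carrier T" using B(1,2) assms(1) by auto
 have z: "?z \<in> carrier T" by (rule T.M.finsum_closed[OF c])
 have zero: "(\<lambda>x. 0) \<in> lfun W" by (rule lfunI) auto
 show ?thesis
 proof (rule that[OF z])
  fix l assume "l \<in> lfun W"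
  then show "slice l ?z = \<Psi> l"
  proof (rule W.dual_induct[OF _ bas])
   fix k assume k: "k < n"
   interpret s: module_hom field_ring T V "slice (c k)"
    by (rule module_homI[OF T.is_module V.is_module slice_hom[OF B(2)[OF k]]])
   have "slice (c k) ?z = finsum V (\<lambda>j. if k = j then \<Psi> (c j) else 0[V]) {..<n}"
    unfolding s.hom_finsum[OF finite_lessThan c]
    by (rule V.M.finsum_cong') (use k B assms(1) in "auto simp: slice_t")
   also have "\<dots> = \<Psi> (c k)" by (subst V.M.add.finprod_singleton) (use k B(2) assms(1) in auto)
   finally show "slice (c k) ?z = \<Psi> (c k)" .
  next
   fix l m assume *: "l \<in> lfun W" "m \<in> lfun W" "\<forall>x\<in>carrier W. l x = m x" "slice l ?z = \<Psi> l"
   show "slice m ?z = \<Psi> m" using slice_cong[OF *(1-3) z] cong[OF *(1-3)] *(4) by simp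
  next
   have "slice (\<lambda>x. 0 * (0::'f)) ?z = 0 *[V] slice (\<lambda>x. 0) ?z" by (rule slice_scale[OF zero z])
   moreover have "\<Psi> (\<lambda>x. 0 * (0::'f)) = 0 *[V] \<Psi> (\<lambda>x. 0)" by (rule scale[OF zero])
   ultimately show "slice (\<lambda>x. 0) ?z = \<Psi> (\<lambda>x. 0)" using zero z cl by simp
  qed (use z in "simp_all add: slice_plus slice_scale add scale")
 qed
qed

lemma t_nonzero:
 assumes "v \<in> carrier V" "w \<in> carrier W" "v \<noteq> 0[V]" "w \<noteq> 0[W]" shows "t v w \<noteq> 0[T]"
proof
 assume *: "t v w = 0[T]"
 obtain l where l: "l \<in> lfun V" "l v = 1" by (rule V.dual_vector[OF assms(1,3)])
 obtain m where m: "m \<in> lfun W" "m w = 1" by (rule W.dual_vector[OF assms(2,4)])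
 obtain f where f: "f \<in> lfun T" "f (t v w) = l v * m w" using t_forms l(1) m(1) assms(1,2) by blast
 then have "f 0[T] = 1" "f \<in> lfun T" using f * l m by simp_all
 then show False using T.lfun_zero[of f] by simp
qed

lemma swap: "vtensor W V T (\<lambda>w v. t v w)"
proof unfold_locales
 show "bilin W V T (\<lambda>w v. t v w)" by (rule bilinI) simp_all
 show "\<forall>H. vsub H T \<longrightarrow> (\<forall>v\<in>carrier W. \<forall>w\<in>carrier V. t w v \<in> H) \<longrightarrow> H = carrier T" using t_span by blast
 show "\<forall>l\<in>lfun W. \<forall>m\<in>lfun V. \<exists>f\<in>lfun T. \<forall>v\<in>carrier W. \<forall>w\<in>carrier V. f (t w v) = l v * m w"
  using t_forms by (metis mult.commute)
qed

end

text \<open>Both sides are the value of l \<otimes> m at z.\<close>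

lemma vtensor_fubini:
 assumes "vtensor V W T t" "l \<in> lfun V" "m \<in> lfun W" "z \<in> carrier T"
 shows "l (vtensor.slice V W T t m z) = m (vtensor.slice W V T (\<lambda>w v. t v w) l z)"
proof -
 interpret vtensor V W T t by fact
 interpret s: vtensor W V T "\<lambda>w v. t v w" by (rule swap)
 show ?thesis using assms(4) by (induction z rule: T_induct)
   (use assms(2,3) in "simp_all add: slice_t s.slice_t lfunD mult.commute")
qed

lemma tmap_ex:
 assumes "vtensor V W T t" "vtensor V' W' T' t'" and f: "f \<in> lin V V'" and g: "g \<in> lin W W'"
 obtains h where "h \<in> lin T T'" "\<forall>v\<in>carrier V. \<forall>w\<in>carrier W. h (t v w) = t' (f v) (g w)"
proof -
 interpret vtensor V W T t by fact
 interpret b: vtensor V' W' T' t' by fact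
 have "bilin V W T' (\<lambda>v w. t' (f v) (g w))" by (rule bilinI) (simp_all add: ahomD[OF f] ahomD[OF g])
 then show ?thesis using that by (rule univ[OF b.T.vspace_axioms])
qed

section \<open>Tensor products of algebras and modules\<close>

lemma (in vspace) vspace_module: "module field_ring V"
proof -
 have "cring (field_ring :: 'f ring)" by (rule cringI[OF ring.is_abelian_group[OF ring_field_ring]])
   (auto intro!: comm_monoidI simp: algebra_simps)
 then show ?thesis
  by (intro moduleI) (use M.abelian_group_axioms in "auto simp: smult_r_distr smult_l_distr[simplified] smult_assoc1[simplified]")
qed

locale tensor_fd = tensor_space + V: fdspace V + W: fdspace W
begin

sublocale vt: vtensor V W T "tens V W"
proof unfold_locales
 show "bilin V W T (tens V W)" by (rule tens_bilin)
 show "\<forall>H. vsub H T \<longrightarrow> (\<forall>v\<in>carrier V. \<forall>w\<in>carrier W. tens V W v w \<in> H) \<longrightarrow> H = carrier T"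
 proof (intro allI impI)
  fix H assume H: "vsub H T" "\<forall>v\<in>carrier V. \<forall>w\<in>carrier W. tens V W v w \<in> H"
  have "z \<in> H" if "z \<in> carrier T" for z
   using that by (induction z rule: tensor_induct) (use H submoduleD(3)[OF H(1)] in auto)
  then show "H = carrier T" using submoduleD(1)[OF H(1)] by auto
 qed
 show "\<forall>l\<in>lfun V. \<forall>m\<in>lfun W. \<exists>f\<in>lfun T. \<forall>v\<in>carrier V. \<forall>w\<in>carrier W. f (tens V W v w) = l v * m w"
  using tens_forms by blast
qed

end

locale alg_pair = A: falg A + B: falg B
 for A :: "('f::field, 'a) module" and B :: "('f, 'b) module"
begin

sublocale ts: tensor_fd A B by unfold_locales

abbreviation "AB \<equiv> tensor A B"
abbreviation ten (infixl "\<Join>" 71) where "a \<Join> b \<equiv> tens A B a b"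

lemma mult_bilin: "bilin A A A (mult A)" "bilin B B B (mult B)"
 by (rule bilinI; simp add: A.l_distr A.r_distr A.mult_smult B.l_distr B.r_distr B.mult_smult)+

sublocale mop: tensor_op A B A B A B "mult A" "mult B" by (unfold_locales; rule mult_bilin)

lemma AB_mult: "x **[AB] y = mop.Op x y" by (simp add: tensor_def quot_module_def rcoset_mult_def mop.Op_def)

lemma AB_one: "1[AB] = 1[A] \<Join> 1[B]" by (simp add: tensor_def quot_module_def tens_def)

lemmas AB_bilin = bilinD[OF mop.Op_bilin, folded AB_mult]

lemma AB_tens: "\<lbrakk>a \<in> carrier A; a' \<in> carrier A; b \<in> carrier B; b' \<in> carrier B\<rbrakk>
  \<Longrightarrow> (a \<Join> b) **[AB] (a' \<Join> b') = (a **[A] a') \<Join> (b **[B] b')" unfolding AB_mult by (rule mop.Op_tens)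

lemma AB_assoc:
 assumes "x \<in> carrier AB" "y \<in> carrier AB" "z \<in> carrier AB"
 shows "(x **[AB] y) **[AB] z = x **[AB] (y **[AB] z)" using assms(1)
proof (induction x rule: ts.vt.T_induct)
 case (tens a b)
 show ?case using assms(2)
 proof (induction y rule: ts.vt.T_induct)
  case (tens a' b')
  show ?case using assms(3) by (induction z rule: ts.vt.T_induct)
    (use tens \<open>a \<in> _\<close> \<open>b \<in> _\<close> in "simp_all add: AB_tens AB_bilin A.m_assoc B.m_assoc")
 next
  case (add x y) then show ?case using tens assms(3) by (simp add: AB_bilin)
 qed
next
 case (add x y) then show ?case using assms(2,3) by (simp add: AB_bilin)
qed

lemma AB_one_mult:
 assumes "x \<in> carrier AB" shows "1[AB] **[AB] x = x" "x **[AB] 1[AB] = x"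
 using assms by (induction x rule: ts.vt.T_induct) (simp_all add: AB_one AB_tens AB_bilin)

lemma AB_fd: "fd_algebra AB" unfolding fd_algebra_def
proof (intro conjI allI ballI)
 have c: "1[AB] \<in> carrier AB" by (simp add: AB_one)
 show "ring AB" by (rule ringI[OF ts.T.M.abelian_group_axioms monoidI])
   (simp_all add: AB_assoc AB_one_mult AB_bilin c)
 show "module field_ring AB" by (rule ts.T.vspace_module)
 show "finitely_generated field_ring AB" by (rule ts.vt.T_fg)
qed (simp_all add: AB_bilin)

sublocale AB: falg AB by unfold_locales (rule AB_fd)

lemma sc_AB: "AB.sc c = A.sc c \<Join> 1[B]" "AB.sc c = 1[A] \<Join> B.sc c" by (simp_all add: AB_one)

end

locale mod_pair = alg_pair A B + M: fdmod A M + N: fdmod B N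
 for A :: "('f::field, 'a) module" and B :: "('f, 'b) module"
  and M :: "('a, 'm) module" and N :: "('b, 'n) module"
begin

abbreviation "MV \<equiv> rs A M"
abbreviation "NV \<equiv> rs B N"

sublocale tm: tensor_fd MV NV by unfold_locales

lemma smult_bilin: "bilin A MV MV (smult M)" "bilin B NV NV (smult N)"
 by (rule bilinI; simp add: M.smult_l_distr M.smult_r_distr N.smult_l_distr N.smult_r_distr;
   simp add: A.sc_simps B.sc_simps flip: M.smult_assoc1 N.smult_assoc1)+

sublocale sop: tensor_op A B MV NV MV NV "smult M" "smult N" by (unfold_locales; rule smult_bilin)

abbreviation "MN \<equiv> tensor_module A B M N"

lemma MN_simps [simp]:
 "carrier MN = carrier (tensor MV NV)" "0[MN] = 0[tensor MV NV]" "x +[MN] y = x +[tensor MV NV] y"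
 by (simp_all add: tensor_module_def Let_def)

lemma MN_smult: "x *[MN] y = sop.Op x y"
 by (simp add: tensor_module_def Let_def sop.Op_def tensor_def quot_module_def)

lemmas MN_bilin = bilinD[OF sop.Op_bilin, folded MN_smult]

lemma MN_tens: "\<lbrakk>a \<in> carrier A; b \<in> carrier B; m \<in> carrier M; n \<in> carrier N\<rbrakk>
  \<Longrightarrow> (a \<Join> b) *[MN] (tens MV NV m n) = tens MV NV (a *[M] m) (b *[N] n)"
 unfolding MN_smult by (rule sop.Op_tens) auto

lemma MN_assoc:
 assumes "x \<in> carrier AB" "y \<in> carrier AB" "z \<in> carrier (tensor MV NV)"
 shows "(x **[AB] y) *[MN] z = x *[MN] (y *[MN] z)" using assms(1)
proof (induction x rule: ts.vt.T_induct)
 case (tens a b)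
 show ?case using assms(2)
 proof (induction y rule: ts.vt.T_induct)
  case (tens a' b')
  show ?case using assms(3) by (induction z rule: tm.vt.T_induct)
    (use tens \<open>a \<in> _\<close> \<open>b \<in> _\<close> in "simp_all add: AB_tens MN_tens AB_bilin MN_bilin M.smult_assoc1 N.smult_assoc1")
 next
  case (add x y) then show ?case using tens assms(3) by (simp add: AB_bilin MN_bilin)
 qed
next
 case (add x y) then show ?case using assms(2,3) by (simp add: AB_bilin MN_bilin)
qed

lemma MN_one:
 assumes "x \<in> carrier (tensor MV NV)" shows "1[AB] *[MN] x = x"
 using assms by (induction x rule: tm.vt.T_induct) (simp_all add: AB_one MN_tens MN_bilin)

lemma MN_left_module: "left_module AB MN"
proof (rule left_moduleI)
 show "\<exists>y\<in>carrier MN. y +[MN] x = 0[MN]" if "x \<in> carrier MN" for x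
  by (rule bexI[of _ "-[tensor MV NV] x"]) (use that in "simp_all add: tm.T.M.l_neg")
qed (simp_all add: AB.ring_axioms tm.T.M.add.m_ac MN_bilin MN_assoc MN_one)

lemma MN_scalar:
 assumes "x \<in> carrier (tensor MV NV)" shows "AB.sc c *[MN] x = c *[tensor MV NV] x"
 using assms by (induction x rule: tm.vt.T_induct) (simp_all add: sc_AB(1) MN_tens MN_bilin tm.T.smult_r_distr del: AB.smult_cl)

end

section \<open>Modules over a tensor product\<close>

lemma simple_nonzero:
 assumes "simple_module R M" obtains x where "x \<in> carrier M" "x \<noteq> 0[M]"
proof -
 interpret left_module R M using assms by (simp add: simple_module_def)
 have "carrier M \<noteq> {0[M]}" using assms by (simp add: simple_module_def)
 then have "\<exists>x. x \<in> carrier M \<and> x \<noteq> 0[M]" using M.zero_closed by auto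
 then show ?thesis by (elim exE conjE) (rule that)
qed

context alg_pair
begin

text \<open>Restriction along a \<mapsto> a \<otimes> 1. Together with \<open>res2\<close> it turns
  a module over the tensor product into one vector space with commuting actions of A and B.\<close>

definition res1 :: "(('a \<times> 'b \<Rightarrow>\<^sub>0 'f) set, 'x) module \<Rightarrow> ('a, 'x) module" where
 "res1 X = \<lparr>carrier = carrier X, mult = mult X, one = 1[X], zero = 0[X], add = add X, smult = (\<lambda>a x. (a \<Join> 1[B]) *[X] x)\<rparr>"

definition res2 :: "(('a \<times> 'b \<Rightarrow>\<^sub>0 'f) set, 'x) module \<Rightarrow> ('b, 'x) module" where
 "res2 X = \<lparr>carrier = carrier X, mult = mult X, one = 1[X], zero = 0[X], add = add X, smult = (\<lambda>b x. (1[A] \<Join> b) *[X] x)\<rparr>"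

lemma res_simps [simp]:
 "carrier (res1 X) = carrier X" "0[res1 X] = 0[X]" "x +[res1 X] y = x +[X] y" "a *[res1 X] x = (a \<Join> 1[B]) *[X] x"
 "carrier (res2 X) = carrier X" "0[res2 X] = 0[X]" "x +[res2 X] y = x +[X] y" "b *[res2 X] x = (1[A] \<Join> b) *[X] x"
 by (simp_all add: res1_def res2_def)

lemma restrict_res [simp]:
 "rs A (res1 X) = rs AB X" "rs B (res2 X) = rs AB X"
proof -
 show "rs A (res1 X) = rs AB X"
  using sc_AB(1) by (simp add: restrict_scalars_def scalar_action_def res1_def fun_eq_iff)
 show "rs B (res2 X) = rs AB X"
  using sc_AB(2) by (simp add: restrict_scalars_def scalar_action_def res2_def fun_eq_iff)
qed

lemma AB_split: "\<lbrakk>a \<in> carrier A; b \<in> carrier B\<rbrakk> \<Longrightarrow> a \<Join> b = (a \<Join> 1[B]) **[AB] (1[A] \<Join> b)"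
 "\<lbrakk>a \<in> carrier A; b \<in> carrier B\<rbrakk> \<Longrightarrow> a \<Join> b = (1[A] \<Join> b) **[AB] (a \<Join> 1[B])" by (simp_all add: AB_tens)

lemma smult_split:
 assumes "left_module AB X" "a \<in> carrier A" "b \<in> carrier B" "x \<in> carrier X"
 shows "(a \<Join> b) *[X] x = (a \<Join> 1[B]) *[X] ((1[A] \<Join> b) *[X] x)"
  "(a \<Join> b) *[X] x = (1[A] \<Join> b) *[X] ((a \<Join> 1[B]) *[X] x)"
proof -
 interpret X: left_module AB X by fact
 show "(a \<Join> b) *[X] x = (a \<Join> 1[B]) *[X] ((1[A] \<Join> b) *[X] x)"
  using assms AB_split(1)[of a b] by (simp add: X.smult_assoc1)
 show "(a \<Join> b) *[X] x = (1[A] \<Join> b) *[X] ((a \<Join> 1[B]) *[X] x)"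
  using assms AB_split(2)[of a b] by (simp add: X.smult_assoc1)
qed

lemma res1_left_module: assumes "left_module AB X" shows "left_module A (res1 X)"
proof -
 interpret X: left_module AB X by fact
 have "(a **[A] b) \<Join> 1[B] = (a \<Join> 1[B]) **[AB] (b \<Join> 1[B])" if "a \<in> carrier A" "b \<in> carrier A" for a b
  using that by (simp add: AB_tens)
 then show ?thesis by (intro left_moduleI) (use X.M.a_inv_closed X.M.l_neg X.smult_one in
   \<open>auto simp: A.ring_axioms X.M.add.m_ac X.smult_l_distr X.smult_r_distr X.smult_assoc1 AB_one[symmetric] simp del: AB_one\<close>)
qed

lemma res2_left_module: assumes "left_module AB X" shows "left_module B (res2 X)"
proof -
 interpret X: left_module AB X by fact
 have "1[A] \<Join> (a **[B] b) = (1[A] \<Join> a) **[AB] (1[A] \<Join> b)" if "a \<in> carrier B" "b \<in> carrier B" for a b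
  using that by (simp add: AB_tens)
 then show ?thesis by (intro left_moduleI) (use X.M.a_inv_closed X.M.l_neg X.smult_one in
   \<open>auto simp: B.ring_axioms X.M.add.m_ac X.smult_l_distr X.smult_r_distr X.smult_assoc1 AB_one[symmetric] simp del: AB_one\<close>)
qed

lemma res_fdmod:
 assumes "fdmod AB X" shows "fdmod A (res1 X)" "fdmod B (res2 X)"
proof -
 interpret X: fdmod AB X by fact
 show "fdmod A (res1 X)"
  using res1_left_module[OF X.is_module] A.fg_fdspace[of "res1 X"] X.rs.fdspace_axioms by (simp add: fdmod_iff A.fd)
 show "fdmod B (res2 X)"
  using res2_left_module[OF X.is_module] B.fg_fdspace[of "res2 X"] X.rs.fdspace_axioms by (simp add: fdmod_iff B.fd)
qed

lemma submodule_res: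
 assumes "left_module AB X" "submodule H AB X" shows "submodule H A (res1 X)" "submodule H B (res2 X)"
proof -
 interpret R1: left_module A "res1 X" by (rule res1_left_module[OF assms(1)])
 interpret R2: left_module B "res2 X" by (rule res2_left_module[OF assms(1)])
 show "submodule H A (res1 X)" by (rule R1.submoduleI) (auto simp: submoduleD[OF assms(2)])
 show "submodule H B (res2 X)" by (rule R2.submoduleI) (auto simp: submoduleD[OF assms(2)])
qed

lemma ahom_res:
 assumes "f \<in> ahom AB X Y" shows "f \<in> ahom A (res1 X) (res1 Y)" "f \<in> ahom B (res2 X) (res2 Y)"
 by (rule ahomI; simp add: ahomD[OF assms])+

text \<open>The elements a \<otimes> 1 and 1 \<otimes> b generate the tensor product, as a \<otimes>
  b is their product.\<close>

lemma ahom_ABI: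
 assumes X: "left_module AB X" and Y: "left_module AB Y" and f: "f \<in> ahom A (res1 X) (res1 Y)" "f \<in> ahom B (res2 X) (res2 Y)"
 shows "f \<in> ahom AB X Y"
proof -
 interpret X: left_module AB X by fact
 interpret Y: left_module AB Y by fact
 note f1 = ahomD[OF f(1), simplified] and f2 = ahomD[OF f(2), simplified]
 have "f (r *[X] x) = r *[Y] f x" if "r \<in> carrier AB" "x \<in> carrier X" for r x using that(1)
 proof (induction r rule: ts.vt.T_induct)
  case (tens a b)
  then show ?case using f1 f2 that(2) smult_split(1)[OF X tens, of x] smult_split(1)[OF Y tens, of "f x"] by simp
 next
  case (add r s)
  then show ?case using f1 that(2) by (simp add: X.smult_l_distr Y.smult_l_distr)
 qed
 then show ?thesis using f1 by (intro ahomI) auto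
qed

end

text \<open>The outer tensor product up to isomorphism. Objects of \<open>fg_modules\<close> have
  their carriers in sequences of scalars, so the standard modules and projective covers of A
  \<otimes> B have to be copies of \<open>tensor_module\<close>; simple modules may be taken as they
  are.\<close>

locale mtensor = alg_pair A B + M: fdmod A M + N: fdmod B N + T: left_module "tensor A B" T
  + vt: vtensor "rs A M" "rs B N" "rs (tensor A B) T" t
 for A :: "('f::field, 'a) module" and B :: "('f, 'b) module"
  and M :: "('a, 'm) module" and N :: "('b, 'n) module" and T :: "(('a \<times> 'b \<Rightarrow>\<^sub>0 'f) set, 't) module" and t +
 assumes act: "\<lbrakk>a \<in> carrier A; b \<in> carrier B; m \<in> carrier M; n \<in> carrier N\<rbrakk>
  \<Longrightarrow> (a \<Join> b) *[T] t m n = t (a *[M] m) (b *[N] n)"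
begin

abbreviation "MV \<equiv> rs A M"
abbreviation "NV \<equiv> rs B N"
abbreviation "TV \<equiv> rs AB T"

lemma t_closed [simp]: "\<lbrakk>m \<in> carrier M; n \<in> carrier N\<rbrakk> \<Longrightarrow> t m n \<in> carrier T"
 and t_add1 [simp]: "\<lbrakk>m \<in> carrier M; m' \<in> carrier M; n \<in> carrier N\<rbrakk> \<Longrightarrow> t (m +[M] m') n = t m n +[T] t m' n"
 and t_add2 [simp]: "\<lbrakk>m \<in> carrier M; n \<in> carrier N; n' \<in> carrier N\<rbrakk> \<Longrightarrow> t m (n +[N] n') = t m n +[T] t m n'"
 and t_zero1 [simp]: "n \<in> carrier N \<Longrightarrow> t 0[M] n = 0[T]"
 and t_zero2 [simp]: "m \<in> carrier M \<Longrightarrow> t m 0[N] = 0[T]" using vt.t_simps(1-3) vt.t_zero by simp_all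

lemma act1 [simp]: "\<lbrakk>a \<in> carrier A; m \<in> carrier M; n \<in> carrier N\<rbrakk> \<Longrightarrow> (a \<Join> 1[B]) *[T] t m n = t (a *[M] m) n"
 and act2 [simp]: "\<lbrakk>b \<in> carrier B; m \<in> carrier M; n \<in> carrier N\<rbrakk> \<Longrightarrow> (1[A] \<Join> b) *[T] t m n = t m (b *[N] n)"
 by (simp_all add: act)

lemma T_induct [consumes 1, case_names tens add]:
 assumes "z \<in> carrier T" "\<And>m n. \<lbrakk>m \<in> carrier M; n \<in> carrier N\<rbrakk> \<Longrightarrow> P (t m n)"
  "\<And>x y. \<lbrakk>x \<in> carrier T; y \<in> carrier T; P x; P y\<rbrakk> \<Longrightarrow> P (x +[T] y)"
 shows "P z" using vt.T_induct[of z P] assms by simp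

sublocale T: fdmod AB T by unfold_locales (use AB.fg_iff[OF T.is_module] vt.T_fg in simp)

sublocale R1: fdmod A "res1 T" by (rule res_fdmod[OF T.fdmod_axioms])
sublocale R2: fdmod B "res2 T" by (rule res_fdmod[OF T.fdmod_axioms])

lemma ahom_tensI:
 assumes X: "left_module AB X" and h: "h \<in> lin TV (rs AB X)"
  and e: "\<And>a b m n. \<lbrakk>a \<in> carrier A; b \<in> carrier B; m \<in> carrier M; n \<in> carrier N\<rbrakk>
   \<Longrightarrow> h (t (a *[M] m) (b *[N] n)) = (a \<Join> b) *[X] h (t m n)"
 shows "h \<in> ahom AB T X"
proof -
 interpret X: left_module AB X by fact
 note hh = ahomD[OF h, simplified]
 have "h (r *[T] z) = r *[X] h z" if r: "r \<in> carrier AB" and z: "z \<in> carrier T" for r z using r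
 proof (induction r rule: ts.vt.T_induct)
  case (tens a b)
  show ?case using z
   by (induction z rule: T_induct) (use tens in "simp_all add: act e hh X.smult_r_distr T.smult_r_distr")
 next
  case (add r s)
  then show ?case using hh z by (simp add: X.smult_l_distr T.smult_l_distr)
 qed
 then show ?thesis using hh by (intro ahomI) auto
qed

lemma univ_hom:
 assumes X: "left_module AB X" and b: "bilin MV NV (rs AB X) f"
  and e: "\<And>a b m n. \<lbrakk>a \<in> carrier A; b \<in> carrier B; m \<in> carrier M; n \<in> carrier N\<rbrakk>
   \<Longrightarrow> f (a *[M] m) (b *[N] n) = (a \<Join> b) *[X] f m n"
 obtains h where "h \<in> ahom AB T X" "\<forall>m\<in>carrier M. \<forall>n\<in>carrier N. h (t m n) = f m n"
proof -
 obtain h where h: "h \<in> lin TV (rs AB X)" "\<forall>m\<in>carrier MV. \<forall>n\<in>carrier NV. h (t m n) = f m n"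
  by (rule vt.univ[OF AB.rs_vspace[OF X] b])
 show ?thesis by (rule that[OF ahom_tensI[OF X h(1)]]) (use h(2) e in auto)
qed

lemma span_AB:
 assumes H: "submodule H AB T" and "\<And>m n. \<lbrakk>m \<in> carrier M; n \<in> carrier N\<rbrakk> \<Longrightarrow> t m n \<in> H"
 shows "H = carrier T" using vt.t_span AB.rs_submodule[OF T.is_module H] assms(2) by simp

sublocale st: vtensor NV MV TV "\<lambda>n m. t m n" by (rule vt.swap)

text \<open>Contracting the second factor commutes with the action on the first. Composed with a
  contraction, a map into T over A \<otimes> B becomes a map into M over A.\<close>

lemma slice_A: "l \<in> lfun NV \<Longrightarrow> vt.slice l \<in> ahom A (res1 T) M"
proof (rule ahomI, unfold res_simps)
 assume l: "l \<in> lfun NV"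
 show "vt.slice l ((a \<Join> 1[B]) *[T] x) = a *[M] vt.slice l x" if a: "a \<in> carrier A" and x: "x \<in> carrier T" for a x
  using x
 proof (induction x rule: T_induct)
  case (tens m n)
  have "A.sc (l n) *[M] (a *[M] m) = a *[M] (A.sc (l n) *[M] m)"
   using a tens by (simp add: A.sc_simps flip: M.smult_assoc1)
  then show ?case using tens a l vt.slice_t[OF l, of "a *[M] m" n] vt.slice_t[OF l, of m n] by simp
 next
  case (add x y)
  then show ?case using a l vt.slice_add[OF l] vt.slice_closed[OF l] by (simp add: T.smult_r_distr M.smult_r_distr)
 qed
qed (use vt.slice_add vt.slice_closed in simp_all)

lemma slice_B: "l \<in> lfun MV \<Longrightarrow> st.slice l \<in> ahom B (res2 T) N"
proof (rule ahomI, unfold res_simps)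
 assume l: "l \<in> lfun MV"
 show "st.slice l ((1[A] \<Join> b) *[T] x) = b *[N] st.slice l x" if b: "b \<in> carrier B" and x: "x \<in> carrier T" for b x
  using x
 proof (induction x rule: T_induct)
  case (tens m n)
  have "B.sc (l m) *[N] (b *[N] n) = b *[N] (B.sc (l m) *[N] n)"
   using b tens by (simp add: B.sc_simps flip: N.smult_assoc1)
  then show ?case using tens b l st.slice_t[OF l, of "b *[N] n" m] st.slice_t[OF l, of n m] by simp
 next
  case (add x y)
  then show ?case using b l st.slice_add[OF l] st.slice_closed[OF l] by (simp add: T.smult_r_distr N.smult_r_distr)
 qed
qed (use st.slice_add st.slice_closed in simp_all)

lemma fubini: "\<lbrakk>l \<in> lfun MV; k \<in> lfun NV; z \<in> carrier T\<rbrakk> \<Longrightarrow> l (vt.slice k z) = k (st.slice l z)"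
 using vtensor_fubini[OF vt.vtensor_axioms, of l k z] by simp

lemma slice_nonzero:
 assumes "z \<in> carrier T" "z \<noteq> 0[T]"
 shows "\<exists>l\<in>lfun NV. vt.slice l z \<noteq> 0[M]" "\<exists>l\<in>lfun MV. st.slice l z \<noteq> 0[N]"
proof -
 have z1: "vt.slice l 0[T] = 0[M]" if "l \<in> lfun NV" for l
  using module_hom.hom_zero[OF module_homI[OF R1.is_module M.is_module slice_A[OF that]]] by simp
 have z2: "st.slice l 0[T] = 0[N]" if "l \<in> lfun MV" for l
  using module_hom.hom_zero[OF module_homI[OF R2.is_module N.is_module slice_B[OF that]]] by simp
 show "\<exists>l\<in>lfun NV. vt.slice l z \<noteq> 0[M]" using vt.slice_eqI[of z "0[T]"] assms z1 by auto
 show "\<exists>l\<in>lfun MV. st.slice l z \<noteq> 0[N]" using st.slice_eqI[of z "0[T]"] assms z2 by auto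
qed

lemma t_left_hom: "n \<in> carrier N \<Longrightarrow> (\<lambda>m. t m n) \<in> ahom A M (res1 T)" by (rule ahomI) simp_all

lemma t_right_hom: "m \<in> carrier M \<Longrightarrow> (\<lambda>n. t m n) \<in> ahom B N (res2 T)" by (rule ahomI) simp_all

end

text \<open>Scalars act on \<open>MN\<close> through the unit of the tensor product algebra; its
  underlying vector space agrees with \<open>tensor MV NV\<close> on the carrier, and the lemma
  carries the tensor property over.\<close>

lemma vtensor_cong:
 assumes "vtensor V W T t" "vspace T'" "carrier T' = carrier T"
  "\<And>x y. x +[T'] y = x +[T] y" "0[T'] = 0[T]" "\<And>c x. x \<in> carrier T \<Longrightarrow> c *[T'] x = c *[T] x"
 shows "vtensor V W T' t"
proof -
 interpret vtensor V W T t by fact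
 interpret T': vspace T' by fact
 have s: "vsub H T" if "vsub H T'" for H by (rule T.submoduleI) (use submoduleD[OF that] assms(3-6) in auto)
 have l: "lfun T' = lfun T" using assms(3,4,6) by (auto simp: lfun_def)
 show ?thesis by unfold_locales (use t_bilin t_span t_forms s in "auto simp: l assms(3,4,6) bilin_def")
qed

lemma (in mod_pair) MN_mtensor: "mtensor A B M N MN (tens MV NV)"
proof (intro mtensor.intro mtensor_axioms.intro)
 show "vtensor MV NV (rs AB MN) (tens MV NV)"
  by (rule vtensor_cong[OF tm.vt.vtensor_axioms AB.rs_vspace[OF MN_left_module]]) (simp_all add: MN_scalar)
 show "left_module AB MN" by (rule MN_left_module)
qed (rule alg_pair_axioms M.fdmod_axioms N.fdmod_axioms MN_tens | assumption)+

lemma (in mtensor) mtensor_iso: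
 assumes T': "left_module AB T'" and f: "f \<in> ahom AB T T'" "bij_betw f (carrier T) (carrier T')"
 shows "mtensor A B M N T' (\<lambda>m n. f (t m n))"
proof (intro mtensor.intro mtensor_axioms.intro)
 interpret T': left_module AB T' by fact
 interpret f: module_hom AB T T' f by (rule module_homI[OF T.is_module T' f(1)])
 let ?g = "inv_into (carrier T) f"
 have g: "?g \<in> ahom AB T' T" by (rule f.inv_ahom[OF f(2)])
 have gf: "?g (f x) = x" if "x \<in> carrier T" for x using f(2) that by (simp add: bij_betw_def)
 have fg: "f (?g x) = x" "?g x \<in> carrier T" if "x \<in> carrier T'" for x
  using f(2) that by (auto simp: bij_betw_def f_inv_into_f inv_into_into)
 interpret T'V: vspace "rs AB T'" by (rule AB.rs_vspace[OF T'])
 have sc: "f (AB.sc c *[T] x) = AB.sc c *[T'] f x" if "x \<in> carrier T" for c x using that by (simp del: AB_one)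
 show "vtensor MV NV (rs AB T') (\<lambda>m n. f (t m n))"
 proof unfold_locales
  show "bilin MV NV (rs AB T') (\<lambda>m n. f (t m n))" by (rule bilinI) (use vt.t_simps(4,5) in "simp_all add: sc")
  show "\<forall>H. vsub H (rs AB T') \<longrightarrow> (\<forall>v\<in>carrier MV. \<forall>w\<in>carrier NV. f (t v w) \<in> H) \<longrightarrow> H = carrier (rs AB T')"
  proof (intro allI impI)
   fix H assume H: "vsub H (rs AB T')" "\<forall>v\<in>carrier MV. \<forall>w\<in>carrier NV. f (t v w) \<in> H"
   have "f z \<in> H" if "z \<in> carrier T" for z
    using that by (induction z rule: T_induct) (use H(2) submoduleD(3)[OF H(1)] in auto)
   then have "f (?g x) \<in> H" if "x \<in> carrier T'" for x by (simp add: fg(2)[OF that])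
   then have "carrier T' \<subseteq> H" using fg(1) by auto
   then show "H = carrier (rs AB T')" using submoduleD(1)[OF H(1)] by auto
  qed
  show "\<forall>l\<in>lfun MV. \<forall>m\<in>lfun NV. \<exists>k\<in>lfun (rs AB T'). \<forall>v\<in>carrier MV. \<forall>w\<in>carrier NV. k (f (t v w)) = l v * m w"
  proof (intro ballI)
   fix l m assume "l \<in> lfun MV" "m \<in> lfun NV"
   then obtain k where k: "k \<in> lfun TV" "\<forall>v\<in>carrier MV. \<forall>w\<in>carrier NV. k (t v w) = l v * m w" using vt.t_forms by blast
   show "\<exists>k\<in>lfun (rs AB T'). \<forall>v\<in>carrier MV. \<forall>w\<in>carrier NV. k (f (t v w)) = l v * m w"
    by (rule bexI[OF _ lfun_comp[OF AB.rs_ahom[OF g] k(1)]]) (use k(2) gf in simp)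
  qed
 qed
 show "left_module AB T'" by fact
 show "(a \<Join> b) *[T'] f (t m n) = f (t (a *[M] m) (b *[N] n))"
  if "a \<in> carrier A" "b \<in> carrier B" "m \<in> carrier M" "n \<in> carrier N" for a b m n
  using that act[OF that] f.hom_simps(3)[of "a \<Join> b" "t m n"] by simp
qed (rule alg_pair_axioms M.fdmod_axioms N.fdmod_axioms)+

lemma enc_mtensor:
 fixes A :: "('f::field, 'a) module" and B :: "('f, 'b) module"
  and M :: "('a, 'm) module" and N :: "('b, 'n) module"
 assumes "fd_algebra A" "fd_algebra B" "fdmod A M" "fdmod B N"
 obtains T :: "(('a \<times> 'b \<Rightarrow>\<^sub>0 'f) set, nat \<Rightarrow> 'f) module" and t
 where "T \<in> fg_modules (tensor A B)" "mtensor A B M N T t"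
proof -
 interpret mod_pair A B M N using assms by (simp add: mod_pair_def alg_pair_def falg_def fdmod_def)
 interpret m: mtensor A B M N MN "tens MV NV" by (rule MN_mtensor)
 note e = enc[OF m.T.fdmod_axioms]
 show ?thesis by (rule that[OF e(1) m.mtensor_iso[OF e(6,2,3)]])
qed

section \<open>Simple modules over a tensor product\<close>

text \<open>A simple A-submodule S of U is isomorphic to M by some contraction. Every contraction of
  the inverse is an endomorphism of M, a scalar by Schur's lemma, so the inverse is x \<mapsto> x
  \<otimes> y for a single vector y. The vectors y with M \<otimes> y inside U form a nonzero
  submodule of N, hence all of N.\<close>

lemma tensor_simple:
 fixes A :: "('f::alg_closed_field, 'a) module"
 assumes "mtensor A B M N T t" and M: "simple_module A M" and N: "simple_module B N"
 shows "simple_module (tensor A B) T"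
proof -
 interpret mtensor A B M N T t by fact
 obtain x1 where x1: "x1 \<in> carrier M" "x1 \<noteq> 0[M]" by (rule simple_nonzero[OF M])
 obtain y1 where y1: "y1 \<in> carrier N" "y1 \<noteq> 0[N]" by (rule simple_nonzero[OF N])
 obtain l where l: "l \<in> lfun MV" "l x1 = 1" using M.rs.dual_vector[of x1] x1 by auto
 show ?thesis unfolding simple_module_def
 proof (intro conjI allI impI)
  show "left_module AB T" by (rule T.is_module)
  have "t x1 y1 \<noteq> 0[T]" using vt.t_nonzero[of x1 y1] x1 y1 by simp
  then show "carrier T \<noteq> {0[T]}" using t_closed[OF x1(1) y1(1)] by (metis singletonD)
  fix U assume U: "submodule U AB T"
  show "U = {0[T]} \<or> U = carrier T"
  proof (cases "U = {0[T]}")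
   case False
   note u = submoduleD[OF U]
   have "U \<noteq> {0[res1 T]}" using False by simp
   then obtain S where S: "submodule S A (res1 T)" "S \<subseteq> U" "simple_module A ((res1 T)\<lparr>carrier := S\<rparr>)"
    by (rule R1.simple_submodule_ex[OF submodule_res(1)[OF T.is_module U]])
   let ?S = "(res1 T)\<lparr>carrier := S\<rparr>"
   have "S \<noteq> {0[T]}" using S(3) by (auto simp: simple_module_def)
   then obtain z where z: "z \<in> S" "z \<noteq> 0[T]" using submoduleD(2)[OF S(1)] by auto
   have zT: "z \<in> carrier T" using submoduleD(6)[OF S(1) z(1)] by simp
   obtain k where k: "k \<in> lfun NV" "vt.slice k z \<noteq> 0[M]" using slice_nonzero(1)[OF zT z(2)] by auto
   have sk: "vt.slice k \<in> ahom A ?S M" using ahom_comp[OF incl_ahom[OF S(1)] slice_A[OF k(1)]] by simp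
   have bij: "bij_betw (vt.slice k) (carrier ?S) (carrier M)"
    by (rule simple_hom_iso(2)[OF S(3) M sk]) (use z k in auto)
   interpret sk: module_hom A ?S M "vt.slice k"
    by (rule module_homI[OF _ M.is_module sk]) (use S(3) in "simp add: simple_module_def")
   let ?g = "inv_into (carrier ?S) (vt.slice k)"
   have g: "?g \<in> ahom A M (res1 T)" using ahom_comp[OF sk.inv_ahom[OF bij] incl_ahom[OF S(1)]] by simp
   have gS: "?g x \<in> S" if "x \<in> carrier M" for x using ahomD(1)[OF sk.inv_ahom[OF bij] that] by simp
   have gT: "?g x \<in> carrier T" if "x \<in> carrier M" for x using ahomD(1)[OF g that] by simp
   \<comment> \<open>Since \<open>l x1\<close> is 1, contracting the image of \<open>x1\<close> by
     \<open>l\<close> reads off the second tensor factor.\<close>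
   define y where "y = st.slice l (?g x1)"
   have y: "y \<in> carrier N" unfolding y_def using st.slice_closed[OF l(1)] gT[OF x1(1)] by simp
   have gt: "?g x = t x y" if x: "x \<in> carrier M" for x
   proof (rule vt.slice_eqI)
    fix p assume p: "p \<in> lfun NV"
    obtain c where c: "\<And>x. x \<in> carrier M \<Longrightarrow> vt.slice p (?g x) = A.sc c *[M] x"
     by (rule schur_scalar[OF A.fd M ahom_comp[OF g slice_A[OF p]]]) blast
    have "p y = l (vt.slice p (?g x1))" unfolding y_def by (rule fubini[OF l(1) p gT[OF x1(1)], symmetric])
    also have "\<dots> = c" using c[OF x1(1)] l lfun_smult[OF l(1), of x1 c] x1(1) by simp
    finally show "vt.slice p (?g x) = vt.slice p (t x y)" using c[OF x] vt.slice_t[OF p, of x y] x y by simp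
   qed (use x y gT in auto)
   have "vt.slice k (?g x1) = x1" by (rule bij_betw_inv_into_right[OF bij x1(1)])
   then have y0: "y \<noteq> 0[N]" using gt[OF x1(1)] x1 vt.slice_smult[OF k(1), of "0[T]" 0] sk.hom_zero by auto
   let ?Y = "{y \<in> carrier N. \<forall>x\<in>carrier M. t x y \<in> U}"
   have "submodule ?Y B N" by (rule N.submoduleI) (use u in "auto simp flip: act2")
   then have "?Y = carrier N" by (rule simple_sub[OF N _ _ y0]) (use y gt gS S(2) in force)
   then have "U = carrier T" by (intro span_AB[OF U]) blast
   then show ?thesis by simp
  qed simp
 qed
qed

text \<open>Fixing a vector of N and contracting after the isomorphism gives a map from M to M'. The
  contraction is chosen so that one given pure tensor survives; the other factor is treated
  symmetrically.\<close>

lemma tensor_iso_factors: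
 assumes "mtensor A B M N T t" "mtensor A B M' N' T' t'"
  and M: "simple_module A M" "simple_module A M'" and N: "simple_module B N" "simple_module B N'"
  and iso: "isomorphic (tensor A B) T T'"
 shows "isomorphic A M M'" "isomorphic B N N'"
proof -
 interpret mtensor A B M N T t by fact
 interpret p: mtensor A B M' N' T' t' by fact
 obtain f where f: "f \<in> ahom AB T T'" "bij_betw f (carrier T) (carrier T')" by (rule isomorphicE[OF iso])
 interpret f: module_hom AB T T' f by (rule module_homI[OF T.is_module p.T.is_module f(1)])
 obtain x where x: "x \<in> carrier M" "x \<noteq> 0[M]" by (rule simple_nonzero[OF M(1)])
 obtain y where y: "y \<in> carrier N" "y \<noteq> 0[N]" by (rule simple_nonzero[OF N(1)])
 have tz: "t x y \<noteq> 0[T]" using vt.t_nonzero[of x y] x y by auto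
 have ft: "f (t x y) \<noteq> 0[T']" using f.inj_iff f(2) tz t_closed[OF x(1) y(1)] by (auto simp: bij_betw_def)
 have ftT: "f (t x y) \<in> carrier T'" using x y by simp
 obtain k where k: "k \<in> lfun p.NV" "p.vt.slice k (f (t x y)) \<noteq> 0[M']" using p.slice_nonzero(1)[OF ftT ft] by auto
 obtain l where l: "l \<in> lfun p.MV" "p.st.slice l (f (t x y)) \<noteq> 0[N']" using p.slice_nonzero(2)[OF ftT ft] by auto
 show "isomorphic A M M'"
  by (rule simple_hom_iso(1)[OF M ahom_comp[OF ahom_comp[OF t_left_hom[OF y(1)] ahom_res(1)[OF f(1)]] p.slice_A[OF k(1)]] x(1)])
   (rule k(2))
 show "isomorphic B N N'"
  by (rule simple_hom_iso(1)[OF N ahom_comp[OF ahom_comp[OF t_right_hom[OF x(1)] ahom_res(2)[OF f(1)]] p.slice_B[OF l(1)]] y(1)])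
   (rule l(2))
qed

lemma simple_cyclic:
 assumes "simple_module R M" and x: "x0 \<in> carrier M" "x0 \<noteq> 0[M]" and y: "y \<in> carrier M"
 obtains a where "a \<in> carrier R" "y = a *[M] x0"
proof -
 interpret left_module R M using assms(1) by (simp add: simple_module_def)
 let ?H = "(\<lambda>a. a *[M] x0) ` carrier R"
 have "submodule ?H R M"
 proof (rule submoduleI)
  show "?H \<subseteq> carrier M" using x by auto
  show "0[M] \<in> ?H" by (rule image_eqI[of _ _ "0[R]"]) (use x in auto)
  fix u v assume "u \<in> ?H" "v \<in> ?H"
  then obtain a b where ab: "a \<in> carrier R" "b \<in> carrier R" "u = a *[M] x0" "v = b *[M] x0" by auto
  then show "u +[M] v \<in> ?H" using x by (intro image_eqI[of _ _ "a +[R] b"]) (simp_all add: smult_l_distr)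
 next
  fix c u assume c: "c \<in> carrier R" and "u \<in> ?H"
  then obtain a where a: "a \<in> carrier R" "u = a *[M] x0" by auto
  then show "c *[M] u \<in> ?H" using x c by (intro image_eqI[of _ _ "c **[R] a"]) (simp_all add: smult_assoc1)
 qed
 moreover have "x0 \<in> ?H" by (rule image_eqI[of _ _ "1[R]"]) (use x in auto)
 ultimately have "?H = carrier M" by (rule simple_sub[OF assms(1) _ _ x(2)])
 then have "y \<in> ?H" using y by simp
 then show ?thesis using that by (elim imageE)
qed

lemma simple_summand_hom:
 assumes A: "fd_algebra A" and X: "fdmod A X" and L: "labels_simples A I L"
  and H: "submodule H A X" "H \<noteq> {0[X]}"
 obtains i g where "i \<in> I" "simple_module A (L i)" "g \<in> ahom A (L i) X" "g ` carrier (L i) \<subseteq> H"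
  "inj_on g (carrier (L i))"
proof -
 interpret X: fdmod A X by fact
 obtain S where S: "submodule S A X" "S \<subseteq> H" "simple_module A (X\<lparr>carrier := S\<rparr>)"
  by (rule X.simple_submodule_ex[OF H])
 obtain i where i: "i \<in> I" "isomorphic A (X\<lparr>carrier := S\<rparr>) (L i)" by (rule label_ex[OF A L S(3)])
 have Li: "simple_module A (L i)" using L i(1) by (auto simp: labels_simples_def)
 have "isomorphic A (L i) (X\<lparr>carrier := S\<rparr>)"
  by (rule isomorphic_sym[OF _ _ i(2)]) (use S(3) Li in "simp_all add: simple_module_def")
 then obtain g where g: "g \<in> ahom A (L i) (X\<lparr>carrier := S\<rparr>)" "bij_betw g (carrier (L i)) (carrier (X\<lparr>carrier := S\<rparr>))"
  by (rule isomorphicE)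
 show ?thesis
 proof (rule that[OF i(1) Li])
  show "g \<in> ahom A (L i) X" using ahom_comp[OF g(1) incl_ahom[OF S(1)]] by simp
  show "g ` carrier (L i) \<subseteq> H" using g(2) S(2) by (simp add: bij_betw_def)
  show "inj_on g (carrier (L i))" using g(2) by (simp add: bij_betw_def)
 qed
qed

text \<open>Choose a copy of some L i in S over A, and then a copy of some K j over B in the
  multiplicity space Hom_A(L i, S). The evaluation map from L i \<otimes> K j to S is nonzero, and
  both modules are simple.\<close>

lemma tensor_classify:
 fixes A :: "('f::alg_closed_field, 'a) module" and B :: "('f, 'b) module"
 assumes A: "fd_algebra A" and B: "fd_algebra B" and L: "labels_simples A I L" and K: "labels_simples B J K"
  and S: "simple_module (tensor A B) S"
 obtains i j where "i \<in> I" "j \<in> J" "isomorphic (tensor A B) S (tensor_module A B (L i) (K j))"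
proof -
 interpret alg_pair A B using A B by (simp add: alg_pair_def falg_def)
 interpret S: fdmod AB S by (rule simple_fdmod[OF AB_fd S])
 have lm: "left_module A (res1 S)" "left_module B (res2 S)"
  by (rule res1_left_module[OF S.is_module], rule res2_left_module[OF S.is_module])
 interpret R1: fdmod A "res1 S" by (rule res_fdmod[OF S.fdmod_axioms])
 interpret R2: fdmod B "res2 S" by (rule res_fdmod[OF S.fdmod_axioms])
 have "carrier (res1 S) \<noteq> {0[res1 S]}" using S by (simp add: simple_module_def)
 then obtain i g where i: "i \<in> I" and Li: "simple_module A (L i)" and g: "g \<in> ahom A (L i) (res1 S)"
  and ginj: "inj_on g (carrier (L i))" by (rule simple_summand_hom[OF A R1.fdmod_axioms L R1.carrier_submodule])
 interpret M: fdmod A "L i" by (rule simple_fdmod[OF A Li])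
 interpret g: module_hom A "L i" "res1 S" g by (rule module_homI[OF M.is_module R1.is_module g])
 obtain x0 where x0: "x0 \<in> carrier (L i)" "x0 \<noteq> 0[L i]" by (rule simple_nonzero[OF Li])
 \<comment> \<open>A map from the cyclic module L i is given by the image of \<open>x0\<close>,
   which may be any vector killed by the annihilator of \<open>x0\<close>. So \<open>W\<close> is
   the multiplicity space, realised inside S.\<close>
 define W where "W = {s \<in> carrier S. \<forall>a\<in>carrier A. a *[L i] x0 = 0[L i] \<longrightarrow> (a \<Join> 1[B]) *[S] s = 0[S]}"
 have comm: "(a \<Join> 1[B]) *[S] ((1[A] \<Join> b) *[S] s) = (1[A] \<Join> b) *[S] ((a \<Join> 1[B]) *[S] s)"
  if "a \<in> carrier A" "b \<in> carrier B" "s \<in> carrier S" for a b s using smult_split[OF S.is_module that] by simp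
 have Wsub: "submodule W B (res2 S)" unfolding W_def by (rule R2.submoduleI) (auto simp: S.smult_r_distr comm)
 have gx0: "g x0 \<in> carrier S" "g x0 \<noteq> 0[S]" using g.hom_simps(1)[OF x0(1)] g.inj_iff ginj x0 by auto
 have "g x0 \<in> W" unfolding W_def
 proof (intro CollectI conjI ballI impI)
  fix a assume a: "a \<in> carrier A" "a *[L i] x0 = 0[L i]"
  have "(a \<Join> 1[B]) *[S] g x0 = g (a *[L i] x0)" using g.hom_simps(3)[OF a(1) x0(1)] by simp
  then show "(a \<Join> 1[B]) *[S] g x0 = 0[S]" using a(2) g.hom_zero by simp
 qed (rule gx0)
 then have "W \<noteq> {0[res2 S]}" using gx0 by auto
 then obtain j k where j: "j \<in> J" and Kj: "simple_module B (K j)" and k: "k \<in> ahom B (K j) (res2 S)"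
  and kW: "k ` carrier (K j) \<subseteq> W" and kinj: "inj_on k (carrier (K j))"
  by (rule simple_summand_hom[OF B R2.fdmod_axioms K Wsub])
 interpret mod_pair A B "L i" "K j"
  using simple_fdmod[OF A Li] simple_fdmod[OF B Kj] alg_pair_axioms by (simp add: mod_pair_def fdmod_def)
 interpret m: mtensor A B "L i" "K j" MN "tens MV NV" by (rule MN_mtensor)
 interpret k: module_hom B "K j" "res2 S" k by (rule module_homI[OF N.is_module R2.is_module k])
 have kS: "k y \<in> carrier S" if "y \<in> carrier (K j)" for y using k.hom_simps(1)[OF that] by simp
 define \<alpha> where "\<alpha> x = (SOME a. a \<in> carrier A \<and> a *[L i] x0 = x)" for x
 have \<alpha>: "\<alpha> x \<in> carrier A \<and> \<alpha> x *[L i] x0 = x" if xL: "x \<in> carrier (L i)" for x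
 proof -
  obtain a where "a \<in> carrier A" "x = a *[L i] x0" by (rule simple_cyclic[OF Li x0 xL])
  then have "a \<in> carrier A \<and> a *[L i] x0 = x" by simp
  then show ?thesis unfolding \<alpha>_def by (rule someI)
 qed
 \<comment> \<open>Two elements that take \<open>x0\<close> to the same x differ by one that kills
   \<open>x0\<close>, and this one acts as zero on \<open>W\<close>; hence the choice in
   \<open>\<alpha>\<close> does not matter.\<close>
 have \<alpha>W: "(\<alpha> x \<Join> 1[B]) *[S] s = (a \<Join> 1[B]) *[S] s"
  if x: "x \<in> carrier (L i)" and a: "a \<in> carrier A" "a *[L i] x0 = x" and s: "s \<in> W" for x a s
 proof -
  have sS: "s \<in> carrier S" using s by (simp add: W_def)
  have nA: "-[A] a \<in> carrier A" using a by simp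
  let ?d = "\<alpha> x +[A] -[A] a"
  have "?d *[L i] x0 = x +[L i] (-[A] a) *[L i] x0" using \<alpha>[OF x] a x0 by (simp add: M.smult_l_distr)
  also have "(-[A] a) *[L i] x0 = -[L i] x"
   using a x0 nA x M.smult_l_distr[of "-[A] a" a x0] by (intro M.M.minus_equality[symmetric]) (simp_all add: A.l_neg)
  finally have "?d *[L i] x0 = 0[L i]" using x by (simp add: M.M.r_neg)
  moreover have dA: "?d \<in> carrier A" using \<alpha>[OF x] a by simp
  ultimately have d: "(?d \<Join> 1[B]) *[S] s = 0[S]" using s unfolding W_def by blast
  have "\<alpha> x = ?d +[A] a" using \<alpha>[OF x] a by (simp add: A.a_assoc A.l_neg)
  then have "(\<alpha> x \<Join> 1[B]) *[S] s = ((?d \<Join> 1[B]) +[AB] (a \<Join> 1[B])) *[S] s"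
   using ts.tens_simps(2)[OF dA a(1), of "1[B]"] by simp
  also have "\<dots> = (?d \<Join> 1[B]) *[S] s +[S] (a \<Join> 1[B]) *[S] s"
   by (rule S.smult_l_distr) (use dA a sS in "simp_all only: ts.tens_closed B.one_closed")
  also have "\<dots> = (a \<Join> 1[B]) *[S] s" unfolding d using a sS by simp
  finally show ?thesis .
 qed
 have kW': "k y \<in> W" if "y \<in> carrier (K j)" for y using kW that by auto
 let ?b = "\<lambda>x y. (\<alpha> x \<Join> 1[B]) *[S] k y"
 have bact: "?b (a *[L i] x) (b *[K j] y) = (a \<Join> b) *[S] ?b x y"
  if h: "a \<in> carrier A" "b \<in> carrier B" "x \<in> carrier (L i)" "y \<in> carrier (K j)" for a b x y
 proof -
  have kb: "k (b *[K j] y) = (1[A] \<Join> b) *[S] k y" using h by simp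
  have "?b (a *[L i] x) (b *[K j] y) = ((a **[A] \<alpha> x) \<Join> 1[B]) *[S] k (b *[K j] y)"
   by (rule \<alpha>W) (use h \<alpha>[OF h(3)] x0 kW'[of "b *[K j] y"] in "simp_all add: M.smult_assoc1 del: k.hom_simps")
  also have "\<dots> = (a \<Join> b) *[S] ?b x y"
  proof (unfold kb)
   have "((a **[A] \<alpha> x) \<Join> 1[B]) **[AB] (1[A] \<Join> b) = (a \<Join> b) **[AB] (\<alpha> x \<Join> 1[B])"
    using h \<alpha>[OF h(3)] by (simp add: AB_tens)
   then show "((a **[A] \<alpha> x) \<Join> 1[B]) *[S] ((1[A] \<Join> b) *[S] k y) = (a \<Join> b) *[S] ?b x y"
    using h \<alpha>[OF h(3)] kS by (simp flip: S.smult_assoc1)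
  qed
  finally show ?thesis .
 qed
 have badd: "?b (x +[L i] x') y = ?b x y +[S] ?b x' y"
  if h: "x \<in> carrier (L i)" "x' \<in> carrier (L i)" "y \<in> carrier (K j)" for x x' y
 proof -
  have "?b (x +[L i] x') y = ((\<alpha> x +[A] \<alpha> x') \<Join> 1[B]) *[S] k y"
   by (rule \<alpha>W) (use h \<alpha>[OF h(1)] \<alpha>[OF h(2)] x0 kW' in "simp_all add: M.smult_l_distr")
  then show ?thesis using h \<alpha>[OF h(1)] \<alpha>[OF h(2)] kS by (simp add: S.smult_l_distr)
 qed
 have bil: "bilin MV NV (rs AB S) ?b"
 proof (rule bilinI)
  fix c v w assume h: "v \<in> carrier MV" "w \<in> carrier NV"
  have h': "v \<in> carrier (L i)" "w \<in> carrier (K j)" using h by auto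
  have "?b (A.sc c *[L i] v) (1[B] *[K j] w) = (A.sc c \<Join> 1[B]) *[S] ?b v w" by (rule bact) (use h' in simp_all)
  then show "?b (c *[MV] v) w = c *[rs AB S] ?b v w" using h' N.smult_one[OF h'(2)] sc_AB(1)[of c] by simp
  have "?b (1[A] *[L i] v) (B.sc c *[K j] w) = (1[A] \<Join> B.sc c) *[S] ?b v w" by (rule bact) (use h' in simp_all)
  then show "?b v (c *[NV] w) = c *[rs AB S] ?b v w" using h' M.smult_one[OF h'(1)] sc_AB(2)[of c] by simp
 qed (use \<alpha> kS badd in "simp_all add: S.smult_r_distr")
 obtain h where h: "h \<in> ahom AB MN S" "\<forall>m\<in>carrier (L i). \<forall>n\<in>carrier (K j). h (tens MV NV m n) = ?b m n"
  by (rule m.univ_hom[OF S.is_module bil bact])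
 obtain y where y: "y \<in> carrier (K j)" "y \<noteq> 0[K j]" by (rule simple_nonzero[OF Kj])
 have "?b x0 y = (1[A] \<Join> 1[B]) *[S] k y" by (rule \<alpha>W) (use x0 y kW' in auto)
 also have "\<dots> = k y" using kS[OF y(1)] S.smult_one by (simp add: AB_one[symmetric])
 finally have "h (tens MV NV x0 y) = k y" using h(2) x0 y by simp
 moreover have "k y \<noteq> 0[S]" using k.inj_iff kinj y by auto
 ultimately have "isomorphic AB MN S"
  using simple_hom_iso(1)[OF tensor_simple[OF m.mtensor_axioms Li Kj] S h(1), of "tens MV NV x0 y"] x0 y m.t_closed[of x0 y] by simp
 then have "isomorphic AB S MN" by (rule isomorphic_sym[OF MN_left_module S.is_module])
 then show ?thesis by (rule that[OF i j])
qed

lemma tensor_labels: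
 fixes A :: "('f::alg_closed_field, 'a) module" and B :: "('f, 'b) module"
 assumes A: "fd_algebra A" and B: "fd_algebra B" and L: "labels_simples A I L" and K: "labels_simples B J K"
 shows "labels_simples (tensor A B) (I \<times> J) (\<lambda>(i, j). tensor_module A B (L i) (K j))"
proof -
 have s: "simple_module A (L i)" if "i \<in> I" for i using L that by (simp add: labels_simples_def)
 have s': "simple_module B (K j)" if "j \<in> J" for j using K that by (simp add: labels_simples_def)
 have mp: "mod_pair A B (L i) (K j)" if "i \<in> I" "j \<in> J" for i j
  using simple_fdmod[OF A s[OF that(1)]] simple_fdmod[OF B s'[OF that(2)]] A B
  by (simp add: mod_pair_def alg_pair_def falg_def fdmod_def)
 note mt = mod_pair.MN_mtensor[OF mp]
 show ?thesis unfolding labels_simples_def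
 proof (intro conjI ballI impI)
  fix p assume "p \<in> I \<times> J"
  then show "simple_module (tensor A B) (case p of (i, j) \<Rightarrow> tensor_module A B (L i) (K j))"
   using tensor_simple[OF mt s s'] by auto
 next
  fix p q assume pq: "p \<in> I \<times> J" "q \<in> I \<times> J"
   and iso: "isomorphic (tensor A B) (case p of (i, j) \<Rightarrow> tensor_module A B (L i) (K j))
    (case q of (i, j) \<Rightarrow> tensor_module A B (L i) (K j))"
  obtain i j i' j' where p: "p = (i, j)" "q = (i', j')" "i \<in> I" "j \<in> J" "i' \<in> I" "j' \<in> J" using pq by auto
  have iso': "isomorphic (tensor A B) (tensor_module A B (L i) (K j)) (tensor_module A B (L i') (K j'))"
   using iso p by simp
  note f = tensor_iso_factors[OF mt[OF p(3,4)] mt[OF p(5,6)] s[OF p(3)] s[OF p(5)] s'[OF p(4)] s'[OF p(6)] iso']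
  have "i = i'" using L f(1) p by (simp add: labels_simples_def)
  moreover have "j = j'" using K f(2) p by (simp add: labels_simples_def)
  ultimately show "p = q" using p by simp
 next
  fix S assume "S \<in> fg_modules (tensor A B)" "simple_module (tensor A B) S"
  then show "\<exists>p\<in>I \<times> J. isomorphic (tensor A B) S (case p of (i, j) \<Rightarrow> tensor_module A B (L i) (K j))"
   using tensor_classify[OF A B L K, of S] by (metis SigmaI case_prod_conv)
 qed
qed

section \<open>Projective covers over a tensor product\<close>

lemma tensor_map:
 assumes T: "mtensor A B M N T t" and T': "mtensor A B M' N' T' t'"
  and f: "f \<in> ahom A M M'" and g: "g \<in> ahom B N N'"
 obtains h where "h \<in> ahom (tensor A B) T T'" "\<forall>m\<in>carrier M. \<forall>n\<in>carrier N. h (t m n) = t' (f m) (g n)"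
proof -
 interpret mtensor A B M N T t by fact
 interpret p: mtensor A B M' N' T' t' by fact
 note ff = ahomD[OF f] and gg = ahomD[OF g]
 have "bilin MV NV (rs AB T') (\<lambda>m n. t' (f m) (g n))"
  by (rule bilinI) (use p.vt.t_simps(4,5) in "simp_all add: ff gg")
 then show ?thesis by (rule univ_hom[OF p.T.is_module]) (simp_all add: ff gg p.act that)
qed

lemma tensor_map_surj:
 assumes T: "mtensor A B M N T t" and T': "mtensor A B M' N' T' t'"
  and h: "h \<in> ahom (tensor A B) T T'" "\<forall>m\<in>carrier M. \<forall>n\<in>carrier N. h (t m n) = t' (f m) (g n)"
  and f: "f ` carrier M = carrier M'" and g: "g ` carrier N = carrier N'"
 shows "h ` carrier T = carrier T'"
proof -
 interpret mtensor A B M N T t by fact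
 interpret p: mtensor A B M' N' T' t' by fact
 interpret h: module_hom AB T T' h by (rule module_homI[OF T.is_module p.T.is_module h(1)])
 show ?thesis
 proof (rule p.span_AB[OF h.image_submodule[OF T.carrier_submodule]])
  fix m' n' assume "m' \<in> carrier M'" "n' \<in> carrier N'"
  then obtain m n where "m \<in> carrier M" "m' = f m" "n \<in> carrier N" "n' = g n" using f g by blast
  then show "t' m' n' \<in> h ` carrier T" using h(2) by (intro image_eqI[of _ _ "t m n"]) simp_all
 qed
qed

context alg_pair
begin

text \<open>The module Hom_B(Q, X) over A, for the adjunction between maps P \<otimes> Q
  \<rightarrow> X and maps P \<rightarrow> Hom_B(Q, X).\<close>

definition hom2 where "hom2 Q X = hom_module B Q (res2 X) (\<lambda>a \<phi>. \<lambda>q\<in>carrier Q. (a \<Join> 1[B]) *[X] \<phi> q)"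

lemma hom2_simps [simp]:
 "carrier (hom2 Q X) = Hom B Q (res2 X)"
 "\<phi> +[hom2 Q X] \<psi> = (\<lambda>q\<in>carrier Q. \<phi> q +[X] \<psi> q)"
 "a *[hom2 Q X] \<phi> = (\<lambda>q\<in>carrier Q. (a \<Join> 1[B]) *[X] \<phi> q)" by (simp_all add: hom2_def restrict_def)

lemma hom2_fdmod:
 assumes Q: "fdmod B Q" and X: "fdmod AB X" shows "fdmod A (hom2 Q X)"
proof -
 interpret Q: fdmod B Q by fact
 interpret X: fdmod AB X by fact
 interpret R1: left_module A "res1 X" by (rule res1_left_module[OF X.is_module])
 interpret R2: left_module B "res2 X" by (rule res2_left_module[OF X.is_module])
 have c: "f q \<in> carrier X" if "f \<in> Hom B Q (res2 X)" "q \<in> carrier Q" for f q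
  using that by (auto simp: Hom_iff dest: ahomD(1))
 have act: "(\<lambda>q\<in>carrier Q. (a \<Join> 1[B]) *[X] \<phi> q) \<in> Hom B Q (res2 X)" if a: "a \<in> carrier A" and \<phi>: "\<phi> \<in> Hom B Q (res2 X)" for a \<phi>
 proof (rule restrict_Hom[OF _ Q.is_module], rule ahomI)
  note p = ahomD[OF Hom_ahom[OF \<phi>], simplified]
  show "(a \<Join> 1[B]) *[X] \<phi> (b *[Q] x) = b *[res2 X] ((a \<Join> 1[B]) *[X] \<phi> x)" if "b \<in> carrier B" "x \<in> carrier Q" for b x
   using a that p smult_split[OF X.is_module a that(1), of "\<phi> x"] by simp
 qed (use a ahomD[OF Hom_ahom[OF \<phi>], simplified] in "simp_all add: X.smult_r_distr")
 have lm: "left_module A (hom2 Q X)" unfolding hom2_def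
  by (rule hom_module_left_module[OF Q.is_module R2.is_module A.ring_axioms act])
   (use c R1.smult_l_distr R1.smult_assoc1 R1.smult_one in "simp_all add: X.smult_r_distr")
 show ?thesis using lm unfolding hom2_def
  by (rule hom_module_fdmod[OF _ A.fd Q.is_module Q.fgM R2.is_module X.rs.fdspace_axioms])
   (use sc_AB(1) in simp_all)
qed

end

text \<open>By tensor-Hom adjunction: projectivity of Q makes Hom_B(Q, X) \<rightarrow> Hom_B(Q, Y)
  surjective, and projectivity of P lifts the map P \<rightarrow> Hom_B(Q, Y) through it.\<close>

lemma tensor_projective:
 assumes T: "mtensor A B P Q T t" and P: "projective A P" and Q: "projective B Q" and Tf: "T \<in> fg_modules (tensor A B)"
 shows "projective (tensor A B) T"
proof -
 interpret mtensor A B P Q T t by fact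
 show ?thesis unfolding projective_def
 proof (intro conjI ballI)
  fix X Y g f assume XY: "X \<in> fg_modules AB" "Y \<in> fg_modules AB" and g: "g \<in> Epi AB X Y" and f: "f \<in> Hom AB T Y"
  interpret X: fdmod AB X using XY(1) by (simp add: fg_modules_fdmod AB_fd)
  interpret Y: fdmod AB Y using XY(2) by (simp add: fg_modules_fdmod AB_fd)
  have gh: "g \<in> ahom AB X Y" "g ` carrier X = carrier Y" using g by (auto simp: Epi_def Hom_iff)
  have fh: "f \<in> ahom AB T Y" by (rule Hom_ahom[OF f])
  note g1 = ahomD[OF gh(1)] and f1 = ahomD[OF fh]
  let ?HX = "hom2 Q X" and ?HY = "hom2 Q Y"
  have c: "\<phi> q \<in> carrier X" if "\<phi> \<in> Hom B Q (res2 X)" "q \<in> carrier Q" for \<phi> q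
   using that by (auto simp: Hom_iff dest: ahomD(1))
  let ?G = "\<lambda>\<phi>. \<lambda>q\<in>carrier Q. g (\<phi> q)" and ?F = "\<lambda>p. \<lambda>q\<in>carrier Q. f (t p q)"
  have GH: "?G \<phi> \<in> Hom B Q (res2 Y)" if "\<phi> \<in> Hom B Q (res2 X)" for \<phi>
   by (rule restrict_Hom[OF ahom_comp[OF Hom_ahom[OF that] ahom_res(2)[OF gh(1)]] N.is_module])
  have G: "?G \<in> ahom A ?HX ?HY" by (rule ahomI, unfold hom2_simps, rule GH) (auto simp: g1 c intro!: restrict_ext)
  have "Hom B Q (res2 Y) \<subseteq> ?G ` Hom B Q (res2 X)"
  proof
   fix \<psi> assume \<psi>: "\<psi> \<in> Hom B Q (res2 Y)"
   have "g ` carrier (res2 X) = carrier (res2 Y)" using gh(2) by simp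
   then obtain h where h: "h \<in> ahom B Q (res2 X)" "\<And>x. x \<in> carrier Q \<Longrightarrow> g (h x) = \<psi> x"
    by (rule projective_lift[OF B.fd Q res_fdmod(2)[OF X.fdmod_axioms] res_fdmod(2)[OF Y.fdmod_axioms] ahom_res(2)[OF gh(1)] _ Hom_ahom[OF \<psi>]]) blast
   have hH: "restrict h (carrier Q) \<in> Hom B Q (res2 X)" by (rule restrict_Hom[OF h(1) N.is_module])
   have "\<psi> = ?G (restrict h (carrier Q))" by (rule Hom_eqI[OF \<psi> GH[OF hH]]) (use h(2) in simp)
   then show "\<psi> \<in> ?G ` Hom B Q (res2 X)" using hH by blast
  qed
  then have Gs: "?G ` carrier ?HX = carrier ?HY" using GH by auto
  have F: "?F \<in> ahom A P ?HY" by (rule ahomI, unfold hom2_simps,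
     rule restrict_Hom[OF ahom_comp[OF t_right_hom ahom_res(2)[OF fh]] N.is_module])
    (auto simp: f1 act1[symmetric] simp del: act1 intro!: restrict_ext)
  obtain h where h: "h \<in> ahom A P ?HX" "\<And>x. x \<in> carrier P \<Longrightarrow> ?G (h x) = ?F x"
   by (rule projective_lift[OF A.fd P hom2_fdmod[OF N.fdmod_axioms X.fdmod_axioms] hom2_fdmod[OF N.fdmod_axioms Y.fdmod_axioms] G Gs F]) blast
  note h1 = ahomD[OF h(1), simplified]
  note h2 = ahomD[OF Hom_ahom[OF h1(1)], simplified]
  have hgt: "g (h p q) = f (t p q)" if "p \<in> carrier P" "q \<in> carrier Q" for p q
   using fun_cong[OF h(2)[OF that(1)], of q] that by simp
  have sc: "h (a *[P] p) q = (a \<Join> 1[B]) *[X] h p q" if "a \<in> carrier A" "p \<in> carrier P" "q \<in> carrier Q" for a p q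
   using h1(3)[OF that(1,2)] that by simp
  have "bilin MV NV (rs AB X) h" by (rule bilinI) (use sc_AB in "simp_all add: h1(2) h2 sc")
  then obtain k where k: "k \<in> ahom AB T X" "\<forall>m\<in>carrier P. \<forall>n\<in>carrier Q. k (t m n) = h m n"
  proof (rule univ_hom[OF X.is_module])
   show "h (a *[P] m) (b *[Q] n) = (a \<Join> b) *[X] h m n"
    if "a \<in> carrier A" "b \<in> carrier B" "m \<in> carrier P" "n \<in> carrier Q" for a b m n
    using that smult_split(2)[OF X.is_module that(1,2), of "h m n"] by (simp add: sc h2)
  qed
  have gk: "g (k z) = f z" if "z \<in> carrier T" for z
   using that by (induction z rule: T_induct) (simp_all add: k(2) hgt ahomD[OF k(1)] g1 f1)
  show "\<exists>h\<in>Hom AB T X. compose (carrier T) g h = f"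
  proof (rule bexI)
   show "restrict k (carrier T) \<in> Hom AB T X" by (rule restrict_Hom[OF k(1) T.is_module])
   then show "compose (carrier T) g (restrict k (carrier T)) = f"
    using f gk by (intro extensionalityI[of _ "carrier T"]) (auto simp: compose_def Hom_iff)
  qed
 qed (rule Tf)
qed

lemma superfluous_kernel_killed:
 assumes P: "left_module A P" and M: "left_module A M" and p: "p \<in> ahom A P M"
  and sup: "\<forall>H. submodule H A P \<and> H <+>\<^bsub>P\<^esub> a_kernel P M p = carrier P \<longrightarrow> H = carrier P"
  and X: "simple_module A X" and f: "f \<in> ahom A P X" and x: "x \<in> a_kernel P M p"
 shows "f x = 0[X]"
proof (rule ccontr)
 assume fx: "f x \<noteq> 0[X]"
 interpret P: left_module A P by fact
 interpret X: left_module A X using X by (simp add: simple_module_def)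
 interpret p: module_hom A P M p by (rule module_homI[OF P M p])
 interpret f: module_hom A P X f by (rule module_homI[OF P X.is_module f])
 let ?K = "a_kernel P M p" and ?H = "a_kernel P X f"
 have K: "k \<in> carrier P" if "k \<in> ?K" for k using that submoduleD(6)[OF p.kernel_submodule] by simp
 have fK: "f ` ?K = carrier X" by (rule simple_sub[OF X f.image_submodule[OF p.kernel_submodule] _ fx]) (use x in auto)
 have "y \<in> ?H <+>\<^bsub>P\<^esub> ?K" if y: "y \<in> carrier P" for y
 proof -
  have "f y \<in> f ` ?K" using fK y by simp
  then obtain k where k: "f y = f k" "k \<in> ?K" by (rule imageE)
  have kP: "k \<in> carrier P" by (rule K[OF k(2)])
  have "f (y -[P] k) = 0[X]" using y kP k(1) by (simp add: X.minus_eq_zero)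
  then have yk: "y -[P] k \<in> ?H" using y kP by (simp add: f.kernel_eq)
  have "y = (y -[P] k) +[P] k" using y kP by (simp add: a_minus_def P.M.a_assoc P.M.l_neg)
  then show ?thesis unfolding set_add_def' using yk k(2) by blast
 qed
 then have "?H <+>\<^bsub>P\<^esub> ?K = carrier P"
  using submoduleD(1)[OF P.sum_submodule(1)[OF f.kernel_submodule p.kernel_submodule]] by blast
 then have "?H = carrier P" using sup f.kernel_submodule by blast
 then show False using fx K[OF x] by (auto simp: f.kernel_eq)
qed

text \<open>With e = s \<otimes> u, the map z \<mapsto> z - e (h z) sends the generators indexed by
  \<open>D\<close> into \<open>U\<close> and fixes the kernel of \<open>h\<close>. The index set
  \<open>D\<close> lets the lemma apply to a term of a filtration as well as to the whole tensor
  product.\<close>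

lemma vtensor_kernel:
 assumes T: "vtensor V W T t" and T': "vtensor V' W' T' t'"
  and f: "f \<in> lin V V'" and g: "g \<in> lin W W'"
  and s: "s \<in> lin V' V" and u: "u \<in> lin W' W"
  and h: "h \<in> lin T T'" "\<forall>v\<in>carrier V. \<forall>w\<in>carrier W. h (t v w) = t' (f v) (g w)"
  and U: "vsub U T" and D: "D \<subseteq> carrier V \<times> carrier W"
  and DU: "\<And>v w. (v, w) \<in> D \<Longrightarrow> t v w -[T] t (s (f v)) (u (g w)) \<in> U"
  and z: "z \<in> span_of T ((\<lambda>(v, w). t v w) ` D)" "h z = 0[T']"
 shows "z \<in> U"
proof -
 interpret vtensor V W T t by fact
 interpret p: vtensor V' W' T' t' by fact
 interpret h: module_hom field_ring T T' h by (rule module_homI[OF T.is_module p.T.is_module h(1)])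
 obtain e where e: "e \<in> lin T' T" "\<forall>v\<in>carrier V'. \<forall>w\<in>carrier W'. e (t' v w) = t (s v) (u w)"
  by (rule tmap_ex[OF T' T s u])
 interpret e: module_hom field_ring T' T e by (rule module_homI[OF p.T.is_module T.is_module e(1)])
 let ?Z = "{z \<in> carrier T. z -[T] e (h z) \<in> U}"
 note uu = submoduleD[OF U]
 have "vsub ?Z T"
 proof (rule T.submoduleI)
  show "0[T] \<in> ?Z" using uu(2) h.hom_zero e.hom_zero by (simp add: a_minus_def T.M.r_neg)
  fix x y assume xy: "x \<in> ?Z" "y \<in> ?Z"
  then have xy': "x \<in> carrier T" "y \<in> carrier T" by auto
  have "(x +[T] y) -[T] e (h (x +[T] y)) = (x -[T] e (h x)) +[T] (y -[T] e (h y))"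
   using xy' by (simp add: a_minus_def T.M.minus_add T.M.add.m_ac)
  then show "x +[T] y \<in> ?Z" using xy uu(3) xy' by simp
 next
  fix c x assume x: "x \<in> ?Z"
  then have x': "x \<in> carrier T" by simp
  have "(c *[T] x) -[T] e (h (c *[T] x)) = c *[T] (x -[T] e (h x))"
   using x' T.smult_minus_distr[of x "e (h x)" c] by simp
  then show "c *[T] x \<in> ?Z" using x x' uu(5) by simp
 qed auto
 moreover have "(\<lambda>(v, w). t v w) ` D \<subseteq> ?Z"
 proof
  fix y assume "y \<in> (\<lambda>(v, w). t v w) ` D"
  then obtain v w where vw: "(v, w) \<in> D" "y = t v w" by auto
  then have "v \<in> carrier V" "w \<in> carrier W" using D by auto
  then show "y \<in> ?Z" using DU[OF vw(1)] vw(2) h(2) e(2) ahomD(1)[OF f] ahomD(1)[OF g] by simp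
 qed
 moreover have "(\<lambda>(v, w). t v w) ` D \<subseteq> carrier T" using calculation(2) by blast
 ultimately have "z \<in> ?Z" using gen_submodule(3)[OF T.is_module] z(1) by blast
 moreover have "z -[T] 0[T] = z" if "z \<in> carrier T" using T.add_eqI[OF that T.M.zero_closed] that by simp
 ultimately show ?thesis using z(2) e.hom_zero by simp
qed

text \<open>The kernel of f \<otimes> g is ker f \<otimes> N + M \<otimes> ker g. Sections of f and
  g that are linear over the field suffice for this.\<close>

lemma tensor_kernel:
 assumes T: "mtensor A B M N T t" and T': "mtensor A B M' N' T' t'"
  and f: "f \<in> ahom A M M'" "f ` carrier M = carrier M'" and g: "g \<in> ahom B N N'" "g ` carrier N = carrier N'"
  and h: "h \<in> ahom (tensor A B) T T'" "\<forall>m\<in>carrier M. \<forall>n\<in>carrier N. h (t m n) = t' (f m) (g n)"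
  and U: "submodule U (tensor A B) T"
  and U1: "\<And>m n. \<lbrakk>m \<in> a_kernel M M' f; n \<in> carrier N\<rbrakk> \<Longrightarrow> t m n \<in> U"
  and U2: "\<And>m n. \<lbrakk>m \<in> carrier M; n \<in> a_kernel N N' g\<rbrakk> \<Longrightarrow> t m n \<in> U"
  and z: "z \<in> carrier T" "h z = 0[T']"
 shows "z \<in> U"
proof -
 interpret mtensor A B M N T t by fact
 interpret p: mtensor A B M' N' T' t' by fact
 interpret f: module_hom A M M' f by (rule module_homI[OF M.is_module p.M.is_module f(1)])
 interpret g: module_hom B N N' g by (rule module_homI[OF N.is_module p.N.is_module g(1)])
 have fl: "f \<in> lin MV p.MV" by (rule A.rs_ahom[OF f(1)])
 have gl: "g \<in> lin NV p.NV" by (rule B.rs_ahom[OF g(1)])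
 obtain s where s: "s \<in> lin p.MV MV" "\<And>x. x \<in> carrier p.MV \<Longrightarrow> f (s x) = x"
  by (rule M.rs.section_ex[OF p.M.rs.vspace_axioms fl]) (use f(2) in simp, blast)
 obtain u where u: "u \<in> lin p.NV NV" "\<And>x. x \<in> carrier p.NV \<Longrightarrow> g (u x) = x"
  by (rule N.rs.section_ex[OF p.N.rs.vspace_axioms gl]) (use g(2) in simp, blast)
 let ?D = "carrier M \<times> carrier N"
 show ?thesis
 proof (rule vtensor_kernel[OF vt.vtensor_axioms p.vt.vtensor_axioms fl gl s(1) u(1) AB.rs_ahom[OF h(1)]])
  show "vsub U TV" by (rule AB.rs_submodule[OF T.is_module U])
  show "?D \<subseteq> carrier MV \<times> carrier NV" by simp
  fix m n assume "(m, n) \<in> ?D"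
  then have mn: "m \<in> carrier M" "n \<in> carrier N" by auto
  have sm: "s (f m) \<in> carrier M" "u (g n) \<in> carrier N" using mn ahomD(1)[OF s(1)] ahomD(1)[OF u(1)] by simp_all
  have k1: "m -[M] s (f m) \<in> a_kernel M M' f" using mn sm s(2) by (simp add: f.kernel_eq p.M.minus_eq_zero)
  have k2: "n -[N] u (g n) \<in> a_kernel N N' g" using mn sm u(2) by (simp add: g.kernel_eq p.N.minus_eq_zero)
  \<comment> \<open>m \<otimes> n - s f m \<otimes> u g n = (m - s f m) \<otimes> n + s f m
    \<otimes> (n - u g n).\<close>
  have "t m n = t (m -[M] s (f m)) n +[T] t (s (f m)) n"
   using mn sm t_add1[of "m -[M] s (f m)" "s (f m)" n] by (simp add: a_minus_def M.M.a_assoc M.M.l_neg)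
  moreover have "t (s (f m)) n = t (s (f m)) (n -[N] u (g n)) +[T] t (s (f m)) (u (g n))"
   using mn sm t_add2[of "s (f m)" "n -[N] u (g n)" "u (g n)"] by (simp add: a_minus_def N.M.a_assoc N.M.l_neg)
  ultimately have "t m n = (t (m -[M] s (f m)) n +[T] t (s (f m)) (n -[N] u (g n))) +[T] t (s (f m)) (u (g n))"
   using mn sm by (simp add: T.M.a_assoc)
  then have "t m n -[TV] t (s (f m)) (u (g n)) = t (m -[M] s (f m)) n +[T] t (s (f m)) (n -[N] u (g n))"
   using T.M.a_assoc[of _ "t (s (f m)) (u (g n))" "-[T] t (s (f m)) (u (g n))"] mn sm
   by (simp only: a_minus_def minus_restrict_scalars restrict_scalars_simps T.M.r_neg T.M.r_zero t_closed T.M.a_closed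
     M.M.minus_closed N.M.minus_closed T.M.a_inv_closed M.M.a_closed N.M.a_closed M.M.a_inv_closed N.M.a_inv_closed)
  then show "t m n -[TV] t (s (f m)) (u (g n)) \<in> U"
   using U1[OF k1 mn(2)] U2[OF sm(1) k2] submoduleD(3)[OF U] by simp
 next
  have "span_of TV ((\<lambda>(m, n). t m n) ` ?D) = carrier T"
  proof -
   have D: "(\<lambda>(m, n). t m n) ` ?D \<subseteq> carrier TV" by auto
   note G = gen_submodule[OF AB.rs_vspace[OF T.is_module, unfolded vspace_def] D]
   show ?thesis using vt.t_span G(1,2) by (auto simp: subset_iff)
  qed
  then show "z \<in> span_of TV ((\<lambda>(m, n). t m n) ` ?D)" using z(1) by simp
 qed (use h(2) z(2) in simp_all)
qed

lemma tensor_projective_cover: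
 fixes A :: "('f::alg_closed_field, 'a) module" and B :: "('f, 'b) module"
 assumes L: "labels_simples A I L" and K: "labels_simples B J K" and i: "i \<in> I" and j: "j \<in> J"
  and T: "mtensor A B P Q T t" and P: "projective_cover A P (L i)" and Q: "projective_cover B Q (K j)"
  and Tf: "T \<in> fg_modules (tensor A B)"
 shows "projective_cover (tensor A B) T (tensor_module A B (L i) (K j))"
proof -
 interpret mtensor A B P Q T t by fact
 have sL: "simple_module A (L k)" if "k \<in> I" for k using L that by (simp add: labels_simples_def)
 have sK: "simple_module B (K k)" if "k \<in> J" for k using K that by (simp add: labels_simples_def)
 have mp: "mod_pair A B (L k) (K l)" if "k \<in> I" "l \<in> J" for k l
  using simple_fdmod[OF A.fd sL[OF that(1)]] simple_fdmod[OF B.fd sK[OF that(2)]] alg_pair_axioms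
  by (simp add: mod_pair_def fdmod_def)
 interpret X: mod_pair A B "L i" "K j" by (rule mp[OF i j])
 note mX = X.MN_mtensor
 obtain p where p: "p \<in> Epi A P (L i)"
  "\<forall>H. submodule H A P \<and> H <+>\<^bsub>P\<^esub> a_kernel P (L i) p = carrier P \<longrightarrow> H = carrier P"
  using P by (auto simp: projective_cover_def)
 obtain q where q: "q \<in> Epi B Q (K j)"
  "\<forall>H. submodule H B Q \<and> H <+>\<^bsub>Q\<^esub> a_kernel Q (K j) q = carrier Q \<longrightarrow> H = carrier Q"
  using Q by (auto simp: projective_cover_def)
 have pp: "p \<in> ahom A P (L i)" "p ` carrier P = carrier (L i)" using p(1) by (auto simp: Epi_def Hom_iff)
 have qq: "q \<in> ahom B Q (K j)" "q ` carrier Q = carrier (K j)" using q(1) by (auto simp: Epi_def Hom_iff)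
 obtain h where h: "h \<in> ahom AB T X.MN" "\<forall>m\<in>carrier P. \<forall>n\<in>carrier Q. h (t m n) = tens X.MV X.NV (p m) (q n)"
  by (rule tensor_map[OF T mX pp(1) qq(1)])
 let ?h = "restrict h (carrier T)"
 have hE: "?h \<in> Epi AB T X.MN"
  using restrict_Hom[OF h(1) T.is_module] tensor_map_surj[where f = p and g = q and h = h and t = t, OF T mX h pp(2) qq(2)] by (simp add: Epi_def)
 have ker: "a_kernel T X.MN ?h = {z \<in> carrier T. h z = 0[X.MN]}" by (auto simp: a_kernel_def kernel_def)
 show ?thesis unfolding projective_cover_def
 proof (intro conjI bexI[OF _ hE] allI impI)
  show "projective AB T" using tensor_projective[OF T _ _ Tf] P Q by (simp add: projective_cover_def)
  fix H assume H: "submodule H AB T \<and> H <+>\<^bsub>T\<^esub> a_kernel T X.MN ?h = carrier T"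
  show "H = carrier T"
  proof (rule ccontr)
   assume "H \<noteq> carrier T"
   then obtain U where U: "submodule U AB T" "H \<subseteq> U" "U \<noteq> carrier T" "simple_module AB (quot_module T U)"
    using T.simple_quotient_ex[of H] H by metis
   obtain i' j' where ij: "i' \<in> I" "j' \<in> J" "isomorphic AB (quot_module T U) (tensor_module A B (L i') (K j'))"
    by (rule tensor_classify[OF A.fd B.fd L K U(4)])
   interpret Y: mod_pair A B "L i'" "K j'" by (rule mp[OF ij(1,2)])
   interpret mY: mtensor A B "L i'" "K j'" Y.MN "tens Y.MV Y.NV" by (rule Y.MN_mtensor)
   interpret U: sub_module AB T U by (rule sub_module.intro[OF T.is_module sub_module_axioms.intro[OF U(1)]])
   obtain f where f: "f \<in> ahom AB T Y.MN" "f ` carrier T = carrier Y.MN" "\<forall>x\<in>carrier T. f x = 0[Y.MN] \<longleftrightarrow> x \<in> U"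
    using U.quot_isoD[OF ij(3) Y.MN_left_module] by metis
   have fc: "f (t m n) \<in> carrier Y.MN" if "m \<in> carrier P" "n \<in> carrier Q" for m n
    using ahomD(1)[OF f(1)] that by simp
   have 1: "t m n \<in> U" if m: "m \<in> a_kernel P (L i) p" and n: "n \<in> carrier Q" for m n
   proof -
    have mP: "m \<in> carrier P" using m by (simp add: a_kernel_def kernel_def)
    have "mY.vt.slice l (f (t m n)) = 0[L i']" if l: "l \<in> lfun mY.NV" for l
     by (rule superfluous_kernel_killed[OF M.is_module X.M.is_module pp(1) p(2) sL[OF ij(1)]
       ahom_comp[OF ahom_comp[OF t_left_hom[OF n] ahom_res(1)[OF f(1)]] mY.slice_A[OF l]] m])
    then have "f (t m n) = 0[Y.MN]" using mY.slice_nonzero(1)[OF fc[OF mP n]] by blast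
    then show ?thesis using f(3) t_closed[OF mP n] by simp
   qed
   have 2: "t m n \<in> U" if m: "m \<in> carrier P" and n: "n \<in> a_kernel Q (K j) q" for m n
   proof -
    have nQ: "n \<in> carrier Q" using n by (simp add: a_kernel_def kernel_def)
    have "mY.st.slice l (f (t m n)) = 0[K j']" if l: "l \<in> lfun mY.MV" for l
     by (rule superfluous_kernel_killed[OF N.is_module X.N.is_module qq(1) q(2) sK[OF ij(2)]
       ahom_comp[OF ahom_comp[OF t_right_hom[OF m] ahom_res(2)[OF f(1)]] mY.slice_B[OF l]] n])
    then have "f (t m n) = 0[Y.MN]" using mY.slice_nonzero(2)[OF fc[OF m nQ]] by blast
    then show ?thesis using f(3) t_closed[OF m nQ] by simp
   qed
   have kU: "a_kernel T X.MN ?h \<subseteq> U"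
    unfolding ker using tensor_kernel[where f = p and g = q and h = h and t = t, OF T mX pp qq h U(1) 1 2] by blast
   have "carrier T \<subseteq> U"
   proof
    fix z assume "z \<in> carrier T"
    then have "z \<in> H <+>\<^bsub>T\<^esub> a_kernel T X.MN ?h" using H by simp
    then obtain x y where "x \<in> H" "y \<in> a_kernel T X.MN ?h" "z = x +[T] y" unfolding set_add_def' by blast
    then show "z \<in> U" using U(2) kU submoduleD(3)[OF U(1)] by blast
   qed
   then show False using U(3) submoduleD(1)[OF U(1)] by blast
  qed
 qed
qed

lemma (in left_module) minus_zero [simp]:
 assumes "x \<in> carrier M" shows "x -[M] 0[M] = x"
proof -
 have "-[M] 0[M] = 0[M]" using smult_neg_one[of "0[M]"] by simp
 then show ?thesis using assms by (simp add: a_minus_def)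
qed

section \<open>Filtrations of tensor products\<close>

lemma has_filtration_zero:
 assumes "left_module R M" "submodule U R M" "U = {0[M]}"
 shows "has_filtration R (M\<lparr>carrier := U\<rparr>) J X"
proof -
 have s: "submodule U R (M\<lparr>carrier := U\<rparr>)" using submodule_sub[OF assms(1,2), of U] assms(2) by simp
 show ?thesis unfolding has_filtration_def by (intro exI[of _ "0::nat"] exI[of _ "\<lambda>_. U"]) (use s assms(3) in simp)
qed

lemma has_filtration_step:
 assumes M: "left_module R M" and U: "submodule U R M" and W: "submodule W R M" "U \<subseteq> W"
  and fil: "has_filtration R (M\<lparr>carrier := U\<rparr>) J X"
  and j: "j \<in> J" "isomorphic R (quot_module (M\<lparr>carrier := W\<rparr>) U) (X j)"
 shows "has_filtration R (M\<lparr>carrier := W\<rparr>) J X"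
proof -
 obtain n F where F: "F 0 = {0[M]}" "F n = U" "\<forall>k\<le>n. submodule (F k) R (M\<lparr>carrier := U\<rparr>)"
  "\<forall>k<n. F k \<subseteq> F (Suc k) \<and> (\<exists>j\<in>J. isomorphic R (quot_module (M\<lparr>carrier := F (Suc k)\<rparr>) (F k)) (X j))"
  using fil by (auto simp: has_filtration_def)
 let ?F = "\<lambda>k. if k \<le> n then F k else W"
 show ?thesis unfolding has_filtration_def
 proof (intro exI[of _ "Suc n"] exI[of _ ?F] conjI allI impI)
  fix k assume "k \<le> Suc n"
  then show "submodule (?F k) R (M\<lparr>carrier := W\<rparr>)"
   using F(3) W by (auto simp: submodule_sub[OF M U] submodule_sub[OF M W(1)])
 next
  fix k assume "k < Suc n"
  then show "?F k \<subseteq> ?F (Suc k)" using F(2,4) W(2) by (auto simp: less_Suc_eq)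
  show "\<exists>j\<in>J. isomorphic R (quot_module (M\<lparr>carrier := W, carrier := ?F (Suc k)\<rparr>) (?F k)) (X j)"
   using \<open>k < Suc n\<close> F(2,4) j by (cases "k = n") auto
 qed (use F in auto)
qed

lemma has_filtration_mono: "\<lbrakk>has_filtration R M I X; I \<subseteq> J\<rbrakk> \<Longrightarrow> has_filtration R M J X"
 unfolding has_filtration_def by (elim exE conjE, intro exI conjI allI impI) (assumption | simp | fast)+

text \<open>A filtration with explicit layer maps: \<open>\<phi> k\<close> has kernel
  \<open>F k\<close>. There are n + 1 layers. In the uses below the last one is the given quotient
  of M, and the first n filter the kernel \<open>F n\<close>.\<close>

definition chain :: "('r, 'd) ring_scheme \<Rightarrow> ('r, 'm) module \<Rightarrow> nat \<Rightarrow> (nat \<Rightarrow> 'm set) \<Rightarrow> (nat \<Rightarrow> 'i)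
  \<Rightarrow> (nat \<Rightarrow> 'm \<Rightarrow> 'x) \<Rightarrow> ('i \<Rightarrow> ('r, 'x) module) \<Rightarrow> bool" where
 "chain R M n F lab \<phi> X \<longleftrightarrow> F 0 = {0[M]} \<and> F (Suc n) = carrier M \<and> (\<forall>k\<le>Suc n. submodule (F k) R M) \<and>
  (\<forall>k\<le>n. F k \<subseteq> F (Suc k) \<and> \<phi> k \<in> ahom R (M\<lparr>carrier := F (Suc k)\<rparr>) (X (lab k)) \<and>
    \<phi> k ` F (Suc k) = carrier (X (lab k)) \<and> (\<forall>m\<in>F (Suc k). \<phi> k m = 0[X (lab k)] \<longleftrightarrow> m \<in> F k))"

lemma filtration_chain:
 assumes M: "left_module R M" and X: "\<And>j. j \<in> insert i J \<Longrightarrow> left_module R (X j)"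
  and f: "f \<in> ahom R M (X i)" "f ` carrier M = carrier (X i)"
  and fil: "has_filtration R (kernel_module M (X i) f) J X"
 obtains n F lab \<phi> where "chain R M n F lab \<phi> X" "F n = a_kernel M (X i) f" "lab n = i" "\<forall>k<n. lab k \<in> J"
proof -
 interpret f: module_hom R M "X i" f by (rule module_homI[OF M X f(1)]) simp
 let ?K = "a_kernel M (X i) f"
 obtain n F where F: "F 0 = {0[M]}" "F n = ?K" "\<forall>k\<le>n. submodule (F k) R (M\<lparr>carrier := ?K\<rparr>)"
  "\<forall>k<n. F k \<subseteq> F (Suc k) \<and> (\<exists>j\<in>J. isomorphic R (quot_module (M\<lparr>carrier := F (Suc k)\<rparr>) (F k)) (X j))"
  using fil unfolding has_filtration_def kernel_module_def by auto
 have sub: "submodule (F k) R M" if "k \<le> n" for k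
  using F(3) that by (simp add: submodule_sub[OF M f.kernel_submodule])
 have "\<exists>p. k < n \<longrightarrow> fst p \<in> J \<and> snd p \<in> ahom R (M\<lparr>carrier := F (Suc k)\<rparr>) (X (fst p)) \<and>
   snd p ` F (Suc k) = carrier (X (fst p)) \<and> (\<forall>m\<in>F (Suc k). snd p m = 0[X (fst p)] \<longleftrightarrow> m \<in> F k)" for k
 proof (cases "k < n")
  case True
  then obtain j where j: "j \<in> J" "isomorphic R (quot_module (M\<lparr>carrier := F (Suc k)\<rparr>) (F k)) (X j)" using F(4) by blast
  have s: "submodule (F k) R (M\<lparr>carrier := F (Suc k)\<rparr>)"
   using sub[of k] F(4) True by (simp add: submodule_sub[OF M sub[of "Suc k"]])
  interpret s: sub_module R "M\<lparr>carrier := F (Suc k)\<rparr>" "F k"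
   by (rule sub_module.intro[OF submodule_left_module[OF M sub] sub_module_axioms.intro[OF s]]) (use True in simp)
  obtain g where "g \<in> ahom R (M\<lparr>carrier := F (Suc k)\<rparr>) (X j)" "g ` carrier (M\<lparr>carrier := F (Suc k)\<rparr>) = carrier (X j)"
   "\<forall>x\<in>carrier (M\<lparr>carrier := F (Suc k)\<rparr>). g x = 0[X j] \<longleftrightarrow> x \<in> F k"
   using s.quot_isoD[OF j(2) X] j(1) by (metis insertI2)
  then show ?thesis using j(1) by (intro exI[of _ "(j, g)"]) simp
 qed auto
 then obtain P where P: "\<And>k. k < n \<Longrightarrow> fst (P k) \<in> J \<and> snd (P k) \<in> ahom R (M\<lparr>carrier := F (Suc k)\<rparr>) (X (fst (P k))) \<and>
   snd (P k) ` F (Suc k) = carrier (X (fst (P k))) \<and> (\<forall>m\<in>F (Suc k). snd (P k) m = 0[X (fst (P k))] \<longleftrightarrow> m \<in> F k)"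
  by metis
 \<comment> \<open>The filtration of the kernel is prolonged by one layer, with label i and with f
   itself as layer map.\<close>
 let ?F = "\<lambda>k. if k \<le> n then F k else carrier M"
 let ?l = "\<lambda>k. if k < n then fst (P k) else i" and ?p = "\<lambda>k. if k < n then snd (P k) else f"
 have K: "m \<in> ?K \<longleftrightarrow> f m = 0[X i]" if "m \<in> carrier M" for m using that by (simp add: f.kernel_eq)
 have "chain R M n ?F ?l ?p X" unfolding chain_def
 proof (intro conjI allI impI)
  fix k assume "k \<le> Suc n"
  then show "submodule (?F k) R M" using sub f.M.carrier_submodule by auto
 next
  fix k assume k: "k \<le> n"
  show "?F k \<subseteq> ?F (Suc k)" using k F(4) submoduleD(1)[OF sub] by (auto simp: Suc_le_eq)
  show "?p k \<in> ahom R (M\<lparr>carrier := ?F (Suc k)\<rparr>) (X (?l k))" using k P[of k] f(1) by (auto simp: Suc_le_eq)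
  show "?p k ` ?F (Suc k) = carrier (X (?l k))" using k P[of k] f(2) by (auto simp: Suc_le_eq)
  show "\<forall>m\<in>?F (Suc k). ?p k m = 0[X (?l k)] \<longleftrightarrow> m \<in> ?F k"
  proof (cases "k < n")
   case True then show ?thesis using P[of k] by (simp add: Suc_le_eq)
  next
   case False
   then have "k = n" using k by simp
   then show ?thesis using F(2) K by simp
  qed
 qed (use F in auto)
 then show ?thesis by (rule that) (use F P in auto)
qed

section \<open>The lexicographic filtration of an outer tensor product\<close>

context mtensor
begin

text \<open>Generators of F0 \<otimes> N + F1 \<otimes> G. With F0, F1 consecutive in a filtration
  of M and G running through one of N, these sums are the terms of the lexicographic
  filtration.\<close>

definition gens :: "'m set \<Rightarrow> 'm set \<Rightarrow> 'n set \<Rightarrow> ('m \<times> 'n) set" where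
 "gens F0 F1 G = F0 \<times> carrier N \<union> F1 \<times> G"

definition tspan :: "('m \<times> 'n) set \<Rightarrow> 't set" where
 "tspan D = span_of TV ((\<lambda>(m, n). t m n) ` D)"

lemma tspan:
 assumes "D \<subseteq> carrier M \<times> carrier N"
 shows "submodule (tspan D) field_ring TV" "(m, n) \<in> D \<Longrightarrow> t m n \<in> tspan D"
  "\<lbrakk>vsub H TV; \<And>m n. (m, n) \<in> D \<Longrightarrow> t m n \<in> H\<rbrakk> \<Longrightarrow> tspan D \<subseteq> H"
proof -
 have D: "(\<lambda>(m, n). t m n) ` D \<subseteq> carrier TV" using assms by auto
 note G = gen_submodule[OF AB.rs_vspace[OF T.is_module, unfolded vspace_def] D]
 show "submodule (tspan D) field_ring TV" unfolding tspan_def by (rule G(1))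
 show "t m n \<in> tspan D" if "(m, n) \<in> D" using G(2) that unfolding tspan_def by blast
 show "tspan D \<subseteq> H" if "vsub H TV" "\<And>m n. (m, n) \<in> D \<Longrightarrow> t m n \<in> H"
  unfolding tspan_def by (rule G(3)) (use that in auto)
qed

lemma tspan_mono: "\<lbrakk>D \<subseteq> E; E \<subseteq> carrier M \<times> carrier N\<rbrakk> \<Longrightarrow> tspan D \<subseteq> tspan E"
proof -
 assume DE: "D \<subseteq> E" "E \<subseteq> carrier M \<times> carrier N"
 then have D: "D \<subseteq> carrier M \<times> carrier N" by blast
 show "tspan D \<subseteq> tspan E" by (rule tspan(3)[OF D tspan(1)[OF DE(2)]]) (use tspan(2)[OF DE(2)] DE(1) in auto)
qed

text \<open>\<open>tspan\<close> is a span over the field only; stability of the generating pairs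
  makes it stable under pure tensors a \<otimes> b, and these span the algebra.\<close>

lemma tspan_AB:
 assumes D: "D \<subseteq> carrier M \<times> carrier N"
  and st: "\<And>a b m n. \<lbrakk>a \<in> carrier A; b \<in> carrier B; (m, n) \<in> D\<rbrakk> \<Longrightarrow> (a *[M] m, b *[N] n) \<in> D"
 shows "submodule (tspan D) AB T"
proof -
 note s = tspan[OF D] and u = submoduleD[OF tspan(1)[OF D], simplified]
 let ?H = "{z \<in> carrier T. \<forall>r\<in>carrier AB. r *[T] z \<in> tspan D}"
 have "vsub ?H TV"
 proof (rule vt.T.submoduleI)
  show "c *[TV] z \<in> ?H" if z: "z \<in> ?H" for c z
  proof -
   have "r *[T] (AB.sc c *[T] z) \<in> tspan D" if "r \<in> carrier AB" for r
   proof -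
    have "r *[T] (AB.sc c *[T] z) = AB.sc c *[T] (r *[T] z)"
     using that z by (simp add: AB.sc_simps flip: T.smult_assoc1)
    then show ?thesis using u(5)[where a = c and x = "r *[T] z"] z that by simp
   qed
   then show ?thesis using z by simp
  qed
 qed (use u in "auto simp: T.smult_r_distr")
 moreover have "t m n \<in> ?H" if mn: "(m, n) \<in> D" for m n
 proof -
  have mn': "m \<in> carrier M" "n \<in> carrier N" using mn D by auto
  have "r *[T] t m n \<in> tspan D" if "r \<in> carrier AB" for r using that
  proof (induction r rule: ts.vt.T_induct)
   case (tens a b) then show ?case using act[OF tens mn'] s(2)[OF st[OF tens mn]] by simp
  next
   case (add x y) then show ?case using mn' u(3) by (simp add: T.smult_l_distr)
  qed
  then show ?thesis using mn' by simp
 qed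
 ultimately have "tspan D \<subseteq> ?H" by (rule s(3))
 then show ?thesis by (intro T.submoduleI) (use u in auto)
qed

lemma gens_stable:
 assumes "submodule F0 A M" "submodule F1 A M" "submodule G B N" "a \<in> carrier A" "b \<in> carrier B" "(m, n) \<in> gens F0 F1 G"
 shows "(a *[M] m, b *[N] n) \<in> gens F0 F1 G"
 using assms(4-6) submoduleD(5)[OF assms(1)] submoduleD(5)[OF assms(2)] submoduleD(5)[OF assms(3)]
 by (auto simp: gens_def)

lemma gens_subset:
 assumes "submodule F0 A M" "submodule F1 A M" "submodule G B N"
 shows "gens F0 F1 G \<subseteq> carrier M \<times> carrier N"
 using submoduleD(1)[OF assms(1)] submoduleD(1)[OF assms(2)] submoduleD(1)[OF assms(3)] by (auto simp: gens_def)

lemma tspan_gens_AB: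
 assumes "submodule F0 A M" "submodule F1 A M" "submodule G B N"
 shows "submodule (tspan (gens F0 F1 G)) AB T" by (rule tspan_AB[OF gens_subset[OF assms] gens_stable[OF assms]])

text \<open>The layer is (F1/F0) \<otimes> (G1/G0). Since f and g are given on F1 and G1 only, they
  are extended to M and N linearly over the field; the product h of the extensions is then shown to
  be linear over A \<otimes> B on the larger term of the filtration.\<close>

lemma tspan_step:
 assumes X: "mtensor A B X1 X2 X x"
  and F0: "submodule F0 A M" and F1: "submodule F1 A M" and F01: "F0 \<subseteq> F1"
  and G0: "submodule G0 B N" and G1: "submodule G1 B N" and G01: "G0 \<subseteq> G1"
  and f: "f \<in> ahom A (M\<lparr>carrier := F1\<rparr>) X1" "f ` F1 = carrier X1" "\<forall>m\<in>F1. f m = 0[X1] \<longleftrightarrow> m \<in> F0"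
  and g: "g \<in> ahom B (N\<lparr>carrier := G1\<rparr>) X2" "g ` G1 = carrier X2" "\<forall>n\<in>G1. g n = 0[X2] \<longleftrightarrow> n \<in> G0"
 shows "isomorphic AB (quot_module (T\<lparr>carrier := tspan (gens F0 F1 G1)\<rparr>) (tspan (gens F0 F1 G0))) X"
proof -
 interpret x: mtensor A B X1 X2 X x by fact
 let ?D = "gens F0 F1 G1" and ?E = "gens F0 F1 G0"
 let ?U = "tspan ?D" and ?W = "tspan ?E"
 note F0D = submoduleD[OF F0] and F1D = submoduleD[OF F1] and G0D = submoduleD[OF G0] and G1D = submoduleD[OF G1]
 note D = gens_subset[OF F0 F1 G1] and D0 = gens_subset[OF F0 F1 G0]
 note U = tspan_gens_AB[OF F0 F1 G1] and U0 = tspan_gens_AB[OF F0 F1 G0]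
 have U0U: "?W \<subseteq> ?U" by (rule tspan_mono[OF _ D]) (use G01 in "auto simp: gens_def")
 note f1 = ahomD[OF f(1), simplified] and g1 = ahomD[OF g(1), simplified]
 interpret MF: fdspace "MV\<lparr>carrier := F1\<rparr>"
  by (rule fdspace_sub[OF M.rs.fdspace_axioms A.rs_submodule[OF M.is_module F1]])
 interpret NG: fdspace "NV\<lparr>carrier := G1\<rparr>"
  by (rule fdspace_sub[OF N.rs.fdspace_axioms B.rs_submodule[OF N.is_module G1]])
 have fl: "f \<in> lin (MV\<lparr>carrier := F1\<rparr>) x.MV" using A.rs_ahom[OF f(1)] by simp
 have gl: "g \<in> lin (NV\<lparr>carrier := G1\<rparr>) x.NV" using B.rs_ahom[OF g(1)] by simp
 obtain f' where f': "f' \<in> lin MV x.MV" "\<And>m. m \<in> F1 \<Longrightarrow> f' m = f m"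
  by (rule M.rs.extend[OF A.rs_submodule[OF M.is_module F1] x.M.rs.vspace_axioms fl]) blast
 obtain g' where g': "g' \<in> lin NV x.NV" "\<And>m. m \<in> G1 \<Longrightarrow> g' m = g m"
  by (rule N.rs.extend[OF B.rs_submodule[OF N.is_module G1] x.N.rs.vspace_axioms gl]) blast
 obtain s where s: "s \<in> lin x.MV (MV\<lparr>carrier := F1\<rparr>)" "\<And>y. y \<in> carrier x.MV \<Longrightarrow> f (s y) = y"
  by (rule MF.section_ex[OF x.M.rs.vspace_axioms fl]) (use f(2) in simp, blast)
 obtain u where u: "u \<in> lin x.NV (NV\<lparr>carrier := G1\<rparr>)" "\<And>y. y \<in> carrier x.NV \<Longrightarrow> g (u y) = y"
  by (rule NG.section_ex[OF x.N.rs.vspace_axioms gl]) (use g(2) in simp, blast)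
 have sM: "s \<in> lin x.MV MV" using ahom_comp[OF s(1) incl_ahom[OF A.rs_submodule[OF M.is_module F1]]] by simp
 have uN: "u \<in> lin x.NV NV" using ahom_comp[OF u(1) incl_ahom[OF B.rs_submodule[OF N.is_module G1]]] by simp
 have sF: "s y \<in> F1" if "y \<in> carrier X1" for y using ahomD(1)[OF s(1)] that by simp
 have uG: "u y \<in> G1" if "y \<in> carrier X2" for y using ahomD(1)[OF u(1)] that by simp
 obtain h where h: "h \<in> lin TV x.TV" "\<forall>m\<in>carrier MV. \<forall>n\<in>carrier NV. h (t m n) = x (f' m) (g' n)"
  by (rule tmap_ex[OF vt.vtensor_axioms x.vt.vtensor_axioms f'(1) g'(1)])
 interpret h: module_hom field_ring TV x.TV h by (rule module_homI[OF vt.T.is_module x.vt.T.is_module h(1)])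
 have f'c: "f' m \<in> carrier X1" if "m \<in> carrier M" for m using ahomD(1)[OF f'(1)] that by simp
 have g'c: "g' n \<in> carrier X2" if "n \<in> carrier N" for n using ahomD(1)[OF g'(1)] that by simp
 have hF0: "h (t m n) = 0[X]" if "m \<in> F0" "n \<in> carrier N" for m n
 proof -
  have "f' m = 0[X1]" using f'(2) f(3) F01 that(1) by auto
  then show ?thesis using h(2) that F0D(6) g'c by simp
 qed
 have hFG: "h (t m n) = x (f m) (g n)" if "m \<in> F1" "n \<in> G1" for m n
  using h(2) that F1D(6) G1D(6) f'(2) g'(2) by simp
 have hT: "h z \<in> carrier X" if "z \<in> carrier T" for z using h.hom_simps(1)[of z] that by simp
 have Ucl: "z \<in> carrier T" if "z \<in> ?U" for z using submoduleD(6)[OF U that] .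
 \<comment> \<open>A generator with m in F0 is killed by h together with its multiples, whatever the
   extension of g does. The other generators lie in F1 \<times> G1, where f and g are
   homomorphisms.\<close>
 have hlin: "?U \<subseteq> {z \<in> carrier T. \<forall>r\<in>carrier AB. h (r *[T] z) = r *[X] h z}"
 proof (rule tspan(3)[OF D])
  show "submodule {z \<in> carrier T. \<forall>r\<in>carrier AB. h (r *[T] z) = r *[X] h z} field_ring TV"
  proof (rule vt.T.submoduleI)
   fix c z assume z: "z \<in> {z \<in> carrier T. \<forall>r\<in>carrier AB. h (r *[T] z) = r *[X] h z}"
   then have zT: "z \<in> carrier T" by simp
   have "h (r *[T] (AB.sc c *[T] z)) = r *[X] h (AB.sc c *[T] z)" if r: "r \<in> carrier AB" for r
   proof -
    have "r *[T] (AB.sc c *[T] z) = AB.sc c *[T] (r *[T] z)"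
     using r zT by (simp add: AB.sc_simps flip: T.smult_assoc1)
    moreover have "r *[X] (AB.sc c *[X] h z) = AB.sc c *[X] (r *[X] h z)"
     using r hT[OF zT] by (simp add: AB.sc_simps flip: x.T.smult_assoc1)
    ultimately show ?thesis using h.hom_simps(3)[of c z] h.hom_simps(3)[of c "r *[T] z"] z r by simp
   qed
   then show "c *[TV] z \<in> {z \<in> carrier T. \<forall>r\<in>carrier AB. h (r *[T] z) = r *[X] h z}" using zT by simp
  qed (use h.hom_zero h.hom_simps(2) hT in "auto simp: T.smult_r_distr x.T.smult_r_distr")
  fix m n assume mn: "(m, n) \<in> ?D"
  have mn': "m \<in> carrier M" "n \<in> carrier N" using mn D by auto
  have "h (r *[T] t m n) = r *[X] h (t m n)" if "r \<in> carrier AB" for r using that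
  proof (induction r rule: ts.vt.T_induct)
   case (tens a b)
   show ?case
   proof (cases "m \<in> F0")
    case True
    then have "a *[M] m \<in> F0" using F0D(5) tens by simp
    then show ?thesis using True tens mn' hF0 act by simp
   next
    case False
    then have m: "m \<in> F1" "n \<in> G1" using mn by (auto simp: gens_def)
    then have "a *[M] m \<in> F1" "b *[N] n \<in> G1" using F1D(5) G1D(5) tens by simp_all
    then show ?thesis using m tens mn' hFG act f1 g1 x.act by simp
   qed
  next
   case (add r q)
   then show ?case using mn' h.hom_simps(2) hT by (simp add: T.smult_l_distr x.T.smult_l_distr)
  qed
  then show "t m n \<in> {z \<in> carrier T. \<forall>r\<in>carrier AB. h (r *[T] z) = r *[X] h z}" using mn' by simp
 qed
 have hU: "h \<in> ahom AB (T\<lparr>carrier := ?U\<rparr>) X" by (rule ahomI) (use hlin hT Ucl h.hom_simps(2) in auto)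
 interpret hU: module_hom AB "T\<lparr>carrier := ?U\<rparr>" X h
  by (rule module_homI[OF submodule_left_module[OF T.is_module U] x.T.is_module hU])
 have surj: "h ` ?U = carrier X"
 proof (rule x.span_AB)
  show "submodule (h ` ?U) AB X" using hU.image_submodule[OF hU.M.carrier_submodule] by simp
  fix m n assume mn: "m \<in> carrier X1" "n \<in> carrier X2"
  have "t (s m) (u n) \<in> ?U" by (rule tspan(2)[OF D]) (use sF uG mn in "simp add: gens_def")
  moreover have "h (t (s m) (u n)) = x m n" using hFG sF uG s(2) u(2) mn by simp
  ultimately show "x m n \<in> h ` ?U" by (metis imageI)
 qed
 have ker0: "?W \<subseteq> {z \<in> carrier T. h z = 0[X]}"
 proof (rule tspan(3)[OF D0])
  show "submodule {z \<in> carrier T. h z = 0[X]} field_ring TV"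
   using h.kernel_submodule unfolding h.kernel_eq by simp
  fix m n assume mn: "(m, n) \<in> ?E"
  have mn': "m \<in> carrier M" "n \<in> carrier N" using mn D0 by auto
  show "t m n \<in> {z \<in> carrier T. h z = 0[X]}"
  proof (cases "m \<in> F0")
   case False
   then have m: "m \<in> F1" "n \<in> G0" using mn by (auto simp: gens_def)
   then have "g n = 0[X2]" using g(3) G01 by auto
   then show ?thesis using hFG[of m n] m G01 mn' f1(1) by auto
  qed (use hF0 mn' in simp)
 qed
 have ker1: "z \<in> ?W" if z: "z \<in> ?U" "h z = 0[X]" for z
 proof (rule vtensor_kernel[OF vt.vtensor_axioms x.vt.vtensor_axioms f'(1) g'(1) sM uN h tspan(1)[OF D0], where D = ?D])
  show "?D \<subseteq> carrier MV \<times> carrier NV" using D by simp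
  show "z \<in> span_of TV ((\<lambda>(v, w). t v w) ` ?D)" using z(1) by (simp add: tspan_def)
  show "h z = 0[x.TV]" using z(2) by simp
  fix m n assume mn: "(m, n) \<in> ?D"
  have mn': "m \<in> carrier M" "n \<in> carrier N" using mn D by auto
  note u0 = submoduleD[OF tspan(1)[OF D0], simplified]
  show "t m n -[TV] t (s (f' m)) (u (g' n)) \<in> ?W"
  proof (cases "m \<in> F0")
   case True
   have "f' m = 0[X1]" using f'(2) f(3) F01 True by auto
   then have "s (f' m) = 0[M]"
    using module_hom.hom_zero[OF module_homI[OF x.M.rs.is_module M.rs.is_module sM]] by simp
   then have "t m n -[TV] t (s (f' m)) (u (g' n)) = t m n"
    using mn' ahomD(1)[OF uN, of "g' n"] g'c vt.T.minus_zero[of "t m n"] by simp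
   moreover have "t m n \<in> ?W" by (rule tspan(2)[OF D0]) (use True mn' in "simp add: gens_def")
   ultimately show ?thesis by simp
  next
   case False
   then have m: "m \<in> F1" "n \<in> G1" using mn by (auto simp: gens_def)
   have e: "f' m = f m" "g' n = g n" using f'(2) g'(2) m by auto
   let ?s = "s (f m)" and ?u = "u (g n)"
   have sm: "?s \<in> F1" "?u \<in> G1" using sF uG f1(1) g1(1) m by auto
   have sm': "?s \<in> carrier M" "?u \<in> carrier N" using sm F1D(6) G1D(6) by auto
   interpret fh: module_hom A "M\<lparr>carrier := F1\<rparr>" X1 f
    by (rule module_homI[OF submodule_left_module[OF M.is_module F1] x.M.is_module f(1)])
   interpret gh: module_hom B "N\<lparr>carrier := G1\<rparr>" X2 g
    by (rule module_homI[OF submodule_left_module[OF N.is_module G1] x.N.is_module g(1)])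
   have "f (m +[M] (-[A] 1[A]) *[M] ?s) = 0[X1]"
    using m sm f1 s(2) F1D(5)[of "-[A] 1[A]" ?s] x.M.smult_neg_one[of "f m"] by (simp add: x.M.M.r_neg)
   moreover have "m +[M] (-[A] 1[A]) *[M] ?s \<in> F1" using m sm F1D(3,5) by simp
   ultimately have "m +[M] (-[A] 1[A]) *[M] ?s \<in> F0" using f(3) by blast
   then have k1: "m -[M] ?s \<in> F0" using M.smult_neg_one[OF sm'(1)] by (simp add: a_minus_def)
   have "g (n +[N] (-[B] 1[B]) *[N] ?u) = 0[X2]"
    using m sm g1 u(2) G1D(5)[of "-[B] 1[B]" ?u] x.N.smult_neg_one[of "g n"] by (simp add: x.N.M.r_neg)
   moreover have "n +[N] (-[B] 1[B]) *[N] ?u \<in> G1" using m sm G1D(3,5) by simp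
   ultimately have "n +[N] (-[B] 1[B]) *[N] ?u \<in> G0" using g(3) by blast
   then have k2: "n -[N] ?u \<in> G0" using N.smult_neg_one[OF sm'(2)] by (simp add: a_minus_def)
   have "t m n = t (m -[M] ?s) n +[T] t ?s n"
    using mn' sm' t_add1[of "m -[M] ?s" ?s n] by (simp add: a_minus_def M.M.a_assoc M.M.l_neg)
   moreover have "t ?s n = t ?s (n -[N] ?u) +[T] t ?s ?u"
    using mn' sm' t_add2[of ?s "n -[N] ?u" ?u] by (simp add: a_minus_def N.M.a_assoc N.M.l_neg)
   ultimately have "t m n = (t (m -[M] ?s) n +[T] t ?s (n -[N] ?u)) +[T] t ?s ?u"
    using mn' sm' by (simp add: T.M.a_assoc)
   then have "t m n -[TV] t ?s ?u = ((t (m -[M] ?s) n +[T] t ?s (n -[N] ?u)) +[T] t ?s ?u) +[T] -[T] t ?s ?u"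
    by (simp only: a_minus_def minus_restrict_scalars restrict_scalars_simps)
   also have "\<dots> = t (m -[M] ?s) n +[T] t ?s (n -[N] ?u)"
    using mn' sm' by (subst T.M.a_assoc) (simp_all add: T.M.r_neg)
   finally have "t m n -[TV] t ?s ?u = t (m -[M] ?s) n +[T] t ?s (n -[N] ?u)" .
   moreover have "t (m -[M] ?s) n \<in> ?W" by (rule tspan(2)[OF D0]) (use k1 mn' in "simp add: gens_def")
   moreover have "t ?s (n -[N] ?u) \<in> ?W" by (rule tspan(2)[OF D0]) (use k2 sm in "simp add: gens_def")
   ultimately show ?thesis using u0(3) e by simp
  qed
 qed
 have sub: "submodule ?W AB (T\<lparr>carrier := ?U\<rparr>)" using U0 U0U by (simp add: submodule_sub[OF T.is_module U])
 interpret q: sub_module AB "T\<lparr>carrier := ?U\<rparr>" ?W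
  by (rule sub_module.intro[OF submodule_left_module[OF T.is_module U] sub_module_axioms.intro[OF sub]])
 show ?thesis by (rule q.quot_isoI[OF x.T.is_module hU]) (use surj ker0 ker1 in auto)
qed

text \<open>Layers are indexed by pairs (k, l) in lexicographic order. The last layer (n, m) is left
  out: the term below it is the kernel of the map onto the product of the two top quotients.\<close>

lemma tensor_chain:
 assumes c1: "chain A M n F lab \<phi> X1" and c2: "chain B N m G lab' \<psi> X2"
  and X: "\<And>k l. \<lbrakk>k \<le> n; l \<le> m\<rbrakk> \<Longrightarrow> \<exists>x. mtensor A B (X1 (lab k)) (X2 (lab' l)) (X (lab k, lab' l)) x"
  and J: "\<And>k l. \<lbrakk>k \<le> n; l \<le> m; (k, l) \<noteq> (n, m)\<rbrakk> \<Longrightarrow> (lab k, lab' l) \<in> J"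
 shows "has_filtration AB (T\<lparr>carrier := tspan (gens (F n) (carrier M) (G m))\<rparr>) J X"
proof -
 have F: "F 0 = {0[M]}" "F (Suc n) = carrier M" "\<And>k. k \<le> Suc n \<Longrightarrow> submodule (F k) A M" "\<And>k. k \<le> n \<Longrightarrow> F k \<subseteq> F (Suc k)"
  "\<And>k. k \<le> n \<Longrightarrow> \<phi> k \<in> ahom A (M\<lparr>carrier := F (Suc k)\<rparr>) (X1 (lab k))"
  "\<And>k. k \<le> n \<Longrightarrow> \<phi> k ` F (Suc k) = carrier (X1 (lab k))" "\<And>k. k \<le> n \<Longrightarrow> \<forall>m\<in>F (Suc k). \<phi> k m = 0[X1 (lab k)] \<longleftrightarrow> m \<in> F k"
  using c1 by (auto simp: chain_def)
 have G: "G 0 = {0[N]}" "G (Suc m) = carrier N" "\<And>k. k \<le> Suc m \<Longrightarrow> submodule (G k) B N" "\<And>k. k \<le> m \<Longrightarrow> G k \<subseteq> G (Suc k)"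
  "\<And>k. k \<le> m \<Longrightarrow> \<psi> k \<in> ahom B (N\<lparr>carrier := G (Suc k)\<rparr>) (X2 (lab' k))"
  "\<And>k. k \<le> m \<Longrightarrow> \<psi> k ` G (Suc k) = carrier (X2 (lab' k))" "\<And>k. k \<le> m \<Longrightarrow> \<forall>m\<in>G (Suc k). \<psi> k m = 0[X2 (lab' k)] \<longleftrightarrow> m \<in> G k"
  using c2 by (auto simp: chain_def)
 define U where "U k l = tspan (gens (F k) (F (Suc k)) (G l))" for k l
 let ?fil = "\<lambda>U. has_filtration AB (T\<lparr>carrier := U\<rparr>) J X"
 have sub: "submodule (U k l) AB T" if "k \<le> n" "l \<le> Suc m" for k l
  unfolding U_def using that F(3) G(3) by (intro tspan_gens_AB) simp_all
 have step: "?fil (U k (Suc l))" if kl: "k \<le> n" "l \<le> m" "(k, l) \<noteq> (n, m)" and f: "?fil (U k l)" for k l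
 proof (rule has_filtration_step[OF T.is_module sub sub _ f J[OF kl]])
  show "U k l \<subseteq> U k (Suc l)" unfolding U_def
   by (rule tspan_mono[OF _ gens_subset]) (use kl F(3) G(3) G(4)[of l] in "auto simp: gens_def")
  obtain x where x: "mtensor A B (X1 (lab k)) (X2 (lab' l)) (X (lab k, lab' l)) x" using X kl by blast
  show "isomorphic AB (quot_module (T\<lparr>carrier := U k (Suc l)\<rparr>) (U k l)) (X (lab k, lab' l))"
   unfolding U_def using kl by (intro tspan_step[OF x F(3) F(3) F(4) G(3) G(3) G(4) F(5,6,7) G(5,6,7)]) simp_all
 qed (use kl in simp_all)
 \<comment> \<open>Both sides are F (k + 1) \<otimes> N, since G 0 is zero and G (m + 1) is all of
   N.\<close>
 have glue: "U (Suc k) 0 = U k (Suc m)" if "k < n" for k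
 proof (rule equalityI)
  have kk: "k \<le> n" "Suc k \<le> n" using that by simp_all
  have D: "gens (F (Suc k)) (F (Suc (Suc k))) (G 0) \<subseteq> carrier M \<times> carrier N"
   "gens (F k) (F (Suc k)) (G (Suc m)) \<subseteq> carrier M \<times> carrier N" using kk by (intro gens_subset F(3) G(3); simp)+
  note S = submoduleD[OF sub[of k "Suc m"]]
  have z: "0[T] \<in> U k (Suc m)" using S(2) kk by simp
  show "U (Suc k) 0 \<subseteq> U k (Suc m)" unfolding U_def
  proof (rule tspan(3)[OF D(1) tspan(1)[OF D(2)]])
   fix a b assume ab: "(a, b) \<in> gens (F (Suc k)) (F (Suc (Suc k))) (G 0)"
   then have ab': "a \<in> carrier M" "b \<in> carrier N" using D(1) by auto
   show "t a b \<in> tspan (gens (F k) (F (Suc k)) (G (Suc m)))"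
   proof (cases "a \<in> F (Suc k)")
    case True
    then show ?thesis by (intro tspan(2)[OF D(2)]) (use ab' G(2) in "simp add: gens_def")
   next
    case False
    then have "b = 0[N]" using ab G(1) by (auto simp: gens_def)
    then show ?thesis using z ab' by (simp add: U_def)
   qed
  qed
  show "U k (Suc m) \<subseteq> U (Suc k) 0" unfolding U_def
   by (rule tspan_mono[OF _ D(1)]) (use F(4)[OF kk(1)] G(2) submoduleD(1)[OF F(3)[of "Suc k"]] kk in "auto simp: gens_def")
 qed
 have U00: "U 0 0 = {0[T]}"
 proof -
  have D: "gens (F 0) (F (Suc 0)) (G 0) \<subseteq> carrier M \<times> carrier N" by (intro gens_subset F(3) G(3)) simp_all
  have "U 0 0 \<subseteq> {0[T]}" unfolding U_def by (rule tspan(3)[OF D vt.T.zero_submodule[simplified]])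
    (use D F(1) G(1) in "auto simp: gens_def")
  then show ?thesis using submoduleD(2)[OF sub[of 0 0]] by auto
 qed
 \<comment> \<open>Rows before the last are completed up to m + 1; the last row stops at m, which
   omits the layer (n, m).\<close>
 have row: "?fil (U k l)" if k: "k \<le> n" and l: "if k = n then l \<le> m else l \<le> Suc m" and f0: "?fil (U k 0)" for k l
  using l
 proof (induction l)
  case (Suc l)
  have lm: "l \<le> m" "(k, l) \<noteq> (n, m)" using Suc.prems by (auto split: if_splits)
  show ?case by (rule step[OF k lm]) (use Suc lm in "auto split: if_splits")
 qed (rule f0)
 have base: "?fil (U k 0)" if "k \<le> n" for k using that
 proof (induction k)
  case 0
  show ?case by (rule has_filtration_zero[OF T.is_module sub U00]) simp_all
 next
  case (Suc k)
  have "?fil (U k (Suc m))" by (rule row) (use Suc in simp_all)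
  then show ?case using glue[of k] Suc.prems by simp
 qed
 have "?fil (U n m)" by (rule row) (use base in simp_all)
 then show ?thesis using F(2) by (simp add: U_def)
qed

lemma kernel_tspan:
 assumes T': "mtensor A B M' N' T' t'"
  and f: "f \<in> ahom A M M'" "f ` carrier M = carrier M'" and g: "g \<in> ahom B N N'" "g ` carrier N = carrier N'"
  and h: "h \<in> ahom AB T T'" "\<forall>m\<in>carrier M. \<forall>n\<in>carrier N. h (t m n) = t' (f m) (g n)"
 shows "a_kernel T T' h = tspan (gens (a_kernel M M' f) (carrier M) (a_kernel N N' g))"
proof -
 interpret p: mtensor A B M' N' T' t' by fact
 interpret f: module_hom A M M' f by (rule module_homI[OF M.is_module p.M.is_module f(1)])
 interpret g: module_hom B N N' g by (rule module_homI[OF N.is_module p.N.is_module g(1)])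
 interpret h: module_hom AB T T' h by (rule module_homI[OF T.is_module p.T.is_module h(1)])
 let ?D = "gens (a_kernel M M' f) (carrier M) (a_kernel N N' g)"
 note s = f.kernel_submodule M.carrier_submodule g.kernel_submodule
 note D = gens_subset[OF s] and U = tspan_gens_AB[OF s]
 show ?thesis
 proof (rule equalityI)
  show "tspan ?D \<subseteq> a_kernel T T' h" by (rule tspan(3)[OF D AB.rs_submodule[OF T.is_module h.kernel_submodule]])
    (use h(2) in "auto simp: gens_def f.kernel_eq g.kernel_eq h.kernel_eq")
  show "a_kernel T T' h \<subseteq> tspan ?D"
  proof
   fix z assume "z \<in> a_kernel T T' h"
   then have z: "z \<in> carrier T" "h z = 0[T']" by (auto simp: h.kernel_eq)
   show "z \<in> tspan ?D"
    by (rule tensor_kernel[where f = f and g = g and h = h and t = t, OF mtensor_axioms T' f g h U _ _ z];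
      rule tspan(2)[OF D]) (auto simp: gens_def f.kernel_eq)
  qed
 qed
qed

end

lemma kernel_restrict: "a_kernel M N (restrict f (carrier M)) = a_kernel M N f"
 by (auto simp: a_kernel_def kernel_def)

text \<open>As i and j label the top layers only, the pair (i, j) belongs to the omitted layer
  alone; hence the label set is the product with that pair removed.\<close>

lemma tensor_filtration:
 assumes T: "mtensor A B M N T t"
  and i: "i \<in> I" and j: "j \<in> J" and I0: "I0 \<subseteq> I" "i \<notin> I0" and J0: "J0 \<subseteq> J" "j \<notin> J0"
  and X: "\<And>i j. \<lbrakk>i \<in> I; j \<in> J\<rbrakk> \<Longrightarrow> \<exists>x. mtensor A B (X1 i) (X2 j) (X (i, j)) x"
  and f: "f \<in> Epi A M (X1 i)" "has_filtration A (kernel_module M (X1 i) f) I0 X1"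
  and g: "g \<in> Epi B N (X2 j)" "has_filtration B (kernel_module N (X2 j) g) J0 X2"
 obtains h where "h \<in> Epi (tensor A B) T (X (i, j))"
  "has_filtration (tensor A B) (kernel_module T (X (i, j)) h) (insert i I0 \<times> insert j J0 - {(i, j)}) X"
proof -
 interpret mtensor A B M N T t by fact
 obtain x where x: "mtensor A B (X1 i) (X2 j) (X (i, j)) x" using X[OF i j] by blast
 have lX1: "left_module A (X1 k)" if k: "k \<in> insert i I0" for k
 proof -
  obtain y where "mtensor A B (X1 k) (X2 j) (X (k, j)) y" using X[of k j] k I0 i j by blast
  then interpret y: mtensor A B "X1 k" "X2 j" "X (k, j)" y .
  show ?thesis by (rule y.M.is_module)
 qed
 have lX2: "left_module B (X2 k)" if k: "k \<in> insert j J0" for k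
 proof -
  obtain y where "mtensor A B (X1 i) (X2 k) (X (i, k)) y" using X[of i k] k J0 i j by blast
  then interpret y: mtensor A B "X1 i" "X2 k" "X (i, k)" y .
  show ?thesis by (rule y.N.is_module)
 qed
 have ff: "f \<in> ahom A M (X1 i)" "f ` carrier M = carrier (X1 i)" using f(1) by (auto simp: Epi_def Hom_iff)
 have gg: "g \<in> ahom B N (X2 j)" "g ` carrier N = carrier (X2 j)" using g(1) by (auto simp: Epi_def Hom_iff)
 obtain n F lab \<phi> where c1: "chain A M n F lab \<phi> X1" "F n = a_kernel M (X1 i) f" "lab n = i" "\<forall>k<n. lab k \<in> I0"
  by (rule filtration_chain[OF M.is_module lX1 ff f(2)])
 obtain m G lab' \<psi> where c2: "chain B N m G lab' \<psi> X2" "G m = a_kernel N (X2 j) g" "lab' m = j" "\<forall>k<m. lab' k \<in> J0"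
  by (rule filtration_chain[OF N.is_module lX2 gg g(2)])
 have l1: "lab k \<in> insert i I0" "lab k = i \<longleftrightarrow> k = n" if "k \<le> n" for k
 proof -
  have "k = n \<or> lab k \<in> I0" using c1(4) that le_neq_implies_less by blast
  then show "lab k \<in> insert i I0" "lab k = i \<longleftrightarrow> k = n" using c1(3) I0(2) by blast+
 qed
 have l2: "lab' k \<in> insert j J0" "lab' k = j \<longleftrightarrow> k = m" if "k \<le> m" for k
 proof -
  have "k = m \<or> lab' k \<in> J0" using c2(4) that le_neq_implies_less by blast
  then show "lab' k \<in> insert j J0" "lab' k = j \<longleftrightarrow> k = m" using c2(3) J0(2) by blast+
 qed
 obtain h where h: "h \<in> ahom AB T (X (i, j))" "\<forall>m\<in>carrier M. \<forall>n\<in>carrier N. h (t m n) = x (f m) (g n)"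
  by (rule tensor_map[OF T x ff(1) gg(1)])
 let ?J = "insert i I0 \<times> insert j J0 - {(i, j)}"
 have fil: "has_filtration AB (T\<lparr>carrier := tspan (gens (F n) (carrier M) (G m))\<rparr>) ?J X"
 proof (rule tensor_chain[OF c1(1) c2(1)])
  show "\<exists>x. mtensor A B (X1 (lab k)) (X2 (lab' l)) (X (lab k, lab' l)) x" if "k \<le> n" "l \<le> m" for k l
   using X[of "lab k" "lab' l"] l1(1)[OF that(1)] l2(1)[OF that(2)] I0(1) J0(1) i j by blast
  show "(lab k, lab' l) \<in> ?J" if "k \<le> n" "l \<le> m" "(k, l) \<noteq> (n, m)" for k l
   using that l1[OF that(1)] l2[OF that(2)] by auto
 qed
 show ?thesis
 proof (rule that)
  show "restrict h (carrier T) \<in> Epi AB T (X (i, j))"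
   using restrict_Hom[OF h(1) T.is_module] tensor_map_surj[where f = f and g = g and h = h and t = t, OF T x h ff(2) gg(2)]
   by (simp add: Epi_def)
  show "has_filtration AB (kernel_module T (X (i, j)) (restrict h (carrier T))) ?J X"
   unfolding kernel_module_def kernel_restrict kernel_tspan[OF x ff gg h] using fil c1(2) c2(2) by simp
 qed
qed

section \<open>Tensor products of quasi-hereditary algebras\<close>

lemma prod_partial_order:
 assumes "partial_order_on I r" "partial_order_on J s"
 shows "partial_order_on (I \<times> J) (prod_order r s)"
proof -
 have i: "r \<subseteq> I \<times> I" "refl_on I r" "trans r" "antisym r" and j: "s \<subseteq> J \<times> J" "refl_on J s" "trans s" "antisym s"
  using assms by (simp_all add: partial_order_on_def preorder_on_def)
 show ?thesis unfolding partial_order_on_def preorder_on_def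
 proof (intro conjI)
  show "prod_order r s \<subseteq> (I \<times> J) \<times> (I \<times> J)" using i(1) j(1) by (auto simp: prod_order_def)
  show "refl_on (I \<times> J) (prod_order r s)" using i(2) j(2) by (auto simp: refl_on_def prod_order_def)
  show "trans (prod_order r s)" using transD[OF i(3)] transD[OF j(3)] by (intro transI) (auto simp: prod_order_def)
  show "antisym (prod_order r s)" using antisymD[OF i(4)] antisymD[OF j(4)] by (intro antisymI) (auto simp: prod_order_def)
 qed
qed

text \<open>One statement on filtrations serves twice, for \<Delta> \<rightarrow> L with smaller
  labels and for P \<rightarrow> \<Delta> with larger ones. If both components are weakly comparable
  with i and j, a pair other than (i, j) is strictly comparable with it in the product
  order.\<close>

lemma tensor_quasi_hereditary:
 fixes A :: "('f::alg_closed_field, 'a) module" and B :: "('f, 'b) module"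
 assumes A: "quasi_hereditary A I r L" and B: "quasi_hereditary B J s K"
 shows "quasi_hereditary (tensor A B) (I \<times> J) (prod_order r s) (\<lambda>(i, j). tensor_module A B (L i) (K j))"
proof -
 have fdA: "fd_algebra A" and fdB: "fd_algebra B" and pr: "partial_order_on I r" and ps: "partial_order_on J s"
  and lL: "labels_simples A I L" and lK: "labels_simples B J K" using A B by (auto simp: quasi_hereditary_def)
 interpret alg_pair A B using fdA fdB by (simp add: alg_pair_def falg_def)
 obtain \<Delta> where \<Delta>: "standard_modules A I r L \<Delta>" using A by (auto simp: quasi_hereditary_def)
 obtain \<Gamma> where \<Gamma>: "standard_modules B J s K \<Gamma>" using B by (auto simp: quasi_hereditary_def)
 have rr: "(i, i) \<in> r" if "i \<in> I" for i using pr that by (auto simp: partial_order_on_def preorder_on_def refl_on_def)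
 have ss: "(j, j) \<in> s" if "j \<in> J" for j using ps that by (auto simp: partial_order_on_def preorder_on_def refl_on_def)
 let ?L = "\<lambda>(i, j). tensor_module A B (L i) (K j)"
 have mL: "\<exists>x. mtensor A B (L i) (K j) (?L (i, j)) x" if ij: "i \<in> I" "j \<in> J" for i j
 proof -
  have "simple_module A (L i)" "simple_module B (K j)" using lL lK ij by (auto simp: labels_simples_def)
  then have "mod_pair A B (L i) (K j)"
   using simple_fdmod[OF fdA, of "L i"] simple_fdmod[OF fdB, of "K j"] alg_pair_axioms by (simp add: mod_pair_def fdmod_def)
  from mod_pair.MN_mtensor[OF this] show ?thesis by auto
 qed
 have ex: "\<exists>p. i \<in> I \<and> j \<in> J \<longrightarrow> fst p \<in> fg_modules AB \<and> mtensor A B (\<Delta> i) (\<Gamma> j) (fst p) (snd p)" for i j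
 proof (cases "i \<in> I \<and> j \<in> J")
  case True
  then have "fdmod A (\<Delta> i)" "fdmod B (\<Gamma> j)"
   using \<Delta> \<Gamma> by (auto simp: standard_modules_def fg_modules_fdmod fdA fdB)
  from enc_mtensor[OF fdA fdB this] show ?thesis by (metis fst_conv snd_conv)
 qed auto
 \<comment> \<open>Copies of the modules \<Delta> i \<otimes> \<Gamma> j, chosen inside the category
   once and for all.\<close>
 define E where "E ij = fst (SOME p. fst p \<in> fg_modules AB \<and> mtensor A B (\<Delta> (fst ij)) (\<Gamma> (snd ij)) (fst p) (snd p))" for ij
 have E: "E (i, j) \<in> fg_modules AB \<and> (\<exists>x. mtensor A B (\<Delta> i) (\<Gamma> j) (E (i, j)) x)" if ij: "i \<in> I" "j \<in> J" for i j
 proof -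
  have "\<exists>p. fst p \<in> fg_modules AB \<and> mtensor A B (\<Delta> i) (\<Gamma> j) (fst p) (snd p)" using ex[of i j] ij by blast
  from someI_ex[OF this] show ?thesis unfolding E_def fst_conv snd_conv by blast
 qed
 have "standard_modules AB (I \<times> J) (prod_order r s) ?L E" unfolding standard_modules_def
 proof (intro ballI)
  fix ij assume "ij \<in> I \<times> J"
  then obtain i j where ij: "ij = (i, j)" "i \<in> I" "j \<in> J" by auto
  obtain e where e: "mtensor A B (\<Delta> i) (\<Gamma> j) (E (i, j)) e" using E ij by blast
  let ?I0 = "{k \<in> I. (k, i) \<in> r \<and> k \<noteq> i}" and ?J0 = "{k \<in> J. (k, j) \<in> s \<and> k \<noteq> j}"
  let ?I1 = "{k \<in> I. (i, k) \<in> r \<and> k \<noteq> i}" and ?J1 = "{k \<in> J. (j, k) \<in> s \<and> k \<noteq> j}"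
  obtain f where f: "f \<in> Epi A (\<Delta> i) (L i)" "has_filtration A (kernel_module (\<Delta> i) (L i) f) ?I0 L"
   using \<Delta> ij(2) unfolding standard_modules_def by blast
  obtain g where g: "g \<in> Epi B (\<Gamma> j) (K j)" "has_filtration B (kernel_module (\<Gamma> j) (K j) g) ?J0 K"
   using \<Gamma> ij(3) unfolding standard_modules_def by blast
  obtain P p where P: "projective_cover A P (L i)" "p \<in> Epi A P (\<Delta> i)" "has_filtration A (kernel_module P (\<Delta> i) p) ?I1 \<Delta>"
   using \<Delta> ij(2) unfolding standard_modules_def by blast
  obtain Q q where Q: "projective_cover B Q (K j)" "q \<in> Epi B Q (\<Gamma> j)" "has_filtration B (kernel_module Q (\<Gamma> j) q) ?J1 \<Gamma>"
   using \<Gamma> ij(3) unfolding standard_modules_def by blast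
  have "fdmod A P" "fdmod B Q"
   using P(1) Q(1) by (simp_all add: projective_cover_def projective_def fg_modules_fdmod fdA fdB)
  then obtain R :: "(('a \<times> 'b \<Rightarrow>\<^sub>0 'f) set, nat \<Rightarrow> 'f) module" and t where R: "R \<in> fg_modules AB" "mtensor A B P Q R t"
   by (rule enc_mtensor[OF fdA fdB])
  have s0: "insert i ?I0 \<times> insert j ?J0 - {(i, j)} \<subseteq> {k \<in> I \<times> J. (k, ij) \<in> prod_order r s \<and> k \<noteq> ij}"
   using ij rr ss by (auto simp: prod_order_def)
  have s1: "insert i ?I1 \<times> insert j ?J1 - {(i, j)} \<subseteq> {k \<in> I \<times> J. (ij, k) \<in> prod_order r s \<and> k \<noteq> ij}"
   using ij rr ss by (auto simp: prod_order_def)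
  obtain h where h: "h \<in> Epi AB (E (i, j)) (?L (i, j))"
   "has_filtration AB (kernel_module (E (i, j)) (?L (i, j)) h) (insert i ?I0 \<times> insert j ?J0 - {(i, j)}) ?L"
   by (rule tensor_filtration[where X = ?L, OF e ij(2,3) _ _ _ _ mL f g]) auto
  obtain k where k: "k \<in> Epi AB R (E (i, j))"
   "has_filtration AB (kernel_module R (E (i, j)) k) (insert i ?I1 \<times> insert j ?J1 - {(i, j)}) E"
  proof (rule tensor_filtration[where X = E, OF R(2) ij(2,3) _ _ _ _ _ P(2,3) Q(2,3)])
   show "\<exists>x. mtensor A B (\<Delta> i) (\<Gamma> j) (E (i, j)) x" if "i \<in> I" "j \<in> J" for i j using E[OF that] by blast
  qed auto
  have pc: "projective_cover AB R (tensor_module A B (L i) (K j))"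
   by (rule tensor_projective_cover[OF lL lK ij(2,3) R(2) P(1) Q(1) R(1)])
  show "E ij \<in> fg_modules AB \<and>
   (\<exists>f\<in>Epi AB (E ij) (?L ij). has_filtration AB (kernel_module (E ij) (?L ij) f) {k \<in> I \<times> J. (k, ij) \<in> prod_order r s \<and> k \<noteq> ij} ?L) \<and>
   (\<exists>P. projective_cover AB P (?L ij) \<and>
    (\<exists>g\<in>Epi AB P (E ij). has_filtration AB (kernel_module P (E ij) g) {k \<in> I \<times> J. (ij, k) \<in> prod_order r s \<and> k \<noteq> ij} E))"
  proof (intro conjI exI[of _ R])
   show "E ij \<in> fg_modules AB" using E ij by blast
   show "\<exists>f\<in>Epi AB (E ij) (?L ij). has_filtration AB (kernel_module (E ij) (?L ij) f) {k \<in> I \<times> J. (k, ij) \<in> prod_order r s \<and> k \<noteq> ij} ?L"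
    using h has_filtration_mono[OF h(2) s0] ij(1) by (intro bexI[of _ h]) simp_all
   show "projective_cover AB R (?L ij)" using pc ij(1) by simp
   show "\<exists>g\<in>Epi AB R (E ij). has_filtration AB (kernel_module R (E ij) g) {k \<in> I \<times> J. (ij, k) \<in> prod_order r s \<and> k \<noteq> ij} E"
    using k has_filtration_mono[OF k(2) s1] ij(1) by (intro bexI[of _ k]) simp_all
  qed
 qed
 then show ?thesis
  using AB_fd prod_partial_order[OF pr ps] tensor_labels[OF fdA fdB lL lK] unfolding quasi_hereditary_def by blast
qed

section \<open>Duality functors given by a dualizing module\<close>

lemma hom_factor:
 assumes M: "left_module R M" and N: "left_module R N" and X: "left_module R X"
  and g: "g \<in> ahom R M N" "g ` carrier M = carrier N" and f: "f \<in> ahom R M X"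
  and k: "\<And>m. \<lbrakk>m \<in> carrier M; g m = 0[N]\<rbrakk> \<Longrightarrow> f m = 0[X]"
 obtains h where "h \<in> ahom R N X" "\<And>m. m \<in> carrier M \<Longrightarrow> h (g m) = f m"
proof -
 interpret g: module_hom R M N g by (rule module_homI[OF M N g(1)])
 interpret f: module_hom R M X f by (rule module_homI[OF M X f])
 have eq: "f m = f m'" if m: "m \<in> carrier M" "m' \<in> carrier M" "g m = g m'" for m m'
 proof -
  have "g (m -[M] m') = 0[N]" using m by (simp add: g.N.minus_eq_zero)
  then have "f (m -[M] m') = 0[X]" using k m by simp
  then show ?thesis using m by (simp add: f.N.minus_eq_zero)
 qed
 define h where "h n = f (inv_into (carrier M) g n)" for n
 have h: "h (g m) = f m" if "m \<in> carrier M" for m unfolding h_def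
  by (rule eq) (use that in "simp_all add: inv_into_into f_inv_into_f")
 show ?thesis
 proof (rule that[of h])
  show "h \<in> ahom R N X"
  proof (rule ahomI)
   fix n assume "n \<in> carrier N"
   then obtain m where m: "m \<in> carrier M" "n = g m" using g(2) by blast
   then show "h n \<in> carrier X" by (simp add: h)
  next
   fix n n' assume "n \<in> carrier N" "n' \<in> carrier N"
   then obtain m m' where m: "m \<in> carrier M" "n = g m" "m' \<in> carrier M" "n' = g m'" using g(2) by blast
   have "h (g (m +[M] m')) = f (m +[M] m')" by (rule h) (use m in simp)
   then show "h (n +[N] n') = h n +[X] h n'" using m by (simp add: h)
  next
   fix a n assume a: "a \<in> carrier R" and "n \<in> carrier N"
   then obtain m where m: "m \<in> carrier M" "n = g m" using g(2) by blast
   have "h (g (a *[M] m)) = f (a *[M] m)" by (rule h) (use m a in simp)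
   then show "h (a *[N] n) = a *[X] h n" using m a by (simp add: h)
  qed
 qed (rule h)
qed

lemma regular_simps [simp]:
 "carrier (regular A) = carrier A" "0[regular A] = 0[A]" "x +[regular A] y = x +[A] y" "x *[regular A] y = x **[A] y"
 by (simp_all add: regular_def)

lemma (in falg) orbit_hom:
 assumes "left_module A X" "x \<in> carrier X" shows "(\<lambda>a. a *[X] x) \<in> ahom A (regular A) X"
proof -
 interpret X: left_module A X by fact
 show ?thesis by (rule ahomI) (use assms(2) in "simp_all add: X.smult_l_distr X.smult_assoc1")
qed

lemma (in falg) regular_fdmod: "fdmod A (regular A)"
proof -
 have "finitely_generated A (regular A)" unfolding finitely_generated_def
 proof (intro exI[of _ "{1[A]}"] conjI)
  show "gen_submodule A (regular A) {1[A]} = carrier (regular A)"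
  proof (rule equalityI)
   note g = gen_submodule[OF regular_left_module, of "{1[A]}"]
   show "gen_submodule A (regular A) {1[A]} \<subseteq> carrier (regular A)"
    by (rule submoduleD(1)[OF g(1)]) (simp add: regular_def)
   show "carrier (regular A) \<subseteq> gen_submodule A (regular A) {1[A]}"
   proof
    fix a assume "a \<in> carrier (regular A)"
    then have "a \<in> carrier A" by (simp add: regular_def)
    moreover have "1[A] \<in> gen_submodule A (regular A) {1[A]}" using g(2) by (simp add: regular_def)
    moreover have "submodule (gen_submodule A (regular A) {1[A]}) A (regular A)" by (rule g(1)) (simp add: regular_def)
    ultimately show "a \<in> gen_submodule A (regular A) {1[A]}"
     using submoduleD(5)[of "gen_submodule A (regular A) {1[A]}" A "regular A" a "1[A]"] by (simp add: regular_def)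
   qed
  qed
 qed (simp_all add: regular_def)
 then show ?thesis using fd regular_left_module by (simp add: fdmod_iff)
qed

text \<open>Hom_A(M, T) is made into a left module again by the second action on T, which commutes
  with the first in a \<open>dualizer\<close>.\<close>

definition dual_module ::
  "('f, 'a) module \<Rightarrow> ('a, 't) module \<Rightarrow> ('a, 't) module \<Rightarrow> ('a, 'm) module \<Rightarrow> ('a, 'm \<Rightarrow> 't) module" where
 "dual_module A T T' M = hom_module A M T (\<lambda>a \<phi>. \<lambda>m\<in>carrier M. a *[T'] \<phi> m)"

lemma dual_module_simps [simp]:
 "carrier (dual_module A T T' M) = Hom A M T"
 "0[dual_module A T T' M] = (\<lambda>m\<in>carrier M. 0[T])"
 "\<phi> +[dual_module A T T' M] \<psi> = (\<lambda>m\<in>carrier M. \<phi> m +[T] \<psi> m)"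
 "a *[dual_module A T T' M] \<phi> = (\<lambda>m\<in>carrier M. a *[T'] \<phi> m)" by (simp_all add: dual_module_def hom_module_def)

text \<open>\<open>T\<close> is the dual of the regular module, with its left action (\<open>T\<close>) and the action (\<open>T'\<close>) induced by the
 right multiplications; \<open>\<tau>\<close> is the identification of \<open>T\<close> with its dual that exchanges the two.\<close>

locale dualizer = falg A + T: fdmod A T + T': left_module A T'
 for A :: "('f::field, 'a) module" and T T' :: "('a, 't) module" and \<tau> +
 assumes carr: "carrier T' = carrier T" and zero': "0[T'] = 0[T]"
  and add': "\<And>x y. \<lbrakk>x \<in> carrier T; y \<in> carrier T\<rbrakk> \<Longrightarrow> x +[T'] y = x +[T] y"
  and scal: "\<And>c x. x \<in> carrier T \<Longrightarrow> sc c *[T'] x = sc c *[T] x"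
  and comm: "\<And>a b x. \<lbrakk>a \<in> carrier A; b \<in> carrier A; x \<in> carrier T\<rbrakk> \<Longrightarrow> a *[T] (b *[T'] x) = b *[T'] (a *[T] x)"
  and \<tau>_bij: "bij_betw \<tau> (carrier T) (carrier T)"
  and \<tau>_add: "\<And>x y. \<lbrakk>x \<in> carrier T; y \<in> carrier T\<rbrakk> \<Longrightarrow> \<tau> (x +[T] y) = \<tau> x +[T] \<tau> y"
  and \<tau>_smult: "\<And>a x. \<lbrakk>a \<in> carrier A; x \<in> carrier T\<rbrakk> \<Longrightarrow> \<tau> (a *[T] x) = a *[T'] \<tau> x"
  and \<tau>_smult': "\<And>a x. \<lbrakk>a \<in> carrier A; x \<in> carrier T\<rbrakk> \<Longrightarrow> \<tau> (a *[T'] x) = a *[T] \<tau> x"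
  and injective: "\<And>(M :: ('a, nat \<Rightarrow> 'f) module) (N :: ('a, nat \<Rightarrow> 'f) module) \<iota> \<phi>. \<lbrakk>fdmod A M; fdmod A N;
    \<iota> \<in> ahom A M N; inj_on \<iota> (carrier M); \<phi> \<in> ahom A M T\<rbrakk>
    \<Longrightarrow> \<exists>\<psi>\<in>ahom A N T. \<forall>m\<in>carrier M. \<psi> (\<iota> m) = \<phi> m"
  and full: "\<And>\<psi>. \<psi> \<in> ahom A T' T \<Longrightarrow> \<exists>b\<in>carrier A. \<forall>x\<in>carrier T. \<psi> x = \<tau> (b *[T] x)"
  and faithful: "\<And>b. \<lbrakk>b \<in> carrier A; \<forall>x\<in>carrier T. b *[T] x = 0[T]\<rbrakk> \<Longrightarrow> b = 0[A]"
begin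

lemma smult'_closed [simp]: "\<lbrakk>a \<in> carrier A; x \<in> carrier T\<rbrakk> \<Longrightarrow> a *[T'] x \<in> carrier T"
 using T'.smult_closed by (simp add: carr)

lemma \<tau>_closed [simp]: "x \<in> carrier T \<Longrightarrow> \<tau> x \<in> carrier T" using \<tau>_bij by (auto simp: bij_betw_def)

lemma \<tau>_inj: "\<lbrakk>\<tau> x = \<tau> y; x \<in> carrier T; y \<in> carrier T\<rbrakk> \<Longrightarrow> x = y"
 using \<tau>_bij by (auto simp: bij_betw_def dest: inj_onD)

lemma \<tau>_hom: "\<tau> \<in> ahom A T T'" by (rule ahomI) (simp_all add: carr add' \<tau>_add \<tau>_smult)

lemma \<tau>_zero [simp]: "\<tau> 0[T] = 0[T]"
 using module_hom.hom_zero[OF module_homI[OF T.is_module T'.is_module \<tau>_hom]] by (simp add: zero')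

text \<open>The injectivity assumption speaks of modules on sequences of scalars; copies extend it
  to finite dimensional modules on any type.\<close>

lemma inject:
 assumes M: "fdmod A M" and N: "fdmod A N" and i: "\<iota> \<in> ahom A M N" "inj_on \<iota> (carrier M)" and f: "\<phi> \<in> ahom A M T"
 obtains \<psi> where "\<psi> \<in> ahom A N T" "\<And>m. m \<in> carrier M \<Longrightarrow> \<psi> (\<iota> m) = \<phi> m"
proof -
 interpret M: fdmod A M by fact
 interpret N: fdmod A N by fact
 let ?d = "inv_into (carrier M) (enc_map A M)"
 note eM = enc[OF M] and eN = enc[OF N]
 have d: "?d \<in> ahom A (enc A M) M" by (rule module_hom.inv_ahom[OF module_homI[OF M.is_module eM(6,2)] eM(3)])
 have db: "bij_betw ?d (carrier (enc A M)) (carrier M)" by (rule bij_betw_inv_into[OF eM(3)])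
 have dinv: "?d (enc_map A M m) = m" if "m \<in> carrier M" for m using eM(3) that by (simp add: bij_betw_def)
 have j: "inj_on (\<lambda>y. enc_map A N (\<iota> (?d y))) (carrier (enc A M))"
 proof (rule inj_onI)
  fix x y assume xy: "x \<in> carrier (enc A M)" "y \<in> carrier (enc A M)"
   "enc_map A N (\<iota> (?d x)) = enc_map A N (\<iota> (?d y))"
  have c: "?d x \<in> carrier M" "?d y \<in> carrier M" using xy ahomD(1)[OF d] by auto
  then have "\<iota> (?d x) = \<iota> (?d y)" using xy(3) eN(3) ahomD(1)[OF i(1)] by (auto simp: bij_betw_def dest: inj_onD)
  then have "?d x = ?d y" using i(2) c by (auto dest: inj_onD)
  then show "x = y" using db xy by (auto simp: bij_betw_def dest: inj_onD)
 qed
 obtain \<psi> where p: "\<psi> \<in> ahom A (enc A N) T" "\<forall>y\<in>carrier (enc A M). \<psi> (enc_map A N (\<iota> (?d y))) = \<phi> (?d y)"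
  using injective[OF eM(5) eN(5) ahom_comp[OF ahom_comp[OF d i(1)] eN(2)] j ahom_comp[OF d f]] by blast
 show ?thesis
 proof (rule that[of "\<lambda>n. \<psi> (enc_map A N n)"])
  show "(\<lambda>n. \<psi> (enc_map A N n)) \<in> ahom A N T" by (rule ahom_comp[OF eN(2) p(1)])
  show "\<psi> (enc_map A N (\<iota> m)) = \<phi> m" if m: "m \<in> carrier M" for m
   using p(2)[rule_format, of "enc_map A M m"] ahomD(1)[OF eM(2) m] m by (simp add: dinv)
 qed
qed

abbreviation "\<delta> \<equiv> dual_module A T T'"

lemma dual_act_hom: "\<lbrakk>a \<in> carrier A; \<phi> \<in> ahom A M T\<rbrakk> \<Longrightarrow> (\<lambda>m. a *[T'] \<phi> m) \<in> ahom A M T"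
 using T'.smult_r_distr[of a] by (intro ahomI) (simp_all add: ahomD comm carr add')

lemma dual_fdmod:
 assumes M: "fdmod A M" shows "fdmod A (\<delta> M)"
proof -
 interpret M: fdmod A M by fact
 have c: "\<phi> m \<in> carrier T" if "\<phi> \<in> Hom A M T" "m \<in> carrier M" for \<phi> m
  using ahomD(1)[OF Hom_ahom[OF that(1)] that(2)] .
 have lm: "left_module A (\<delta> M)" unfolding dual_module_def
 proof (rule hom_module_left_module[OF M.is_module T.is_module ring_axioms])
  show "(\<lambda>m\<in>carrier M. a *[T'] \<phi> m) \<in> Hom A M T" if "a \<in> carrier A" "\<phi> \<in> Hom A M T" for a \<phi>
   by (rule restrict_Hom[OF dual_act_hom[OF that(1) Hom_ahom[OF that(2)]] M.is_module])
  show "(\<lambda>m\<in>carrier M. (a +[A] b) *[T'] \<phi> m) x = (\<lambda>m\<in>carrier M. a *[T'] \<phi> m) x +[T] (\<lambda>m\<in>carrier M. b *[T'] \<phi> m) x"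
   if "a \<in> carrier A" "b \<in> carrier A" "\<phi> \<in> Hom A M T" "x \<in> carrier M" for a b \<phi> x
   using that c[OF that(3,4)] T'.smult_l_distr[of a b "\<phi> x"] by (simp add: carr add')
  show "(\<lambda>m\<in>carrier M. a *[T'] (\<lambda>x\<in>carrier M. \<phi> x +[T] \<psi> x) m) x
   = (\<lambda>m\<in>carrier M. a *[T'] \<phi> m) x +[T] (\<lambda>m\<in>carrier M. a *[T'] \<psi> m) x"
   if "a \<in> carrier A" "\<phi> \<in> Hom A M T" "\<psi> \<in> Hom A M T" "x \<in> carrier M" for a \<phi> \<psi> x
   using that c[of \<phi> x] c[of \<psi> x] T'.smult_r_distr[of a "\<phi> x" "\<psi> x"] by (simp add: carr add')
  show "(\<lambda>m\<in>carrier M. (a **[A] b) *[T'] \<phi> m) x = (\<lambda>m\<in>carrier M. a *[T'] (\<lambda>m\<in>carrier M. b *[T'] \<phi> m) m) x"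
   if "a \<in> carrier A" "b \<in> carrier A" "\<phi> \<in> Hom A M T" "x \<in> carrier M" for a b \<phi> x
   using that c[OF that(3,4)] T'.smult_assoc1[of a b "\<phi> x"] by (simp add: carr)
  show "(\<lambda>m\<in>carrier M. 1[A] *[T'] \<phi> m) x = \<phi> x" if "\<phi> \<in> Hom A M T" "x \<in> carrier M" for \<phi> x
   using that c[OF that] T'.smult_one[of "\<phi> x"] by (simp add: carr)
 qed
 show ?thesis unfolding dual_module_def
  by (rule hom_module_fdmod[OF lm[unfolded dual_module_def] fd M.is_module M.fgM T.is_module T.rs.fdspace_axioms])
   (use c in "auto simp: scal")
qed

section \<open>Evaluation into the double dual\<close>

lemma Hom_closed: "\<lbrakk>\<phi> \<in> Hom A M T; m \<in> carrier M\<rbrakk> \<Longrightarrow> \<phi> m \<in> carrier T" by (rule ahomD(1)[OF Hom_ahom])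

text \<open>Plain evaluation at m is linear into \<open>T'\<close>, because A acts on the dual
  through that action. The map \<open>\<tau>\<close> corrects the target to T, so that evaluations
  lie in the double dual.\<close>

lemma eval_hom:
 assumes m: "m \<in> carrier M" shows "(\<lambda>\<phi>. \<tau> (\<phi> m)) \<in> ahom A (\<delta> M) T"
proof -
 note [simp] = Hom_closed[OF _ m]
 show ?thesis by (rule ahomI) (use m in "simp_all add: \<tau>_add \<tau>_smult'")
qed

lemma eval_hom':
 assumes m: "m \<in> carrier M" shows "(\<lambda>\<phi>. \<phi> m) \<in> ahom A (\<delta> M) T'"
proof -
 note [simp] = Hom_closed[OF _ m]
 show ?thesis by (rule ahomI) (use m in "simp_all add: add' carr")
qed

text \<open>Induction on a finite set such that \<open>\<Phi>\<close> kills all maps vanishing on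
  it. On the maps that vanish on the smaller set, \<open>\<Phi>\<close> depends on the value at s
  only; injectivity extends this dependence to a map from T' to T, \<open>full\<close> shows that it
  is evaluation at b s, and this evaluation is subtracted. The bound H records where the resulting
  vector lies; it is the whole module in one use and an annihilator in the other.\<close>

lemma eval_onto_aux:
 assumes M: "fdmod A M" and S: "finite S" "S \<subseteq> H" and H: "submodule H A M"
  and F: "\<Phi> \<in> ahom A (\<delta> M) T" "\<And>\<phi>. \<lbrakk>\<phi> \<in> Hom A M T; \<forall>s\<in>S. \<phi> s = 0[T]\<rbrakk> \<Longrightarrow> \<Phi> \<phi> = 0[T]"
 shows "\<exists>m\<in>H. \<forall>\<phi>\<in>Hom A M T. \<Phi> \<phi> = \<tau> (\<phi> m)" using S F
proof (induction S arbitrary: \<Phi> rule: finite_induct)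
 interpret M: fdmod A M by fact
 have z: "\<phi> 0[M] = 0[T]" if "\<phi> \<in> Hom A M T" for \<phi>
  using module_hom.hom_zero[OF module_homI[OF M.is_module T.is_module Hom_ahom[OF that]]] .
 case empty
 then show ?case using submoduleD(2)[OF H] by (intro bexI[of _ "0[M]"]) (auto simp: z)
next
 interpret M: fdmod A M by fact
 interpret d: fdmod A "\<delta> M" by (rule dual_fdmod[OF M])
 case (insert s S)
 note h = submoduleD[OF H]
 have s: "s \<in> carrier M" "s \<in> H" using insert.prems(1) h(6) by auto
 let ?K = "{\<phi> \<in> Hom A M T. \<forall>x\<in>S. \<phi> x = 0[T]}"
 have SM: "x \<in> carrier M" if "x \<in> S" for x using that insert.prems(1) h(6) by auto
 have K: "submodule ?K A (\<delta> M)"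
 proof (rule d.submoduleI)
  show "0[\<delta> M] \<in> ?K" using d.M.zero_closed SM by simp
  show "\<phi> +[\<delta> M] \<psi> \<in> ?K" if "\<phi> \<in> ?K" "\<psi> \<in> ?K" for \<phi> \<psi> using that SM d.M.a_closed[of \<phi> \<psi>] by simp
  show "a *[\<delta> M] \<phi> \<in> ?K" if "a \<in> carrier A" "\<phi> \<in> ?K" for a \<phi>
   using that SM d.smult_closed[of a \<phi>] T'.smult_r_null[of a] by (simp add: zero')
 qed auto
 interpret e: module_hom A "\<delta> M" T' "\<lambda>\<phi>. \<phi> s" by (rule module_homI[OF d.is_module T'.is_module eval_hom'[OF s(1)]])
 let ?I = "(\<lambda>\<phi>. \<phi> s) ` ?K"
 have I: "submodule ?I A T'" by (rule e.image_submodule[OF K])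
 have T'f: "fdmod A T'"
  by (rule fdmod_surj[OF T.fdmod_axioms T'.is_module \<tau>_hom]) (use \<tau>_bij in "simp add: bij_betw_def carr")
 \<comment> \<open>On \<open>?K\<close> a map that also vanishes at s is killed by
   \<open>\<Phi>\<close>, so \<open>\<Phi>\<close> factors through evaluation at s.\<close>
 obtain \<chi> where x: "\<chi> \<in> ahom A (T'\<lparr>carrier := ?I\<rparr>) T" "\<And>\<phi>. \<phi> \<in> ?K \<Longrightarrow> \<chi> (\<phi> s) = \<Phi> \<phi>"
 proof (rule hom_factor[OF submodule_left_module[OF d.is_module K]
    submodule_left_module[OF T'.is_module I] T.is_module])
  show "(\<lambda>\<phi>. \<phi> s) \<in> ahom A (\<delta> M\<lparr>carrier := ?K\<rparr>) (T'\<lparr>carrier := ?I\<rparr>)" using e.hom_simps(2,3) by (intro ahomI) auto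
  show "\<Phi> \<in> ahom A (\<delta> M\<lparr>carrier := ?K\<rparr>) T" by (rule ahom_comp[OF incl_ahom[OF K] insert.prems(2)])
  show "\<Phi> \<phi> = 0[T]" if "\<phi> \<in> carrier (\<delta> M\<lparr>carrier := ?K\<rparr>)" "\<phi> s = 0[T'\<lparr>carrier := ?I\<rparr>]" for \<phi>
   using that by (intro insert.prems(3)) (auto simp: zero')
 qed (simp, simp)
 have "inj_on (\<lambda>y. y) (carrier (T'\<lparr>carrier := ?I\<rparr>))" by simp
 then obtain \<psi> where p: "\<psi> \<in> ahom A T' T" "\<And>y. y \<in> carrier (T'\<lparr>carrier := ?I\<rparr>) \<Longrightarrow> \<psi> y = \<chi> y"
  by (rule inject[OF fdmod_sub[OF T'f I] T'f incl_ahom[OF I] _ x(1)]) blast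
 obtain b where b: "b \<in> carrier A" "\<forall>x\<in>carrier T. \<psi> x = \<tau> (b *[T] x)" using full[OF p(1)] by blast
 \<comment> \<open>Adding the evaluation at - b s leaves a homomorphism that vanishes on
   \<open>?K\<close>, as the induction hypothesis requires.\<close>
 let ?u = "-[M] (b *[M] s)"
 have u: "?u \<in> carrier M" "?u \<in> H" using s b(1) h(4,5) by simp_all
 have ev: "\<Phi> \<phi> +[T] \<tau> (\<phi> ?u) = 0[T]" if k: "\<phi> \<in> ?K" for \<phi>
 proof -
  interpret f: module_hom A M T \<phi> using k by (intro module_homI[OF M.is_module T.is_module Hom_ahom]) simp
  have "\<Phi> \<phi> = \<psi> (\<phi> s)" using x(2)[OF k] p(2)[of "\<phi> s"] k by auto
  also have "\<dots> = \<tau> (\<phi> (b *[M] s))" using b s by simp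
  finally have "\<Phi> \<phi> +[T] \<tau> (\<phi> ?u) = \<tau> (\<phi> (b *[M] s) +[T] \<phi> ?u)" using b s u by (simp add: \<tau>_add)
  also have "\<dots> = \<tau> 0[T]" using b s by (simp add: T.M.r_neg)
  finally show ?thesis by simp
 qed
 have "\<exists>m\<in>H. \<forall>\<phi>\<in>Hom A M T. \<Phi> \<phi> +[T] \<tau> (\<phi> ?u) = \<tau> (\<phi> m)"
 proof (rule insert.IH)
  show "(\<lambda>\<phi>. \<Phi> \<phi> +[T] \<tau> (\<phi> ?u)) \<in> ahom A (\<delta> M) T"
   by (rule hom_add_ahom[OF T.is_module insert.prems(2) eval_hom[OF u(1)]])
 qed (use insert.prems(1) ev in auto)
 then obtain m where m: "m \<in> H" "\<And>\<phi>. \<phi> \<in> Hom A M T \<Longrightarrow> \<Phi> \<phi> +[T] \<tau> (\<phi> ?u) = \<tau> (\<phi> m)" by blast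
 have "\<Phi> \<phi> = \<tau> (\<phi> (m +[M] b *[M] s))" if k: "\<phi> \<in> Hom A M T" for \<phi>
 proof -
  interpret f: module_hom A M T \<phi> by (rule module_homI[OF M.is_module T.is_module Hom_ahom[OF k]])
  have c: "\<Phi> \<phi> \<in> carrier T" using ahomD(1)[OF insert.prems(2)] k by simp
  have mc: "m \<in> carrier M" using m(1) h(6) by simp
  have bs: "b *[M] s \<in> carrier M" using b s by simp
  obtain w where w: "w = \<phi> (b *[M] s)" "w \<in> carrier T" using bs f.hom_simps(1) by blast
  have "\<tau> (\<phi> (m +[M] b *[M] s)) = \<tau> (\<phi> m) +[T] \<tau> w" using mc bs w by (simp add: \<tau>_add)
  also have "\<tau> (\<phi> m) = \<Phi> \<phi> +[T] \<tau> (\<phi> ?u)" by (rule m(2)[OF k, symmetric])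
  also have "\<phi> ?u = -[T] w" unfolding w(1) by (rule f.hom_neg[OF bs])
  also have "(\<Phi> \<phi> +[T] \<tau> (-[T] w)) +[T] \<tau> w = \<Phi> \<phi> +[T] \<tau> (-[T] w +[T] w)"
   using c w(2) by (simp add: \<tau>_add T.M.a_assoc)
  also have "\<dots> = \<Phi> \<phi>" using c w(2) by (simp add: T.M.l_neg)
  finally show ?thesis by simp
 qed
 then show ?case using m(1) h(3)[OF m(1) h(5)[OF b(1) s(2)]] by blast
qed

lemma eval_onto:
 assumes M: "fdmod A M" and F: "\<Phi> \<in> ahom A (\<delta> M) T"
 obtains m where "m \<in> carrier M" "\<And>\<phi>. \<phi> \<in> Hom A M T \<Longrightarrow> \<Phi> \<phi> = \<tau> (\<phi> m)"
proof -
 interpret M: fdmod A M by fact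
 interpret d: fdmod A "\<delta> M" by (rule dual_fdmod[OF M])
 obtain S where S: "finite S" "S \<subseteq> carrier M" "gen_submodule A M S = carrier M"
  using M.fgM by (auto simp: finitely_generated_def)
 have "\<Phi> \<phi> = 0[T]" if p: "\<phi> \<in> Hom A M T" "\<forall>s\<in>S. \<phi> s = 0[T]" for \<phi>
 proof -
  interpret f: module_hom A M T \<phi> by (rule module_homI[OF M.is_module T.is_module Hom_ahom[OF p(1)]])
  have "gen_submodule A M S \<subseteq> a_kernel M T \<phi>"
   by (rule gen_submodule(3)[OF M.is_module S(2) f.kernel_submodule]) (use p(2) S(2) in "auto simp: f.kernel_eq")
  then have "\<phi> x = 0[T]" if "x \<in> carrier M" for x using that S(3) by (auto simp: f.kernel_eq)
  then have "\<phi> = 0[\<delta> M]" using d.M.zero_closed by (intro Hom_eqI[OF p(1)]) auto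
  then show ?thesis using module_hom.hom_zero[OF module_homI[OF d.is_module T.is_module F]] by simp
 qed
 then have "\<exists>m\<in>carrier M. \<forall>\<phi>\<in>Hom A M T. \<Phi> \<phi> = \<tau> (\<phi> m)" by (intro eval_onto_aux[OF M S(1,2) M.carrier_submodule F])
 then show ?thesis using that by blast
qed

text \<open>T is a cogenerator. Let I be the annihilator of m. A vector of T killed by I is the
  image of m under some map to T, hence zero. So evaluation at 1 on Hom(A, T) kills the maps that
  vanish on I, and by the preceding induction it equals evaluation at some i in I. Then i acts on T
  as the identity, i = 1 by \<open>faithful\<close>, and m = i m = 0.\<close>

lemma eval_inj:
 assumes M: "fdmod A M" and m: "m \<in> carrier M" "\<And>\<phi>. \<phi> \<in> Hom A M T \<Longrightarrow> \<phi> m = 0[T]"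
 shows "m = 0[M]"
proof -
 interpret M: fdmod A M by fact
 interpret R: fdmod A "regular A" by (rule regular_fdmod)
 interpret o: module_hom A "regular A" M "\<lambda>a. a *[M] m"
  by (rule module_homI[OF R.is_module M.is_module orbit_hom[OF M.is_module m(1)]])
 let ?I = "{a \<in> carrier A. a *[M] m = 0[M]}" and ?C = "(\<lambda>a. a *[M] m) ` carrier A"
 have I: "submodule ?I A (regular A)" using o.kernel_submodule by (simp add: o.kernel_eq)
 have C: "submodule ?C A M" using o.image_submodule[OF R.carrier_submodule] by simp
 have key: "t = 0[T]" if t: "t \<in> carrier T" "\<forall>a\<in>?I. a *[T] t = 0[T]" for t
 proof -
  obtain h where h: "h \<in> ahom A (M\<lparr>carrier := ?C\<rparr>) T" "\<And>a. a \<in> carrier (regular A) \<Longrightarrow> h (a *[M] m) = a *[T] t"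
  proof (rule hom_factor[OF R.is_module submodule_left_module[OF M.is_module C] T.is_module])
   show "(\<lambda>a. a *[M] m) \<in> ahom A (regular A) (M\<lparr>carrier := ?C\<rparr>)" using o.hom_simps(2,3) by (intro ahomI) auto
   show "(\<lambda>a. a *[T] t) \<in> ahom A (regular A) T" by (rule orbit_hom[OF T.is_module t(1)])
   show "a *[T] t = 0[T]" if "a \<in> carrier (regular A)" "a *[M] m = 0[M\<lparr>carrier := ?C\<rparr>]" for a
    using that t(2) by simp
  qed (simp, simp)
  have "inj_on (\<lambda>y. y) (carrier (M\<lparr>carrier := ?C\<rparr>))" by simp
  then obtain \<psi> where p: "\<psi> \<in> ahom A M T" "\<And>y. y \<in> carrier (M\<lparr>carrier := ?C\<rparr>) \<Longrightarrow> \<psi> y = h y"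
   by (rule inject[OF fdmod_sub[OF M C] M incl_ahom[OF C] _ h(1)]) blast
  have "m \<in> ?C" using m(1) by (intro image_eqI[of _ _ "1[A]"]) simp_all
  then have "\<psi> m = t" using p(2)[of m] h(2)[of "1[A]"] m(1) t(1) by simp
  moreover have "\<psi> m = 0[T]" using m(2)[OF restrict_Hom[OF p(1) M.is_module]] m(1) by simp
  ultimately show ?thesis by simp
 qed
 have val: "\<phi> a = a *[T] \<phi> 1[A]" if "\<phi> \<in> Hom A (regular A) T" "a \<in> carrier A" for \<phi> a
  using ahomD(3)[OF Hom_ahom[OF that(1)], of a "1[A]"] that(2) by simp
 have val1: "\<phi> 1[A] \<in> carrier T" if "\<phi> \<in> Hom A (regular A) T" for \<phi> using ahomD(1)[OF Hom_ahom[OF that]] by simp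
 interpret I: fdmod A "regular A\<lparr>carrier := ?I\<rparr>" by (rule fdmod_sub[OF R.fdmod_axioms I])
 obtain S where S: "finite S" "S \<subseteq> ?I" "gen_submodule A (regular A\<lparr>carrier := ?I\<rparr>) S = ?I"
  using I.fgM by (auto simp: finitely_generated_def)
 have "\<exists>i\<in>?I. \<forall>\<phi>\<in>Hom A (regular A) T. \<tau> (\<phi> 1[A]) = \<tau> (\<phi> i)"
 proof (rule eval_onto_aux[OF R.fdmod_axioms S(1,2) I eval_hom])
  fix \<phi> assume p: "\<phi> \<in> Hom A (regular A) T" "\<forall>s\<in>S. \<phi> s = 0[T]"
  have "\<phi> \<in> ahom A (regular A\<lparr>carrier := ?I\<rparr>) T" using ahomD[OF Hom_ahom[OF p(1)]] by (intro ahomI) auto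
  then interpret f: module_hom A "regular A\<lparr>carrier := ?I\<rparr>" T \<phi> by (intro module_homI I.is_module T.is_module)
  have "gen_submodule A (regular A\<lparr>carrier := ?I\<rparr>) S \<subseteq> a_kernel (regular A\<lparr>carrier := ?I\<rparr>) T \<phi>"
   by (rule gen_submodule(3)[OF I.is_module _ f.kernel_submodule]) (use p(2) S(2) in "auto simp: f.kernel_eq")
  then have "\<phi> a = 0[T]" if "a \<in> ?I" for a using that S(3) by (auto simp: f.kernel_eq)
  then have "a *[T] \<phi> 1[A] = 0[T]" if "a \<in> ?I" for a using that val[OF p(1), of a] by simp
  then have "\<phi> 1[A] = 0[T]" by (intro key val1[OF p(1)]) blast
  then show "\<tau> (\<phi> 1[A]) = 0[T]" by simp
 qed simp
 then obtain i where i: "i \<in> carrier A" "i *[M] m = 0[M]" "\<And>\<phi>. \<phi> \<in> Hom A (regular A) T \<Longrightarrow> \<tau> (\<phi> 1[A]) = \<tau> (\<phi> i)" by blast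
 have "(1[A] +[A] -[A] i) *[T] t = 0[T]" if t: "t \<in> carrier T" for t
 proof -
  let ?f = "restrict (\<lambda>a. a *[T] t) (carrier (regular A))"
  have "?f \<in> Hom A (regular A) T" by (rule restrict_Hom[OF orbit_hom[OF T.is_module t] R.is_module])
  then have "\<tau> t = \<tau> (i *[T] t)" using i(3)[of ?f] i(1) t by simp
  then have e: "t = i *[T] t" by (rule \<tau>_inj) (use t i(1) in simp_all)
  have "(1[A] +[A] -[A] i) *[T] t = t +[T] (-[A] i) *[T] t" using t i(1) by (simp add: T.smult_l_distr)
  also have "\<dots> = i *[T] t +[T] (-[A] i) *[T] t" by (rule arg_cong[where f = "\<lambda>z. z +[T] (-[A] i) *[T] t", OF e])
  also have "\<dots> = (i +[A] -[A] i) *[T] t" using t i(1) by (simp only: T.smult_l_distr a_inv_closed)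
  finally show ?thesis using t i(1) by (simp add: r_neg)
 qed
 then have "1[A] +[A] -[A] i = 0[A]" using i(1) by (intro faithful) simp_all
 then have "(1[A] +[A] -[A] i) +[A] i = 0[A] +[A] i" by simp
 then have "i = 1[A]" using i(1) by (simp add: a_assoc l_neg)
 then show ?thesis using i(2) m(1) by simp
qed

text \<open>For a proper submodule K, the quotient by K has a nonzero map to T because T is a
  cogenerator; on the dual it is evaluation at some m, followed by \<open>\<tau>\<close>, and m is
  killed by all of K. A nonzero element of K is injective on the simple module L, so m = 0 and the
  map vanishes, a contradiction.\<close>

lemma dual_simple:
 assumes L: "simple_module A L" shows "simple_module A (\<delta> L)"
proof -
 have Lf: "fdmod A L" by (rule simple_fdmod[OF fd L])
 interpret L: fdmod A L by fact
 interpret d: fdmod A "\<delta> L" by (rule dual_fdmod[OF Lf])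
 obtain x where x: "x \<in> carrier L" "x \<noteq> 0[L]" by (rule simple_nonzero[OF L])
 have hz: "\<phi> 0[L] = 0[T]" if "\<phi> \<in> Hom A L T" for \<phi>
  using module_hom.hom_zero[OF module_homI[OF L.is_module T.is_module Hom_ahom[OF that]]] .
 show ?thesis unfolding simple_module_def
 proof (intro conjI allI impI)
  show "carrier (\<delta> L) \<noteq> {0[\<delta> L]}"
  proof
   assume "carrier (\<delta> L) = {0[\<delta> L]}"
   then have "\<phi> x = 0[T]" if "\<phi> \<in> Hom A L T" for \<phi> using that x(1) by simp
   then show False using eval_inj[OF Lf x(1)] x(2) by blast
  qed
  fix K assume K: "submodule K A (\<delta> L)"
  show "K = {0[\<delta> L]} \<or> K = carrier (\<delta> L)"
  proof (rule ccontr)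
   assume c: "\<not> (K = {0[\<delta> L]} \<or> K = carrier (\<delta> L))"
   obtain \<kappa> where k: "\<kappa> \<in> K" "\<kappa> \<noteq> 0[\<delta> L]" using c submoduleD(2)[OF K] by blast
   obtain \<phi>0 where f0: "\<phi>0 \<in> Hom A L T" "\<phi>0 \<notin> K" using c submoduleD(1)[OF K] by auto
   have KH: "\<phi> \<in> Hom A L T" if "\<phi> \<in> K" for \<phi> using submoduleD(6)[OF K that] by simp
   interpret q: sub_module A "\<delta> L" K by (rule sub_module.intro[OF d.is_module sub_module_axioms.intro[OF K]])
   let ?Q = "quot_module (\<delta> L) K" and ?p = "\<lambda>\<phi>. K +>\<^bsub>\<delta> L\<^esub> \<phi>"
   have Q: "fdmod A ?Q" by (rule fdmod_surj[OF d.fdmod_axioms q.quot_left_module q.quot_proj]) (simp add: q.quot_carrier)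
   have "?p \<phi>0 \<in> carrier ?Q" using f0(1) q.quot_carrier by auto
   moreover have "?p \<phi>0 \<noteq> 0[?Q]" using q.quot_proj_zero[of \<phi>0] f0 by simp
   ultimately obtain \<Psi> where P: "\<Psi> \<in> Hom A ?Q T" "\<Psi> (?p \<phi>0) \<noteq> 0[T]" using eval_inj[OF Q] by blast
   obtain m where m: "m \<in> carrier L" "\<And>\<phi>. \<phi> \<in> Hom A L T \<Longrightarrow> \<Psi> (?p \<phi>) = \<tau> (\<phi> m)"
    using eval_onto[OF Lf ahom_comp[OF q.quot_proj Hom_ahom[OF P(1)]]] by blast
   have Km: "\<phi> m = 0[T]" if "\<phi> \<in> K" for \<phi>
   proof -
    have "?p \<phi> = 0[?Q]" using q.quot_proj_zero[of \<phi>] KH[OF that] that by simp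
    then have "\<tau> (\<phi> m) = \<Psi> 0[?Q]" using m(2)[OF KH[OF that]] by simp
    also have "\<dots> = \<tau> 0[T]"
     using module_hom.hom_zero[OF module_homI[OF q.quot_left_module T.is_module Hom_ahom[OF P(1)]]] by simp
    finally have "\<tau> (\<phi> m) = \<tau> 0[T]" .
    then show ?thesis by (rule \<tau>_inj) (use Hom_closed[OF KH[OF that] m(1)] in simp_all)
   qed
   let ?H = "a_kernel L T \<kappa>"
   interpret k: module_hom A L T \<kappa> by (rule module_homI[OF L.is_module T.is_module Hom_ahom[OF KH[OF k(1)]]])
   have "?H \<noteq> carrier L"
   proof
    assume "?H = carrier L"
    then have "\<kappa> y = 0[T]" if "y \<in> carrier L" for y using that by (auto simp: k.kernel_eq)
    then have "\<kappa> = 0[\<delta> L]" using d.M.zero_closed by (intro Hom_eqI[OF KH[OF k(1)]]) auto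
    then show False using k(2) by simp
   qed
   moreover have "m \<in> ?H" unfolding k.kernel_eq using m(1) Km[OF k(1)] by blast
   ultimately have m0: "m = 0[L]" using simple_sub[OF L k.kernel_submodule] by blast
   have "\<Psi> (?p \<phi>0) = \<tau> (\<phi>0 0[L])" using m(2)[OF f0(1)] unfolding m0 .
   then show False using P(2) hz[OF f0(1)] by simp
  qed
 qed (rule d.is_module)
qed

end

section \<open>The duality functor attached to a dualizing module\<close>

context dualizer
begin

text \<open>The dual moved back into the category; \<open>dual_enc\<close> and
  \<open>dual_dec\<close> are the mutually inverse identifications with Hom_A(M, T).\<close>

definition dual where "dual M = enc A (\<delta> M)"
definition dual_enc where "dual_enc M = enc_map A (\<delta> M)"
definition dual_dec where "dual_dec M = inv_into (Hom A M T) (dual_enc M)"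
definition dual_map where "dual_map M N f = (\<lambda>y\<in>carrier (dual N). dual_enc M (compose (carrier M) (dual_dec N y) f))"

lemma dual_obj:
 assumes M: "fdmod A M"
 shows "dual M \<in> fg_modules A" "fdmod A (dual M)" "dual_enc M \<in> ahom A (\<delta> M) (dual M)"
  "dual_dec M \<in> ahom A (dual M) (\<delta> M)" "isomorphic A (\<delta> M) (dual M)"
  and dual_dec_closed: "y \<in> carrier (dual M) \<Longrightarrow> dual_dec M y \<in> Hom A M T"
  and dual_enc_closed: "\<phi> \<in> Hom A M T \<Longrightarrow> dual_enc M \<phi> \<in> carrier (dual M)"
  and dual_enc_dec: "y \<in> carrier (dual M) \<Longrightarrow> dual_enc M (dual_dec M y) = y"
  and dual_dec_enc: "\<phi> \<in> Hom A M T \<Longrightarrow> dual_dec M (dual_enc M \<phi>) = \<phi>"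
proof -
 interpret d: fdmod A "\<delta> M" by (rule dual_fdmod[OF M])
 note e = enc[OF d.fdmod_axioms, folded dual_def dual_enc_def]
 show "dual M \<in> fg_modules A" "fdmod A (dual M)" "dual_enc M \<in> ahom A (\<delta> M) (dual M)"
  "isomorphic A (\<delta> M) (dual M)" by (fact e)+
 interpret e: module_hom A "\<delta> M" "dual M" "dual_enc M" by (rule module_homI[OF d.is_module e(6,2)])
 show h: "dual_dec M \<in> ahom A (dual M) (\<delta> M)" using e.inv_ahom[OF e(3)] by (simp add: dual_dec_def)
 show "dual_dec M y \<in> Hom A M T" if "y \<in> carrier (dual M)" using ahomD(1)[OF h that] by simp
 show "dual_enc M \<phi> \<in> carrier (dual M)" if "\<phi> \<in> Hom A M T" using e.hom_simps(1) that by simp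
 show "dual_enc M (dual_dec M y) = y" if "y \<in> carrier (dual M)"
  using e(3) that by (simp add: dual_dec_def bij_betw_def f_inv_into_f)
 show "dual_dec M (dual_enc M \<phi>) = \<phi>" if "\<phi> \<in> Hom A M T" using e(3) that by (simp add: dual_dec_def bij_betw_def)
qed

lemma compose_Hom:
 assumes "left_module A M" "f \<in> ahom A M N" "\<phi> \<in> ahom A N T"
 shows "compose (carrier M) \<phi> f \<in> Hom A M T"
 unfolding compose_def by (rule restrict_Hom[OF ahom_comp[OF assms(2,3)] assms(1)])

lemma dual_map_apply:
 assumes "fdmod A M" "fdmod A N" "f \<in> ahom A M N" "y \<in> carrier (dual N)"
 shows "dual_map M N f y = dual_enc M (compose (carrier M) (dual_dec N y) f)"
  "dual_map M N f y \<in> carrier (dual M)"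
  "dual_dec M (dual_map M N f y) = compose (carrier M) (dual_dec N y) f"
proof -
 interpret M: fdmod A M by fact
 have c: "compose (carrier M) (dual_dec N y) f \<in> Hom A M T"
  by (rule compose_Hom[OF M.is_module assms(3) Hom_ahom[OF dual_dec_closed[OF assms(2,4)]]])
 show e: "dual_map M N f y = dual_enc M (compose (carrier M) (dual_dec N y) f)" using assms(4) by (simp add: dual_map_def)
 show "dual_map M N f y \<in> carrier (dual M)" "dual_dec M (dual_map M N f y) = compose (carrier M) (dual_dec N y) f"
  unfolding e by (simp_all add: dual_enc_closed[OF assms(1) c] dual_dec_enc[OF assms(1) c])
qed

lemma dual_eqI:
 assumes "fdmod A M" "y \<in> carrier (dual M)" "z \<in> carrier (dual M)"
  "\<And>m. m \<in> carrier M \<Longrightarrow> dual_dec M y m = dual_dec M z m"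
 shows "y = z"
proof -
 have "dual_dec M y = dual_dec M z"
  by (rule Hom_eqI[OF dual_dec_closed[OF assms(1,2)] dual_dec_closed[OF assms(1,3)] assms(4)])
 then show ?thesis using dual_enc_dec[OF assms(1,2)] dual_enc_dec[OF assms(1,3)] by metis
qed

lemma dual_dec_add:
 assumes "fdmod A M" "y \<in> carrier (dual M)" "z \<in> carrier (dual M)" "m \<in> carrier M"
 shows "dual_dec M (y +[dual M] z) m = dual_dec M y m +[T] dual_dec M z m"
 using ahomD(2)[OF dual_obj(4)[OF assms(1)] assms(2,3)] assms(4) by simp

lemma dual_dec_smult:
 assumes "fdmod A M" "y \<in> carrier (dual M)" "a \<in> carrier A" "m \<in> carrier M"
 shows "dual_dec M (a *[dual M] y) m = a *[T'] dual_dec M y m"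
 using ahomD(3)[OF dual_obj(4)[OF assms(1)] assms(3,2)] assms(4) by simp

lemma dual_map_hom:
 assumes M: "fdmod A M" and N: "fdmod A N" and f: "f \<in> ahom A M N"
 shows "dual_map M N f \<in> Hom A (dual N) (dual M)"
proof -
 interpret M: fdmod A M by fact
 interpret dM: fdmod A "dual M" by (rule dual_obj(2)[OF M])
 interpret dN: fdmod A "dual N" by (rule dual_obj(2)[OF N])
 note [simp] = dual_map_apply(2,3)[OF M N f] ahomD(1)[OF f]
 have "dual_map M N f \<in> ahom A (dual N) (dual M)"
 proof (rule ahomI)
  show "dual_map M N f (x +[dual N] y) = dual_map M N f x +[dual M] dual_map M N f y"
   if "x \<in> carrier (dual N)" "y \<in> carrier (dual N)" for x y
   by (rule dual_eqI[OF M]) (use that in "simp_all add: dual_dec_add[OF M] dual_dec_add[OF N] compose_eq")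
  show "dual_map M N f (a *[dual N] y) = a *[dual M] dual_map M N f y"
   if "a \<in> carrier A" "y \<in> carrier (dual N)" for a y
   by (rule dual_eqI[OF M]) (use that in "simp_all add: dual_dec_smult[OF M] dual_dec_smult[OF N] compose_eq")
 qed simp
 then show ?thesis by (simp add: Hom_iff dual_map_def)
qed

text \<open>Left exactness of Hom, together with injectivity of T for the surjectivity of
  \<open>dual_map L M f\<close>.\<close>

lemma dual_exact:
 assumes L: "fdmod A L" and M: "fdmod A M" and N: "fdmod A N" and ex: "short_exact A L M N f g"
 shows "short_exact A (dual N) (dual M) (dual L) (dual_map M N g) (dual_map L M f)"
proof -
 interpret L: fdmod A L by fact
 interpret M: fdmod A M by fact
 interpret N: fdmod A N by fact
 have f: "f \<in> ahom A L M" "inj_on f (carrier L)" and g: "g \<in> ahom A M N" "g ` carrier M = carrier N"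
  and fg: "f ` carrier L = a_kernel M N g" using ex by (simp_all add: short_exact_def Epi_def Hom_ahom)
 interpret g: module_hom A M N g by (rule module_homI[OF M.is_module N.is_module g(1)])
 interpret dL: fdmod A "dual L" by (rule dual_obj(2)[OF L])
 interpret dM: fdmod A "dual M" by (rule dual_obj(2)[OF M])
 interpret G: module_hom A "dual M" "dual L" "dual_map L M f"
  by (rule module_homI[OF dM.is_module dL.is_module Hom_ahom[OF dual_map_hom[OF L M f(1)]]])
 have zero: "dual_dec L 0[dual L] = (\<lambda>l\<in>carrier L. 0[T])"
  using module_hom.hom_zero[OF module_homI[OF dL.is_module fdmod.axioms(2)[OF dual_fdmod[OF L]] dual_obj(4)[OF L]]] by simp
 have decH: "dual_dec M y \<in> ahom A M T" if "y \<in> carrier (dual M)" for y by (rule Hom_ahom[OF dual_dec_closed[OF M that]])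
 have 1: "inj_on (dual_map M N g) (carrier (dual N))"
 proof (rule inj_onI)
  fix y z assume yz: "y \<in> carrier (dual N)" "z \<in> carrier (dual N)" "dual_map M N g y = dual_map M N g z"
  have e: "compose (carrier M) (dual_dec N y) g = compose (carrier M) (dual_dec N z) g"
   using dual_map_apply(3)[OF M N g(1)] yz by metis
  show "y = z"
  proof (rule dual_eqI[OF N yz(1,2)])
   fix n assume "n \<in> carrier N"
   then obtain m where "m \<in> carrier M" "n = g m" using g(2) by blast
   then show "dual_dec N y n = dual_dec N z n" using fun_cong[OF e, of m] by (simp add: compose_eq)
  qed
 qed
 have 2: "dual_map L M f ` carrier (dual M) = carrier (dual L)"
 proof (intro equalityI subsetI)
  fix y assume y: "y \<in> carrier (dual L)"
  obtain \<psi> where p: "\<psi> \<in> ahom A M T" "\<And>l. l \<in> carrier L \<Longrightarrow> \<psi> (f l) = dual_dec L y l"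
   by (rule inject[OF L M f Hom_ahom[OF dual_dec_closed[OF L y]]]) blast
  let ?p = "restrict \<psi> (carrier M)"
  have r: "?p \<in> Hom A M T" by (rule restrict_Hom[OF p(1) M.is_module])
  have c: "dual_enc M ?p \<in> carrier (dual M)" by (rule dual_enc_closed[OF M r])
  have "dual_map L M f (dual_enc M ?p) = y" by (rule dual_eqI[OF L dual_map_apply(2)[OF L M f(1) c] y])
    (simp add: dual_map_apply(3)[OF L M f(1) c] dual_dec_enc[OF M r] compose_eq ahomD(1)[OF f(1)] p(2))
  then show "y \<in> dual_map L M f ` carrier (dual M)" using c by blast
 qed auto
 have 3: "dual_map M N g ` carrier (dual N) = a_kernel (dual M) (dual L) (dual_map L M f)"
 proof (intro equalityI subsetI)
  fix y assume "y \<in> dual_map M N g ` carrier (dual N)"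
  then obtain z where z: "z \<in> carrier (dual N)" "y = dual_map M N g z" by blast
  have y: "y \<in> carrier (dual M)" unfolding z(2) by (rule dual_map_apply(2)[OF M N g(1) z(1)])
  interpret z: module_hom A N T "dual_dec N z"
   by (rule module_homI[OF N.is_module T.is_module Hom_ahom[OF dual_dec_closed[OF N z(1)]]])
  have gf: "g (f l) = 0[N]" if "l \<in> carrier L" for l using fg that by (auto simp: g.kernel_eq)
  have "dual_map L M f y = 0[dual L]" by (rule dual_eqI[OF L dual_map_apply(2)[OF L M f(1) y] dL.M.zero_closed])
    (simp add: dual_map_apply(3)[OF L M f(1) y, unfolded z(2)] zero compose_eq z(2) dual_map_apply(3)[OF M N g(1) z(1)]
      ahomD(1)[OF f(1)] gf)
  then show "y \<in> a_kernel (dual M) (dual L) (dual_map L M f)" using y by (simp add: G.kernel_eq)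
 next
  fix y assume "y \<in> a_kernel (dual M) (dual L) (dual_map L M f)"
  then have y: "y \<in> carrier (dual M)" "dual_map L M f y = 0[dual L]" by (auto simp: G.kernel_eq)
  have e: "compose (carrier L) (dual_dec M y) f = (\<lambda>l\<in>carrier L. 0[T])"
   using dual_map_apply(3)[OF L M f(1) y(1)] y(2) zero by simp
  obtain \<psi> where p: "\<psi> \<in> ahom A N T" "\<And>m. m \<in> carrier M \<Longrightarrow> \<psi> (g m) = dual_dec M y m"
  proof (rule hom_factor[OF M.is_module N.is_module T.is_module g decH[OF y(1)]])
   fix m assume "m \<in> carrier M" "g m = 0[N]"
   then have "m \<in> f ` carrier L" unfolding fg by (simp add: g.kernel_eq)
   then obtain l where "l \<in> carrier L" "m = f l" by blast
   then show "dual_dec M y m = 0[T]" using fun_cong[OF e, of l] by (simp add: compose_eq)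
  qed blast
  let ?p = "restrict \<psi> (carrier N)"
  have r: "?p \<in> Hom A N T" by (rule restrict_Hom[OF p(1) N.is_module])
  have c: "dual_enc N ?p \<in> carrier (dual N)" by (rule dual_enc_closed[OF N r])
  have "dual_map M N g (dual_enc N ?p) = y" by (rule dual_eqI[OF M dual_map_apply(2)[OF M N g(1) c] y(1)])
    (simp add: dual_map_apply(3)[OF M N g(1) c] dual_dec_enc[OF N r] compose_eq p(2))
  then show "y \<in> dual_map M N g ` carrier (dual N)" using c by blast
 qed
 show ?thesis unfolding short_exact_def Epi_def
  using 1 2 3 dual_map_hom[OF M N g(1)] dual_map_hom[OF L M f(1)] by simp
qed

text \<open>The natural map into the double dual; \<open>\<tau>\<close> is inserted for linearity
  over A.\<close>

definition dual_unit where
 "dual_unit M = (\<lambda>m\<in>carrier M. dual_enc (dual M) (\<lambda>y\<in>carrier (dual M). \<tau> (dual_dec M y m)))"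

lemma dual_unit:
 assumes M: "fdmod A M"
 shows "dual_unit M \<in> Hom A M (dual (dual M))" "bij_betw (dual_unit M) (carrier M) (carrier (dual (dual M)))"
  and dual_unit_dec: "\<lbrakk>m \<in> carrier M; y \<in> carrier (dual M)\<rbrakk> \<Longrightarrow> dual_dec (dual M) (dual_unit M m) y = \<tau> (dual_dec M y m)"
  and dual_unit_closed: "m \<in> carrier M \<Longrightarrow> dual_unit M m \<in> carrier (dual (dual M))"
proof -
 interpret M: fdmod A M by fact
 have D: "fdmod A (dual M)" by (rule dual_obj(2)[OF M])
 interpret D: fdmod A "dual M" by (rule D)
 have DD: "fdmod A (dual (dual M))" by (rule dual_obj(2)[OF D])
 interpret DD: fdmod A "dual (dual M)" by (rule DD)
 have ev: "(\<lambda>y\<in>carrier (dual M). \<tau> (dual_dec M y m)) \<in> Hom A (dual M) T" if "m \<in> carrier M" for m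
  by (rule restrict_Hom[OF ahom_comp[OF dual_obj(4)[OF M] eval_hom[OF that]] D.is_module])
 show c: "dual_unit M m \<in> carrier (dual (dual M))" if "m \<in> carrier M" for m
  using that dual_enc_closed[OF D ev[OF that]] by (simp add: dual_unit_def)
 show d: "dual_dec (dual M) (dual_unit M m) y = \<tau> (dual_dec M y m)" if "m \<in> carrier M" "y \<in> carrier (dual M)" for m y
  using that dual_dec_enc[OF D ev[OF that(1)]] by (simp add: dual_unit_def)
 note [simp] = Hom_closed[OF dual_dec_closed[OF M]]
 have h: "dual_unit M \<in> ahom A M (dual (dual M))"
 proof (rule ahomI)
  show "dual_unit M (x +[M] y) = dual_unit M x +[dual (dual M)] dual_unit M y"
   if "x \<in> carrier M" "y \<in> carrier M" for x y by (rule dual_eqI[OF D])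
    (use that in "simp_all add: c d dual_dec_add[OF D] \<tau>_add ahomD(2)[OF Hom_ahom[OF dual_dec_closed[OF M]]]")
  show "dual_unit M (a *[M] x) = a *[dual (dual M)] dual_unit M x" if "a \<in> carrier A" "x \<in> carrier M" for a x
   by (rule dual_eqI[OF D])
    (use that in "simp_all add: c d dual_dec_smult[OF D] \<tau>_smult ahomD(3)[OF Hom_ahom[OF dual_dec_closed[OF M]]]")
 qed (rule c)
 then show "dual_unit M \<in> Hom A M (dual (dual M))" by (simp add: Hom_iff dual_unit_def)
 interpret u: module_hom A M "dual (dual M)" "dual_unit M" by (rule module_homI[OF M.is_module DD.is_module h])
 have z: "dual_dec (dual M) 0[dual (dual M)] = (\<lambda>y\<in>carrier (dual M). 0[T])"
  using module_hom.hom_zero[OF module_homI[OF DD.is_module fdmod.axioms(2)[OF dual_fdmod[OF D]] dual_obj(4)[OF D]]]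
  by simp
 show "bij_betw (dual_unit M) (carrier M) (carrier (dual (dual M)))"
 proof (rule bij_betw_imageI)
  show "inj_on (dual_unit M) (carrier M)" unfolding u.inj_iff
  proof (intro ballI impI)
   fix m assume m: "m \<in> carrier M" "dual_unit M m = 0[dual (dual M)]"
   have "\<phi> m = 0[T]" if p: "\<phi> \<in> Hom A M T" for \<phi>
   proof -
    have "\<tau> (\<phi> m) = dual_dec (dual M) (dual_unit M m) (dual_enc M \<phi>)"
     using d[OF m(1) dual_enc_closed[OF M p]] by (simp add: dual_dec_enc[OF M p])
    also have "\<dots> = \<tau> 0[T]" unfolding m(2) z using dual_enc_closed[OF M p] by simp
    finally have "\<tau> (\<phi> m) = \<tau> 0[T]" .
    then show ?thesis by (rule \<tau>_inj) (use Hom_closed[OF p m(1)] in simp_all)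
   qed
   then show "m = 0[M]" by (rule eval_inj[OF M m(1)])
  qed
  show "dual_unit M ` carrier M = carrier (dual (dual M))"
  proof (intro equalityI subsetI)
   fix w assume w: "w \<in> carrier (dual (dual M))"
   obtain m where m: "m \<in> carrier M" "\<And>\<phi>. \<phi> \<in> Hom A M T \<Longrightarrow> dual_dec (dual M) w (dual_enc M \<phi>) = \<tau> (\<phi> m)"
    by (rule eval_onto[OF M ahom_comp[OF dual_obj(3)[OF M] Hom_ahom[OF dual_dec_closed[OF D w]]]]) blast
   have "dual_unit M m = w"
   proof (rule dual_eqI[OF D c[OF m(1)] w])
    fix y assume y: "y \<in> carrier (dual M)"
    show "dual_dec (dual M) (dual_unit M m) y = dual_dec (dual M) w y"
     using m(2)[OF dual_dec_closed[OF M y]] by (simp add: d[OF m(1) y] dual_enc_dec[OF M y])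
   qed
   then show "w \<in> dual_unit M ` carrier M" using m(1) by blast
  qed (use c in auto)
 qed
qed

lemma duality: "duality_functor A dual dual_map"
proof
 note f = fg_modules_fdmod[OF fd, THEN iffD1]
 fix M :: "('a, nat \<Rightarrow> 'f) module" assume "M \<in> fg_modules A"
 then have M: "fdmod A M" by (rule f)
 interpret M: fdmod A M by (rule M)
 show "dual M \<in> fg_modules A" by (rule dual_obj(1)[OF M])
 have [simp]: "restrict (compose (carrier M) \<phi> (\<lambda>x\<in>carrier M. x)) (carrier M) = restrict \<phi> (carrier M)" for \<phi> :: "(nat \<Rightarrow> 'f) \<Rightarrow> 't"
  by (auto simp: compose_def)
 have id: "(\<lambda>x\<in>carrier M. x) \<in> ahom A M M" by (rule Hom_ahom[OF restrict_Hom[OF ahom_id M.is_module]])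
 show "dual_map M M (\<lambda>x\<in>carrier M. x) = (\<lambda>x\<in>carrier (dual M). x)"
 proof (rule Hom_eqI[OF dual_map_hom[OF M M id]])
  show "(\<lambda>x\<in>carrier (dual M). x) \<in> Hom A (dual M) (dual M)"
   by (rule restrict_Hom[OF ahom_id fdmod.axioms(2)[OF dual_obj(2)[OF M]]])
  fix y assume y: "y \<in> carrier (dual M)"
  show "dual_map M M (\<lambda>x\<in>carrier M. x) y = (\<lambda>x\<in>carrier (dual M). x) y"
   by (rule dual_eqI[OF M dual_map_apply(2)[OF M M id y]])
    (use y in "simp_all add: dual_map_apply(3)[OF M M id] compose_eq")
 qed
next
 note f = fg_modules_fdmod[OF fd, THEN iffD1]
 fix M N :: "('a, nat \<Rightarrow> 'f) module" and g assume MN: "M \<in> fg_modules A" "N \<in> fg_modules A" "g \<in> Hom A M N"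
 note M = f[OF MN(1)] and N = f[OF MN(2)] and g = Hom_ahom[OF MN(3)]
 interpret M: fdmod A M by (rule M)
 interpret N: fdmod A N by (rule N)
 interpret dM: fdmod A "dual M" by (rule dual_obj(2)[OF M])
 interpret dN: fdmod A "dual N" by (rule dual_obj(2)[OF N])
 show "dual_map M N g \<in> Hom A (dual N) (dual M)" by (rule dual_map_hom[OF M N g])
 show "dual_map M N (\<lambda>x\<in>carrier M. g x +[N] h x)
   = (\<lambda>x\<in>carrier (dual N). dual_map M N g x +[dual M] dual_map M N h x)" if h: "h \<in> Hom A M N" for h
 proof -
  note h' = Hom_ahom[OF h]
  have s: "(\<lambda>x\<in>carrier M. g x +[N] h x) \<in> ahom A M N"
   by (rule Hom_ahom[OF restrict_Hom[OF hom_add_ahom[OF N.is_module g h'] M.is_module]])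
  show ?thesis
  proof (rule Hom_eqI[OF dual_map_hom[OF M N s]])
   show "(\<lambda>x\<in>carrier (dual N). dual_map M N g x +[dual M] dual_map M N h x) \<in> Hom A (dual N) (dual M)"
    by (rule restrict_Hom[OF hom_add_ahom[OF dM.is_module Hom_ahom[OF dual_map_hom[OF M N g]]
       Hom_ahom[OF dual_map_hom[OF M N h']]] dN.is_module])
   fix y assume y: "y \<in> carrier (dual N)"
   show "dual_map M N (\<lambda>x\<in>carrier M. g x +[N] h x) y = (\<lambda>x\<in>carrier (dual N). dual_map M N g x +[dual M] dual_map M N h x) y"
    by (rule dual_eqI[OF M dual_map_apply(2)[OF M N s y]])
     (use y in \<open>simp_all add: dual_map_apply(2,3)[OF M N s] dual_map_apply(2,3)[OF M N g] dual_map_apply(2,3)[OF M N h']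
       compose_eq dual_dec_add[OF M] ahomD(1)[OF g] ahomD(1)[OF h'] ahomD(2)[OF Hom_ahom[OF dual_dec_closed[OF N]]]\<close>)
  qed
 qed
 show "dual_map M N (\<lambda>x\<in>carrier M. scalar_action A N c (g x))
   = (\<lambda>x\<in>carrier (dual N). scalar_action A (dual M) c (dual_map M N g x))" for c
 proof -
  have sh: "(\<lambda>x. scalar_action A X c (k x)) \<in> ahom A Y X" if "k \<in> ahom A Y X" "left_module A X" for k X
    and Y :: "('a, nat \<Rightarrow> 'f) module"
  proof -
   interpret X: left_module A X by fact
   show ?thesis
   proof (rule ahomI)
    fix a x assume ax: "a \<in> carrier A" "x \<in> carrier Y"
    have "sc c **[A] a = a **[A] sc c" using ax(1) by (simp add: sc_simps)
    then show "scalar_action A X c (k (a *[Y] x)) = a *[X] scalar_action A X c (k x)"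
     using ax by (simp add: scalar_action_def ahomD[OF that(1)] flip: X.smult_assoc1)
   qed (simp_all add: scalar_action_def ahomD[OF that(1)] X.smult_r_distr)
  qed
  have s: "(\<lambda>x\<in>carrier M. scalar_action A N c (g x)) \<in> ahom A M N"
   by (rule Hom_ahom[OF restrict_Hom[OF sh[OF g N.is_module] M.is_module]])
  show ?thesis
  proof (rule Hom_eqI[OF dual_map_hom[OF M N s]])
   show "(\<lambda>x\<in>carrier (dual N). scalar_action A (dual M) c (dual_map M N g x)) \<in> Hom A (dual N) (dual M)"
    by (rule restrict_Hom[OF sh[OF Hom_ahom[OF dual_map_hom[OF M N g]] dM.is_module] dN.is_module])
   fix y assume y: "y \<in> carrier (dual N)"
   show "dual_map M N (\<lambda>x\<in>carrier M. scalar_action A N c (g x)) y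
     = (\<lambda>x\<in>carrier (dual N). scalar_action A (dual M) c (dual_map M N g x)) y"
    by (rule dual_eqI[OF M dual_map_apply(2)[OF M N s y]])
     (use y in \<open>simp_all add: scalar_action_def dual_map_apply(2,3)[OF M N s, unfolded scalar_action_def]
       dual_map_apply(2,3)[OF M N g] compose_eq dual_dec_smult[OF M] ahomD(1)[OF g] scal
       ahomD(3)[OF Hom_ahom[OF dual_dec_closed[OF N]]] Hom_closed[OF dual_dec_closed[OF N]]\<close>)
  qed
 qed
 show "dual_map L N (compose (carrier L) g h) = compose (carrier (dual N)) (dual_map L M h) (dual_map M N g)"
  if L: "L \<in> fg_modules A" and h: "h \<in> Hom A L M" for L h
 proof -
  note L' = f[OF L] and h' = Hom_ahom[OF h]
  interpret L: fdmod A L by (rule L')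
  have s: "compose (carrier L) g h \<in> ahom A L N" unfolding compose_def
   by (rule Hom_ahom[OF restrict_Hom[OF ahom_comp[OF h' g] L.is_module]])
  show ?thesis
  proof (rule Hom_eqI[OF dual_map_hom[OF L' N s]])
   show "compose (carrier (dual N)) (dual_map L M h) (dual_map M N g) \<in> Hom A (dual N) (dual L)" unfolding compose_def
    by (rule restrict_Hom[OF ahom_comp[OF Hom_ahom[OF dual_map_hom[OF M N g]] Hom_ahom[OF dual_map_hom[OF L' M h']]]
       dN.is_module])
   fix y assume y: "y \<in> carrier (dual N)"
   show "dual_map L N (compose (carrier L) g h) y = compose (carrier (dual N)) (dual_map L M h) (dual_map M N g) y"
    by (rule dual_eqI[OF L' dual_map_apply(2)[OF L' N s y]])
     (use y in \<open>simp_all add: dual_map_apply(2,3)[OF L' N s] dual_map_apply(2,3)[OF L' M h'] dual_map_apply(2,3)[OF M N g]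
       compose_eq ahomD(1)[OF h']\<close>)
  qed
 qed
next
 note f = fg_modules_fdmod[OF fd, THEN iffD1]
 show "short_exact A (dual N) (dual M) (dual L) (dual_map M N g) (dual_map L M h)"
  if "L \<in> fg_modules A" "M \<in> fg_modules A" "N \<in> fg_modules A" "short_exact A L M N h g" for L M N h g
  by (rule dual_exact[OF f[OF that(1)] f[OF that(2)] f[OF that(3)] that(4)])
 show "\<exists>\<eta>. (\<forall>M\<in>fg_modules A. \<eta> M \<in> Hom A M (dual (dual M)) \<and> bij_betw (\<eta> M) (carrier M) (carrier (dual (dual M)))) \<and>
   (\<forall>M\<in>fg_modules A. \<forall>N\<in>fg_modules A. \<forall>f\<in>Hom A M N.
    compose (carrier M) (\<eta> N) f = compose (carrier M) (dual_map (dual N) (dual M) (dual_map M N f)) (\<eta> M))"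
 proof (intro exI[of _ dual_unit] conjI ballI)
  fix M N :: "('a, nat \<Rightarrow> 'f) module" and g assume MN: "M \<in> fg_modules A" "N \<in> fg_modules A" "g \<in> Hom A M N"
  note M = f[OF MN(1)] and N = f[OF MN(2)] and g = Hom_ahom[OF MN(3)]
  have DM: "fdmod A (dual M)" and DN: "fdmod A (dual N)" using dual_obj(2) M N by auto
  note Dg = Hom_ahom[OF dual_map_hom[OF M N g]]
  show "compose (carrier M) (dual_unit N) g = compose (carrier M) (dual_map (dual N) (dual M) (dual_map M N g)) (dual_unit M)"
  proof (rule ext)
   fix m
   show "compose (carrier M) (dual_unit N) g m = compose (carrier M) (dual_map (dual N) (dual M) (dual_map M N g)) (dual_unit M) m"
   proof (cases "m \<in> carrier M")
    case m: True
    have "dual_unit N (g m) = dual_map (dual N) (dual M) (dual_map M N g) (dual_unit M m)"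
     by (rule dual_eqI[OF DN dual_unit_closed[OF N ahomD(1)[OF g m]] dual_map_apply(2)[OF DN DM Dg dual_unit_closed[OF M m]]])
      (simp add: dual_map_apply(3)[OF DN DM Dg dual_unit_closed[OF M m]] compose_eq dual_unit_dec[OF N ahomD(1)[OF g m]]
        dual_unit_dec[OF M m] dual_map_apply(2,3)[OF M N g] m)
    then show ?thesis using m by (simp add: compose_eq)
   qed (simp add: compose_def)
  qed
 qed (simp_all add: dual_unit(1,2) f)
qed

text \<open>The dual of a simple module is simple, so a single nonzero map from L to its dual is an
  isomorphism. This reduces self-duality to an existence statement that passes to tensor
  products.\<close>

lemma dual_self:
 assumes L: "simple_module A L" and g: "g \<in> ahom A L (\<delta> L)" "x \<in> carrier L" "g x \<noteq> 0[\<delta> L]"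
  and S: "left_module A S" "isomorphic A S L"
 shows "isomorphic A (dual S) L"
proof -
 have Lf: "fdmod A L" by (rule simple_fdmod[OF fd L])
 interpret L: fdmod A L by fact
 have Ss: "simple_module A S" by (rule simple_module_iso[OF L S(1) isomorphic_sym[OF S(1) L.is_module S(2)]])
 have Sf: "fdmod A S" by (rule simple_fdmod[OF fd Ss])
 interpret d: fdmod A "\<delta> L" by (rule dual_fdmod[OF Lf])
 interpret e: fdmod A "\<delta> S" by (rule dual_fdmod[OF Sf])
 interpret D: fdmod A "dual S" by (rule dual_obj(2)[OF Sf])
 obtain f where f: "f \<in> ahom A S L" "bij_betw f (carrier S) (carrier L)" by (rule isomorphicE[OF S(2)])
 have fc: "f ` carrier S = carrier L" using f(2) by (simp add: bij_betw_def)
 let ?p = "\<lambda>\<phi>. compose (carrier S) \<phi> f"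
 have "?p \<in> ahom A (\<delta> L) (\<delta> S)"
 proof (rule ahomI)
  show "?p \<phi> \<in> carrier (\<delta> S)" if "\<phi> \<in> carrier (\<delta> L)" for \<phi> using compose_Hom[OF S(1) f(1) Hom_ahom] that by simp
 qed (auto simp: compose_def ahomD(1)[OF f(1)] fun_eq_iff)
 then have h: "(\<lambda>x. ?p (g x)) \<in> ahom A L (\<delta> S)" by (rule ahom_comp[OF g(1)])
 have "?p (g x) \<noteq> 0[\<delta> S]"
 proof
  assume z: "?p (g x) = 0[\<delta> S]"
  have gx: "g x \<in> Hom A L T" using ahomD(1)[OF g(1,2)] by simp
  have "g x = 0[\<delta> L]"
  proof (rule Hom_eqI[OF gx])
   show "0[\<delta> L] \<in> Hom A L T" using d.M.zero_closed by simp
   fix y assume "y \<in> carrier L"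
   then obtain s where "s \<in> carrier S" "y = f s" using fc by blast
   then show "g x y = 0[\<delta> L] y" using fun_cong[OF z, of s] ahomD(1)[OF f(1)] by (simp add: compose_eq)
  qed
  then show False using g(3) by simp
 qed
 then have "isomorphic A L (\<delta> S)" by (rule simple_hom_iso(1)[OF L dual_simple[OF Ss] h g(2)])
 then have "isomorphic A L (dual S)" by (rule isomorphic_trans[OF L.is_module _ dual_obj(5)[OF Sf]])
 then show ?thesis by (rule isomorphic_sym[OF L.is_module D.is_module])
qed

end

section \<open>The dualizing module of a duality functor\<close>

locale duality = falg A + duality_functor A D D'
 for A :: "('f::field, 'a) module" and D D'
begin

lemma fgm: "M \<in> fg_modules A \<longleftrightarrow> fdmod A M" by (rule fg_modules_fdmod[OF fd])

lemma lm: "M \<in> fg_modules A \<Longrightarrow> left_module A M" by (simp add: fg_modules_def)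

definition unit where "unit = (SOME \<eta>.
 (\<forall>M\<in>fg_modules A. \<eta> M \<in> Hom A M (D (D M)) \<and> bij_betw (\<eta> M) (carrier M) (carrier (D (D M)))) \<and>
 (\<forall>M\<in>fg_modules A. \<forall>N\<in>fg_modules A. \<forall>f\<in>Hom A M N.
   compose (carrier M) (\<eta> N) f = compose (carrier M) (D' (D N) (D M) (D' M N f)) (\<eta> M)))"

lemma unit:
 assumes M: "M \<in> fg_modules A"
 shows "unit M \<in> ahom A M (D (D M))" "bij_betw (unit M) (carrier M) (carrier (D (D M)))"
  and unit_nat: "\<lbrakk>N \<in> fg_modules A; f \<in> Hom A M N; m \<in> carrier M\<rbrakk>
   \<Longrightarrow> unit N (f m) = D' (D N) (D M) (D' M N f) (unit M m)"
proof -
 note u = someI_ex[OF involutive, folded unit_def]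
 show "unit M \<in> ahom A M (D (D M))" "bij_betw (unit M) (carrier M) (carrier (D (D M)))"
  using u M by (auto intro: Hom_ahom)
 assume N: "N \<in> fg_modules A" "f \<in> Hom A M N" "m \<in> carrier M"
 then have "compose (carrier M) (unit N) f = compose (carrier M) (D' (D N) (D M) (D' M N f)) (unit M)"
  using u M by blast
 from fun_cong[OF this, of m] show "unit N (f m) = D' (D N) (D M) (D' M N f) (unit M m)"
  using N(3) by (simp add: compose_eq)
qed

lemma unit_surj: "\<lbrakk>M \<in> fg_modules A; z \<in> carrier (D (D M))\<rbrakk> \<Longrightarrow> \<exists>m\<in>carrier M. z = unit M m"
 using unit(2)[of M] by (auto simp: bij_betw_def)

lemma unit_eq: "\<lbrakk>M \<in> fg_modules A; unit M x = unit M y; x \<in> carrier M; y \<in> carrier M\<rbrakk> \<Longrightarrow> x = y"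
 using unit(2)[of M] by (auto simp: bij_betw_def dest: inj_onD)

lemma Hom_val: "\<lbrakk>f \<in> Hom A M N; m \<in> carrier M\<rbrakk> \<Longrightarrow> f m \<in> carrier N" by (rule ahomD(1)[OF Hom_ahom])

text \<open>By naturality of \<open>unit\<close>, f is conjugate to its double dual, which is
  determined by D' f.\<close>

lemma D_faithful:
 assumes "M \<in> fg_modules A" "N \<in> fg_modules A" "f \<in> Hom A M N" "g \<in> Hom A M N" "D' M N f = D' M N g"
 shows "f = g"
proof (rule Hom_eqI[OF assms(3,4)])
 fix m assume m: "m \<in> carrier M"
 show "f m = g m" by (rule unit_eq[OF assms(2) _ Hom_val[OF assms(3) m] Hom_val[OF assms(4) m]])
   (simp add: unit_nat[OF assms(1,2) assms(3) m] unit_nat[OF assms(1,2) assms(4) m] assms(5))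
qed

text \<open>The candidate is the dual of h conjugated by \<open>unit\<close>. Its double dual is
  then the dual of h, and faithfulness cancels one dual.\<close>

lemma D_full:
 assumes M: "M \<in> fg_modules A" and N: "N \<in> fg_modules A" and h: "h \<in> Hom A (D N) (D M)"
 obtains f where "f \<in> Hom A M N" "D' M N f = h"
proof -
 note o = obj[OF M] obj[OF N] and oo = obj[OF obj[OF M]] obj[OF obj[OF N]]
 let ?i = "inv_into (carrier N) (unit N)"
 have i: "?i \<in> ahom A (D (D N)) N"
  by (rule module_hom.inv_ahom[OF module_homI[OF lm[OF N] lm[OF oo(2)] unit(1)[OF N]] unit(2)[OF N]])
 have ui: "unit N (?i z) = z" if "z \<in> carrier (D (D N))" for z
  using unit(2)[OF N] that by (simp add: bij_betw_def f_inv_into_f)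
 let ?h = "D' (D N) (D M) h"
 have h': "?h \<in> Hom A (D (D M)) (D (D N))" by (rule mor[OF o(2,1) h])
 let ?f = "\<lambda>m\<in>carrier M. ?i (?h (unit M m))"
 have f: "?f \<in> Hom A M N"
  by (rule restrict_Hom[OF ahom_comp[OF ahom_comp[OF unit(1)[OF M] Hom_ahom[OF h']] i] lm[OF M]])
 have Df: "D' M N ?f \<in> Hom A (D N) (D M)" by (rule mor[OF M N f])
 have "D' (D N) (D M) (D' M N ?f) = ?h"
 proof (rule Hom_eqI[OF mor[OF o(2,1) Df] h'])
  fix z assume "z \<in> carrier (D (D M))"
  then obtain m where m: "m \<in> carrier M" "z = unit M m" using unit_surj[OF M] by blast
  have "D' (D N) (D M) (D' M N ?f) z = unit N (?f m)" unfolding m(2) by (rule unit_nat[OF M N f m(1), symmetric])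
  also have "\<dots> = ?h z" using m ui[OF Hom_val[OF h' ahomD(1)[OF unit(1)[OF M] m(1)]]] by simp
  finally show "D' (D N) (D M) (D' M N ?f) z = ?h z" .
 qed
 then have "D' M N ?f = h" by (rule D_faithful[OF o(2,1) Df h])
 then show ?thesis by (rule that[OF f])
qed

section \<open>The regular module and the representing module\<close>

definition R where "R = enc A (regular A)"
definition e where "e = enc_map A (regular A)"
definition orb where "orb M y = (\<lambda>r\<in>carrier R. inv_into (carrier A) e r *[M] y)"
abbreviation "u \<equiv> e 1[A]"
abbreviation "T \<equiv> D R"
text \<open>Right multiplications are the endomorphisms of the regular module; the contravariant
  functor turns them into a left action on T, which commutes with the given one since D' has
  homomorphisms as values.\<close>

definition act where "act a = D' R R (orb R (e a))"
text \<open>Outside the carrier the action of T is kept, so that T and T' restrict to literally the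
  same record over the field and hence have the same tensor products of vector spaces.\<close>

definition T' where "T' = T\<lparr>smult := \<lambda>a t. if t \<in> carrier T then act a t else a *[T] t\<rparr>"
text \<open>The isomorphism of D M with Hom(M, T): an element y of D M is a map R \<rightarrow> D M,
  its dual is a map from the double dual of M to T, and \<open>unit\<close> replaces the double dual
  by M.\<close>

definition \<theta> where "\<theta> M y = compose (carrier M) (D' R (D M) (orb (D M) y)) (unit M)"
text \<open>For M = R, an element t of T becomes a map from R to T, which is recorded by its value
  at the generator \<open>u\<close>.\<close>

definition \<tau> where "\<tau> t = \<theta> R t u"

lemma R: "R \<in> fg_modules A" "e \<in> ahom A (regular A) R" "bij_betw e (carrier A) (carrier R)"
 using enc[OF regular_fdmod, folded R_def e_def] by simp_all

lemma e_closed [simp]: "a \<in> carrier A \<Longrightarrow> e a \<in> carrier R" using ahomD(1)[OF R(2)] by simp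

lemma e_mult: "\<lbrakk>x \<in> carrier A; a \<in> carrier A\<rbrakk> \<Longrightarrow> e (x **[A] a) = x *[R] e a" using ahomD(3)[OF R(2)] by simp

lemma R_surj: "r \<in> carrier R \<Longrightarrow> \<exists>a\<in>carrier A. r = e a" using R(3) by (auto simp: bij_betw_def)

lemma e_inj: "\<lbrakk>e a = e b; a \<in> carrier A; b \<in> carrier A\<rbrakk> \<Longrightarrow> a = b"
 using R(3) by (auto simp: bij_betw_def dest: inj_onD)

lemma orb_e: "a \<in> carrier A \<Longrightarrow> orb M y (e a) = a *[M] y" using R(3) by (simp add: orb_def bij_betw_def)

lemma orb_Hom:
 assumes M: "left_module A M" and y: "y \<in> carrier M" shows "orb M y \<in> Hom A R M"
proof -
 interpret M: left_module A M by fact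
 let ?d = "inv_into (carrier A) e"
 have d: "?d \<in> ahom A R (regular A)"
  using module_hom.inv_ahom[OF module_homI[OF regular_left_module lm[OF R(1)] R(2)]] R(3) by simp
 show ?thesis unfolding orb_def by (rule restrict_Hom[OF ahom_comp[OF d orbit_hom[OF M y]] lm[OF R(1)]])
qed

lemma orb_u: "\<lbrakk>left_module A M; y \<in> carrier M\<rbrakk> \<Longrightarrow> orb M y u = y"
 using left_module.smult_one by (fastforce simp: orb_e)

lemma Hom_R_eqI:
 assumes "f \<in> Hom A R M" "g \<in> Hom A R M" "\<And>a. a \<in> carrier A \<Longrightarrow> f (e a) = g (e a)"
 shows "f = g" by (rule Hom_eqI[OF assms(1,2)]) (use R_surj assms(3) in blast)

lemma Hom_R:
 assumes M: "left_module A M" and f: "f \<in> Hom A R M"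
 shows "f = orb M (f u)"
proof (rule Hom_R_eqI[OF f orb_Hom[OF M Hom_val[OF f]]])
 fix a assume a: "a \<in> carrier A"
 have "e a = a *[R] u" using e_mult[of a "1[A]"] a by simp
 then have "f (e a) = a *[M] f u" using ahomD(3)[OF Hom_ahom[OF f] a, of u] by simp
 then show "f (e a) = orb M (f u) (e a)" using a by (simp only: orb_e)
qed simp

lemma comp_Hom: "\<lbrakk>left_module A L; f \<in> Hom A L M; g \<in> Hom A M N\<rbrakk> \<Longrightarrow> compose (carrier L) g f \<in> Hom A L N"
 unfolding compose_def by (rule restrict_Hom[OF ahom_comp[OF Hom_ahom Hom_ahom]])

lemma orb_right:
 fixes M :: "('a, 'm) module"
 assumes M: "left_module A M" and y: "y \<in> carrier M" and a: "a \<in> carrier A"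
 shows "orb M (a *[M] y) = compose (carrier R) (orb M y) (orb R (e a))"
proof -
 interpret M: left_module A M by fact
 note l = lm[OF R(1)]
 have 1: "orb M (a *[M] y) \<in> Hom A R M" by (rule orb_Hom) (use assms in simp_all)
 have 2: "orb M y \<in> Hom A R M" by (rule orb_Hom) (use assms in simp_all)
 have 3: "orb R (e a) \<in> Hom A R R" by (rule orb_Hom) (use a l in simp_all)
 show ?thesis by (rule Hom_R_eqI[OF 1 comp_Hom[OF l 3 2]])
   (use a y in "simp_all add: orb_e compose_eq M.smult_assoc1 flip: e_mult")
qed

lemma orb_comp:
 assumes M: "left_module A M" and N: "left_module A N" and f: "f \<in> Hom A M N" and y: "y \<in> carrier M"
 shows "orb N (f y) = compose (carrier R) f (orb M y)"
 by (rule Hom_R_eqI[OF orb_Hom[OF N Hom_val[OF f y]] comp_Hom[OF lm[OF R(1)] orb_Hom[OF M y] f]])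
  (simp add: orb_e compose_eq ahomD(3)[OF Hom_ahom[OF f]] y)

lemma T: "T \<in> fg_modules A" by (rule obj[OF R(1)])

lemma act_Hom: "a \<in> carrier A \<Longrightarrow> act a \<in> Hom A T T"
 unfolding act_def by (rule mor[OF R(1) R(1) orb_Hom[OF lm[OF R(1)]]]) simp

context
 fixes M assumes M: "M \<in> fg_modules A"
begin

lemma \<theta>_aux: "y \<in> carrier (D M) \<Longrightarrow> D' R (D M) (orb (D M) y) \<in> Hom A (D (D M)) T"
 by (rule mor[OF R(1) obj[OF M] orb_Hom[OF lm[OF obj[OF M]]]])

lemma \<theta>_Hom: "y \<in> carrier (D M) \<Longrightarrow> \<theta> M y \<in> Hom A M T" unfolding \<theta>_def compose_def
 by (rule restrict_Hom[OF ahom_comp[OF unit(1)[OF M] Hom_ahom[OF \<theta>_aux]] lm[OF M]])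

lemma \<theta>_eq: "m \<in> carrier M \<Longrightarrow> \<theta> M y m = D' R (D M) (orb (D M) y) (unit M m)" by (simp add: \<theta>_def compose_eq)

lemma unit_val [simp]: "m \<in> carrier M \<Longrightarrow> unit M m \<in> carrier (D (D M))" by (rule ahomD(1)[OF unit(1)[OF M]])

lemma \<theta>_add:
 assumes "y \<in> carrier (D M)" "z \<in> carrier (D M)" "m \<in> carrier M"
 shows "\<theta> M (y +[D M] z) m = \<theta> M y m +[T] \<theta> M z m"
proof -
 interpret DM: left_module A "D M" by (rule lm[OF obj[OF M]])
 note o = orb_Hom[OF DM.is_module assms(1)] orb_Hom[OF DM.is_module assms(2)]
 have "orb (D M) (y +[D M] z) = (\<lambda>x\<in>carrier R. orb (D M) y x +[D M] orb (D M) z x)"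
 proof (rule Hom_R_eqI[OF orb_Hom[OF DM.is_module]])
  show "(\<lambda>x\<in>carrier R. orb (D M) y x +[D M] orb (D M) z x) \<in> Hom A R (D M)"
   by (rule restrict_Hom[OF hom_add_ahom[OF DM.is_module Hom_ahom[OF o(1)] Hom_ahom[OF o(2)]] lm[OF R(1)]])
 qed (use assms in "simp_all add: orb_e DM.smult_r_distr")
 then show ?thesis using additive[OF R(1) obj[OF M] o] assms by (simp add: \<theta>_eq)
qed

text \<open>For the multiple a y, the map from R is preceded by right multiplication by a, which D
  turns into \<open>act a\<close> applied afterwards. Thus A acts on D M through T' on the
  values.\<close>

lemma \<theta>_smult:
 assumes "a \<in> carrier A" "y \<in> carrier (D M)" "m \<in> carrier M"
 shows "\<theta> M (a *[D M] y) m = act a (\<theta> M y m)"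
proof -
 note l = lm[OF obj[OF M]] lm[OF R(1)]
 have "D' R (D M) (orb (D M) (a *[D M] y)) = compose (carrier (D (D M))) (act a) (D' R (D M) (orb (D M) y))"
  unfolding act_def orb_right[OF l(1) assms(2,1)]
  by (rule comp[OF R(1) R(1) obj[OF M] orb_Hom[OF l(2)] orb_Hom[OF l(1) assms(2)]]) (use assms(1) in simp)
 then show ?thesis using assms(3) by (simp add: \<theta>_eq compose_eq)
qed

text \<open>The right side is \<open>\<theta> N y (f m)\<close> in unfolded form; the identity comes
  from functoriality of D and naturality of \<open>unit\<close>.\<close>

lemma \<theta>_nat:
 assumes N: "N \<in> fg_modules A" and f: "f \<in> Hom A M N" and "y \<in> carrier (D N)" "m \<in> carrier M"
 shows "\<theta> M (D' M N f y) m = D' R (D N) (orb (D N) y) (unit N (f m))"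
proof -
 note l = lm[OF obj[OF N]] lm[OF obj[OF M]] and F = mor[OF M N f]
 have "D' R (D M) (orb (D M) (D' M N f y))
   = compose (carrier (D (D M))) (D' R (D N) (orb (D N) y)) (D' (D N) (D M) (D' M N f))"
  unfolding orb_comp[OF l F assms(3)] by (rule comp[OF R(1) obj[OF N] obj[OF M] orb_Hom[OF l(1) assms(3)] F])
 then show ?thesis using assms(4) unit_nat[OF M N f assms(4)] by (simp add: \<theta>_eq compose_eq)
qed

lemma \<theta>_inj:
 assumes "y \<in> carrier (D M)" "z \<in> carrier (D M)" "\<And>m. m \<in> carrier M \<Longrightarrow> \<theta> M y m = \<theta> M z m"
 shows "y = z"
proof -
 note l = lm[OF obj[OF M]]
 have "D' R (D M) (orb (D M) y) = D' R (D M) (orb (D M) z)"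
 proof (rule Hom_eqI[OF \<theta>_aux[OF assms(1)] \<theta>_aux[OF assms(2)]])
  fix w assume "w \<in> carrier (D (D M))"
  then obtain m where "m \<in> carrier M" "w = unit M m" using unit_surj[OF M] by blast
  then show "D' R (D M) (orb (D M) y) w = D' R (D M) (orb (D M) z) w" using assms(3)[of m] by (simp add: \<theta>_eq)
 qed
 then have "orb (D M) y = orb (D M) z"
  by (rule D_faithful[OF R(1) obj[OF M] orb_Hom[OF l assms(1)] orb_Hom[OF l assms(2)]])
 then show ?thesis using orb_u[OF l assms(1)] orb_u[OF l assms(2)] by metis
qed

text \<open>Since D is full, a map from the double dual of M to T comes from a map R \<rightarrow> D
  M, and this is given by the image of the generator.\<close>

lemma \<theta>_surj:
 assumes p: "\<phi> \<in> ahom A M T"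
 obtains y where "y \<in> carrier (D M)" "\<And>m. m \<in> carrier M \<Longrightarrow> \<theta> M y m = \<phi> m"
proof -
 note l = lm[OF obj[OF M]]
 let ?i = "inv_into (carrier M) (unit M)" and ?DD = "carrier (D (D M))"
 have i: "?i \<in> ahom A (D (D M)) M"
  by (rule module_hom.inv_ahom[OF module_homI[OF lm[OF M] lm[OF obj[OF obj[OF M]]] unit(1)[OF M]] unit(2)[OF M]])
 have "(\<lambda>z\<in>?DD. \<phi> (?i z)) \<in> Hom A (D (D M)) T"
  by (rule restrict_Hom[OF ahom_comp[OF i p] lm[OF obj[OF obj[OF M]]]])
 then obtain f where f: "f \<in> Hom A R (D M)" "D' R (D M) f = (\<lambda>z\<in>?DD. \<phi> (?i z))" by (rule D_full[OF R(1) obj[OF M]])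
 have fu: "f u \<in> carrier (D M)" by (rule Hom_val[OF f(1)]) simp
 show ?thesis
 proof (rule that[OF fu])
  fix m assume m: "m \<in> carrier M"
  have "?i (unit M m) = m" using unit(2)[OF M] m by (simp add: bij_betw_def)
  then show "\<theta> M (f u) m = \<phi> m" using m f(2) by (simp add: \<theta>_eq Hom_R[OF l f(1), symmetric])
 qed
qed

end

text \<open>A scalar acts on R both by a right multiplication and as a multiple of the identity;
  linearity of the functor over the field compares the two on T.\<close>

lemma act_scalar:
 assumes t: "t \<in> carrier T" shows "act (sc c) t = sc c *[T] t"
proof -
 interpret R: left_module A R by (rule lm[OF R(1)])
 have id: "(\<lambda>x\<in>carrier R. x) \<in> Hom A R R" by (rule restrict_Hom[OF ahom_id lm[OF R(1)]])
 have s: "(\<lambda>x\<in>carrier R. scalar_action A R c ((\<lambda>x\<in>carrier R. x) x)) = orb R (e (sc c))"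
 proof
  fix x show "(\<lambda>x\<in>carrier R. scalar_action A R c ((\<lambda>x\<in>carrier R. x) x)) x = orb R (e (sc c)) x"
  proof (cases "x \<in> carrier R")
   case True
   then obtain a where a: "a \<in> carrier A" "x = e a" using R_surj by blast
   then show ?thesis using True by (simp add: scalar_action_def orb_e sc_simps flip: e_mult)
  qed (simp add: orb_def)
 qed
 have "D' R R (orb R (e (sc c))) = (\<lambda>x\<in>carrier T. scalar_action A T c (D' R R (\<lambda>x\<in>carrier R. x) x))"
  using homogeneous[OF R(1) R(1) id, of c] unfolding s .
 then show ?thesis using t by (simp add: act_def ident[OF R(1)] scalar_action_def)
qed

lemma T'_simps [simp]: "carrier T' = carrier T" "0[T'] = 0[T]" "x +[T'] y = x +[T] y"
 "t \<in> carrier T \<Longrightarrow> a *[T'] t = act a t" by (simp_all add: T'_def)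

lemma rs_T': "rs A T' = rs A T" by (auto simp: restrict_scalars_def T'_def scalar_action_def fun_eq_iff act_scalar)

lemma T'_left_module: "left_module A T'"
proof -
 interpret T: left_module A T by (rule lm[OF T])
 interpret R: left_module A R by (rule lm[OF R(1)])
 note cl = Hom_val[OF act_Hom]
 note oH = orb_Hom[OF lm[OF R(1)] e_closed]
 have e_add: "e (a +[A] b) = e a +[R] e b" if "a \<in> carrier A" "b \<in> carrier A" for a b
  using ahomD(2)[OF R(2)] that by simp
 have add: "act (a +[A] b) x = act a x +[T] act b x" if ab: "a \<in> carrier A" "b \<in> carrier A" "x \<in> carrier T" for a b x
 proof -
  have "orb R (e (a +[A] b)) = (\<lambda>x\<in>carrier R. orb R (e a) x +[R] orb R (e b) x)"
  proof (rule Hom_R_eqI[OF oH])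
   show "(\<lambda>x\<in>carrier R. orb R (e a) x +[R] orb R (e b) x) \<in> Hom A R R"
    by (rule restrict_Hom[OF hom_add_ahom[OF lm[OF R(1)] Hom_ahom[OF oH[OF ab(1)]] Hom_ahom[OF oH[OF ab(2)]]] lm[OF R(1)]])
  qed (use ab in "simp_all add: orb_e e_add R.smult_r_distr")
  then show ?thesis using additive[OF R(1) R(1) oH[OF ab(1)] oH[OF ab(2)]] ab by (simp add: act_def)
 qed
 have mul: "act (a **[A] b) x = act a (act b x)" if ab: "a \<in> carrier A" "b \<in> carrier A" "x \<in> carrier T" for a b x
 proof -
  have "orb R (e (a **[A] b)) = compose (carrier R) (orb R (e b)) (orb R (e a))"
   using orb_right[OF lm[OF R(1)] e_closed[OF ab(2)] ab(1)] ab by (simp add: e_mult)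
  then show ?thesis using comp[OF R(1) R(1) R(1) oH[OF ab(1)] oH[OF ab(2)]] ab(3) by (simp add: act_def compose_eq)
 qed
 have one: "act 1[A] x = x" if "x \<in> carrier T" for x using act_scalar[OF that, of 1] that by (simp add: sc_simps)
 show ?thesis
 proof (rule left_moduleI)
  show "\<exists>y\<in>carrier T'. y +[T'] x = 0[T']" if "x \<in> carrier T'" for x
   using that by (intro bexI[of _ "-[T] x"]) (simp_all add: T.M.l_neg)
  show "x +[T'] y = y +[T'] x" if "x \<in> carrier T'" "y \<in> carrier T'" for x y using that T.M.a_comm by simp
 qed (simp_all add: ring_axioms cl add mul one T.M.a_assoc ahomD(2)[OF Hom_ahom[OF act_Hom]])
qed

lemma \<tau>_add: "\<lbrakk>x \<in> carrier T; y \<in> carrier T\<rbrakk> \<Longrightarrow> \<tau> (x +[T] y) = \<tau> x +[T] \<tau> y" by (simp add: \<tau>_def \<theta>_add[OF R(1)])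

lemma \<tau>_smult: "\<lbrakk>a \<in> carrier A; x \<in> carrier T\<rbrakk> \<Longrightarrow> \<tau> (a *[T] x) = act a (\<tau> x)" by (simp add: \<tau>_def \<theta>_smult[OF R(1)])

lemma \<tau>_closed: "x \<in> carrier T \<Longrightarrow> \<tau> x \<in> carrier T" unfolding \<tau>_def by (rule Hom_val[OF \<theta>_Hom[OF R(1)]]) simp_all

lemma \<theta>_R: "\<lbrakk>x \<in> carrier T; a \<in> carrier A\<rbrakk> \<Longrightarrow> \<theta> R x (e a) = a *[T] \<tau> x"
 using Hom_R[OF lm[OF T] \<theta>_Hom[OF R(1), of x]] orb_e[of a T "\<tau> x"] unfolding \<tau>_def by simp

text \<open>Naturality of \<open>\<theta>\<close> under right multiplication by a. Together with the
  rule for multiples it says that \<open>\<tau>\<close> exchanges the two actions.\<close>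

lemma \<tau>_act:
 assumes "a \<in> carrier A" "x \<in> carrier T" shows "\<tau> (act a x) = a *[T] \<tau> x"
proof -
 note oH = orb_Hom[OF lm[OF R(1)] e_closed[OF assms(1)]]
 have "\<tau> (act a x) = \<theta> R x (orb R (e a) u)"
  using \<theta>_nat[OF R(1) R(1) oH assms(2), of u] \<theta>_eq[OF R(1) Hom_val[OF oH, of u], of x] by (simp add: \<tau>_def act_def)
 also have "orb R (e a) u = e a" by (rule orb_u[OF lm[OF R(1)]]) (use assms in simp)
 finally show ?thesis using assms by (simp add: \<theta>_R)
qed

lemma \<tau>_bij: "bij_betw \<tau> (carrier T) (carrier T)"
proof (rule bij_betw_imageI)
 show "inj_on \<tau> (carrier T)"
 proof (rule inj_onI)
  fix x y assume xy: "x \<in> carrier T" "y \<in> carrier T" "\<tau> x = \<tau> y"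
  show "x = y"
  proof (rule \<theta>_inj[OF R(1) xy(1,2)])
   fix m assume "m \<in> carrier R"
   then obtain a where "a \<in> carrier A" "m = e a" using R_surj by blast
   then show "\<theta> R x m = \<theta> R y m" using xy by (simp add: \<theta>_R)
  qed
 qed
 show "\<tau> ` carrier T = carrier T"
 proof (intro equalityI subsetI)
  fix t assume t: "t \<in> carrier T"
  obtain y where "y \<in> carrier T" "\<And>m. m \<in> carrier R \<Longrightarrow> \<theta> R y m = orb T t m"
   by (rule \<theta>_surj[OF R(1) Hom_ahom[OF orb_Hom[OF lm[OF T] t]]]) blast
  then show "t \<in> \<tau> ` carrier T" using orb_u[OF lm[OF T] t] by (intro image_eqI[of _ _ y]) (simp_all add: \<tau>_def)
 qed (use \<tau>_closed in auto)
qed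

text \<open>The exact functor D takes the embedding of M in N to a surjection D N \<rightarrow> D M,
  which under \<open>\<theta>\<close> is the restriction of maps to T. The cokernel is copied into
  the category to complete a short exact sequence.\<close>

lemma T_injective:
 fixes M N :: "('a, nat \<Rightarrow> 'f) module"
 assumes M: "fdmod A M" and N: "fdmod A N" and i: "\<iota> \<in> ahom A M N" "inj_on \<iota> (carrier M)" and p: "\<phi> \<in> ahom A M T"
 shows "\<exists>\<psi>\<in>ahom A N T. \<forall>m\<in>carrier M. \<psi> (\<iota> m) = \<phi> m"
proof -
 interpret M: fdmod A M by fact
 interpret N: fdmod A N by fact
 interpret i: module_hom A M N \<iota> by (rule module_homI[OF M.is_module N.is_module i(1)])
 have fM: "M \<in> fg_modules A" and fN: "N \<in> fg_modules A" using M N by (simp_all add: fgm)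
 let ?I = "\<iota> ` carrier M"
 have I: "submodule ?I A N" by (rule i.image_submodule[OF M.carrier_submodule])
 interpret q: sub_module A N ?I by (rule sub_module.intro[OF N.is_module sub_module_axioms.intro[OF I]])
 have Q: "fdmod A (quot_module N ?I)"
  by (rule fdmod_surj[OF N q.quot_left_module q.quot_proj]) (simp add: q.quot_carrier)
 let ?Q = "enc A (quot_module N ?I)"
 note E = enc[OF Q]
 interpret en: module_hom A "quot_module N ?I" ?Q "enc_map A (quot_module N ?I)"
  by (rule module_homI[OF q.quot_left_module E(6,2)])
 let ?p = "\<lambda>n\<in>carrier N. enc_map A (quot_module N ?I) (?I +>\<^bsub>N\<^esub> n)" and ?i = "restrict \<iota> (carrier M)"
 have pH: "?p \<in> Hom A N ?Q" by (rule restrict_Hom[OF ahom_comp[OF q.quot_proj E(2)] N.is_module])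
 have iH: "?i \<in> Hom A M N" by (rule restrict_Hom[OF i(1) M.is_module])
 have ps: "?p ` carrier N = carrier ?Q" using E(3) by (auto simp: bij_betw_def q.quot_carrier image_image)
 have ker: "?p n = 0[?Q] \<longleftrightarrow> n \<in> ?I" if n: "n \<in> carrier N" for n
 proof -
  have "?I +>\<^bsub>N\<^esub> n \<in> carrier (quot_module N ?I)" using n q.quot_carrier by auto
  moreover have "inj_on (enc_map A (quot_module N ?I)) (carrier (quot_module N ?I))" using E(3) by (simp add: bij_betw_def)
  ultimately have "?p n = 0[?Q] \<longleftrightarrow> ?I +>\<^bsub>N\<^esub> n = 0[quot_module N ?I]"
   using n en.hom_zero unfolding en.inj_iff by auto
  then show ?thesis using q.quot_proj_zero[OF n] by simp
 qed
 have "short_exact A M N ?Q ?i ?p" unfolding short_exact_def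
 proof (intro conjI)
  show "inj_on ?i (carrier M)" using i(2) by (simp add: inj_on_def)
  show "?p \<in> Epi A N ?Q" using pH ps by (simp add: Epi_def)
  show "?i ` carrier M = a_kernel N ?Q ?p" using ker submoduleD(1)[OF I] by (auto simp: a_kernel_def kernel_def)
 qed (rule iH)
 from exact[OF fM fN E(1) this] have s: "D' M N ?i ` carrier (D N) = carrier (D M)"
  by (simp add: short_exact_def Epi_def)
 obtain y where y: "y \<in> carrier (D M)" "\<And>m. m \<in> carrier M \<Longrightarrow> \<theta> M y m = \<phi> m" by (rule \<theta>_surj[OF fM p]) blast
 obtain z where z: "z \<in> carrier (D N)" "y = D' M N ?i z" using s y(1) by blast
 show ?thesis
 proof (intro bexI[of _ "\<theta> N z"] ballI)
  fix m assume m: "m \<in> carrier M"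
  show "\<theta> N z (\<iota> m) = \<phi> m"
   using \<theta>_nat[OF fM fN iH z(1) m] \<theta>_eq[OF fN, of "\<iota> m" z] y(2)[OF m] m by (simp add: z(2))
 qed (rule Hom_ahom[OF \<theta>_Hom[OF fN z(1)]])
qed

text \<open>Composed with the inverse of \<open>\<tau>\<close>, the map becomes an endomorphism of
  T. As D is full, it is the dual of an endomorphism of R, that is, of right multiplication by some
  b.\<close>

lemma T_full:
 assumes p: "\<psi> \<in> ahom A T' T" shows "\<exists>b\<in>carrier A. \<forall>x\<in>carrier T. \<psi> x = \<tau> (b *[T] x)"
proof -
 have h: "\<tau> \<in> ahom A T' T" by (rule ahomI) (simp_all add: \<tau>_closed \<tau>_add \<tau>_act)
 have i: "inv_into (carrier T') \<tau> \<in> ahom A T T'"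
  by (rule module_hom.inv_ahom[OF module_homI[OF T'_left_module lm[OF T] h]]) (simp add: \<tau>_bij)
 have "(\<lambda>x\<in>carrier T. \<psi> (inv_into (carrier T') \<tau> x)) \<in> Hom A T T"
  by (rule restrict_Hom[OF ahom_comp[OF i p] lm[OF T]])
 then obtain f where f: "f \<in> Hom A R R" "D' R R f = (\<lambda>x\<in>carrier T. \<psi> (inv_into (carrier T') \<tau> x))"
  by (rule D_full[OF R(1) R(1)])
 have "f u \<in> carrier R" by (rule Hom_val[OF f(1)]) simp
 then obtain b where b: "b \<in> carrier A" "f u = e b" using R_surj by blast
 have "\<psi> x = \<tau> (b *[T] x)" if x: "x \<in> carrier T" for x
 proof -
  have "\<psi> x = D' R R f (\<tau> x)" unfolding f(2) using \<tau>_bij \<tau>_closed[OF x] x by (simp add: bij_betw_def)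
  also have "D' R R f = act b" unfolding act_def b(2)[symmetric] Hom_R[OF lm[OF R(1)] f(1), symmetric] ..
  finally show ?thesis using b x by (simp add: \<tau>_smult)
 qed
 then show ?thesis using b by blast
qed

text \<open>If b acts as zero on T, so does \<open>act b\<close> by means of \<open>\<tau>\<close>;
  then right multiplication by b is zero because D is faithful.\<close>

lemma T_faithful:
 assumes b: "b \<in> carrier A" "\<forall>x\<in>carrier T. b *[T] x = 0[T]" shows "b = 0[A]"
proof -
 interpret T': left_module A T' by (rule T'_left_module)
 note oH = orb_Hom[OF lm[OF R(1)] e_closed]
 have z: "act 0[A] t = 0[T]" if "t \<in> carrier T" for t using T'.smult_l_null[of t] that by simp
 have "D' R R (orb R (e b)) = D' R R (orb R (e 0[A]))"
 proof (rule Hom_eqI[OF mor[OF R(1) R(1) oH[OF b(1)]] mor[OF R(1) R(1) oH[OF zero_closed]]])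
  fix t assume t: "t \<in> carrier T"
  then have "t \<in> \<tau> ` carrier T" using \<tau>_bij by (simp add: bij_betw_def)
  then obtain x where x: "x \<in> carrier T" "t = \<tau> x" by blast
  have "act b t = \<tau> (b *[T] x)" using x b(1) by (simp add: \<tau>_smult)
  also have "b *[T] x = 0[A] *[T] x" using b(2) x left_module.smult_l_null[OF lm[OF T] x(1)] by simp
  also have "\<tau> \<dots> = act 0[A] t" using x by (simp add: \<tau>_smult)
  finally show "D' R R (orb R (e b)) t = D' R R (orb R (e 0[A])) t" by (simp add: act_def)
 qed
 then have "orb R (e b) = orb R (e 0[A])" by (rule D_faithful[OF R(1) R(1) oH[OF b(1)] oH[OF zero_closed]])
 then have "e b = e 0[A]" using orb_u[OF lm[OF R(1)] e_closed] b(1) by (metis zero_closed)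
 then show ?thesis by (rule e_inj) (use b in simp_all)
qed

lemma dualizer: "dualizer A T T' \<tau>"
proof -
 interpret T: fdmod A T using T by (simp add: fgm)
 interpret T': left_module A T' by (rule T'_left_module)
 show ?thesis
 proof
  show "\<And>\<psi>. \<psi> \<in> ahom A T' T \<Longrightarrow> \<exists>b\<in>carrier A. \<forall>x\<in>carrier T. \<psi> x = \<tau> (b *[T] x)" by (rule T_full)
  show "\<And>b. \<lbrakk>b \<in> carrier A; \<forall>x\<in>carrier T. b *[T] x = 0[T]\<rbrakk> \<Longrightarrow> b = 0[A]" by (rule T_faithful)
  show "\<And>a b x. \<lbrakk>a \<in> carrier A; b \<in> carrier A; x \<in> carrier T\<rbrakk> \<Longrightarrow> a *[T] (b *[T'] x) = b *[T'] (a *[T] x)"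
   by (simp add: ahomD(3)[OF Hom_ahom[OF act_Hom]])
 qed (simp_all add: act_scalar \<tau>_bij \<tau>_add \<tau>_smult \<tau>_act \<tau>_closed Hom_val[OF act_Hom] T_injective)
qed

text \<open>The isomorphism between L and its dual is read through \<open>\<theta>\<close>, whose
  injectivity keeps it from vanishing.\<close>

lemma self_dual:
 assumes L: "simple_module A L" and iso: "isomorphic A (D (enc A L)) L"
 shows "\<exists>g\<in>ahom A L (dual_module A T T' L). \<exists>x\<in>carrier L. g x \<noteq> 0[dual_module A T T' L]"
proof -
 have Lf: "fdmod A L" by (rule simple_fdmod[OF fd L])
 interpret L: fdmod A L by fact
 let ?S = "enc A L"
 note S = enc[OF Lf]
 have "isomorphic A L (D ?S)" by (rule isomorphic_sym[OF lm[OF obj[OF S(1)]] L.is_module iso])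
 then obtain k where k: "k \<in> ahom A L (D ?S)" "bij_betw k (carrier L) (carrier (D ?S))" by (rule isomorphicE)
 define g where "g x = (\<lambda>y\<in>carrier L. \<theta> ?S (k x) (enc_map A L y))" for x
 have ev: "enc_map A L y \<in> carrier ?S" if "y \<in> carrier L" for y by (rule ahomD(1)[OF S(2) that])
 have "g \<in> ahom A L (dual_module A T T' L)"
 proof (rule ahomI)
  show "g x \<in> carrier (dual_module A T T' L)" if "x \<in> carrier L" for x unfolding dual_module_simps g_def
   by (rule restrict_Hom[OF ahom_comp[OF S(2) Hom_ahom[OF \<theta>_Hom[OF S(1) ahomD(1)[OF k(1) that]]]] L.is_module])
 qed (auto simp: g_def ahomD[OF k(1)] \<theta>_add[OF S(1)] \<theta>_smult[OF S(1)] ev fun_eq_iff Hom_val[OF \<theta>_Hom[OF S(1)]])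
 moreover have "\<exists>x\<in>carrier L. g x \<noteq> 0[dual_module A T T' L]"
 proof (rule ccontr)
  assume z: "\<not> ?thesis"
  obtain x where x: "x \<in> carrier L" "x \<noteq> 0[L]" by (rule simple_nonzero[OF L])
  have gx: "g x = g 0[L]" using z x(1) by auto
  have "k x = k 0[L]"
  proof (rule \<theta>_inj[OF S(1) ahomD(1)[OF k(1) x(1)] ahomD(1)[OF k(1) L.M.zero_closed]])
   fix m assume "m \<in> carrier ?S"
   then have "m \<in> enc_map A L ` carrier L" using S(3) by (simp add: bij_betw_def)
   then obtain y where "y \<in> carrier L" "m = enc_map A L y" by blast
   then show "\<theta> ?S (k x) m = \<theta> ?S (k 0[L]) m" using fun_cong[OF gx, of y] by (simp add: g_def)
  qed
  then show False using k(2) x by (auto simp: bij_betw_def dest: inj_onD)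
 qed
 ultimately show ?thesis by blast
qed

end

section \<open>Tensor products of dualizing modules\<close>

lemma lfun_rs:
 assumes "l \<in> lfun (rs A M)" "x \<in> carrier M"
 shows "y \<in> carrier M \<Longrightarrow> l (x +[M] y) = l x + l y" "l ((c *[A] 1[A]) *[M] x) = c * l x"
 using lfun_add[of l "rs A M" x y] lfun_smult[of l "rs A M" x c] assms by simp_all

context dualizer
begin

lemma T'_fdmod: "fdmod A T'"
 by (rule fdmod_surj[OF T.fdmod_axioms T'.is_module \<tau>_hom]) (use \<tau>_bij in "simp add: bij_betw_def carr")

lemma \<tau>_scalar: "x \<in> carrier T \<Longrightarrow> \<tau> (sc c *[T] x) = sc c *[T] \<tau> x" by (simp add: \<tau>_smult scal)

lemma \<tau>_linear: "\<tau> \<in> lin (rs A T) (rs A T)" by (rule ahomI) (simp_all add: \<tau>_add \<tau>_scalar)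

lemma faithful_eq:
 assumes "a \<in> carrier A" "b \<in> carrier A" "\<And>x. x \<in> carrier T \<Longrightarrow> \<tau> (a *[T] x) = \<tau> (b *[T] x)"
 shows "a = b"
proof -
 have "(a +[A] -[A] b) *[T] x = 0[T]" if x: "x \<in> carrier T" for x
 proof -
  have "a *[T] x = b *[T] x" by (rule \<tau>_inj) (use assms x in simp_all)
  then have "(a +[A] -[A] b) *[T] x = (b +[A] -[A] b) *[T] x" using assms x by (simp only: T.smult_l_distr a_inv_closed)
  then show ?thesis using assms x by (simp add: r_neg)
 qed
 then have "a +[A] -[A] b = 0[A]" using assms by (intro faithful) simp_all
 then have "(a +[A] -[A] b) +[A] b = 0[A] +[A] b" by simp
 then show ?thesis using assms by (simp add: a_assoc l_neg)
qed

text \<open>The coinduced module Hom_F(A, T), with A acting by right multiplication of the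
  argument.\<close>

definition coind where
 "coind = hom_module field_ring A (rs A T) (\<lambda>b h. \<lambda>a\<in>carrier A. h (a **[A] b))"

lemma coind_fdmod: "fdmod A coind"
proof -
 note l = V.is_module T.rs.is_module
 have hc: "h a \<in> carrier T" if "h \<in> Hom field_ring A (rs A T)" "a \<in> carrier A" for h a
  using ahomD(1)[OF Hom_ahom[OF that(1)] that(2)] by simp
 have ha: "h (a +[A] b) = h a +[T] h b" if "h \<in> Hom field_ring A (rs A T)" "a \<in> carrier A" "b \<in> carrier A" for h a b
  using ahomD(2)[OF Hom_ahom[OF that(1)] that(2,3)] by simp
 have hs: "h (c *[A] a) = sc c *[T] h a" if "h \<in> Hom field_ring A (rs A T)" "a \<in> carrier A" for h a c
  using ahomD(3)[OF Hom_ahom[OF that(1)] _ that(2), of c] by simp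
 have "left_module A coind" unfolding coind_def
 proof (rule hom_module_left_module[OF l ring_axioms])
  show "(\<lambda>a\<in>carrier A. h (a **[A] b)) \<in> Hom field_ring A (rs A T)"
   if "b \<in> carrier A" "h \<in> Hom field_ring A (rs A T)" for b h
  proof (rule restrict_Hom[OF ahomI l(1)])
  qed (use that in "simp_all add: hc ha hs l_distr mult_smult")
 qed (simp_all add: hc ha hs r_distr m_assoc)
 then show ?thesis unfolding coind_def
  by (rule hom_module_fdmod[OF _ fd l(1) V.fg l(2) T.rs.fdspace_axioms]) (simp_all add: hs sc_simps)
qed

text \<open>A retraction of the embedding of an injective module into a coinduced one; it replaces the average
 over a group in the proof of Maschke's theorem.\<close>

lemma reynolds:
 obtains \<rho> where "\<rho> \<in> ahom A coind T" "\<And>x. x \<in> carrier T \<Longrightarrow> \<rho> (\<lambda>a\<in>carrier A. a *[T] x) = x"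
proof -
 let ?i = "\<lambda>x. \<lambda>a\<in>carrier A. a *[T] x"
 have i: "?i \<in> ahom A T coind"
 proof (rule ahomI)
  show "?i x \<in> carrier coind" if x: "x \<in> carrier T" for x
  proof -
   have "(\<lambda>a. a *[T] x) \<in> lin A (rs A T)"
   proof (rule ahomI)
    fix c a assume a: "a \<in> carrier A"
    have "(c *[A] a) *[T] x = (sc c **[A] a) *[T] x" using a by (simp add: sc_simps)
    then show "(c *[A] a) *[T] x = c *[rs A T] (a *[T] x)" using a x by (simp add: T.smult_assoc1)
   qed (use x in "simp_all add: T.smult_l_distr")
   then show ?thesis using restrict_Hom[OF _ V.is_module] by (simp add: coind_def)
  qed
 qed (auto simp: coind_def T.smult_r_distr T.smult_assoc1 fun_eq_iff)
 have inj: "inj_on ?i (carrier T)"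
 proof (rule inj_onI)
  fix x y assume xy: "x \<in> carrier T" "y \<in> carrier T" and e: "?i x = ?i y"
  from fun_cong[OF e, of "1[A]"] xy show "x = y" by simp
 qed
 obtain \<rho> where "\<rho> \<in> ahom A coind T" "\<And>x. x \<in> carrier T \<Longrightarrow> \<rho> (?i x) = x"
  by (rule inject[OF T.fdmod_axioms coind_fdmod i inj ahom_id]) blast
 then show ?thesis by (rule that)
qed

end

text \<open>T carries the outer tensor product of the actions of T1 and T2; T' carries, on the same
  vector space, that of T1' and T2'.\<close>

locale dualizer_pair = mtensor A B T1 T2 T t + d1: dualizer A T1 T1' \<tau>1 + d2: dualizer B T2 T2' \<tau>2
  + T': left_module "tensor A B" T' for A :: "('f::field, 'a) module" and B :: "('f, 'b) module"
  and T1 T1' :: "('a, 'm) module" and \<tau>1 and T2 T2' :: "('b, 'n) module" and \<tau>2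
  and T T' :: "(('a \<times> 'b \<Rightarrow>\<^sub>0 'f) set, 't) module" and t +
 assumes carr': "carrier T' = carrier T" and zero': "0[T'] = 0[T]"
  and add': "\<And>x y. \<lbrakk>x \<in> carrier T; y \<in> carrier T\<rbrakk> \<Longrightarrow> x +[T'] y = x +[T] y"
  and scal': "\<And>c x. x \<in> carrier T \<Longrightarrow> AB.sc c *[T'] x = AB.sc c *[T] x"
  and act': "\<And>a b m n. \<lbrakk>a \<in> carrier A; b \<in> carrier B; m \<in> carrier T1; n \<in> carrier T2\<rbrakk>
   \<Longrightarrow> (a \<Join> b) *[T'] t m n = t (a *[T1'] m) (b *[T2'] n)"
begin

lemma smult'_closed [simp]: "\<lbrakk>r \<in> carrier AB; x \<in> carrier T\<rbrakk> \<Longrightarrow> r *[T'] x \<in> carrier T"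
 using T'.smult_closed[of r x] by (simp add: carr')

lemma smult'_add [simp]:
 "\<lbrakk>r \<in> carrier AB; x \<in> carrier T; y \<in> carrier T\<rbrakk> \<Longrightarrow> r *[T'] (x +[T] y) = r *[T'] x +[T] r *[T'] y"
 "\<lbrakk>r \<in> carrier AB; s \<in> carrier AB; x \<in> carrier T\<rbrakk> \<Longrightarrow> (r +[AB] s) *[T'] x = r *[T'] x +[T] s *[T'] x"
 using T'.smult_r_distr[of r x y] T'.smult_l_distr[of r s x] by (simp_all add: carr' add')

lemma ten_closed [simp]: "\<lbrakk>a \<in> carrier A; b \<in> carrier B\<rbrakk> \<Longrightarrow> a \<Join> b \<in> carrier AB" by (rule ts.tens_closed)

lemma AB_T_induct [consumes 2, case_names tens add_left add_right]:
 assumes "r \<in> carrier AB" "x \<in> carrier T"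
  and P: "\<And>a b m n. \<lbrakk>a \<in> carrier A; b \<in> carrier B; m \<in> carrier T1; n \<in> carrier T2\<rbrakk> \<Longrightarrow> P (a \<Join> b) (t m n)"
  and l: "\<And>r s x. \<lbrakk>r \<in> carrier AB; s \<in> carrier AB; x \<in> carrier T; P r x; P s x\<rbrakk> \<Longrightarrow> P (r +[AB] s) x"
  and q: "\<And>r x y. \<lbrakk>r \<in> carrier AB; x \<in> carrier T; y \<in> carrier T; P r x; P r y\<rbrakk> \<Longrightarrow> P r (x +[T] y)"
 shows "P r x" using assms(2)
proof (induction x rule: T_induct)
 case (tens m n)
 show ?case using assms(1)
 proof (induction r rule: ts.vt.T_induct)
  case (tens a b) then show ?case using P \<open>m \<in> carrier T1\<close> \<open>n \<in> carrier T2\<close> by blast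
 next
  case (add r s) then show ?case using l t_closed[OF \<open>m \<in> carrier T1\<close> \<open>n \<in> carrier T2\<close>] by blast
 qed
next
 case (add x y) then show ?case using q assms(1) by blast
qed

definition \<tau> where
 "\<tau> = (SOME h. h \<in> lin TV TV \<and> (\<forall>m\<in>carrier T1. \<forall>n\<in>carrier T2. h (t m n) = t (\<tau>1 m) (\<tau>2 n)))"

lemma \<tau>_linear: "\<tau> \<in> lin TV TV"
 and \<tau>_t [simp]: "\<lbrakk>m \<in> carrier T1; n \<in> carrier T2\<rbrakk> \<Longrightarrow> \<tau> (t m n) = t (\<tau>1 m) (\<tau>2 n)"
proof -
 have "\<exists>h. h \<in> lin TV TV \<and> (\<forall>m\<in>carrier T1. \<forall>n\<in>carrier T2. h (t m n) = t (\<tau>1 m) (\<tau>2 n))"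
  by (rule tmap_ex[OF vt.vtensor_axioms vt.vtensor_axioms d1.\<tau>_linear d2.\<tau>_linear]) auto
 from someI_ex[OF this] show "\<tau> \<in> lin TV TV"
  "\<lbrakk>m \<in> carrier T1; n \<in> carrier T2\<rbrakk> \<Longrightarrow> \<tau> (t m n) = t (\<tau>1 m) (\<tau>2 n)" by (simp_all add: \<tau>_def)
qed

lemma \<tau>_closed [simp]: "x \<in> carrier T \<Longrightarrow> \<tau> x \<in> carrier T"
 and \<tau>_add [simp]: "\<lbrakk>x \<in> carrier T; y \<in> carrier T\<rbrakk> \<Longrightarrow> \<tau> (x +[T] y) = \<tau> x +[T] \<tau> y"
 using ahomD(1,2)[OF \<tau>_linear] by simp_all

lemma \<tau>_bij: "bij_betw \<tau> (carrier T) (carrier T)"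
proof -
 let ?i1 = "inv_into (carrier T1) \<tau>1" and ?i2 = "inv_into (carrier T2) \<tau>2"
 have i1: "?i1 \<in> lin MV MV"
  using module_hom.inv_ahom[OF module_homI[OF M.rs.is_module M.rs.is_module d1.\<tau>_linear]] d1.\<tau>_bij by simp
 have i2: "?i2 \<in> lin NV NV"
  using module_hom.inv_ahom[OF module_homI[OF N.rs.is_module N.rs.is_module d2.\<tau>_linear]] d2.\<tau>_bij by simp
 have c: "m \<in> carrier T1 \<Longrightarrow> ?i1 m \<in> carrier T1" "n \<in> carrier T2 \<Longrightarrow> ?i2 n \<in> carrier T2" for m n
  using ahomD(1)[OF i1] ahomD(1)[OF i2] by simp_all
 have inv: "m \<in> carrier T1 \<Longrightarrow> ?i1 (\<tau>1 m) = m" "m \<in> carrier T1 \<Longrightarrow> \<tau>1 (?i1 m) = m"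
  "n \<in> carrier T2 \<Longrightarrow> ?i2 (\<tau>2 n) = n" "n \<in> carrier T2 \<Longrightarrow> \<tau>2 (?i2 n) = n" for m n
  using d1.\<tau>_bij d2.\<tau>_bij by (simp_all add: bij_betw_def f_inv_into_f)
 obtain h where h: "h \<in> lin TV TV" "\<forall>m\<in>carrier MV. \<forall>n\<in>carrier NV. h (t m n) = t (?i1 m) (?i2 n)"
  by (rule tmap_ex[OF vt.vtensor_axioms vt.vtensor_axioms i1 i2])
 have 1: "h (\<tau> x) = x" if "x \<in> carrier T" for x
  by (rule vt.ahom_eq[OF vt.T.vspace_axioms ahom_comp[OF \<tau>_linear h(1)] ahom_id]) (use that h(2) inv in simp_all)
 have 2: "\<tau> (h x) = x" if "x \<in> carrier T" for x
  by (rule vt.ahom_eq[OF vt.T.vspace_axioms ahom_comp[OF h(1) \<tau>_linear] ahom_id]) (use that h(2) c inv in simp_all)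
 show ?thesis
  by (rule bij_betw_byWitness[where f' = h]) (use ahomD(1)[OF h(1)] in "simp_all add: image_subset_iff 1 2")
qed

lemma \<tau>_smult: "\<lbrakk>r \<in> carrier AB; x \<in> carrier T\<rbrakk> \<Longrightarrow> \<tau> (r *[T] x) = r *[T'] \<tau> x"
proof (induction r x rule: AB_T_induct)
 case (tens a b m n)
 then show ?case by (simp add: act act' d1.\<tau>_smult d2.\<tau>_smult)
qed (simp_all add: T.smult_l_distr T.smult_r_distr)

lemma \<tau>_smult': "\<lbrakk>r \<in> carrier AB; x \<in> carrier T\<rbrakk> \<Longrightarrow> \<tau> (r *[T'] x) = r *[T] \<tau> x"
proof (induction r x rule: AB_T_induct)
 case (tens a b m n)
 then show ?case by (simp add: act act' d1.\<tau>_smult' d2.\<tau>_smult')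
qed (simp_all add: T.smult_l_distr T.smult_r_distr)

lemma comm: "\<lbrakk>r \<in> carrier AB; x \<in> carrier T; s \<in> carrier AB\<rbrakk> \<Longrightarrow> r *[T] (s *[T'] x) = s *[T'] (r *[T] x)"
proof (induction r x rule: AB_T_induct)
 case (tens a b m n)
 show ?case using tens(5)
 proof (induction s rule: ts.vt.T_induct)
  case (tens c d)
  then show ?case using \<open>a \<in> carrier A\<close> \<open>b \<in> carrier B\<close> \<open>m \<in> carrier T1\<close> \<open>n \<in> carrier T2\<close>
   by (simp add: act act' d1.comm d2.comm)
 next
  case (add x y)
  then show ?case using \<open>a \<in> carrier A\<close> \<open>b \<in> carrier B\<close> \<open>m \<in> carrier T1\<close> \<open>n \<in> carrier T2\<close>
   by (simp add: T.smult_r_distr)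
 qed
qed (simp_all add: T.smult_l_distr T.smult_r_distr)

text \<open>Acting on the second factor before contracting it amounts to contracting along a twisted
  form.\<close>

lemma slice_twist:
 assumes l: "l \<in> lfun NV" and b: "b \<in> carrier B" and x: "x \<in> carrier T"
 shows "(\<lambda>n. l (b *[T2] n)) \<in> lfun NV" "vt.slice l ((1[A] \<Join> b) *[T] x) = vt.slice (\<lambda>n. l (b *[T2] n)) x"
proof -
 have bs: "b *[T2] (B.sc c *[T2] n) = B.sc c *[T2] (b *[T2] n)" if "n \<in> carrier T2" for c n
  using b that by (simp add: B.sc_simps flip: N.smult_assoc1)
 show l': "(\<lambda>n. l (b *[T2] n)) \<in> lfun NV"
  by (rule lfunI) (use b in "simp_all add: N.smult_r_distr lfun_rs[OF l] bs")
 show "vt.slice l ((1[A] \<Join> b) *[T] x) = vt.slice (\<lambda>n. l (b *[T2] n)) x" using x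
 proof (induction x rule: T_induct)
  case (tens m n) then show ?case using b vt.slice_t[OF l, of m "b *[T2] n"] vt.slice_t[OF l', of m n] by simp
 next
  case (add x y)
  then show ?case using b vt.slice_add[OF l, of "(1[A] \<Join> b) *[T] x" "(1[A] \<Join> b) *[T] y"] vt.slice_add[OF l', of x y]
   by (simp add: T.smult_r_distr)
 qed
qed

lemma slice_twist':
 assumes l: "l \<in> lfun MV" and a: "a \<in> carrier A" and x: "x \<in> carrier T"
 shows "(\<lambda>m. l (a *[T1] m)) \<in> lfun MV" "st.slice l ((a \<Join> 1[B]) *[T] x) = st.slice (\<lambda>m. l (a *[T1] m)) x"
proof -
 have as: "a *[T1] (A.sc c *[T1] m) = A.sc c *[T1] (a *[T1] m)" if "m \<in> carrier T1" for c m
  using a that by (simp add: A.sc_simps flip: M.smult_assoc1)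
 show l': "(\<lambda>m. l (a *[T1] m)) \<in> lfun MV"
  by (rule lfunI) (use a in "simp_all add: M.smult_r_distr lfun_rs[OF l] as")
 show "st.slice l ((a \<Join> 1[B]) *[T] x) = st.slice (\<lambda>m. l (a *[T1] m)) x" using x
 proof (induction x rule: T_induct)
  case (tens m n) then show ?case using a st.slice_t[OF l, of n "a *[T1] m"] st.slice_t[OF l', of n m] by simp
 next
  case (add x y)
  then show ?case using a st.slice_add[OF l, of "(a \<Join> 1[B]) *[T] x" "(a \<Join> 1[B]) *[T] y"] st.slice_add[OF l', of x y]
   by (simp add: T.smult_r_distr)
 qed
qed

sublocale sw: vtensor B A AB "\<lambda>b a. a \<Join> b" by (rule ts.vt.swap)

lemma orbit_form: "\<lbrakk>\<mu> \<in> lfun MV; x \<in> carrier T1\<rbrakk> \<Longrightarrow> (\<lambda>a. \<mu> (\<tau>1 (a *[T1] x))) \<in> lfun A"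
proof (rule lfunI)
 fix c a assume *: "\<mu> \<in> lfun MV" "x \<in> carrier T1" "a \<in> carrier A"
 have "(c *[A] a) *[T1] x = (A.sc c **[A] a) *[T1] x" using * by (simp add: A.sc_simps)
 then show "\<mu> (\<tau>1 ((c *[A] a) *[T1] x)) = c * \<mu> (\<tau>1 (a *[T1] x))"
  using * by (simp add: M.smult_assoc1 d1.\<tau>_scalar lfun_rs)
qed (simp_all add: M.smult_l_distr d1.\<tau>_add lfun_rs)

text \<open>The formula that reduces an element r of A \<otimes> B to its contractions in B: testing
  the action of r by \<mu> and l contracts the first factor of r along the form a \<mapsto> \<mu>
  (\<tau>1 (a x)).\<close>

lemma slice_action:
 assumes m: "\<mu> \<in> lfun MV" and l: "l \<in> lfun NV" and x: "x \<in> carrier T1" and y: "y \<in> carrier T2" and r: "r \<in> carrier AB"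
 shows "\<mu> (vt.slice l (\<tau> (r *[T] t x y))) = l (\<tau>2 (sw.slice (\<lambda>a. \<mu> (\<tau>1 (a *[T1] x))) r *[T2] y))" using r
proof (induction r rule: ts.vt.T_induct)
 let ?\<xi> = "\<lambda>a. \<mu> (\<tau>1 (a *[T1] x))"
 note xi = orbit_form[OF m x]
 {
  case (tens a b)
  have "vt.slice l (\<tau> ((a \<Join> b) *[T] t x y)) = l (\<tau>2 (b *[T2] y)) *[MV] \<tau>1 (a *[T1] x)"
   using tens x y vt.slice_t[OF l, of "\<tau>1 (a *[T1] x)" "\<tau>2 (b *[T2] y)"] by (simp add: act)
  then have "\<mu> (vt.slice l (\<tau> ((a \<Join> b) *[T] t x y))) = l (\<tau>2 (b *[T2] y)) * ?\<xi> a"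
   using tens x by (simp add: lfun_rs[OF m])
  moreover have "sw.slice ?\<xi> (a \<Join> b) *[T2] y = B.sc (?\<xi> a) *[T2] (b *[T2] y)"
  proof -
   have "sw.slice ?\<xi> (a \<Join> b) = B.sc (?\<xi> a) **[B] b" using sw.slice_t[OF xi tens(2,1)] tens by (simp add: B.sc_simps)
   then show ?thesis using tens y by (simp add: N.smult_assoc1)
  qed
  ultimately show ?case using tens y by (simp add: d2.\<tau>_scalar lfun_rs[OF l])
 next
  case (add r s)
  have c: "r *[T] t x y \<in> carrier T" "s *[T] t x y \<in> carrier T" using add x y by simp_all
  have "\<mu> (vt.slice l (\<tau> ((r +[AB] s) *[T] t x y))) = \<mu> (vt.slice l (\<tau> (r *[T] t x y))) + \<mu> (vt.slice l (\<tau> (s *[T] t x y)))"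
   using add c x y vt.slice_add[OF l, of "\<tau> (r *[T] t x y)" "\<tau> (s *[T] t x y)"]
    vt.slice_closed[OF l, of "\<tau> (r *[T] t x y)"] vt.slice_closed[OF l, of "\<tau> (s *[T] t x y)"]
   by (simp add: T.smult_l_distr lfun_rs[OF m])
  also have "\<dots> = l (\<tau>2 (sw.slice ?\<xi> r *[T2] y)) + l (\<tau>2 (sw.slice ?\<xi> s *[T2] y))" using add by simp
  also have "\<dots> = l (\<tau>2 (sw.slice ?\<xi> (r +[AB] s) *[T2] y))"
   using add y xi by (simp add: N.smult_l_distr d2.\<tau>_add lfun_rs[OF l])
  finally show ?case .
 }
qed

text \<open>If r kills T, its contractions along all forms a \<mapsto> \<mu> (\<tau>1 (a x)) kill T2
  and so vanish. Exchanging the order of contraction, these forms vanish at every contraction of r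
  in A; such a contraction kills T1 and vanishes too.\<close>

lemma faithful:
 assumes r: "r \<in> carrier AB" "\<forall>x\<in>carrier T. r *[T] x = 0[T]"
 shows "r = 0[AB]"
proof (rule ts.vt.slice_eqI[OF r(1) ts.T.M.zero_closed])
 fix \<zeta> assume z: "\<zeta> \<in> lfun B"
 interpret z: module_hom field_ring AB A "ts.vt.slice \<zeta>"
  by (rule module_homI[OF ts.T.is_module A.V.is_module ts.vt.slice_hom[OF z]])
 have "ts.vt.slice \<zeta> r = 0[A]"
 proof (rule d1.faithful_eq)
  fix x assume x: "x \<in> carrier T1"
  show "\<tau>1 (ts.vt.slice \<zeta> r *[T1] x) = \<tau>1 (0[A] *[T1] x)"
  proof (rule M.rs.lfun_eqI)
   fix \<mu> assume m: "\<mu> \<in> lfun MV"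
   let ?\<xi> = "\<lambda>a. \<mu> (\<tau>1 (a *[T1] x))"
   note xi = orbit_form[OF m x]
   have "sw.slice ?\<xi> r = 0[B]"
   proof (rule d2.faithful_eq)
    fix y assume y: "y \<in> carrier T2"
    show "\<tau>2 (sw.slice ?\<xi> r *[T2] y) = \<tau>2 (0[B] *[T2] y)"
    proof (rule N.rs.lfun_eqI)
     fix l assume l: "l \<in> lfun NV"
     have "l (\<tau>2 (sw.slice ?\<xi> r *[T2] y)) = l (\<tau>2 (sw.slice ?\<xi> 0[AB] *[T2] y))"
      using slice_action[OF m l x y r(1)] slice_action[OF m l x y ts.T.M.zero_closed] r(2) x y by simp
     also have "sw.slice ?\<xi> 0[AB] = 0[B]"
      by (rule module_hom.hom_zero[OF module_homI[OF ts.T.is_module B.V.is_module sw.slice_hom[OF xi]]])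
     finally show "l (\<tau>2 (sw.slice ?\<xi> r *[T2] y)) = l (\<tau>2 (0[B] *[T2] y))" .
    qed (use y r(1) xi in simp_all)
   qed (use r(1) xi in simp_all)
   then have "?\<xi> (ts.vt.slice \<zeta> r) = \<zeta> 0[B]" using vtensor_fubini[OF ts.vt.vtensor_axioms xi z r(1)] by simp
   also have "\<dots> = 0" by (rule B.V.lfun_zero[OF z])
   also have "0 = ?\<xi> 0[A]" by (rule A.V.lfun_zero[OF xi, symmetric])
   finally show "\<mu> (\<tau>1 (ts.vt.slice \<zeta> r *[T1] x)) = \<mu> (\<tau>1 (0[A] *[T1] x))" .
  qed (use x z r(1) in simp_all)
 qed (use z r(1) in simp_all)
 then show "ts.vt.slice \<zeta> r = ts.vt.slice \<zeta> 0[AB]" by simp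
qed

text \<open>Fullness is applied in each factor. The contraction of \<psi> (x \<otimes> y) by l is,
  as a map of x, given by an element \<open>\<alpha> l y\<close> of A. For a form \<xi> on A,
  reflexivity makes l \<mapsto> \<xi> (\<alpha> l y) a vector \<open>X \<xi> y\<close> of T2; this
  is linear in y over B and so given by an element \<open>\<beta> \<xi>\<close> of B. The family
  \<open>\<beta>\<close> consists of the contractions of the element r sought.\<close>

lemma full:
 assumes p: "\<psi> \<in> ahom AB T' T"
 shows "\<exists>r\<in>carrier AB. \<forall>x\<in>carrier T. \<psi> x = \<tau> (r *[T] x)"
proof -
 have pc [simp]: "\<psi> x \<in> carrier T" if "x \<in> carrier T" for x using ahomD(1)[OF p] that by (simp add: carr')
 have pa: "\<psi> (x +[T] y) = \<psi> x +[T] \<psi> y" if "x \<in> carrier T" "y \<in> carrier T" for x y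
  using ahomD(2)[OF p, of x y] that by (simp add: carr' add')
 have ps: "\<psi> (r *[T'] x) = r *[T] \<psi> x" if "r \<in> carrier AB" "x \<in> carrier T" for r x
  using ahomD(3)[OF p, of r x] that by (simp add: carr')
 have one1: "1[A] *[T1'] x = x" if "x \<in> carrier T1" for x using d1.T'.smult_one[of x] that by (simp add: d1.carr)
 have one2: "1[B] *[T2'] x = x" if "x \<in> carrier T2" for x using d2.T'.smult_one[of x] that by (simp add: d2.carr)
 have sc1 [simp]: "vt.slice l x \<in> carrier T1" if "l \<in> lfun NV" "x \<in> carrier T" for l x
  using vt.slice_closed[OF that(1), of x] that(2) by simp
 have "\<exists>a. a \<in> carrier A \<and> (\<forall>x\<in>carrier T1. vt.slice l (\<psi> (t x y)) = \<tau>1 (a *[T1] x))"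
  if l: "l \<in> lfun NV" and y: "y \<in> carrier T2" for l y
 proof -
  have "(\<lambda>x. vt.slice l (\<psi> (t x y))) \<in> ahom A T1' T1"
  proof (rule ahomI)
   fix x x' assume "x \<in> carrier T1'" "x' \<in> carrier T1'"
   then show "vt.slice l (\<psi> (t (x +[T1'] x') y)) = vt.slice l (\<psi> (t x y)) +[T1] vt.slice l (\<psi> (t x' y))"
    using y vt.slice_add[OF l, of "\<psi> (t x y)" "\<psi> (t x' y)"] by (simp add: d1.carr d1.add' pa)
  next
   fix a x assume a: "a \<in> carrier A" and "x \<in> carrier T1'"
   then have x: "x \<in> carrier T1" by (simp add: d1.carr)
   have "\<psi> (t (a *[T1'] x) y) = (a \<Join> 1[B]) *[T] \<psi> (t x y)"
    using ps[of "a \<Join> 1[B]" "t x y"] a x y by (simp add: act' one2)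
   then show "vt.slice l (\<psi> (t (a *[T1'] x) y)) = a *[T1] vt.slice l (\<psi> (t x y))"
    using ahomD(3)[OF slice_A[OF l] a, of "\<psi> (t x y)"] x y by simp
  qed (use l y in "simp add: d1.carr")
  from d1.full[OF this] show ?thesis by blast
 qed
 then have "\<exists>\<alpha>. \<forall>l\<in>lfun NV. \<forall>y\<in>carrier T2. \<alpha> l y \<in> carrier A \<and> (\<forall>x\<in>carrier T1. vt.slice l (\<psi> (t x y)) = \<tau>1 (\<alpha> l y *[T1] x))"
  by metis
 then obtain \<alpha> where a: "\<And>l y. \<lbrakk>l \<in> lfun NV; y \<in> carrier T2\<rbrakk> \<Longrightarrow> \<alpha> l y \<in> carrier A"
  "\<And>l y x. \<lbrakk>l \<in> lfun NV; y \<in> carrier T2; x \<in> carrier T1\<rbrakk> \<Longrightarrow> \<tau>1 (\<alpha> l y *[T1] x) = vt.slice l (\<psi> (t x y))" by metis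
 note [simp] = a(1)
 \<comment> \<open>\<open>\<alpha> l y\<close> is determined by its action on T1 and so inherits the
   behaviour of contractions: linearity in l and y, and the twist by B.\<close>
 have acong: "\<alpha> l y = \<alpha> k y" if "l \<in> lfun NV" "k \<in> lfun NV" "\<forall>x\<in>carrier NV. l x = k x" "y \<in> carrier T2" for l k y
  by (rule d1.faithful_eq) (use that a(2) vt.slice_cong[OF that(1-3)] in simp_all)
 have aplus: "\<alpha> (\<lambda>x. l x + k x) y = \<alpha> l y +[A] \<alpha> k y" if lk: "l \<in> lfun NV" "k \<in> lfun NV" and y: "y \<in> carrier T2" for l k y
 proof (rule d1.faithful_eq)
  fix x assume x: "x \<in> carrier T1"
  show "\<tau>1 (\<alpha> (\<lambda>x. l x + k x) y *[T1] x) = \<tau>1 ((\<alpha> l y +[A] \<alpha> k y) *[T1] x)"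
   using vt.slice_plus[OF lk, of "\<psi> (t x y)"] x y lk by (simp add: a(2) lfun_plus M.smult_l_distr d1.\<tau>_add)
 qed (use lk y in "simp_all add: lfun_plus")
 have ascale: "\<alpha> (\<lambda>x. c * l x) y = c *[A] \<alpha> l y" if l: "l \<in> lfun NV" and y: "y \<in> carrier T2" for l y c
 proof (rule d1.faithful_eq)
  fix x assume x: "x \<in> carrier T1"
  have "c *[A] \<alpha> l y = A.sc c **[A] \<alpha> l y" using l y by (simp add: A.sc_simps)
  then have "\<tau>1 ((c *[A] \<alpha> l y) *[T1] x) = A.sc c *[T1] \<tau>1 (\<alpha> l y *[T1] x)"
   using x y l by (simp add: M.smult_assoc1 d1.\<tau>_scalar)
  then show "\<tau>1 (\<alpha> (\<lambda>x. c * l x) y *[T1] x) = \<tau>1 ((c *[A] \<alpha> l y) *[T1] x)"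
   using vt.slice_scale[OF l, of "\<psi> (t x y)" c] x y l by (simp add: a(2) lfun_scale)
 qed (use l y in "simp_all add: lfun_scale")
 have aadd: "\<alpha> l (y +[T2] y') = \<alpha> l y +[A] \<alpha> l y'" if l: "l \<in> lfun NV" and y: "y \<in> carrier T2" "y' \<in> carrier T2" for l y y'
 proof (rule d1.faithful_eq)
  fix x assume x: "x \<in> carrier T1"
  show "\<tau>1 (\<alpha> l (y +[T2] y') *[T1] x) = \<tau>1 ((\<alpha> l y +[A] \<alpha> l y') *[T1] x)"
   using vt.slice_add[OF l, of "\<psi> (t x y)" "\<psi> (t x y')"] x y l by (simp add: a(2) pa M.smult_l_distr d1.\<tau>_add)
 qed (use l y in simp_all)
 have atwist: "\<alpha> l (b *[T2'] y) = \<alpha> (\<lambda>n. l (b *[T2] n)) y" if l: "l \<in> lfun NV" and y: "y \<in> carrier T2" and b: "b \<in> carrier B" for l y b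
 proof (rule d1.faithful_eq)
  note l' = slice_twist(1)[OF l b T.M.zero_closed]
  fix x assume x: "x \<in> carrier T1"
  have "\<psi> (t x (b *[T2'] y)) = (1[A] \<Join> b) *[T] \<psi> (t x y)"
   using ps[of "1[A] \<Join> b" "t x y"] b x y by (simp add: act' one1)
  then show "\<tau>1 (\<alpha> l (b *[T2'] y) *[T1] x) = \<tau>1 (\<alpha> (\<lambda>n. l (b *[T2] n)) y *[T1] x)"
   using x y l l' b slice_twist(2)[OF l b, of "\<psi> (t x y)"] by (simp add: a(2))
 qed (use l y b slice_twist(1)[OF l b T.M.zero_closed] in simp_all)
 have "\<exists>v. v \<in> carrier T2 \<and> (\<forall>l\<in>lfun NV. l v = \<xi> (\<alpha> l y))" if xi: "\<xi> \<in> lfun A" and y: "y \<in> carrier T2" for \<xi> y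
 proof -
  obtain v where "v \<in> carrier NV" "\<And>l. l \<in> lfun NV \<Longrightarrow> l v = \<xi> (\<alpha> l y)"
  proof (rule N.rs.reflexive[of "\<lambda>l. \<xi> (\<alpha> l y)"])
   show "\<xi> (\<alpha> l y) = \<xi> (\<alpha> m y)" if "l \<in> lfun NV" "m \<in> lfun NV" "\<forall>x\<in>carrier NV. l x = m x" for l m
    using acong[OF that y] by simp
   show "\<xi> (\<alpha> (\<lambda>x. l x + m x) y) = \<xi> (\<alpha> l y) + \<xi> (\<alpha> m y)" if "l \<in> lfun NV" "m \<in> lfun NV" for l m
    using aplus[OF that y] that y xi by (simp add: lfunD)
   show "\<xi> (\<alpha> (\<lambda>x. c * l x) y) = c * \<xi> (\<alpha> l y)" if "l \<in> lfun NV" for l c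
    using ascale[OF that y] that y xi by (simp add: lfunD)
  qed blast
  then show ?thesis by auto
 qed
 then have "\<exists>X. \<forall>\<xi>\<in>lfun A. \<forall>y\<in>carrier T2. X \<xi> y \<in> carrier T2 \<and> (\<forall>l\<in>lfun NV. l (X \<xi> y) = \<xi> (\<alpha> l y))" by metis
 then obtain X where X: "\<And>\<xi> y. \<lbrakk>\<xi> \<in> lfun A; y \<in> carrier T2\<rbrakk> \<Longrightarrow> X \<xi> y \<in> carrier T2"
  "\<And>\<xi> y l. \<lbrakk>\<xi> \<in> lfun A; y \<in> carrier T2; l \<in> lfun NV\<rbrakk> \<Longrightarrow> l (X \<xi> y) = \<xi> (\<alpha> l y)" by metis
 note [simp] = X(1)
 have "\<exists>b. b \<in> carrier B \<and> (\<forall>y\<in>carrier T2. X \<xi> y = \<tau>2 (b *[T2] y))" if xi: "\<xi> \<in> lfun A" for \<xi>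
 proof -
  have "X \<xi> \<in> ahom B T2' T2"
  proof (rule ahomI)
   fix y y' assume "y \<in> carrier T2'" "y' \<in> carrier T2'"
   then have y: "y \<in> carrier T2" "y' \<in> carrier T2" by (simp_all add: d2.carr)
   have "X \<xi> (y +[T2] y') = X \<xi> y +[T2] X \<xi> y'"
    by (rule N.rs.lfun_eqI) (use y xi aadd in "simp_all add: lfun_rs X(2) lfunD")
   then show "X \<xi> (y +[T2'] y') = X \<xi> y +[T2] X \<xi> y'" using y by (simp add: d2.add')
  next
   fix b y assume b: "b \<in> carrier B" and "y \<in> carrier T2'"
   then have y: "y \<in> carrier T2" by (simp add: d2.carr)
   show "X \<xi> (b *[T2'] y) = b *[T2] X \<xi> y"
   proof (rule N.rs.lfun_eqI)
    fix l assume l: "l \<in> lfun NV"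
    show "l (X \<xi> (b *[T2'] y)) = l (b *[T2] X \<xi> y)"
     using X(2)[OF xi y slice_twist(1)[OF l b T.M.zero_closed]] X(2)[OF xi _ l, of "b *[T2'] y"] atwist[OF l y b] b y by simp
   qed (use b y xi in simp_all)
  qed (use xi in "simp add: d2.carr")
  from d2.full[OF this] show ?thesis by blast
 qed
 then have "\<exists>\<beta>. \<forall>\<xi>\<in>lfun A. \<beta> \<xi> \<in> carrier B \<and> (\<forall>y\<in>carrier T2. X \<xi> y = \<tau>2 (\<beta> \<xi> *[T2] y))" by metis
 then obtain \<beta> where b: "\<And>\<xi>. \<xi> \<in> lfun A \<Longrightarrow> \<beta> \<xi> \<in> carrier B"
  "\<And>\<xi> y. \<lbrakk>\<xi> \<in> lfun A; y \<in> carrier T2\<rbrakk> \<Longrightarrow> \<tau>2 (\<beta> \<xi> *[T2] y) = X \<xi> y" by metis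
 note [simp] = b(1)
 obtain r where r: "r \<in> carrier AB" "\<And>\<xi>. \<xi> \<in> lfun A \<Longrightarrow> sw.slice \<xi> r = \<beta> \<xi>"
 proof (rule sw.of_slices[of \<beta>])
  show "\<beta> \<xi> = \<beta> \<chi>" if xc: "\<xi> \<in> lfun A" "\<chi> \<in> lfun A" "\<forall>x\<in>carrier A. \<xi> x = \<chi> x" for \<xi> \<chi>
  proof (rule d2.faithful_eq)
   fix y assume y: "y \<in> carrier T2"
   have "X \<xi> y = X \<chi> y" by (rule N.rs.lfun_eqI) (use xc y in "simp_all add: X(2)")
   then show "\<tau>2 (\<beta> \<xi> *[T2] y) = \<tau>2 (\<beta> \<chi> *[T2] y)" using xc y by (simp add: b(2))
  qed (use xc in simp_all)
  show "\<beta> (\<lambda>x. \<xi> x + \<chi> x) = \<beta> \<xi> +[B] \<beta> \<chi>" if xc: "\<xi> \<in> lfun A" "\<chi> \<in> lfun A" for \<xi> \<chi>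
  proof (rule d2.faithful_eq)
   fix y assume y: "y \<in> carrier T2"
   have "X (\<lambda>x. \<xi> x + \<chi> x) y = X \<xi> y +[T2] X \<chi> y"
    by (rule N.rs.lfun_eqI) (use xc y in "simp_all add: X(2) lfun_rs lfun_plus")
   then show "\<tau>2 (\<beta> (\<lambda>x. \<xi> x + \<chi> x) *[T2] y) = \<tau>2 ((\<beta> \<xi> +[B] \<beta> \<chi>) *[T2] y)"
    using xc y by (simp add: b(2) lfun_plus N.smult_l_distr d2.\<tau>_add)
  qed (use xc in "simp_all add: lfun_plus")
  show "\<beta> (\<lambda>x. c * \<xi> x) = c *[B] \<beta> \<xi>" if xc: "\<xi> \<in> lfun A" for \<xi> c
  proof (rule d2.faithful_eq)
   fix y assume y: "y \<in> carrier T2"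
   have "X (\<lambda>x. c * \<xi> x) y = B.sc c *[T2] X \<xi> y"
    by (rule N.rs.lfun_eqI) (use xc y in "simp_all add: X(2) lfun_rs lfun_scale")
   moreover have "c *[B] \<beta> \<xi> = B.sc c **[B] \<beta> \<xi>" using xc by (simp add: B.sc_simps)
   ultimately show "\<tau>2 (\<beta> (\<lambda>x. c * \<xi> x) *[T2] y) = \<tau>2 ((c *[B] \<beta> \<xi>) *[T2] y)"
    using xc y by (simp add: b(2) lfun_scale N.smult_assoc1 d2.\<tau>_scalar)
  qed (use xc in "simp_all add: lfun_scale")
 qed (simp, blast)
 have "\<psi> x = \<tau> (r *[T] x)" if "x \<in> carrier T" for x using that
 proof (induction x rule: T_induct)
  case (tens x y)
  show ?case
  proof (rule vt.slice_eqI)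
   fix l assume l: "l \<in> lfun NV"
   show "vt.slice l (\<psi> (t x y)) = vt.slice l (\<tau> (r *[T] t x y))"
   proof (rule M.rs.lfun_eqI)
    fix \<mu> assume m: "\<mu> \<in> lfun MV"
    let ?\<xi> = "\<lambda>a. \<mu> (\<tau>1 (a *[T1] x))"
    note xi = orbit_form[OF m tens(1)]
    have "\<mu> (vt.slice l (\<tau> (r *[T] t x y))) = l (X ?\<xi> y)"
     using slice_action[OF m l tens r(1)] b(2)[OF xi tens(2)] r(2)[OF xi] by simp
    also have "\<dots> = \<mu> (vt.slice l (\<psi> (t x y)))" using X(2)[OF xi tens(2) l] a(2)[OF l tens(2,1)] by simp
    finally show "\<mu> (vt.slice l (\<psi> (t x y))) = \<mu> (vt.slice l (\<tau> (r *[T] t x y)))" ..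
   qed (use l tens r(1) in simp_all)
  qed (use tens r(1) in simp_all)
 next
  case (add x y) then show ?case using r(1) by (simp add: pa T.smult_r_distr)
 qed
 then show ?thesis using r(1) by blast
qed

end

section \<open>Injectivity of the tensor product, and self-duality of its simple modules\<close>

context dualizer_pair
begin

text \<open>With a basis of T2, a map to T is a finite family of maps to T1, its contractions along
  the dual basis. Each of them extends by injectivity of T1, but linearly over A alone.\<close>

lemma extend_A:
 assumes Y: "fdmod AB Y" and Z: "fdmod AB Z" and i: "\<iota> \<in> ahom AB Y Z" "inj_on \<iota> (carrier Y)" and p: "\<phi> \<in> ahom AB Y T"
 obtains f where "f \<in> ahom A (res1 Z) (res1 T)" "\<And>y. y \<in> carrier Y \<Longrightarrow> f (\<iota> y) = \<phi> y"
proof -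
 obtain n b c where bas: "basis NV n b c" by (rule N.rs.basis_ex)
 note bD = basisD[OF bas]
 interpret Z: fdmod AB Z by fact
 note lZ = res1_left_module[OF Z.is_module]
 have "\<exists>\<psi>. \<psi> \<in> ahom A (res1 Z) T1 \<and> (\<forall>y\<in>carrier Y. \<psi> (\<iota> y) = vt.slice (c j) (\<phi> y))" if j: "j < n" for j
 proof -
  obtain \<psi> where "\<psi> \<in> ahom A (res1 Z) T1" "\<And>y. y \<in> carrier (res1 Y) \<Longrightarrow> \<psi> (\<iota> y) = vt.slice (c j) (\<phi> y)"
   by (rule d1.inject[OF res_fdmod(1)[OF Y] res_fdmod(1)[OF Z] ahom_res(1)[OF i(1)] _
      ahom_comp[OF ahom_res(1)[OF p] slice_A[OF bD(2)[OF j]]]]) (use i(2) in simp, blast)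
  then show ?thesis by auto
 qed
 then obtain \<psi> where ps: "\<And>j. j < n \<Longrightarrow> \<psi> j \<in> ahom A (res1 Z) T1"
  "\<And>j y. \<lbrakk>j < n; y \<in> carrier Y\<rbrakk> \<Longrightarrow> \<psi> j (\<iota> y) = vt.slice (c j) (\<phi> y)" by metis
 have bc: "b j \<in> carrier T2" if "j < n" for j using bD(1)[OF that] by simp
 define f where "f k z = finsum TV (\<lambda>j. t (\<psi> j z) (b j)) {..<k}" for k z
 have tc: "t (\<psi> j z) (b j) \<in> carrier TV" if "j < n" "z \<in> carrier Z" for j z
  using ahomD(1)[OF ps(1)[OF that(1)]] that(2) bc[OF that(1)] by simp
 have "f k \<in> ahom A (res1 Z) (res1 T)" if "k \<le> n" for k using that
 proof (induction k)
  case 0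
  show ?case by (rule ahomI) (simp_all add: f_def R1.smult_r_null[simplified])
 next
  case (Suc k)
  have "(\<lambda>z. t (\<psi> k z) (b k) +[res1 T] f k z) \<in> ahom A (res1 Z) (res1 T)"
   by (rule hom_add_ahom[OF R1.is_module ahom_comp[OF ps(1) t_left_hom[OF bc]] Suc.IH]) (use Suc.prems in simp_all)
  then show ?case
  proof (rule ahom_cong[OF _ _ lZ])
   fix z assume "z \<in> carrier (res1 Z)"
   then show "f (Suc k) z = t (\<psi> k z) (b k) +[res1 T] f k z" unfolding f_def lessThan_Suc using Suc.prems tc
    by (subst vt.T.M.finsum_insert) (auto simp del: restrict_scalars_simps(1))
  qed
 qed
 then have "f n \<in> ahom A (res1 Z) (res1 T)" by simp
 moreover have "f n (\<iota> y) = \<phi> y" if y: "y \<in> carrier Y" for y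
 proof -
  have "\<phi> y \<in> carrier TV" using ahomD(1)[OF p y] by simp
  from vt.slice_expand[OF bas this] have "\<phi> y = finsum TV (\<lambda>j. t (vt.slice (c j) (\<phi> y)) (b j)) {..<n}" .
  also have "\<dots> = f n (\<iota> y)" unfolding f_def
  proof (rule vt.T.M.finsum_cong')
   show "(\<lambda>j. t (\<psi> j (\<iota> y)) (b j)) \<in> {..<n} \<rightarrow> carrier TV" using tc ahomD(1)[OF i(1) y] by blast
  qed (use ps(2) y in simp_all)
  finally show ?thesis by simp
 qed
 ultimately show ?thesis by (rule that)
qed

text \<open>The extension f over A is made linear over B: for fixed z the contractions of b
  \<mapsto> f (b z) lie in the coinduced module of T2, the retraction \<open>\<rho>\<close> brings
  them back to T2, and \<open>of_slices\<close> assembles the results. On the image of \<iota>,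
  where f is already linear over B, nothing changes.\<close>

lemma injective:
 assumes Y: "fdmod AB Y" and Z: "fdmod AB Z" and i: "\<iota> \<in> ahom AB Y Z" "inj_on \<iota> (carrier Y)" and p: "\<phi> \<in> ahom AB Y T"
 shows "\<exists>\<psi>\<in>ahom AB Z T. \<forall>y\<in>carrier Y. \<psi> (\<iota> y) = \<phi> y"
proof -
 interpret Y: fdmod AB Y by fact
 interpret Z: fdmod AB Z by fact
 obtain f where f: "f \<in> ahom A (res1 Z) (res1 T)" "\<And>y. y \<in> carrier Y \<Longrightarrow> f (\<iota> y) = \<phi> y"
  by (rule extend_A[OF Y Z i p]) blast
 have fl: "f \<in> lin (rs AB Z) TV" using A.rs_ahom[OF f(1)] by simp
 have fc [simp]: "f z \<in> carrier T" if "z \<in> carrier Z" for z using ahomD(1)[OF f(1)] that by simp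
 have fa: "f (z +[Z] w) = f z +[T] f w" if "z \<in> carrier Z" "w \<in> carrier Z" for z w using ahomD(2)[OF f(1)] that by simp
 have fs: "f ((a \<Join> 1[B]) *[Z] z) = (a \<Join> 1[B]) *[T] f z" if "a \<in> carrier A" "z \<in> carrier Z" for a z
  using ahomD(3)[OF f(1) that(1), of z] that(2) by simp
 have fsc: "f (AB.sc c *[Z] z) = AB.sc c *[T] f z" if "z \<in> carrier Z" for c z
  using ahomD(3)[OF fl, of c z] that by simp
 have ssc [simp]: "st.slice l x \<in> carrier T2" if "l \<in> lfun MV" "x \<in> carrier T" for l x
  using st.slice_closed[OF that(1), of x] that(2) by simp
 have ssa: "st.slice l (x +[T] y) = st.slice l x +[T2] st.slice l y" if "l \<in> lfun MV" "x \<in> carrier T" "y \<in> carrier T" for l x y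
  using st.slice_add[OF that(1), of x y] that by simp
 have sss: "st.slice l (AB.sc c *[T] x) = B.sc c *[T2] st.slice l x" if "l \<in> lfun MV" "x \<in> carrier T" for l x c
  using st.slice_smult[OF that(1), of x c] that by simp
 obtain \<rho> where rho: "\<rho> \<in> ahom B d2.coind T2" "\<And>x. x \<in> carrier T2 \<Longrightarrow> \<rho> (\<lambda>b\<in>carrier B. b *[T2] x) = x"
  by (rule d2.reynolds) blast
 have cc [simp]: "carrier d2.coind = Hom field_ring B NV" by (simp add: d2.coind_def)
 have ra: "\<rho> (\<lambda>b\<in>carrier B. h b +[T2] k b) = \<rho> h +[T2] \<rho> k" if "h \<in> Hom field_ring B NV" "k \<in> Hom field_ring B NV" for h k
  using ahomD(2)[OF rho(1), of h k] that by (simp add: d2.coind_def)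
 have rs: "\<rho> (\<lambda>a\<in>carrier B. h (a **[B] b)) = b *[T2] \<rho> h" if "b \<in> carrier B" "h \<in> Hom field_ring B NV" for b h
  by (rule ahomD(3)[OF rho(1) that(1), unfolded d2.coind_def hom_module_simps, OF that(2)])
 have rc [simp]: "\<rho> h \<in> carrier T2" if "h \<in> Hom field_ring B NV" for h using ahomD(1)[OF rho(1)] that by simp
 define h where "h l z = (\<lambda>b\<in>carrier B. st.slice l (f ((1[A] \<Join> b) *[Z] z)))" for l z
 have one_add: "1[A] \<Join> (b +[B] b') = 1[A] \<Join> b +[AB] 1[A] \<Join> b'" if "b \<in> carrier B" "b' \<in> carrier B" for b b'
  using that by (simp add: ts.tens_simps(3))
 have one_sc: "1[A] \<Join> (c *[B] b) = AB.sc c **[AB] (1[A] \<Join> b)" if "b \<in> carrier B" for b c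
  using that AB_tens[of "1[A]" "1[A]" "B.sc c" b] by (simp add: sc_AB(2) B.sc_simps)
 have hH: "h l z \<in> Hom field_ring B NV" if l: "l \<in> lfun MV" and z: "z \<in> carrier Z" for l z unfolding h_def
 proof (rule restrict_Hom[OF _ B.V.is_module], rule ahomI)
  fix b b' assume "b \<in> carrier B" "b' \<in> carrier B"
  then show "st.slice l (f ((1[A] \<Join> (b +[B] b')) *[Z] z))
    = st.slice l (f ((1[A] \<Join> b) *[Z] z)) +[NV] st.slice l (f ((1[A] \<Join> b') *[Z] z))"
   using l z by (simp add: one_add Z.smult_l_distr fa ssa)
 next
  fix c b assume b: "b \<in> carrier B"
  have "(1[A] \<Join> (c *[B] b)) *[Z] z = AB.sc c *[Z] ((1[A] \<Join> b) *[Z] z)"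
   unfolding one_sc[OF b] by (rule Z.smult_assoc1) (use b z in simp_all)
  then show "st.slice l (f ((1[A] \<Join> (c *[B] b)) *[Z] z)) = c *[NV] st.slice l (f ((1[A] \<Join> b) *[Z] z))"
   using b l z by (simp add: fsc sss)
 qed (use l z in simp)
 have "\<exists>w. w \<in> carrier T \<and> (\<forall>l\<in>lfun MV. st.slice l w = \<rho> (h l z))" if z: "z \<in> carrier Z" for z
 proof -
  note fz = fc[OF Z.smult_closed[OF ten_closed[OF A.one_closed] z]]
  obtain w where "w \<in> carrier TV" "\<And>l. l \<in> lfun MV \<Longrightarrow> st.slice l w = \<rho> (h l z)"
  proof (rule st.of_slices[of "\<lambda>l. \<rho> (h l z)"])
   show "\<rho> (h l z) = \<rho> (h m z)" if lm: "l \<in> lfun MV" "m \<in> lfun MV" "\<forall>x\<in>carrier MV. l x = m x" for l m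
   proof -
    have "h l z = h m z" unfolding h_def by (rule restrict_ext) (use st.slice_cong[OF lm] fz in simp)
    then show ?thesis by simp
   qed
   show "\<rho> (h (\<lambda>x. l x + m x) z) = \<rho> (h l z) +[NV] \<rho> (h m z)" if lm: "l \<in> lfun MV" "m \<in> lfun MV" for l m
   proof -
    have "h (\<lambda>x. l x + m x) z = (\<lambda>b\<in>carrier B. h l z b +[T2] h m z b)" unfolding h_def
     by (rule restrict_ext) (use st.slice_plus[OF lm] fz in simp)
    then show ?thesis using ra[OF hH[OF lm(1) z] hH[OF lm(2) z]] by simp
   qed
   show "\<rho> (h (\<lambda>x. c * l x) z) = c *[NV] \<rho> (h l z)" if l: "l \<in> lfun MV" for l c
   proof -
    \<comment> \<open>Scalars reach \<open>\<rho>\<close> through the central elements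
      \<open>B.sc c\<close>, because its linearity is over B.\<close>
    have "h (\<lambda>x. c * l x) z = (\<lambda>b\<in>carrier B. h l z (b **[B] B.sc c))"
    proof -
     have "h l z (c *[B] b) = B.sc c *[T2] h l z b" if "b \<in> carrier B" for b
      using ahomD(3)[OF Hom_ahom[OF hH[OF l z]], of c b] that by simp
     then show ?thesis unfolding h_def
      by (intro restrict_ext) (use st.slice_scale[OF l] fz in "simp add: B.sc_simps")
    qed
    then show ?thesis using rs[OF _ hH[OF l z], of "B.sc c"] by simp
   qed
  qed (use hH z in "simp_all")
  then show ?thesis by auto
 qed
 then obtain E where E: "\<And>z. z \<in> carrier Z \<Longrightarrow> E z \<in> carrier T"
  "\<And>z l. \<lbrakk>z \<in> carrier Z; l \<in> lfun MV\<rbrakk> \<Longrightarrow> st.slice l (E z) = \<rho> (h l z)" by metis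
 note [simp] = E(1)
 have Eadd: "E (z +[Z] w) = E z +[T] E w" if zw: "z \<in> carrier Z" "w \<in> carrier Z" for z w
 proof (rule st.slice_eqI)
  fix l assume l: "l \<in> lfun MV"
  have "h l (z +[Z] w) = (\<lambda>b\<in>carrier B. h l z b +[T2] h l w b)" unfolding h_def
   by (rule restrict_ext) (use l zw in "simp add: Z.smult_r_distr fa ssa")
  then show "st.slice l (E (z +[Z] w)) = st.slice l (E z +[T] E w)"
   using l zw ra[OF hH hH, OF l zw(1) l zw(2)] by (simp add: E(2) ssa)
 qed (use zw in simp_all)
 have "E \<in> ahom AB Z T"
 proof (rule ahom_ABI[OF Z.is_module T.is_module])
  show "E \<in> ahom A (res1 Z) (res1 T)"
  proof (rule ahomI)
   fix a z assume a: "a \<in> carrier A" and "z \<in> carrier (res1 Z)"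
   then have z: "z \<in> carrier Z" by simp
   have "E ((a \<Join> 1[B]) *[Z] z) = (a \<Join> 1[B]) *[T] E z"
   proof (rule st.slice_eqI)
    fix l assume l: "l \<in> lfun MV"
    note l' = slice_twist'(1)[OF l a T.M.zero_closed]
    \<comment> \<open>Linearity over A survives: a acts on the factor that is contracted and so only
      changes the form.\<close>
    have "h l ((a \<Join> 1[B]) *[Z] z) = h (\<lambda>m. l (a *[T1] m)) z" unfolding h_def
    proof (rule restrict_ext)
     fix b assume b: "b \<in> carrier B"
     have "f ((1[A] \<Join> b) *[Z] ((a \<Join> 1[B]) *[Z] z)) = (a \<Join> 1[B]) *[T] f ((1[A] \<Join> b) *[Z] z)"
      using smult_split[OF Z.is_module a b z] fs[OF a, of "(1[A] \<Join> b) *[Z] z"] b z by simp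
     then show "st.slice l (f ((1[A] \<Join> b) *[Z] ((a \<Join> 1[B]) *[Z] z))) = st.slice (\<lambda>m. l (a *[T1] m)) (f ((1[A] \<Join> b) *[Z] z))"
      using slice_twist'(2)[OF l a, of "f ((1[A] \<Join> b) *[Z] z)"] b z by simp
    qed
    then show "st.slice l (E ((a \<Join> 1[B]) *[Z] z)) = st.slice l ((a \<Join> 1[B]) *[T] E z)"
     using slice_twist'(2)[OF l a, of "E z"] E(2)[OF z l'] E(2)[OF _ l, of "(a \<Join> 1[B]) *[Z] z"] a z by simp
   qed (use a z in simp_all)
   then show "E (a *[res1 Z] z) = a *[res1 T] E z" by simp
  qed (simp_all add: Eadd)
  show "E \<in> ahom B (res2 Z) (res2 T)"
  proof (rule ahomI)
   fix b z assume b: "b \<in> carrier B" and "z \<in> carrier (res2 Z)"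
   then have z: "z \<in> carrier Z" by simp
   have "E ((1[A] \<Join> b) *[Z] z) = (1[A] \<Join> b) *[T] E z"
   proof (rule st.slice_eqI)
    fix l assume l: "l \<in> lfun MV"
    \<comment> \<open>Acting by b on z translates the argument of \<open>h l z\<close>; this is the
      coinduced action, which \<open>\<rho>\<close> respects.\<close>
    have "h l ((1[A] \<Join> b) *[Z] z) = (\<lambda>a\<in>carrier B. h l z (a **[B] b))" unfolding h_def
    proof (rule restrict_ext)
     fix a assume a: "a \<in> carrier B"
     have "(1[A] \<Join> a) *[Z] ((1[A] \<Join> b) *[Z] z) = (1[A] \<Join> (a **[B] b)) *[Z] z"
      using a b z AB_tens[of "1[A]" "1[A]" a b] by (simp flip: Z.smult_assoc1)
     then show "st.slice l (f ((1[A] \<Join> a) *[Z] ((1[A] \<Join> b) *[Z] z)))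
       = (\<lambda>b\<in>carrier B. st.slice l (f ((1[A] \<Join> b) *[Z] z))) (a **[B] b)" using a b by simp
    qed
    then have "st.slice l (E ((1[A] \<Join> b) *[Z] z)) = b *[T2] st.slice l (E z)"
     using E(2)[OF _ l, of "(1[A] \<Join> b) *[Z] z"] E(2)[OF z l] rs[OF b hH[OF l z]] b z by simp
    also have "\<dots> = st.slice l ((1[A] \<Join> b) *[T] E z)" using ahomD(3)[OF slice_B[OF l] b, of "E z"] z by simp
    finally show "st.slice l (E ((1[A] \<Join> b) *[Z] z)) = st.slice l ((1[A] \<Join> b) *[T] E z)" .
   qed (use b z in simp_all)
   then show "E (b *[res2 Z] z) = b *[res2 T] E z" by simp
  qed (simp_all add: Eadd)
 qed
 moreover have "E (\<iota> y) = \<phi> y" if y: "y \<in> carrier Y" for y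
 proof (rule st.slice_eqI)
  note iy = ahomD(1)[OF i(1) y] and py = ahomD(1)[OF p y]
  fix l assume l: "l \<in> lfun MV"
  have "h l (\<iota> y) = (\<lambda>b\<in>carrier B. b *[T2] st.slice l (\<phi> y))" unfolding h_def
  proof (rule restrict_ext)
   fix b assume b: "b \<in> carrier B"
   have "(1[A] \<Join> b) *[Z] \<iota> y = \<iota> ((1[A] \<Join> b) *[Y] y)" using ahomD(3)[OF i(1), of "1[A] \<Join> b" y] b y by simp
   then have "f ((1[A] \<Join> b) *[Z] \<iota> y) = (1[A] \<Join> b) *[T] \<phi> y"
    using f(2)[of "(1[A] \<Join> b) *[Y] y"] ahomD(3)[OF p, of "1[A] \<Join> b" y] b y by simp
   then show "st.slice l (f ((1[A] \<Join> b) *[Z] \<iota> y)) = b *[T2] st.slice l (\<phi> y)"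
    using ahomD(3)[OF slice_B[OF l] b, of "\<phi> y"] py by simp
  qed
  then show "st.slice l (E (\<iota> y)) = st.slice l (\<phi> y)" using E(2)[OF iy l] rho(2)[of "st.slice l (\<phi> y)"] l py by simp
 qed (use ahomD(1)[OF i(1) y] ahomD(1)[OF p y] in simp_all)
 ultimately show ?thesis by blast
qed

sublocale dz: dualizer AB T T' \<tau>
proof unfold_locales
 show "\<And>\<psi>. \<psi> \<in> ahom AB T' T \<Longrightarrow> \<exists>b\<in>carrier AB. \<forall>x\<in>carrier T. \<psi> x = \<tau> (b *[T] x)" by (rule full)
 show "\<And>b. \<lbrakk>b \<in> carrier AB; \<forall>x\<in>carrier T. b *[T] x = 0[T]\<rbrakk> \<Longrightarrow> b = 0[AB]" by (rule faithful)
qed (simp_all add: carr' zero' add' scal' comm \<tau>_bij \<tau>_smult \<tau>_smult' injective)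

text \<open>The two maps into the duals of the factors combine to x \<otimes> y \<mapsto> g x
  \<otimes> k y. Nonzero vectors have a nonzero tensor product, so a pure tensor detects that the
  result is not zero.\<close>

lemma self_dual:
 assumes P: "mtensor A B L K P p"
  and g: "g \<in> ahom A L (dual_module A T1 T1' L)" "x0 \<in> carrier L" "g x0 \<noteq> 0[dual_module A T1 T1' L]"
  and k: "k \<in> ahom B K (dual_module B T2 T2' K)" "y0 \<in> carrier K" "k y0 \<noteq> 0[dual_module B T2 T2' K]"
 shows "\<exists>h\<in>ahom AB P (dual_module AB T T' P). \<exists>w\<in>carrier P. h w \<noteq> 0[dual_module AB T T' P]"
proof -
 interpret P: mtensor A B L K P p by fact
 interpret dP: fdmod AB "dual_module AB T T' P" by (rule dz.dual_fdmod[OF P.T.fdmod_axioms])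
 have gH: "g x \<in> Hom A L T1" if "x \<in> carrier L" for x using ahomD(1)[OF g(1) that] by simp
 have kH: "k y \<in> Hom B K T2" if "y \<in> carrier K" for y using ahomD(1)[OF k(1) that] by simp
 note gc [simp] = d1.Hom_closed[OF gH] and kc [simp] = d2.Hom_closed[OF kH]
 have ex: "\<exists>f. f \<in> Hom AB P T \<and> (\<forall>m\<in>carrier L. \<forall>n\<in>carrier K. f (p m n) = t (g x m) (k y n))"
  if xy: "x \<in> carrier L" "y \<in> carrier K" for x y
 proof -
  obtain f where f: "f \<in> ahom AB P T" "\<forall>m\<in>carrier L. \<forall>n\<in>carrier K. f (p m n) = t (g x m) (k y n)"
   by (rule tensor_map[OF P mtensor_axioms Hom_ahom[OF gH[OF xy(1)]] Hom_ahom[OF kH[OF xy(2)]]])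
  show ?thesis by (rule exI[of _ "restrict f (carrier P)"]) (use restrict_Hom[OF f(1) P.T.is_module] f(2) in simp)
 qed
 define F where "F x y = (SOME f. f \<in> Hom AB P T \<and> (\<forall>m\<in>carrier L. \<forall>n\<in>carrier K. f (p m n) = t (g x m) (k y n)))" for x y
 have F: "\<lbrakk>x \<in> carrier L; y \<in> carrier K\<rbrakk> \<Longrightarrow> F x y \<in> Hom AB P T"
  "\<lbrakk>x \<in> carrier L; y \<in> carrier K; m \<in> carrier L; n \<in> carrier K\<rbrakk> \<Longrightarrow> F x y (p m n) = t (g x m) (k y n)" for x y m n
  using someI_ex[OF ex[of x y], folded F_def] by blast+
 have ext: "f = h" if f: "f \<in> Hom AB P T" and h: "h \<in> Hom AB P T"
  and e: "\<And>m n. \<lbrakk>m \<in> carrier L; n \<in> carrier K\<rbrakk> \<Longrightarrow> f (p m n) = h (p m n)" for f h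
 proof (rule Hom_eqI[OF f h])
  fix z assume "z \<in> carrier P"
  then have z: "z \<in> carrier P.TV" by simp
  show "f z = h z"
   by (rule P.vt.ahom_eq[OF vt.T.vspace_axioms AB.rs_ahom[OF Hom_ahom[OF f]] AB.rs_ahom[OF Hom_ahom[OF h]] _ z]) (use e in simp)
 qed
 let ?X = "dual_module AB T T' P"
 have plus: "(\<lambda>w\<in>carrier P. f w +[T] h w) \<in> Hom AB P T" if "f \<in> Hom AB P T" "h \<in> Hom AB P T" for f h
  using dP.M.a_closed[of f h] that by simp
 have times: "(\<lambda>w\<in>carrier P. r *[T'] f w) \<in> Hom AB P T" if "r \<in> carrier AB" "f \<in> Hom AB P T" for r f
  using dP.smult_closed[of r f] that by simp
 have eq: "F (a *[L] x) (b *[K] y) = (a \<Join> b) *[?X] F x y"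
  if "a \<in> carrier A" "b \<in> carrier B" "x \<in> carrier L" "y \<in> carrier K" for a b x y unfolding dual_module_simps
  by (rule ext[OF F(1) times[OF ten_closed F(1)]])
   (use that in "simp_all add: F(2) ahomD(3)[OF g(1)] ahomD(3)[OF k(1)] act'")
 have "bilin P.MV P.NV (rs AB ?X) F"
 proof (rule bilinI)
  show "F x y \<in> carrier (rs AB ?X)" if "x \<in> carrier P.MV" "y \<in> carrier P.NV" for x y using that F(1) by simp
  show "F (x +[P.MV] x') y = F x y +[rs AB ?X] F x' y"
   if "x \<in> carrier P.MV" "x' \<in> carrier P.MV" "y \<in> carrier P.NV" for x x' y
   unfolding restrict_scalars_simps dual_module_simps
   by (rule ext[OF F(1) plus[OF F(1) F(1)]]) (use that in "simp_all add: F(2) ahomD(2)[OF g(1)]")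
  show "F x (y +[P.NV] y') = F x y +[rs AB ?X] F x y'"
   if "x \<in> carrier P.MV" "y \<in> carrier P.NV" "y' \<in> carrier P.NV" for x y y'
   unfolding restrict_scalars_simps dual_module_simps
   by (rule ext[OF F(1) plus[OF F(1) F(1)]]) (use that in "simp_all add: F(2) ahomD(2)[OF k(1)]")
  show "F (c *[P.MV] x) y = c *[rs AB ?X] F x y" if "x \<in> carrier P.MV" "y \<in> carrier P.NV" for c x y
   using eq[of "A.sc c" "1[B]" x y] that unfolding restrict_scalars_simps sc_AB(1) by simp
  show "F x (c *[P.NV] y) = c *[rs AB ?X] F x y" if "x \<in> carrier P.MV" "y \<in> carrier P.NV" for c x y
   using eq[of "1[A]" "B.sc c" x y] that unfolding restrict_scalars_simps sc_AB(2) by simp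
 qed
 then obtain h where h: "h \<in> ahom AB P ?X" "\<forall>m\<in>carrier L. \<forall>n\<in>carrier K. h (p m n) = F m n"
  using P.univ_hom[OF dP.is_module _ eq] by blast
 have "\<exists>m\<in>carrier L. g x0 m \<noteq> 0[T1]"
 proof (rule ccontr)
  assume "\<not> ?thesis"
  then have "g x0 = (\<lambda>m\<in>carrier L. 0[T1])"
   using hom_zero_Hom[OF P.M.is_module M.is_module] by (intro Hom_eqI[OF gH[OF g(2)]]) auto
  then show False using g(3) by simp
 qed
 then obtain m where m: "m \<in> carrier L" "g x0 m \<noteq> 0[T1]" by blast
 have "\<exists>n\<in>carrier K. k y0 n \<noteq> 0[T2]"
 proof (rule ccontr)
  assume "\<not> ?thesis"
  then have "k y0 = (\<lambda>n\<in>carrier K. 0[T2])"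
   using hom_zero_Hom[OF P.N.is_module N.is_module] by (intro Hom_eqI[OF kH[OF k(2)]]) auto
  then show False using k(3) by simp
 qed
 then obtain n where n: "n \<in> carrier K" "k y0 n \<noteq> 0[T2]" by blast
 have "F x0 y0 (p m n) \<noteq> 0[T]"
  using vt.t_nonzero[of "g x0 m" "k y0 n"] m n F(2)[OF g(2) k(2) m(1) n(1)] g(2) k(2) by simp
 then have "h (p x0 y0) \<noteq> 0[?X]" using h(2) g(2) k(2) m(1) n(1) by auto
 then show ?thesis using h(1) P.t_closed[OF g(2) k(2)] by blast
qed

end

section \<open>From BGG algebras to dualizing modules and back\<close>

lemma BGG_dualizer:
 fixes A :: "('f::field, 'a) module"
 assumes "BGG_algebra A I r L"
 obtains T T' :: "('a, nat \<Rightarrow> 'f) module" and \<tau> where "dualizer A T T' \<tau>" "rs A T' = rs A T"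
  "\<forall>i\<in>I. \<exists>g\<in>ahom A (L i) (dual_module A T T' (L i)). \<exists>x\<in>carrier (L i). g x \<noteq> 0[dual_module A T T' (L i)]"
proof -
 obtain D D' where D: "duality_functor A D D'"
  "\<And>i S. \<lbrakk>i \<in> I; S \<in> fg_modules A; isomorphic A S (L i)\<rbrakk> \<Longrightarrow> isomorphic A (D S) (L i)"
  using assms unfolding BGG_algebra_def by blast
 have fd: "fd_algebra A" and s: "\<And>i. i \<in> I \<Longrightarrow> simple_module A (L i)"
  using assms by (auto simp: BGG_algebra_def quasi_hereditary_def labels_simples_def)
 interpret duality A D D' using D(1) fd by (simp add: duality_def falg_def)
 show ?thesis
 proof (rule that[OF dualizer rs_T'], rule ballI)
  fix i assume i: "i \<in> I"
  have f: "fdmod A (L i)" by (rule simple_fdmod[OF fd s[OF i]])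
  interpret Li: fdmod A "L i" by (rule f)
  note E = enc[OF f]
  show "\<exists>g\<in>ahom A (L i) (dual_module A T T' (L i)). \<exists>x\<in>carrier (L i). g x \<noteq> 0[dual_module A T T' (L i)]"
   by (rule self_dual[OF s[OF i] D(2)[OF i E(1) isomorphic_sym[OF Li.is_module E(6,4)]]])
 qed
qed

theorem lemma5:
 fixes A1 :: "('f::alg_closed_field, 'a) module"
  and A2 :: "('f, 'b) module"
  and I1 :: "'i set" and r1 :: "('i \<times> 'i) set"
  and I2 :: "'j set" and r2 :: "('j \<times> 'j) set"
  and L1 :: "'i \<Rightarrow> ('a, 'm) module"
  and L2 :: "'j \<Rightarrow> ('b, 'n) module"
 assumes "BGG_algebra A1 I1 r1 L1"
  and "BGG_algebra A2 I2 r2 L2"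
 shows "BGG_algebra (tensor A1 A2) (I1 \<times> I2) (prod_order r1 r2) (\<lambda>(x1, x2). tensor_module A1 A2 (L1 x1) (L2 x2))"
proof -
 let ?AB = "tensor A1 A2"
 have q1: "quasi_hereditary A1 I1 r1 L1" and q2: "quasi_hereditary A2 I2 r2 L2"
  using assms by (auto simp: BGG_algebra_def)
 have fd1: "fd_algebra A1" and fd2: "fd_algebra A2"
  and s1: "\<And>i. i \<in> I1 \<Longrightarrow> simple_module A1 (L1 i)" and s2: "\<And>j. j \<in> I2 \<Longrightarrow> simple_module A2 (L2 j)"
  using q1 q2 by (auto simp: quasi_hereditary_def labels_simples_def)
 obtain T1 T1' :: "('a, nat \<Rightarrow> 'f) module" and \<tau>1 where d1: "dualizer A1 T1 T1' \<tau>1" "rs A1 T1' = rs A1 T1"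
  "\<forall>i\<in>I1. \<exists>g\<in>ahom A1 (L1 i) (dual_module A1 T1 T1' (L1 i)). \<exists>x\<in>carrier (L1 i). g x \<noteq> 0[dual_module A1 T1 T1' (L1 i)]"
  by (rule BGG_dualizer[OF assms(1)])
 obtain T2 T2' :: "('b, nat \<Rightarrow> 'f) module" and \<tau>2 where d2: "dualizer A2 T2 T2' \<tau>2" "rs A2 T2' = rs A2 T2"
  "\<forall>i\<in>I2. \<exists>g\<in>ahom A2 (L2 i) (dual_module A2 T2 T2' (L2 i)). \<exists>x\<in>carrier (L2 i). g x \<noteq> 0[dual_module A2 T2 T2' (L2 i)]"
  by (rule BGG_dualizer[OF assms(2)])
 interpret d1: dualizer A1 T1 T1' \<tau>1 by (rule d1(1))
 interpret d2: dualizer A2 T2 T2' \<tau>2 by (rule d2(1))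
 have ap: "alg_pair A1 A2" using fd1 fd2 by (simp add: alg_pair_def falg_def)
 have mp: "mod_pair A1 A2 M N" if "fdmod A1 M" "fdmod A2 N" for M N
  using that ap by (simp add: mod_pair_def fdmod_def)
 interpret t: mod_pair A1 A2 T1 T2 by (rule mp[OF d1.T.fdmod_axioms d2.T.fdmod_axioms])
 interpret t': mod_pair A1 A2 T1' T2' by (rule mp[OF d1.T'_fdmod d2.T'_fdmod])
 let ?T = "tensor_module A1 A2 T1 T2" and ?T' = "tensor_module A1 A2 T1' T2'"
  and ?t = "tens (rs A1 T1) (rs A2 T2)"
 note eqs = d1(2) d2(2)
 \<comment> \<open>T1 and T1' have equal underlying vector spaces, and so have T2 and T2'; the two
   outer tensor products therefore share carrier, zero and addition, and only their actions
   differ.\<close>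
 interpret dp: dualizer_pair A1 A2 T1 T1' \<tau>1 T2 T2' \<tau>2 ?T ?T' ?t
 proof (intro dualizer_pair.intro dualizer_pair_axioms.intro t.MN_mtensor d1(1) d2(1) t'.MN_left_module)
  show "carrier ?T' = carrier ?T" "0[?T'] = 0[?T]" "\<And>x y. x +[?T'] y = x +[?T] y"
   unfolding t.MN_simps t'.MN_simps eqs by (rule refl)+
  show "t.AB.sc c *[?T'] x = t.AB.sc c *[?T] x" if "x \<in> carrier ?T" for c x
   using t.MN_scalar[of x c] t'.MN_scalar[of x c] that by (simp add: eqs)
  show "tens A1 A2 a b *[?T'] ?t m n = ?t (a *[T1'] m) (b *[T2'] n)"
   if "a \<in> carrier A1" "b \<in> carrier A2" "m \<in> carrier T1" "n \<in> carrier T2" for a b m n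
   using t'.MN_tens[of a b m n] that by (simp add: eqs d1.carr d2.carr)
 qed
 have "isomorphic ?AB (dp.dz.dual S) (tensor_module A1 A2 (L1 i) (L2 j))"
  if ij: "i \<in> I1" "j \<in> I2" and S: "S \<in> fg_modules ?AB" "isomorphic ?AB S (tensor_module A1 A2 (L1 i) (L2 j))" for i j S
 proof -
  note P = mod_pair.MN_mtensor[OF mp[OF simple_fdmod[OF fd1 s1[OF ij(1)]] simple_fdmod[OF fd2 s2[OF ij(2)]]]]
  let ?P = "tensor_module A1 A2 (L1 i) (L2 j)"
  have Ps: "simple_module ?AB ?P" by (rule tensor_simple[OF P s1[OF ij(1)] s2[OF ij(2)]])
  have "\<exists>h\<in>ahom ?AB ?P (dual_module ?AB ?T ?T' ?P). \<exists>w\<in>carrier ?P. h w \<noteq> 0[dual_module ?AB ?T ?T' ?P]"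
   using bspec[OF d1(3) ij(1)] bspec[OF d2(3) ij(2)] dp.self_dual[OF P] by blast
  then obtain h w where h: "h \<in> ahom ?AB ?P (dual_module ?AB ?T ?T' ?P)" "w \<in> carrier ?P" "h w \<noteq> 0[dual_module ?AB ?T ?T' ?P]"
   by blast
  have "left_module ?AB S" using S(1) by (simp add: fg_modules_def)
  then show ?thesis by (rule dp.dz.dual_self[OF Ps h _ S(2)])
 qed
 then show ?thesis unfolding BGG_algebra_def using tensor_quasi_hereditary[OF q1 q2] dp.dz.duality by fastforce
qed

end
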